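(* Let $n\ge 2$, let $(S^3,L)=(B^+,B^+\cap L)\cup_S(B^-,B^-\cap L)$ be an $n$-bridge decomposition $(L;S)$ of a link $L\subset S^3$, let $q:M_L\to S^3$ be the $2$-fold covering branched over $L$, put $\Sigma=q^{-1}(S)$ and let $T$ be the non-trivial deck transformation of $q$. Then $$\mathcal{HG}_T(M_L;\Sigma)/\langle [T]\rangle\cong\mathcal{G}(L;S).$$
   Context: Everything is in the piecewise linear category. A trivial $n$-tangle is a pair $(B,\mathcal T)$ of a $3$-ball $B$ and $n$ disjoint properly embedded arcs $\mathcal T\subset B$ that are simultaneously parallel into $\partial B$. An $n$-bridge decomposition $(L;S)$ of a link $L\subset S^3$ is a splitting of $(S^3,L)$ along a $2$-sphere $S$ into two trivial $n$-tangles $(B^\pm,B^\pm\cap L)$, where $S^3=B^+\cup_S B^-$. For subspaces $X_1,\dots,X_m$ of an orientable manifold $M$, $\mathrm{MCG}(M,X_1,\dots,X_m)=\pi_0(\mathrm{Homeo}_+(M,X_1,\dots,X_m))$, where $\mathrm{Homeo}_+(M,X_1,\dots,X_m)$ is the group of orientation-preserving self-homeomorphisms of $M$ mapping each $X_i$ onto itself. The Goeritz group of the bridge decomposition is $\mathcal G(L;S)=\mathrm{MCG}(S^3,B^+,L)$. The branched covering $q$ is the one for which every meridian of $L$ acts non-trivially. The preimages $V^\pm=q^{-1}(B^\pm)$ are handlebodies giving a Heegaard splitting $M_L=V^+\cup_\Sigma V^-$. A self-homeomorphism of $M_L$ is fiber-preserving if it takes the $q$-fiber of each point of $S^3$ to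 the $q$-fiber of some point of $S^3$. The hyperelliptic Goeritz group $\mathcal{HG}_T(M_L;\Sigma)$ is the group of orientation-preserving, fiber-preserving self-homeomorphisms of $M_L$ that preserve each of $V^+$ and $V^-$ setwise, modulo isotopy through such fiber-preserving homeomorphisms (equivalently, $\pi_0$ of the centralizer of $T$ in $\mathrm{Homeo}_+(M_L,V^+)$). $[T]$ is the class of $T$ in this group. *)

theory Defs
  imports "HOL-Homology.Homology" "HOL-Algebra.Bij" "HOL-Analysis.Analysis"
begin

section \<open>The piecewise linear category\<close>

definition compact_polyhedron :: "'a::euclidean_space set \<Rightarrow> bool" where
  "compact_polyhedron P \<longleftrightarrow> (\<exists>C. finite C \<and> (\<forall>c\<in>C. polytope c) \<and> \<Union>C = P)"

text \<open>
  A map of a compact polyhedron is PL if it is affine on each of finitely many polytopes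
  covering the domain.  Such a map is continuous by the pasting lemma, and the inverse of an
  injective PL map is PL, so a PL homeomorphism is just a bijective PL map.
\<close>
definition pl_map :: "'a::euclidean_space set \<Rightarrow> ('a \<Rightarrow> 'b::euclidean_space) \<Rightarrow> bool" where
  "pl_map P f \<longleftrightarrow>
     (\<exists>C. finite C \<and> \<Union>C = P \<and>
          (\<forall>c\<in>C. polytope c \<and> (\<exists>A b. linear A \<and> (\<forall>x\<in>c. f x = A x + b))))"

definition pl_homeomorphism ::
  "'a::euclidean_space set \<Rightarrow> 'b::euclidean_space set \<Rightarrow> ('a \<Rightarrow> 'b) \<Rightarrow> bool" where
  "pl_homeomorphism P Q f \<longleftrightarrow> pl_map P f \<and> bij_betw f P Q"

text \<open>
  The model simplex may be taken in the same ambient space: an n-ball or n-sphere in a Euclidean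
  space forces the dimension to be at least n, respectively n + 1.  In \<open>pl_ball n B D\<close> the
  set D is the boundary sphere of the ball B.
\<close>
definition pl_ball :: "nat \<Rightarrow> 'a::euclidean_space set \<Rightarrow> 'a set \<Rightarrow> bool" where
  "pl_ball n B D \<longleftrightarrow>
     (\<exists>(\<Delta>::'a set) f. int n simplex \<Delta> \<and> pl_homeomorphism \<Delta> B f \<and> f ` rel_frontier \<Delta> = D)"

definition pl_sphere :: "nat \<Rightarrow> 'a::euclidean_space set \<Rightarrow> bool" where
  "pl_sphere n S \<longleftrightarrow>
     (\<exists>(\<Delta>::'a set) f. (int n + 1) simplex \<Delta> \<and> pl_homeomorphism (rel_frontier \<Delta>) S f)"

definition closed_pl_manifold :: "nat \<Rightarrow> 'a::euclidean_space set \<Rightarrow> bool" where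
  "closed_pl_manifold n M \<longleftrightarrow>
     compact_polyhedron M \<and>
     (\<forall>x\<in>M. \<exists>B D. pl_ball n B D \<and> B \<subseteq> M \<and> x \<in> B - D \<and> openin (top_of_set M) (B - D))"

section \<open>Links, trivial tangles and bridge decompositions\<close>

definition pl_link :: "'a::euclidean_space set \<Rightarrow> bool" where
  "pl_link L \<longleftrightarrow> (\<exists>K. finite K \<and> (\<forall>C\<in>K. pl_sphere 1 C) \<and> pairwise disjnt K \<and> \<Union>K = L)"

definition properly_embedded_arc ::
  "'a::euclidean_space set \<Rightarrow> 'a set \<Rightarrow> 'a set \<Rightarrow> bool" where
  "properly_embedded_arc B D t \<longleftrightarrow> t \<subseteq> B \<and> (\<exists>E. pl_ball 1 t E \<and> t \<inter> D = E)"

text \<open>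
  Here D is the boundary of the ball B.  The arcs in \<open>\<T>\<close> are simultaneously parallel into D if
  they cobound pairwise disjoint discs \<open>\<delta> t\<close> with arcs in D: the boundary circle \<open>\<gamma> t\<close> of
  \<open>\<delta> t\<close> consists of t and of the complementary arc, and \<open>\<delta> t\<close> meets D exactly in the latter.
\<close>
definition simultaneously_parallel ::
  "'a::euclidean_space set \<Rightarrow> 'a set \<Rightarrow> 'a set set \<Rightarrow> bool" where
  "simultaneously_parallel B D \<T> \<longleftrightarrow>
     (\<exists>\<delta> \<gamma>. (\<forall>t\<in>\<T>. pl_ball 2 (\<delta> t) (\<gamma> t) \<and> \<delta> t \<subseteq> B \<and> t \<subseteq> \<gamma> t \<and>
                     \<delta> t \<inter> D = closure (\<gamma> t - t)) \<and>
            (\<forall>s\<in>\<T>. \<forall>t\<in>\<T>. s \<noteq> t \<longrightarrow> \<delta> s \<inter> \<delta> t = {}))"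

text \<open>\<open>trivial_tangle n B D A\<close>: the pair (B, A) is a trivial n-tangle and D is the boundary of B.\<close>
definition trivial_tangle ::
  "nat \<Rightarrow> 'a::euclidean_space set \<Rightarrow> 'a set \<Rightarrow> 'a set \<Rightarrow> bool" where
  "trivial_tangle n B D A \<longleftrightarrow>
     pl_ball 3 B D \<and>
     (\<exists>\<T>. finite \<T> \<and> card \<T> = n \<and> \<Union>\<T> = A \<and> pairwise disjnt \<T> \<and>
          (\<forall>t\<in>\<T>. properly_embedded_arc B D t) \<and> simultaneously_parallel B D \<T>)"

definition bridge_decomposition ::
  "nat \<Rightarrow> 'a::euclidean_space set \<Rightarrow> 'a set \<Rightarrow> 'a set \<Rightarrow> 'a set \<Rightarrow> 'a set \<Rightarrow> bool" where
  "bridge_decomposition n S3 L Bp Bm S \<longleftrightarrow>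
     pl_link L \<and> L \<subseteq> S3 \<and> pl_sphere 2 S \<and> Bp \<union> Bm = S3 \<and> Bp \<inter> Bm = S \<and>
     trivial_tangle n Bp S (Bp \<inter> L) \<and> trivial_tangle n Bm S (Bm \<inter> L)"

section \<open>Double branched coverings\<close>

text \<open>
  A meridian of L bounds a disc that meets L transversely in a single point.  Transversality is
  expressed by a PL embedded product neighbourhood of the disc in which L is a single fibre.
\<close>
definition meridian :: "'a::euclidean_space set \<Rightarrow> 'a set \<Rightarrow> 'a set \<Rightarrow> bool" where
  "meridian S3 L m \<longleftrightarrow>
     (\<exists>(\<Delta>::'a set) c (\<phi> :: 'a \<times> real \<Rightarrow> 'a).
        2 simplex \<Delta> \<and> c \<in> rel_interior \<Delta> \<and>
        pl_map (\<Delta> \<times> {-1..1}) \<phi> \<and> inj_on \<phi> (\<Delta> \<times> {-1..1}) \<and> \<phi> ` (\<Delta> \<times> {-1..1}) \<subseteq> S3 \<and>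
        {z \<in> \<Delta> \<times> {-1..1}. \<phi> z \<in> L} = {c} \<times> {-1..1} \<and>
        m = \<phi> ` (rel_frontier \<Delta> \<times> {0}))"

text \<open>
  The last clause says that meridians act non-trivially on the two-point fibres: no lift of a
  loop that runs once around a meridian is closed.  Finiteness of all fibres (non-degeneracy of
  q) is what makes q the completion of the covering of the complement of L.
\<close>
definition double_branched_cover ::
  "'b::euclidean_space set \<Rightarrow> ('b \<Rightarrow> 'a::euclidean_space) \<Rightarrow> 'a set \<Rightarrow> 'a set \<Rightarrow> bool" where
  "double_branched_cover M q S3 L \<longleftrightarrow>
     closed_pl_manifold 3 M \<and> pl_map M q \<and> q ` M = S3 \<and>
     (\<forall>y\<in>S3. finite {x\<in>M. q x = y}) \<and>
     covering_space {x\<in>M. q x \<notin> L} q (S3 - L) \<and>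
     (\<forall>y\<in>S3 - L. card {x\<in>M. q x = y} = 2) \<and>
     (\<forall>m g. meridian S3 L m \<and> path g \<and> path_image g \<subseteq> M \<and> simple_path (q \<circ> g) \<and>
            pathfinish (q \<circ> g) = pathstart (q \<circ> g) \<and> path_image (q \<circ> g) = m
            \<longrightarrow> pathfinish g \<noteq> pathstart g)"

definition deck_transformation ::
  "'b::euclidean_space set \<Rightarrow> ('b \<Rightarrow> 'a) \<Rightarrow> ('b \<Rightarrow> 'b) \<Rightarrow> bool" where
  "deck_transformation M q T \<longleftrightarrow> T \<in> Bij M \<and> pl_map M T \<and> (\<forall>x\<in>M. q (T x) = q x)"

section \<open>Orientations\<close>

text \<open>
  An orientation of an n-manifold M is a locally consistent choice of generators of the local
  homology groups H_n(M, M - x).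
\<close>
definition orientation ::
  "nat \<Rightarrow> 'a::topological_space set \<Rightarrow> ('a \<Rightarrow> 'a chain set) \<Rightarrow> bool" where
  "orientation n M \<mu> \<longleftrightarrow>
     (\<forall>x\<in>M. \<mu> x \<in> carrier (relative_homology_group n (top_of_set M) (M - {x})) \<and>
            generate (relative_homology_group n (top_of_set M) (M - {x})) {\<mu> x} =
            carrier (relative_homology_group n (top_of_set M) (M - {x}))) \<and>
     (\<forall>x\<in>M. \<exists>U. x \<in> U \<and> openin (top_of_set M) U \<and>
        (\<exists>\<alpha>\<in>carrier (relative_homology_group n (top_of_set M) (M - U)). \<forall>y\<in>U.
           hom_induced n (top_of_set M) (M - U) (top_of_set M) (M - {y}) (\<lambda>z. z) \<alpha> = \<mu> y))"

text \<open>
  Intended for connected orientable M, where a homeomorphism that preserves one orientation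
  preserves both.
\<close>
definition orientation_preserving ::
  "nat \<Rightarrow> 'a::topological_space set \<Rightarrow> ('a \<Rightarrow> 'a) \<Rightarrow> bool" where
  "orientation_preserving n M f \<longleftrightarrow>
     (\<forall>\<mu>. orientation n M \<mu> \<longrightarrow>
        (\<forall>x\<in>M. hom_induced n (top_of_set M) (M - {x}) (top_of_set M) (M - {f x}) f (\<mu> x) = \<mu> (f x)))"

section \<open>Homeomorphism groups and mapping class groups\<close>

definition homeo_plus ::
  "nat \<Rightarrow> 'a::euclidean_space set \<Rightarrow> 'a set set \<Rightarrow> ('a \<Rightarrow> 'a) monoid" where
  "homeo_plus n M \<Y> = (BijGroup M)
     \<lparr>carrier := {f \<in> Bij M. pl_map M f \<and> orientation_preserving n M f \<and> (\<forall>Y\<in>\<Y>. f ` Y = Y)}\<rparr>"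

text \<open>
  For a group G of PL homeomorphisms of M, \<open>pi0 M G\<close> is the group of PL isotopy classes, where
  isotopies run through G.
\<close>
definition isotopic ::
  "'a::euclidean_space set \<Rightarrow> ('a \<Rightarrow> 'a) monoid \<Rightarrow> ('a \<Rightarrow> 'a) \<Rightarrow> ('a \<Rightarrow> 'a) \<Rightarrow> bool" where
  "isotopic M G f g \<longleftrightarrow>
     (\<exists>H :: real \<Rightarrow> 'a \<Rightarrow> 'a. pl_map (M \<times> {0..1}) (\<lambda>(x, t). H t x) \<and>
        (\<forall>t\<in>{0..1}. H t \<in> carrier G) \<and> H 0 = f \<and> H 1 = g)"

definition isotopy_class ::
  "'a::euclidean_space set \<Rightarrow> ('a \<Rightarrow> 'a) monoid \<Rightarrow> ('a \<Rightarrow> 'a) \<Rightarrow> ('a \<Rightarrow> 'a) set" where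
  "isotopy_class M G f = {g \<in> carrier G. isotopic M G f g}"

definition pi0 ::
  "'a::euclidean_space set \<Rightarrow> ('a \<Rightarrow> 'a) monoid \<Rightarrow> ('a \<Rightarrow> 'a) set monoid" where
  "pi0 M G =
     \<lparr>carrier = isotopy_class M G ` carrier G,
      monoid.mult = set_mult G,
      one = isotopy_class M G \<one>\<^bsub>G\<^esub>\<rparr>"

definition MCG :: "nat \<Rightarrow> 'a::euclidean_space set \<Rightarrow> 'a set set \<Rightarrow> ('a \<Rightarrow> 'a) set monoid" where
  "MCG n M \<Y> = pi0 M (homeo_plus n M \<Y>)"

definition goeritz_group ::
  "'a::euclidean_space set \<Rightarrow> 'a set \<Rightarrow> 'a set \<Rightarrow> ('a \<Rightarrow> 'a) set monoid" where
  "goeritz_group S3 L Bp = MCG 3 S3 {Bp, L}"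

definition fiber_preserving :: "'b set \<Rightarrow> ('b \<Rightarrow> 'a) \<Rightarrow> ('b \<Rightarrow> 'b) \<Rightarrow> bool" where
  "fiber_preserving M q f \<longleftrightarrow>
     (\<forall>y\<in>q ` M. \<exists>y'\<in>q ` M. f ` {x\<in>M. q x = y} = {x\<in>M. q x = y'})"

definition fiber_preserving_homeos ::
  "'b::euclidean_space set \<Rightarrow> ('b \<Rightarrow> 'a) \<Rightarrow> 'b set \<Rightarrow> 'b set \<Rightarrow> ('b \<Rightarrow> 'b) monoid" where
  "fiber_preserving_homeos M q Vp Vm = (BijGroup M)
     \<lparr>carrier := {f \<in> carrier (homeo_plus 3 M {Vp, Vm}). fiber_preserving M q f}\<rparr>"

definition hyperelliptic_goeritz_group ::
  "'b::euclidean_space set \<Rightarrow> ('b \<Rightarrow> 'a) \<Rightarrow> 'b set \<Rightarrow> 'b set \<Rightarrow> ('b \<Rightarrow> 'b) set monoid" where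
  "hyperelliptic_goeritz_group M q Vp Vm = pi0 M (fiber_preserving_homeos M q Vp Vm)"

end

theory Submission
  imports Defs
begin

text \<open>
  A fiber-preserving homeomorphism f of M commutes with T and descends to a homeomorphism of
  the pair (\<open>S3\<close>, L).  Conversely let g be a homeomorphism of (\<open>S3\<close>, L).  Near L it
  carries meridian charts to meridian charts, and since the lift of a meridian of L is not
  closed, g lifts there; away from L, q is a local homeomorphism.  The local lifts come in
  pairs that differ by T, so they can be continued over \<open>S3\<close> minus a point, which is a cell,
  and hence over the simply connected sphere: locally there are exactly two lifts, and no
  appeal to the fundamental group of the complement of L is needed.  A lift of an isotopy is
  obtained from homotopy lifting for the covering off L.  All lifts extend over L because the
  fibres over L are single points, and a continuous lift of a PL map through the
  finite-to-one PL map q is PL.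

  Therefore descending is a surjective homomorphism of homeomorphism groups with kernel
  generated by T that also lifts isotopies, and a general argument turns this into the
  isomorphism of isotopy class groups.

  For the orientations, an orientation of \<open>S3\<close> is pulled back to M: off L through the local
  homeomorphism q, and across L because L does not separate small balls in M.  At a point off
  L, f preserves the pulled back orientation exactly when g preserves the given one.
\<close>

subsection \<open>Piecewise linear maps\<close>

text \<open>The preimage of a connected open set may fall into two pieces, on which lifts could be
  chosen independently. Requiring lifts to commute with T leaves exactly two of them, so that the
  lifts form a locally constant sheaf with two-element stalks on all of \<open>S3\<close>; the
  obstacle is local triviality at points of L. There one passes to a strip that is the universal
  covering of a punctured cylinder around L. One turn around L exchanges the sheets, which is where
  the clause on meridians enters. The same exchange makes preimages of punctured cylinders
  connected; this yields single points over L, connectedness of M and the extension of orientations.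
  The covering clause is silent over L, so it must first be excluded that an open part of M lies
  over L; this is done by invariance of domain, using finite fibres. For orientations the difficulty
  is that q does not map the complement of x into the complement of \<open>q x\<close> and hence
  induces no map of local homology. A relation between local classes, defined through charts on
  which q is an embedding, replaces such a map.\<close>

definition affine_on :: "'a::euclidean_space set \<Rightarrow> ('a \<Rightarrow> 'b::euclidean_space) \<Rightarrow> bool" where
  "affine_on c f \<longleftrightarrow> (\<exists>A b. linear A \<and> (\<forall>x\<in>c. f x = A x + b))"

lemma pl_map_iff:
  "pl_map P f \<longleftrightarrow> (\<exists>C. finite C \<and> \<Union>C = P \<and> (\<forall>c\<in>C. polytope c \<and> affine_on c f))"
  by (simp add: pl_map_def affine_on_def)

lemma affine_on_subset: "affine_on c f \<Longrightarrow> d \<subseteq> c \<Longrightarrow> affine_on d f"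
  unfolding affine_on_def by blast

lemma affine_on_cong: "affine_on c f \<Longrightarrow> (\<And>x. x \<in> c \<Longrightarrow> f x = g x) \<Longrightarrow> affine_on c g"
  unfolding affine_on_def by metis

lemma affine_on_compose:
  assumes "affine_on c f" "affine_on d g" "f ` c \<subseteq> d"
  shows "affine_on c (g \<circ> f)"
proof -
  obtain A b where A: "linear A" "\<And>x. x \<in> c \<Longrightarrow> f x = A x + b" using assms(1) unfolding affine_on_def by blast
  obtain A' b' where A': "linear A'" "\<And>x. x \<in> d \<Longrightarrow> g x = A' x + b'" using assms(2) unfolding affine_on_def by blast
  have "(g \<circ> f) x = (A' \<circ> A) x + (A' b + b')" if "x \<in> c" for x
    using that assms(3) A(2)[OF that] A'(2)[of "f x"] by (auto simp: linear_add[OF A'(1)])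
  moreover have "linear (A' \<circ> A)" by (rule linear_compose) fact+
  ultimately show ?thesis unfolding affine_on_def by blast
qed

lemma affine_on_continuous: "affine_on c f \<Longrightarrow> continuous_on c f"
proof -
  assume "affine_on c f"
  then obtain A b where A: "linear A" "\<And>x. x \<in> c \<Longrightarrow> f x = A x + b" unfolding affine_on_def by blast
  have "continuous_on c (\<lambda>x. A x + b)"
    by (intro continuous_intros linear_continuous_on linear_conv_bounded_linear[THEN iffD1] A)
  then show ?thesis using A(2) by (simp cong: continuous_on_cong)
qed

lemma affine_on_Times_id: "affine_on c f \<Longrightarrow> affine_on (c \<times> d) (\<lambda>(x, t). (f x, t))"
proof -
  assume "affine_on c f"
  then obtain A b where A: "linear A" "\<And>x. x \<in> c \<Longrightarrow> f x = A x + b" unfolding affine_on_def by blast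
  have "linear (\<lambda>(x, t). (A x, t))"
    by (rule linearI) (auto simp: linear_add[OF A(1)] linear_scale[OF A(1)])
  moreover have "\<forall>z\<in>c \<times> d. (\<lambda>(x, t). (f x, t)) z = (\<lambda>(x, t). (A x, t)) z + (b, 0)" using A(2) by auto
  ultimately show ?thesis unfolding affine_on_def by blast
qed

section \<open>Polytopes and PL maps under composition, products and restriction\<close>

lemma polyhedron_linear_vimage:
  fixes A :: "'a::euclidean_space \<Rightarrow> 'b::euclidean_space"
  assumes "linear A" "polyhedron d"
  shows "polyhedron {x. A x + b \<in> d}"
proof -
  obtain F where F: "finite F" "d = \<Inter>F" "\<forall>h\<in>F. \<exists>a b. a \<noteq> 0 \<and> h = {x. a \<bullet> x \<le> b}"
    using assms(2) unfolding polyhedron_def by auto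
  have "{x. A x + b \<in> d} = \<Inter>((\<lambda>h. {x. A x + b \<in> h}) ` F)" using F(2) by auto
  moreover have "polyhedron {x. A x + b \<in> h}" if h: "h \<in> F" for h
  proof -
    obtain a \<beta> where a: "h = {x. a \<bullet> x \<le> \<beta>}" using F(3) h by blast
    have "{x. A x + b \<in> h} = {x. adjoint A a \<bullet> x \<le> \<beta> - a \<bullet> b}"
      using adjoint_works[OF assms(1), of _ a] by (auto simp: a inner_add_right inner_commute algebra_simps)
    then show ?thesis by (simp add: polyhedron_halfspace_le)
  qed
  ultimately show ?thesis using F(1) by auto
qed

lemma polytope_affine_vimage:
  assumes "polytope c" "polytope d" "affine_on c f"
  shows "polytope {x \<in> c. f x \<in> d}"
proof -
  obtain A b where A: "linear A" "\<And>x. x \<in> c \<Longrightarrow> f x = A x + b" using assms(3) unfolding affine_on_def by blast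
  have "{x \<in> c. f x \<in> d} = c \<inter> {x. A x + b \<in> d}" using A(2) by auto
  then show ?thesis
    using polytope_Int_polyhedron[OF assms(1) polyhedron_linear_vimage[OF A(1) polytope_imp_polyhedron[OF assms(2)]]] by metis
qed

lemma polytope_affine_image:
  assumes "polytope c" "affine_on c f" shows "polytope (f ` c)"
proof -
  obtain A b where A: "linear A" "\<And>x. x \<in> c \<Longrightarrow> f x = A x + b" using assms(2) unfolding affine_on_def by blast
  have "f ` c = (+) b ` (A ` c)" using A(2) by (force simp: image_image add.commute)
  then show ?thesis using A(1) assms(1) by (simp add: polytope_translation_eq polytope_linear_image)
qed

lemma pl_map_imp_polyhedron: "pl_map P f \<Longrightarrow> compact_polyhedron P"
  unfolding pl_map_def compact_polyhedron_def by blast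

lemma polytope_imp_compact_polyhedron: "polytope P \<Longrightarrow> compact_polyhedron P"
  unfolding compact_polyhedron_def by (rule exI[of _ "{P}"]) auto

lemma compact_polyhedron_imp_compact: "compact_polyhedron P \<Longrightarrow> compact P"
  unfolding compact_polyhedron_def by (auto intro: polytope_imp_compact compact_Union)

lemma compact_polyhedron_Times:
  assumes "compact_polyhedron P" "compact_polyhedron Q" shows "compact_polyhedron (P \<times> Q)"
proof -
  obtain C D where C: "finite C" "\<forall>c\<in>C. polytope c" "\<Union>C = P" and D: "finite D" "\<forall>c\<in>D. polytope c" "\<Union>D = Q"
    using assms unfolding compact_polyhedron_def by auto
  have "finite ((\<lambda>(c, d). c \<times> d) ` (C \<times> D))" using C D by auto
  moreover have "\<Union>((\<lambda>(c, d). c \<times> d) ` (C \<times> D)) = P \<times> Q" using C(3) D(3) by blast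
  moreover have "\<forall>e\<in>(\<lambda>(c, d). c \<times> d) ` (C \<times> D). polytope e" using C D by (auto intro: polytope_Times)
  ultimately show ?thesis unfolding compact_polyhedron_def by blast
qed

lemma pl_map_cong: "pl_map P f \<Longrightarrow> (\<And>x. x \<in> P \<Longrightarrow> f x = g x) \<Longrightarrow> pl_map P g"
  unfolding pl_map_iff by (metis UnionI affine_on_cong)

lemma pl_map_affine:
  assumes "compact_polyhedron P" "affine_on P f" shows "pl_map P f"
proof -
  obtain C where C: "finite C" "\<forall>c\<in>C. polytope c" "\<Union>C = P" using assms(1) unfolding compact_polyhedron_def by auto
  then show ?thesis unfolding pl_map_iff using affine_on_subset[OF assms(2)] by (metis Union_upper)
qed

lemma affine_on_linear: "linear A \<Longrightarrow> affine_on c (\<lambda>x. A x + b)"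
  unfolding affine_on_def by blast

lemma affine_on_id: "affine_on c (\<lambda>x. x)"
  using affine_on_linear[of "\<lambda>x. x" c 0] by (simp add: linear_iff)

lemma pl_map_continuous: assumes "pl_map P f" shows "continuous_on P f"
proof -
  obtain C where C: "finite C" "\<Union>C = P" "\<forall>c\<in>C. polytope c \<and> affine_on c f" using assms unfolding pl_map_iff by auto
  have "continuous_on (\<Union>c\<in>C. c) f"
    by (rule continuous_on_closed_Union) (use C in \<open>auto intro: affine_on_continuous polytope_imp_closed\<close>)
  then show ?thesis using C(2) by simp
qed

lemma pl_map_Union:
  assumes "finite I" "\<And>i. i \<in> I \<Longrightarrow> pl_map (P i) f" shows "pl_map (\<Union>i\<in>I. P i) f"
proof -
  have "\<forall>i\<in>I. \<exists>C. finite C \<and> \<Union>C = P i \<and> (\<forall>c\<in>C. polytope c \<and> affine_on c f)" using assms(2) unfolding pl_map_iff by blast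
  then obtain C where C: "\<And>i. i \<in> I \<Longrightarrow> finite (C i) \<and> \<Union>(C i) = P i \<and> (\<forall>c\<in>C i. polytope c \<and> affine_on c f)" by metis
  show ?thesis unfolding pl_map_iff
    by (rule exI[of _ "\<Union>i\<in>I. C i"]) (use C assms(1) in fastforce)
qed

lemma pl_map_Un: "pl_map P f \<Longrightarrow> pl_map Q f \<Longrightarrow> pl_map (P \<union> Q) f"
  using pl_map_Union[of "{P, Q}" "\<lambda>x. x" f] by auto

lemma pl_map_compose:
  assumes "pl_map P f" "pl_map Q g" "f ` P \<subseteq> Q" shows "pl_map P (g \<circ> f)"
proof -
  obtain C where C: "finite C" "\<Union>C = P" "\<forall>c\<in>C. polytope c \<and> affine_on c f" using assms unfolding pl_map_iff by auto
  obtain D where D: "finite D" "\<Union>D = Q" "\<forall>c\<in>D. polytope c \<and> affine_on c g" using assms unfolding pl_map_iff by auto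
  let ?E = "(\<lambda>(c, d). {x \<in> c. f x \<in> d}) ` (C \<times> D)"
  have "finite ?E" using C D by auto
  moreover have "\<Union>?E = P" using C(2) D(2) assms(3) by fastforce
  moreover have "\<forall>e\<in>?E. polytope e \<and> affine_on e (g \<circ> f)"
  proof (clarify, intro conjI)
    fix c d assume cd: "c \<in> C" "d \<in> D"
    show "polytope {x \<in> c. f x \<in> d}" using cd C D by (auto intro: polytope_affine_vimage)
    show "affine_on {x \<in> c. f x \<in> d} (g \<circ> f)"
      by (rule affine_on_compose[where d=d]) (use cd C D in \<open>auto intro: affine_on_subset\<close>)
  qed
  ultimately show ?thesis unfolding pl_map_iff by blast
qed

lemma pl_map_subset:
  assumes "pl_map P f" "compact_polyhedron Q" "Q \<subseteq> P" shows "pl_map Q f"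
proof -
  have "pl_map Q (f \<circ> (\<lambda>x. x))"
    by (rule pl_map_compose[OF pl_map_affine[OF assms(2) affine_on_id] assms(1)]) (use assms(3) in auto)
  then show ?thesis by (simp add: comp_def)
qed

lemma pl_map_image_polyhedron: "pl_map P f \<Longrightarrow> compact_polyhedron (f ` P)"
  unfolding pl_map_iff compact_polyhedron_def
  by (metis (no_types, lifting) finite_imageI imageE image_Union polytope_affine_image)

lemma pl_map_Times_id:
  assumes "pl_map P f" "polytope I" shows "pl_map (P \<times> I) (\<lambda>(x, t). (f x, t))"
proof -
  obtain C where C: "finite C" "\<Union>C = P" "\<forall>c\<in>C. polytope c \<and> affine_on c f" using assms unfolding pl_map_iff by auto
  let ?E = "(\<lambda>c. c \<times> I) ` C"
  have "finite ?E" "\<Union>?E = P \<times> I" using C by auto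
  moreover have "\<forall>e\<in>?E. polytope e \<and> affine_on e (\<lambda>(x, t). (f x, t))"
    using C assms(2) by (auto intro: polytope_Times affine_on_Times_id)
  ultimately show ?thesis unfolding pl_map_iff by blast
qed

lemma affine_on_Pair:
  assumes "affine_on c f" "affine_on c g" shows "affine_on c (\<lambda>x. (f x, g x))"
proof -
  obtain A b where A: "linear A" "\<And>x. x \<in> c \<Longrightarrow> f x = A x + b" using assms(1) unfolding affine_on_def by blast
  obtain A' b' where A': "linear A'" "\<And>x. x \<in> c \<Longrightarrow> g x = A' x + b'" using assms(2) unfolding affine_on_def by blast
  have "linear (\<lambda>x. (A x, A' x))"
    by (rule linearI) (auto simp: linear_add[OF A(1)] linear_scale[OF A(1)] linear_add[OF A'(1)] linear_scale[OF A'(1)])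
  moreover have "\<forall>x\<in>c. (f x, g x) = (A x, A' x) + (b, b')" using A(2) A'(2) by auto
  ultimately show ?thesis unfolding affine_on_def by blast
qed

lemma pl_map_Pair:
  assumes "pl_map P f" "pl_map P g" shows "pl_map P (\<lambda>x. (f x, g x))"
proof -
  obtain C where C: "finite C" "\<Union>C = P" "\<forall>c\<in>C. polytope c \<and> affine_on c f" using assms unfolding pl_map_iff by auto
  obtain D where D: "finite D" "\<Union>D = P" "\<forall>c\<in>D. polytope c \<and> affine_on c g" using assms unfolding pl_map_iff by auto
  let ?E = "(\<lambda>(c, d). c \<inter> d) ` (C \<times> D)"
  have "finite ?E" using C D by auto
  moreover have "\<Union>?E = P"
  proof -
    have "\<Union>?E = \<Union>C \<inter> \<Union>D" by blast
    then show ?thesis using C D by simp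
  qed
  moreover have "\<forall>e\<in>?E. polytope e \<and> affine_on e (\<lambda>x. (f x, g x))"
    using C(3) D(3) by (auto intro!: polytope_Int affine_on_Pair intro: affine_on_subset)
  ultimately show ?thesis unfolding pl_map_iff by blast
qed

text \<open>The linear part is injective on the direction space V of c: a vector of V in its kernel,
  scaled down, could be added to a point of the relative interior without leaving c and without
  changing f. A linear left inverse on V then gives the affine one. It is defined on the whole
  space, which is convenient for later composition.\<close>

lemma affine_on_inverse:
  assumes "convex c" "affine_on c f" "inj_on f c"
  obtains g where "affine_on UNIV g" "\<And>x. x \<in> c \<Longrightarrow> g (f x) = x"
proof (cases "c = {}")
  case True
  then show ?thesis using that[of "\<lambda>x. 0 + 0"] affine_on_linear[of "\<lambda>x. 0"] linear_zero by blast
next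
  case False
  then obtain x0 where x0: "x0 \<in> rel_interior c" using assms(1) rel_interior_eq_empty by auto
  then have x0c: "x0 \<in> c" using rel_interior_subset by auto
  obtain A b where A: "linear A" "\<And>x. x \<in> c \<Longrightarrow> f x = A x + b" using assms(2) unfolding affine_on_def by blast
  define V where "V = span ((\<lambda>x. x - x0) ` c)"
  have V: "subspace V" by (simp add: V_def)
  have "v = 0" if v: "v \<in> V" "A v = 0" for v
  proof (rule ccontr)
    assume "v \<noteq> 0"
    obtain e where e: "e > 0" "ball x0 e \<inter> affine hull c \<subseteq> c" using x0 mem_rel_interior_ball by blast
    define s where "s = e / (2 * norm v)"
    have s: "s > 0" "s * norm v < e" using \<open>v \<noteq> 0\<close> e by (auto simp: s_def)
    have "(+) (- x0) ` c = (\<lambda>x. x - x0) ` c" by auto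
    then have "affine hull c = (+) x0 ` V" using affine_hull_span_gen[of x0 c] x0c
      unfolding V_def by (simp add: hull_inc)
    then have "x0 + s *\<^sub>R v \<in> affine hull c" using subspace_scale[OF V v(1)] by auto
    moreover have "x0 + s *\<^sub>R v \<in> ball x0 e" using s by (simp add: dist_norm)
    ultimately have c: "x0 + s *\<^sub>R v \<in> c" using e by blast
    have "f (x0 + s *\<^sub>R v) = f x0" using A(2)[OF c] A(2)[OF x0c] v(2) by (simp add: linear_add[OF A(1)] linear_scale[OF A(1)])
    then show False using inj_onD[OF assms(3) _ c x0c] s \<open>v \<noteq> 0\<close> by auto
  qed
  then have "inj_on A V" using linear_inj_on_iff_eq_0[OF A(1) V] by blast
  then obtain g where g: "linear g" "\<And>v. v \<in> V \<Longrightarrow> g (A v) = v"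
    using linear_exists_left_inverse_on[OF A(1) V] by blast
  show ?thesis
  proof (rule that)
    show "affine_on UNIV (\<lambda>y. g y + (x0 - g (f x0)))" by (rule affine_on_linear[OF g(1)])
    fix x assume x: "x \<in> c"
    then have "x - x0 \<in> V" unfolding V_def by (auto intro: span_base)
    moreover have "f x - f x0 = A (x - x0)" using A(2)[OF x] A(2)[OF x0c] by (simp add: linear_diff[OF A(1)])
    ultimately have "g (f x) - g (f x0) = x - x0" using g(2) by (metis linear_diff[OF g(1)])
    then show "g (f x) + (x0 - g (f x0)) = x" by (simp add: algebra_simps)
  qed
qed

lemma pl_map_inverse:
  assumes "pl_map P f" "\<And>x. x \<in> P \<Longrightarrow> g (f x) = x" shows "pl_map (f ` P) g"
proof -
  obtain C where C: "finite C" "\<Union>C = P" "\<forall>c\<in>C. polytope c \<and> affine_on c f" using assms unfolding pl_map_iff by auto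
  have "affine_on (f ` c) g" if c: "c \<in> C" for c
  proof -
    have "inj_on f c" using c C(2) assms(2) by (metis UnionI inj_onI)
    then obtain h where h: "affine_on UNIV h" "\<And>x. x \<in> c \<Longrightarrow> h (f x) = x"
      using affine_on_inverse[of c f] c C(3) polytope_imp_convex by metis
    have "h (f x) = g (f x)" if "x \<in> c" for x using h(2)[OF that] assms(2)[of x] that c C(2) by (metis UnionI)
    then show ?thesis by (intro affine_on_cong[OF affine_on_subset[OF h(1)]]) auto
  qed
  then have "polytope (f ` c) \<and> affine_on (f ` c) g" if "c \<in> C" for c
    using that C(3) polytope_affine_image by metis
  moreover have "\<Union>((`) f ` C) = f ` P" using C(2) by (metis image_Union)
  ultimately show ?thesis unfolding pl_map_iff using C(1) by (intro exI[of _ "(`) f ` C"]) blast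
qed

text \<open>A fibre of an affine map on a convex set is convex, so two points in it would bring a
  whole segment along.\<close>

lemma affine_on_finite_fibres_imp_inj:
  assumes "convex c" "affine_on c f" "\<And>y. finite {x \<in> c. f x = y}"
  shows "inj_on f c"
proof (rule inj_onI, rule ccontr)
  fix x y assume xy: "x \<in> c" "y \<in> c" "f x = f y" "x \<noteq> y"
  obtain A b where A: "linear A" "\<And>x. x \<in> c \<Longrightarrow> f x = A x + b" using assms(2) unfolding affine_on_def by blast
  have "closed_segment x y \<subseteq> {z \<in> c. f z = f y}"
  proof
    fix z assume z: "z \<in> closed_segment x y"
    then have zc: "z \<in> c" using xy assms(1) by (metis closed_segment_subset subsetD)
    obtain u where u: "z = (1 - u) *\<^sub>R x + u *\<^sub>R y" using z by (auto simp: in_segment)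
    have "A x = A y" using A(2)[OF xy(1)] A(2)[OF xy(2)] xy(3) by simp
    then have "A z = A y" unfolding u by (simp add: linear_add[OF A(1)] linear_scale[OF A(1)] flip: scaleR_add_left)
    then show "z \<in> {z \<in> c. f z = f y}" using zc A(2)[OF zc] A(2)[OF xy(2)] by simp
  qed
  then have "finite (closed_segment x y)" using assms(3) finite_subset by blast
  then show False using xy(4) by simp
qed

lemma pl_map_finite_fibres_pieces:
  assumes "pl_map M q" "\<And>y. finite {x \<in> M. q x = y}"
  obtains C where "finite C" "\<Union>C = M" "\<And>c. c \<in> C \<Longrightarrow> polytope c \<and> affine_on c q \<and> inj_on q c"
proof -
  obtain C where C: "finite C" "\<Union>C = M" "\<forall>c\<in>C. polytope c \<and> affine_on c q" using assms(1) unfolding pl_map_iff by auto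
  have "inj_on q c" if c: "c \<in> C" for c
  proof (rule affine_on_finite_fibres_imp_inj)
    show "convex c" "affine_on c q" using c C(3) polytope_imp_convex by auto
    fix y have "{x \<in> c. q x = y} \<subseteq> {x \<in> M. q x = y}" using c C(2) by auto
    then show "finite {x \<in> c. q x = y}" using assms(2) finite_subset by blast
  qed
  then show ?thesis using that C by blast
qed

lemma pl_map_descend:
  assumes "pl_map M q" "\<And>y. finite {x \<in> M. q x = y}" "pl_map M f"
    and "\<And>x. x \<in> M \<Longrightarrow> F (q x) = f x"
  shows "pl_map (q ` M) F"
proof -
  obtain C where C: "finite C" "\<Union>C = M" "\<And>c. c \<in> C \<Longrightarrow> polytope c \<and> affine_on c q \<and> inj_on q c"
    using pl_map_finite_fibres_pieces[OF assms(1,2)] by metis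
  have "pl_map (q ` c) F" if c: "c \<in> C" for c
  proof -
    have cM: "c \<subseteq> M" using c C(2) by auto
    have cp: "compact_polyhedron c" using C(3)[OF c] polytope_imp_compact_polyhedron by blast
    have "pl_map (q ` c) (inv_into c q)"
      by (rule pl_map_inverse) (use C(3)[OF c] cp in \<open>auto intro: pl_map_affine\<close>)
    then have "pl_map (q ` c) (f \<circ> inv_into c q)"
      by (rule pl_map_compose[OF _ pl_map_subset[OF assms(3) cp cM]]) (auto intro: inv_into_into)
    then show ?thesis
    proof (rule pl_map_cong)
      fix y assume "y \<in> q ` c"
      then show "(f \<circ> inv_into c q) y = F y" using assms(4) cM
        by (metis comp_apply f_inv_into_f inv_into_into subsetD)
    qed
  qed
  then have "pl_map (\<Union>c\<in>C. q ` c) F" using C(1) by (intro pl_map_Union)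
  then show ?thesis using C(2) by (metis image_Union)
qed

text \<open>
  On the cells of the arrangement of the hyperplanes where coordinates of two of the affine
  functions agree, any two of them agree everywhere or nowhere in the relative interior.
\<close>
lemma pl_map_finite_affine_selection:
  fixes h :: "'a::euclidean_space \<Rightarrow> 'b::euclidean_space"
  assumes c: "polytope c" and h: "continuous_on c h"
    and I: "finite I" "\<And>i. i \<in> I \<Longrightarrow> affine_on UNIV (a i)"
    and sel: "\<And>x. x \<in> c \<Longrightarrow> \<exists>i\<in>I. h x = a i x"
  shows "pl_map c h"
proof -
  define \<phi> where "\<phi> = (\<lambda>(i, j, e) x. (a i x - a j x) \<bullet> (e::'b))"
  define P where "P = I \<times> I \<times> (Basis :: 'b set)"
  have finP: "finite P" using I by (simp add: P_def)
  have aff: "\<exists>v \<beta>. \<forall>x. \<phi> p x = v \<bullet> x - \<beta>" if pP: "p \<in> P" for p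
  proof -
    obtain i j e where p: "p = (i, j, e)" "i \<in> I" "j \<in> I" using pP unfolding P_def by auto
    obtain A b where A: "linear A" "\<And>x. a i x = A x + b" using I(2)[OF p(2)] unfolding affine_on_def by auto
    obtain A' b' where A': "linear A'" "\<And>x. a j x = A' x + b'" using I(2)[OF p(3)] unfolding affine_on_def by auto
    have "\<phi> p x = (adjoint A e - adjoint A' e) \<bullet> x - ((b' - b) \<bullet> e)" for x
      unfolding p \<phi>_def using adjoint_works[OF A(1), of x e] adjoint_works[OF A'(1), of x e]
      by (simp add: A(2) A'(2) inner_diff_left inner_add_left inner_commute algebra_simps)
    then show ?thesis by blast
  qed
  \<comment> \<open>The cells of the arrangement are indexed by sign patterns. The set s collects
    the triples whose function is nonpositive on the cell, and all others are nonnegative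
    there.\<close>
  define K where "K s = {x \<in> c. \<forall>p\<in>P. if p \<in> s then \<phi> p x \<le> 0 else \<phi> p x \<ge> 0}" for s
  have polyK: "polytope (K s)" for s
  proof -
    have ph: "polyhedron {x. if p \<in> s then \<phi> p x \<le> 0 else \<phi> p x \<ge> 0}" if p: "p \<in> P" for p
    proof -
      obtain v \<beta> where v: "\<And>x. \<phi> p x = v \<bullet> x - \<beta>" using aff[OF p] by blast
      show ?thesis by (cases "p \<in> s") (auto simp: v polyhedron_halfspace_le polyhedron_halfspace_ge)
    qed
    have "K s = c \<inter> (\<Inter>p\<in>P. {x. if p \<in> s then \<phi> p x \<le> 0 else \<phi> p x \<ge> 0})" unfolding K_def by auto
    also have "polytope \<dots>" using c finP ph by (intro polytope_Int_polyhedron polyhedron_Inter) auto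
    finally show ?thesis .
  qed
  have cov: "\<Union>(K ` Pow P) = c"
  proof
    show "\<Union>(K ` Pow P) \<subseteq> c" unfolding K_def by auto
    show "c \<subseteq> \<Union>(K ` Pow P)"
    proof
      fix x assume "x \<in> c"
      moreover have "if p \<in> {p \<in> P. \<phi> p x \<le> 0} then \<phi> p x \<le> 0 else \<phi> p x \<ge> 0" if "p \<in> P" for p
        using that by simp
      ultimately have "x \<in> K {p \<in> P. \<phi> p x \<le> 0}" unfolding K_def by blast
      moreover have "{p \<in> P. \<phi> p x \<le> 0} \<in> Pow P" by blast
      ultimately show "x \<in> \<Union>(K ` Pow P)" by blast
    qed
  qed
  have "affine_on (K s) h" for s
  proof (cases "K s = {}")
    case True
    then show ?thesis unfolding affine_on_def using linear_zero by auto
  next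
    case False
    have conv: "convex (K s)" using polyK polytope_imp_convex by blast
    let ?R = "rel_interior (K s)"
    have R: "?R \<noteq> {}" "convex ?R" "?R \<subseteq> K s" using False conv rel_interior_eq_empty rel_interior_subset convex_rel_interior by auto
    \<comment> \<open>A function of constant sign on \<open>K s\<close> vanishes on a face. If that
      face contains a point of the relative interior, it is all of \<open>K s\<close>.\<close>
    have zero: "\<phi> p y = 0" if p: "p \<in> P" and x: "x \<in> ?R" "\<phi> p x = 0" and y: "y \<in> K s" for p x y
    proof -
      obtain v \<beta> where v: "\<And>x. \<phi> p x = v \<bullet> x - \<beta>" using aff[OF p] by blast
      have "(K s \<inter> {x. v \<bullet> x = \<beta>}) face_of K s"
      proof (cases "p \<in> s")
        case True
        then show ?thesis using p v by (intro face_of_Int_supporting_hyperplane_le[OF conv]) (auto simp: K_def)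
      next
        case False
        then show ?thesis using p v by (intro face_of_Int_supporting_hyperplane_ge[OF conv]) (auto simp: K_def)
      qed
      then have "K s \<subseteq> K s \<inter> {x. v \<bullet> x = \<beta>}"
        by (rule subset_of_face_of) (use x v R in auto)
      then show ?thesis using y v by auto
    qed
    have same: "a i y = a j y" if ij: "i \<in> I" "j \<in> I" and x: "x \<in> ?R" "a i x = a j x" and y: "y \<in> K s" for i j x y
    proof -
      have "(a i y - a j y) \<bullet> e = 0" if e: "e \<in> Basis" for e
        using zero[of "(i, j, e)" x y] ij x y e unfolding \<phi>_def P_def by auto
      then show ?thesis using euclidean_eqI[of "a i y - a j y" 0] by auto
    qed
    obtain x0 where x0: "x0 \<in> ?R" using R by blast
    have Kc: "K s \<subseteq> c" unfolding K_def by auto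
    obtain i where i: "i \<in> I" "h x0 = a i x0" using sel x0 R Kc by blast
    have cont: "continuous_on X h" "continuous_on X (a j)" if "X \<subseteq> c" "j \<in> I" for X j
      using that h I(2) continuous_on_subset affine_on_continuous by blast+
    \<comment> \<open>By \<open>same\<close>, two candidates coincide on the cell or differ at every
      point of its relative interior. So the closed sets where h equals candidate i, or one of the
      essentially different candidates in J, split a connected set.\<close>
    define Z where "Z j = {x \<in> ?R. h x = a j x}" for j
    have cl: "closedin (top_of_set ?R) (Z j)" if "j \<in> I" for j
    proof -
      have "continuous_on ?R (\<lambda>x. h x - a j x)"
        by (intro continuous_on_diff cont that) (use R Kc that in auto)
      then have "closedin (top_of_set ?R) (?R \<inter> (\<lambda>x. h x - a j x) -` {0})" by (rule continuous_closedin_preimage) auto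
      moreover have "?R \<inter> (\<lambda>x. h x - a j x) -` {0} = Z j" unfolding Z_def by auto
      ultimately show ?thesis by simp
    qed
    define J where "J = {j \<in> I. a j x0 \<noteq> a i x0}"
    have ne: "Z j \<inter> Z i = {}" if "j \<in> J" for j
    proof (rule ccontr)
      assume "Z j \<inter> Z i \<noteq> {}"
      then obtain x where "x \<in> ?R" "a j x = a i x" unfolding Z_def by fastforce
      then have "a j x0 = a i x0" using same[of j i x x0] that i x0 R unfolding J_def by auto
      then show False using that unfolding J_def by auto
    qed
    have un: "?R \<subseteq> Z i \<union> (\<Union>j\<in>J. Z j)"
    proof
      fix x assume x: "x \<in> ?R"
      then obtain j where j: "j \<in> I" "h x = a j x" using sel R Kc by blast
      show "x \<in> Z i \<union> (\<Union>j\<in>J. Z j)"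
      proof (cases "j \<in> J")
        case True then show ?thesis using j x unfolding Z_def by auto
      next
        case False
        then have "a j x0 = a i x0" using j unfolding J_def by auto
        then have "a j x = a i x" using same[of j i x0 x] j i x0 x R by auto
        then show ?thesis using j x unfolding Z_def by auto
      qed
    qed
    have "closedin (top_of_set ?R) (\<Union>j\<in>J. Z j)" using I(1) cl unfolding J_def by (intro closedin_Union) auto
    moreover have "closedin (top_of_set ?R) (Z i)" using cl i by auto
    moreover have "connected ?R" using R convex_connected by blast
    moreover have "(\<Union>j\<in>J. Z j) \<inter> Z i = {}" using ne by blast
    moreover have "Z i \<noteq> {}" using x0 i unfolding Z_def by auto
    ultimately have "(\<Union>j\<in>J. Z j) = {}" using un unfolding connected_closedin
      by (metis Int_commute)
    then have eqR: "h x = a i x" if "x \<in> ?R" for x using un that unfolding Z_def by auto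
    \<comment> \<open>The equality passes from the relative interior to the cell, which is its
      closure.\<close>
    have "h x = a i x" if x: "x \<in> K s" for x
    proof -
      have cl': "closure ?R = K s"
        using convex_closure_rel_interior[OF conv] polytope_imp_closed[OF polyK[of s]] by (metis closure_closed)
      have "continuous_on (closure ?R) (\<lambda>x. h x - a i x)"
        unfolding cl' using cont(1)[OF Kc i(1)] cont(2)[OF Kc i(1)] by (rule continuous_on_diff)
      then have "h x - a i x = 0"
        by (rule continuous_constant_on_closure) (use eqR x cl' in auto)
      then show ?thesis by simp
    qed
    then show ?thesis using affine_on_cong[OF affine_on_subset[OF I(2)[OF i(1)]]] by (metis subset_UNIV)
  qed
  then show ?thesis unfolding pl_map_iff using cov polyK finP
    by (intro exI[of _ "K ` Pow P"]) auto
qed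

text \<open>On each piece of M the map q has an affine left inverse. At every point h therefore
  takes one of finitely many values, each depending affinely on the point within a piece of P. A
  continuous choice among them is PL.\<close>

lemma pl_map_lift:
  assumes q: "pl_map M q" "\<And>y. finite {x \<in> M. q x = y}"
    and h: "continuous_on P h" "h ` P \<subseteq> M" and qh: "pl_map P (q \<circ> h)"
  shows "pl_map P h"
proof -
  obtain D where D: "finite D" "\<Union>D = M" "\<And>c. c \<in> D \<Longrightarrow> polytope c \<and> affine_on c q \<and> inj_on q c"
    using pl_map_finite_fibres_pieces[OF q] by metis
  have "\<forall>d\<in>D. \<exists>g. affine_on UNIV g \<and> (\<forall>x\<in>d. g (q x) = x)"
    using affine_on_inverse D(3) polytope_imp_convex by metis
  then obtain g where g: "\<And>d. d \<in> D \<Longrightarrow> affine_on UNIV (g d)" "\<And>d x. d \<in> D \<Longrightarrow> x \<in> d \<Longrightarrow> g d (q x) = x"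
    by metis
  obtain C where C: "finite C" "\<Union>C = P" "\<forall>c\<in>C. polytope c \<and> affine_on c (q \<circ> h)" using qh unfolding pl_map_iff by auto
  have "pl_map c h" if c: "c \<in> C" for c
  proof -
    obtain A b where A: "linear A" "\<And>x. x \<in> c \<Longrightarrow> (q \<circ> h) x = A x + b" using c C(3) unfolding affine_on_def by blast
    show ?thesis
    proof (rule pl_map_finite_affine_selection[where I=D and a="\<lambda>d. g d \<circ> (\<lambda>x. A x + b)"])
      show "polytope c" using c C by auto
      show "continuous_on c h" using h(1) c C(2) by (metis Union_upper continuous_on_subset)
      show "finite D" by fact
      show "affine_on UNIV (g d \<circ> (\<lambda>x. A x + b))" if "d \<in> D" for d
        by (rule affine_on_compose[OF affine_on_linear[OF A(1)] g(1)[OF that]]) auto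
      fix x assume x: "x \<in> c"
      then have "h x \<in> M" using c C(2) h(2) by blast
      then obtain d where d: "d \<in> D" "h x \<in> d" using D(2) by auto
      then have "h x = (g d \<circ> (\<lambda>x. A x + b)) x" using g(2)[OF d] A(2)[OF x] by simp
      then show "\<exists>d\<in>D. h x = (g d \<circ> (\<lambda>x. A x + b)) x" using d by blast
    qed
  qed
  then have "pl_map (\<Union>c\<in>C. c) h" using C(1) by (intro pl_map_Union)
  then show ?thesis using C(2) by simp
qed

subsection \<open>Groups of isotopy classes\<close>

lemma pl_map_time_reparam:
  assumes "compact_polyhedron P" "polytope I"
  shows "pl_map (P \<times> I) (\<lambda>(x, t). (x, (a::real) * t + b))"
proof -
  have "linear (\<lambda>(x::'a, t). (x, a * t))" by (rule linearI) (auto simp: algebra_simps)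
  then have "affine_on (P \<times> I) (\<lambda>z. (\<lambda>(x::'a, t). (x, a * t)) z + (0, b))" by (rule affine_on_linear)
  then have "affine_on (P \<times> I) (\<lambda>(x, t). (x, a * t + b))" by (rule affine_on_cong) auto
  then show ?thesis
    using assms by (intro pl_map_affine compact_polyhedron_Times polytope_imp_compact_polyhedron[of I])
qed

lemma polytope_real_interval: "polytope {a..b::real}"
  using polytope_interval[of a b] by simp

lemma pl_map_slice:
  assumes "pl_map (P \<times> I) h" "t \<in> I" "compact_polyhedron P" shows "pl_map P (\<lambda>x. h (x, t))"
proof -
  have "linear (\<lambda>x::'a. (x, 0::'b))" by (rule linearI) auto
  from affine_on_linear[OF this, of P "(0, t)"] have "affine_on P (\<lambda>x. (x, t))" by simp
  then have "pl_map P (\<lambda>x. (x, t))" using assms(3) by (rule pl_map_affine[rotated])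
  from pl_map_compose[OF this assms(1)] have "pl_map P (h \<circ> (\<lambda>x. (x, t)))" using assms(2) by auto
  then show ?thesis by (simp add: comp_def)
qed

lemma pl_map_fst: assumes "pl_map P f" "polytope I" shows "pl_map (P \<times> I) (\<lambda>(x, t). f x)"
proof -
  have "affine_on (P \<times> I) fst" using affine_on_linear[OF linear_fst, of _ 0] by simp
  then have "pl_map (P \<times> I) fst"
    using assms by (intro pl_map_affine compact_polyhedron_Times polytope_imp_compact_polyhedron[of I]) (auto intro: pl_map_imp_polyhedron)
  from pl_map_compose[OF this assms(1)] show ?thesis by (auto simp: comp_def case_prod_unfold)
qed

lemma isotopic_trans:
  assumes "isotopic M G f g" "isotopic M G g h" shows "isotopic M G f h"
proof -
  obtain H where H: "pl_map (M \<times> {0..1}) (\<lambda>(x, t). H t x)" "\<forall>t\<in>{0..1}. H t \<in> carrier G" "H (0::real) = f" "H 1 = g"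
    using assms(1) unfolding isotopic_def by blast
  obtain K where K: "pl_map (M \<times> {0..1}) (\<lambda>(x, t). K t x)" "\<forall>t\<in>{0..1}. K t \<in> carrier G" "K (0::real) = g" "K 1 = h"
    using assms(2) unfolding isotopic_def by blast
  have "compact_polyhedron M"
  proof -
    have "compact_polyhedron (fst ` (M \<times> {0..1::real}))"
      by (rule pl_map_image_polyhedron[OF pl_map_affine[OF pl_map_imp_polyhedron[OF H(1)]]])
        (use affine_on_linear[OF linear_fst, of _ 0] in simp)
    then show ?thesis by simp
  qed
  define J where "J t = (if t \<le> 1/2 then H (2 * t + 0) else K (2 * t + (-1)))" for t
  have "pl_map (M \<times> {0..1/2}) ((\<lambda>(x, t). H t x) \<circ> (\<lambda>(x, t). (x, 2 * t + 0)))"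
    by (rule pl_map_compose[OF pl_map_time_reparam H(1)]) (use \<open>compact_polyhedron M\<close> polytope_real_interval in auto)
  then have 1: "pl_map (M \<times> {0..1/2}) (\<lambda>(x, t). J t x)"
    by (rule pl_map_cong) (auto simp: J_def)
  have "pl_map (M \<times> {1/2..1}) ((\<lambda>(x, t). K t x) \<circ> (\<lambda>(x, t). (x, 2 * t + (-1))))"
    by (rule pl_map_compose[OF pl_map_time_reparam K(1)]) (use \<open>compact_polyhedron M\<close> polytope_real_interval in auto)
  \<comment> \<open>At t = 1/2 the definition of J uses H, and the end \<open>H 1\<close> is the
    start \<open>K 0\<close>, so J also agrees with the second half there.\<close>
  then have 2: "pl_map (M \<times> {1/2..1}) (\<lambda>(x, t). J t x)"
  proof (rule pl_map_cong)
    fix z :: "'a \<times> real" assume z: "z \<in> M \<times> {1/2..1}"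
    obtain x t where [simp]: "z = (x, t)" by force
    show "((\<lambda>(x, t). K t x) \<circ> (\<lambda>(x, t). (x, 2 * t + (-1)))) z = (case z of (x, t) \<Rightarrow> J t x)"
    proof (cases "t = 1/2")
      case True
      then have "2 * t + 0 = 1" "2 * t + (-1) = 0" by auto
      moreover have "J t = H (2 * t + 0)" using True by (simp add: J_def)
      ultimately have "K (2 * t + (-1)) = J t" using H(4) K(3) by metis
      then show ?thesis by simp
    next
      case False then show ?thesis using z by (auto simp: J_def)
    qed
  qed
  have "M \<times> {0..1/2} \<union> M \<times> {1/2..1} = M \<times> {0..1::real}" by auto
  then have "pl_map (M \<times> {0..1}) (\<lambda>(x, t). J t x)" using pl_map_Un[OF 1 2] by simp
  moreover have "\<forall>t\<in>{0..1}. J t \<in> carrier G" using H(2) K(2) by (auto simp: J_def)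
  moreover have "J 0 = f" "J 1 = h" using H K by (auto simp: J_def)
  ultimately show ?thesis unfolding isotopic_def by blast
qed

lemma isotopic_sym:
  assumes "isotopic M G f g" shows "isotopic M G g f"
proof -
  obtain H where H: "pl_map (M \<times> {0..1}) (\<lambda>(x, t). H t x)" "\<forall>t\<in>{0..1}. H t \<in> carrier G" "H (0::real) = f" "H 1 = g"
    using assms(1) unfolding isotopic_def by blast
  have "compact_polyhedron M"
  proof -
    have "compact_polyhedron (fst ` (M \<times> {0..1::real}))"
      by (rule pl_map_image_polyhedron[OF pl_map_affine[OF pl_map_imp_polyhedron[OF H(1)]]])
        (use affine_on_linear[OF linear_fst, of _ 0] in simp)
    then show ?thesis by simp
  qed
  have "pl_map (M \<times> {0..1}) ((\<lambda>(x, t). H t x) \<circ> (\<lambda>(x, t). (x, (-1) * t + 1)))"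
    by (rule pl_map_compose[OF pl_map_time_reparam H(1)]) (use \<open>compact_polyhedron M\<close> polytope_real_interval in auto)
  then have "pl_map (M \<times> {0..1}) (\<lambda>(x, t). H (1 - t) x)" by (rule pl_map_cong) auto
  then show ?thesis unfolding isotopic_def
    by (intro exI[of _ "\<lambda>t. H (1 - t)"]) (use H in auto)
qed

text \<open>The set of maps is the parameter, and the group is cut out of \<open>BijGroup M\<close>,
  because both groups of the theorem arise from \<open>BijGroup\<close> by a change of
  carrier.\<close>

locale pl_homeo_group =
  fixes M :: "'a::euclidean_space set" and X :: "('a \<Rightarrow> 'a) set"
  assumes subgroup: "subgroup X (BijGroup M)" and pl: "\<And>f. f \<in> X \<Longrightarrow> pl_map M f"
begin

abbreviation G where "G \<equiv> (BijGroup M)\<lparr>carrier := X\<rparr>"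

lemma carrier_G [simp]: "carrier G = X" by simp

lemma in_Bij: "f \<in> X \<Longrightarrow> f \<in> Bij M"
  using subgroup.subset[OF subgroup] by (auto simp: BijGroup_def)

lemma in_funcset: "f \<in> X \<Longrightarrow> f \<in> M \<rightarrow> M"
  using in_Bij Bij_imp_funcset by blast

lemma group_G: "group G"
  using subgroup.subgroup_is_group[OF subgroup group_BijGroup] .

lemma mult_G: "f \<in> X \<Longrightarrow> g \<in> X \<Longrightarrow> f \<otimes>\<^bsub>G\<^esub> g = compose M f g"
  using in_Bij by (simp add: BijGroup_def)

lemma one_G: "\<one>\<^bsub>G\<^esub> = (\<lambda>x\<in>M. x)" by (simp add: BijGroup_def)

lemma isotopic_refl: "f \<in> X \<Longrightarrow> isotopic M G f f"
  unfolding isotopic_def using pl_map_fst[OF pl polytope_real_interval] by (intro exI[of _ "\<lambda>t. f"]) auto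

lemma isotopic_mult:
  assumes "isotopic M G f g" "isotopic M G f' g'"
  shows "isotopic M G (f \<otimes>\<^bsub>G\<^esub> f') (g \<otimes>\<^bsub>G\<^esub> g')"
proof -
  obtain H where H: "pl_map (M \<times> {0..1}) (\<lambda>(x, t). H t x)" "\<forall>t\<in>{0..1}. H t \<in> X" "H (0::real) = f" "H 1 = g"
    using assms(1) unfolding isotopic_def by auto
  obtain K where K: "pl_map (M \<times> {0..1}) (\<lambda>(x, t). K t x)" "\<forall>t\<in>{0..1}. K t \<in> X" "K (0::real) = f'" "K 1 = g'"
    using assms(2) unfolding isotopic_def by auto
  have snd: "pl_map (M \<times> {0..1::real}) snd"
    by (rule pl_map_affine[OF pl_map_imp_polyhedron[OF H(1)]]) (use affine_on_linear[OF linear_snd, of _ 0] in simp)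
  have "pl_map (M \<times> {0..1}) (\<lambda>z. ((\<lambda>(x, t). K t x) z, snd z))" by (rule pl_map_Pair[OF K(1) snd])
  then have "pl_map (M \<times> {0..1}) ((\<lambda>(x, t). H t x) \<circ> (\<lambda>z. ((\<lambda>(x, t). K t x) z, snd z)))"
    by (rule pl_map_compose[OF _ H(1)]) (use K(2) in_funcset in fastforce)
  then have "pl_map (M \<times> {0..1}) (\<lambda>(x, t). (H t \<otimes>\<^bsub>G\<^esub> K t) x)"
  proof (rule pl_map_cong)
    fix z assume "z \<in> M \<times> {0..1::real}"
    then obtain x t where z: "z = (x, t)" "x \<in> M" "t \<in> {0..1}" by blast
    have "(H t \<otimes>\<^bsub>G\<^esub> K t) x = H t (K t x)"
      using mult_G[of "H t" "K t"] H(2) K(2) z by (simp add: compose_def)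
    then show "((\<lambda>(x, t). H t x) \<circ> (\<lambda>z. ((\<lambda>(x, t). K t x) z, snd z))) z = (case z of (x, t) \<Rightarrow> (H t \<otimes>\<^bsub>G\<^esub> K t) x)"
      using z by simp
  qed
  moreover have "\<forall>t\<in>{0..1}. H t \<otimes>\<^bsub>G\<^esub> K t \<in> X"
    using H(2) K(2) group.is_monoid[OF group_G, THEN monoid.m_closed] by simp
  ultimately show ?thesis unfolding isotopic_def
    by (intro exI[of _ "\<lambda>t. H t \<otimes>\<^bsub>G\<^esub> K t"]) (use H K in auto)
qed

lemma isotopic_in: "isotopic M G f g \<Longrightarrow> f \<in> X \<and> g \<in> X"
  unfolding isotopic_def by force

abbreviation cls where "cls \<equiv> isotopy_class M G"

lemma in_cls: "g \<in> cls f \<longleftrightarrow> isotopic M G f g"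
  unfolding isotopy_class_def using isotopic_in by auto

lemma cls_eq_iff: "f \<in> X \<Longrightarrow> g \<in> X \<Longrightarrow> cls f = cls g \<longleftrightarrow> isotopic M G f g"
  using in_cls isotopic_refl isotopic_sym isotopic_trans by blast

text \<open>The product in \<open>pi0\<close> is the product of sets, so it must be seen that it
  yields an entire class. If h is isotopic to the product of f and g, then h times the inverse of g
  is isotopic to f, and h is the product of this element with g.\<close>

lemma cls_mult:
  assumes "f \<in> X" "g \<in> X" shows "cls f <#>\<^bsub>G\<^esub> cls g = cls (f \<otimes>\<^bsub>G\<^esub> g)"
proof -
  interpret G: group G by (rule group_G)
  have 1: "f \<in> carrier G" "g \<in> carrier G" using assms by auto
  show ?thesis
  proof
    show "cls f <#>\<^bsub>G\<^esub> cls g \<subseteq> cls (f \<otimes>\<^bsub>G\<^esub> g)"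
      unfolding set_mult_def using in_cls isotopic_mult by blast
    show "cls (f \<otimes>\<^bsub>G\<^esub> g) \<subseteq> cls f <#>\<^bsub>G\<^esub> cls g"
    proof
      fix h assume "h \<in> cls (f \<otimes>\<^bsub>G\<^esub> g)"
      then have h: "isotopic M G (f \<otimes>\<^bsub>G\<^esub> g) h" and hX: "h \<in> carrier G" using in_cls isotopic_in by auto
      have "isotopic M G ((f \<otimes>\<^bsub>G\<^esub> g) \<otimes>\<^bsub>G\<^esub> inv\<^bsub>G\<^esub> g) (h \<otimes>\<^bsub>G\<^esub> inv\<^bsub>G\<^esub> g)"
        by (rule isotopic_mult[OF h isotopic_refl]) (use G.inv_closed[OF 1(2)] in simp)
      moreover have "(f \<otimes>\<^bsub>G\<^esub> g) \<otimes>\<^bsub>G\<^esub> inv\<^bsub>G\<^esub> g = f"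
        using 1 G.m_assoc G.inv_closed G.r_inv G.r_one by metis
      ultimately have "h \<otimes>\<^bsub>G\<^esub> inv\<^bsub>G\<^esub> g \<in> cls f" unfolding in_cls by (simp only:)
      moreover have "h = (h \<otimes>\<^bsub>G\<^esub> inv\<^bsub>G\<^esub> g) \<otimes>\<^bsub>G\<^esub> g"
        using 1 hX G.m_assoc G.inv_closed G.l_inv G.r_one by metis
      ultimately show "h \<in> cls f <#>\<^bsub>G\<^esub> cls g" unfolding set_mult_def using in_cls isotopic_refl assms by blast
    qed
  qed
qed

lemma carrier_pi0: "carrier (pi0 M G) = cls ` X"
  and mult_pi0: "monoid.mult (pi0 M G) = set_mult G" and one_pi0: "\<one>\<^bsub>pi0 M G\<^esub> = cls \<one>\<^bsub>G\<^esub>"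
  by (simp_all add: pi0_def)

lemma group_pi0: "group (pi0 M G)"
proof -
  interpret G: group G by (rule group_G)
  show ?thesis
  proof (rule groupI)
    show "\<one>\<^bsub>pi0 M G\<^esub> \<in> carrier (pi0 M G)" using G.one_closed unfolding carrier_pi0 one_pi0 by simp
    fix x assume "x \<in> carrier (pi0 M G)"
    then obtain f where f: "f \<in> X" "x = cls f" unfolding carrier_pi0 by auto
    have m: "cls f <#>\<^bsub>G\<^esub> cls g = cls (f \<otimes>\<^bsub>G\<^esub> g)" if "f \<in> carrier G" "g \<in> carrier G" for f g
      using cls_mult that by (simp only: carrier_G)
    have fG: "f \<in> carrier G" using f by simp
    show "\<one>\<^bsub>pi0 M G\<^esub> \<otimes>\<^bsub>pi0 M G\<^esub> x = x"
      unfolding mult_pi0 one_pi0 f(2) m[OF G.one_closed fG] G.l_one[OF fG] ..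
    show "\<exists>y\<in>carrier (pi0 M G). y \<otimes>\<^bsub>pi0 M G\<^esub> x = \<one>\<^bsub>pi0 M G\<^esub>"
    proof
      show "cls (inv\<^bsub>G\<^esub> f) \<otimes>\<^bsub>pi0 M G\<^esub> x = \<one>\<^bsub>pi0 M G\<^esub>"
        unfolding mult_pi0 one_pi0 f(2) m[OF G.inv_closed[OF fG] fG] G.l_inv[OF fG] ..
      show "cls (inv\<^bsub>G\<^esub> f) \<in> carrier (pi0 M G)" using G.inv_closed[OF fG] unfolding carrier_pi0 by simp
    qed
    fix y assume "y \<in> carrier (pi0 M G)"
    then obtain g where g: "g \<in> X" "y = cls g" unfolding carrier_pi0 by auto
    have gG: "g \<in> carrier G" using g by simp
    show "x \<otimes>\<^bsub>pi0 M G\<^esub> y \<in> carrier (pi0 M G)"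
      unfolding mult_pi0 f(2) g(2) m[OF fG gG] carrier_pi0 using G.m_closed[OF fG gG] by simp
    fix z assume "z \<in> carrier (pi0 M G)"
    then obtain h where h: "h \<in> X" "z = cls h" unfolding carrier_pi0 by auto
    have hG: "h \<in> carrier G" using h by simp
    show "x \<otimes>\<^bsub>pi0 M G\<^esub> y \<otimes>\<^bsub>pi0 M G\<^esub> z = x \<otimes>\<^bsub>pi0 M G\<^esub> (y \<otimes>\<^bsub>pi0 M G\<^esub> z)"
      unfolding mult_pi0 f(2) g(2) h(2) m[OF fG gG] m[OF gG hG] m[OF G.m_closed[OF fG gG] hG]
        m[OF fG G.m_closed[OF gG hG]] G.m_assoc[OF fG gG hG] ..
  qed
qed

end

text \<open>
  A surjection of groups of homeomorphisms with the isotopy lifting property induces a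
  surjection of isotopy class groups whose kernel is the image of its kernel.
\<close>
lemma pi0_quotient_iso:
  fixes M :: "'b::euclidean_space set" and N :: "'a::euclidean_space set"
  assumes X: "pl_homeo_group M X" and Y: "pl_homeo_group N Y"
  defines "F \<equiv> (BijGroup M)\<lparr>carrier := X\<rparr>" and "K \<equiv> (BijGroup N)\<lparr>carrier := Y\<rparr>"
  assumes hom: "\<Phi> \<in> hom F K" and surj: "\<Phi> ` X = Y"
    and desc: "\<And>f g. isotopic M F f g \<Longrightarrow> isotopic N K (\<Phi> f) (\<Phi> g)"
    and lift: "\<And>f k. f \<in> X \<Longrightarrow> isotopic N K (\<Phi> f) k \<Longrightarrow> \<exists>f'. isotopic M F f f' \<and> \<Phi> f' = k"
    and T: "T \<in> X" and ker: "\<And>f. f \<in> X \<Longrightarrow> \<Phi> f = \<one>\<^bsub>K\<^esub> \<longleftrightarrow> f = \<one>\<^bsub>F\<^esub> \<or> f = T"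
  shows "generate (pi0 M F) {isotopy_class M F T} \<lhd> pi0 M F \<and>
    pi0 M F Mod generate (pi0 M F) {isotopy_class M F T} \<cong> pi0 N K"
proof -
  interpret X: pl_homeo_group M X by fact
  interpret Y: pl_homeo_group N Y by fact
  interpret F: group F using X.group_G F_def by simp
  interpret K: group K using Y.group_G K_def by simp
  interpret PF: group "pi0 M F" using X.group_pi0 F_def by simp
  interpret PK: group "pi0 N K" using Y.group_pi0 K_def by simp
  \<comment> \<open>The induced map sends a class to its direct image, which avoids a choice of
    representatives.\<close>
  let ?\<psi> = "\<lambda>c. \<Phi> ` c"
  have cF: "carrier F = X" and cK: "carrier K = Y" by (simp_all add: F_def K_def)
  have \<Phi>Y: "\<Phi> f \<in> Y" if "f \<in> X" for f using surj that by auto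
  have inX: "g \<in> isotopy_class M F f \<longleftrightarrow> isotopic M F f g" for f g using X.in_cls F_def by simp
  have inY: "g \<in> isotopy_class N K f \<longleftrightarrow> isotopic N K f g" for f g using Y.in_cls K_def by simp
  \<comment> \<open>That the image of a class is contained in a class is the descent of isotopies;
    that it fills the class is the lifting of isotopies.\<close>
  have \<psi>: "?\<psi> (isotopy_class M F f) = isotopy_class N K (\<Phi> f)" if fX: "f \<in> X" for f
  proof
    show "?\<psi> (isotopy_class M F f) \<subseteq> isotopy_class N K (\<Phi> f)" using desc inX inY by blast
    show "isotopy_class N K (\<Phi> f) \<subseteq> ?\<psi> (isotopy_class M F f)"
    proof
      fix k assume "k \<in> isotopy_class N K (\<Phi> f)"
      then obtain f' where "isotopic M F f f'" "\<Phi> f' = k" using lift[OF fX] inY by blast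
      then show "k \<in> ?\<psi> (isotopy_class M F f)" using inX by blast
    qed
  qed
  have cPF: "carrier (pi0 M F) = isotopy_class M F ` X" and cPK: "carrier (pi0 N K) = isotopy_class N K ` Y"
    using X.carrier_pi0 Y.carrier_pi0 F_def K_def by auto
  have mF: "isotopy_class M F f \<otimes>\<^bsub>pi0 M F\<^esub> isotopy_class M F g = isotopy_class M F (f \<otimes>\<^bsub>F\<^esub> g)" if "f \<in> X" "g \<in> X" for f g
    using X.cls_mult that X.mult_pi0 F_def by simp
  have mK: "isotopy_class N K f \<otimes>\<^bsub>pi0 N K\<^esub> isotopy_class N K g = isotopy_class N K (f \<otimes>\<^bsub>K\<^esub> g)" if "f \<in> Y" "g \<in> Y" for f g
    using Y.cls_mult that Y.mult_pi0 K_def by simp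
  have oF: "\<one>\<^bsub>pi0 M F\<^esub> = isotopy_class M F \<one>\<^bsub>F\<^esub>" and oK: "\<one>\<^bsub>pi0 N K\<^esub> = isotopy_class N K \<one>\<^bsub>K\<^esub>"
    using X.one_pi0 Y.one_pi0 F_def K_def by auto
  have "?\<psi> \<in> hom (pi0 M F) (pi0 N K)"
  proof (rule homI)
    fix x assume "x \<in> carrier (pi0 M F)"
    then obtain f where f: "f \<in> X" "x = isotopy_class M F f" unfolding cPF by auto
    show "?\<psi> x \<in> carrier (pi0 N K)" using f \<psi> \<Phi>Y cPK by auto
    fix y assume "y \<in> carrier (pi0 M F)"
    then obtain g where g: "g \<in> X" "y = isotopy_class M F g" unfolding cPF by auto
    have "f \<otimes>\<^bsub>F\<^esub> g \<in> X" using F.m_closed[of f g] f g cF by simp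
    then show "?\<psi> (x \<otimes>\<^bsub>pi0 M F\<^esub> y) = ?\<psi> x \<otimes>\<^bsub>pi0 N K\<^esub> ?\<psi> y"
      using f g \<psi> mF mK \<Phi>Y hom_mult[OF hom, of f g] cF by simp
  qed
  then interpret \<psi>: group_hom "pi0 M F" "pi0 N K" ?\<psi> by (simp add: group_hom_def group_hom_axioms_def PF.is_group PK.is_group)
  have im: "?\<psi> ` carrier (pi0 M F) = carrier (pi0 N K)"
  proof -
    have "?\<psi> ` (isotopy_class M F ` X) = isotopy_class N K ` (\<Phi> ` X)" using \<psi> by (simp add: image_image)
    then show ?thesis using cPF cPK surj by simp
  qed
  let ?k = "kernel (pi0 M F) (pi0 N K) ?\<psi>"
  have one: "\<one>\<^bsub>F\<^esub> \<in> X" using F.one_closed cF by simp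
  have \<Phi>1: "\<Phi> \<one>\<^bsub>F\<^esub> = \<one>\<^bsub>K\<^esub>" "\<Phi> T = \<one>\<^bsub>K\<^esub>" using ker one T by auto
  have k1: "isotopy_class M F T \<in> ?k"
    unfolding kernel_def using T \<psi>[OF T] \<Phi>1 cPF oK by simp
  \<comment> \<open>If the image of f is isotopic to the identity, lifting this isotopy from f moves
    f within its class to an element of the kernel of \<open>\<Phi>\<close>, which is the identity
    or T.\<close>
  have k2: "x = \<one>\<^bsub>pi0 M F\<^esub> \<or> x = isotopy_class M F T" if xk: "x \<in> ?k" for x
  proof -
    obtain f where f: "f \<in> X" "x = isotopy_class M F f" "isotopy_class N K (\<Phi> f) = isotopy_class N K \<one>\<^bsub>K\<^esub>"
      using xk \<psi> oK unfolding kernel_def cPF by auto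
    have "\<one>\<^bsub>K\<^esub> \<in> Y" using K.one_closed cK by simp
    then have "isotopic N K (\<Phi> f) \<one>\<^bsub>K\<^esub>" using f(3) Y.cls_eq_iff[of "\<Phi> f"] \<Phi>Y[OF f(1)] K_def by simp
    then obtain f' where f': "isotopic M F f f'" "\<Phi> f' = \<one>\<^bsub>K\<^esub>" using lift f(1) by blast
    have f'X: "f' \<in> X" using X.isotopic_in f'(1) F_def by auto
    have "isotopy_class M F f = isotopy_class M F f'" using X.cls_eq_iff[OF f(1) f'X] f'(1) F_def by simp
    moreover have "f' = \<one>\<^bsub>F\<^esub> \<or> f' = T" using ker[OF f'X] f'(2) by simp
    ultimately show ?thesis using f oF by auto
  qed
  have gk: "generate (pi0 M F) {isotopy_class M F T} = ?k"
  proof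
    show "generate (pi0 M F) {isotopy_class M F T} \<subseteq> ?k"
      by (rule PF.generate_subgroup_incl) (use k1 \<psi>.subgroup_kernel in auto)
    show "?k \<subseteq> generate (pi0 M F) {isotopy_class M F T}"
      using k2 generate.one generate.incl by (metis singletonI subsetI)
  qed
  show ?thesis unfolding gk using \<psi>.normal_kernel \<psi>.FactGroup_iso[OF im] by simp
qed

subsection \<open>Charts of PL spheres\<close>

lemma barycentric_unique:
  assumes C: "\<not> affine_dependent C" and "finite C"
    and u: "sum u C = 1" and v: "sum v C = 1" and eq: "(\<Sum>x\<in>C. u x *\<^sub>R x) = (\<Sum>x\<in>C. v x *\<^sub>R x)"
    and x: "x \<in> C"
  shows "u x = v x"
proof (rule ccontr)
  assume "u x \<noteq> v x"
  moreover have "sum (\<lambda>x. u x - v x) C = 0" using u v by (simp add: sum_subtractf)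
  moreover have "(\<Sum>x\<in>C. (u x - v x) *\<^sub>R x) = 0" using eq by (simp add: scaleR_diff_left sum_subtractf)
  ultimately show False using C affine_dependent_explicit_finite[OF \<open>finite C\<close>] x by auto
qed

text \<open>Two domains are needed: \<open>pl_map\<close> refers to compact polyhedra, whereas a
  chart should be open. So k is PL and injective on Q and an open map on the part \<open>O'\<close>
  of Q.\<close>

definition pl_chart ::
  "nat \<Rightarrow> 'a::euclidean_space set \<Rightarrow> 'a set \<Rightarrow> 'a set \<Rightarrow> 'a set \<Rightarrow> ('a \<Rightarrow> 'a) \<Rightarrow> bool" where
  "pl_chart n S T O' Q k \<longleftrightarrow> affine T \<and> aff_dim T = int n \<and> openin (top_of_set T) O' \<and> O' \<subseteq> Q \<and> Q \<subseteq> T \<and>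
    pl_map Q k \<and> inj_on k Q \<and> k ` Q \<subseteq> S \<and>
    (\<forall>U. openin (top_of_set T) U \<longrightarrow> U \<subseteq> O' \<longrightarrow> openin (top_of_set S) (k ` U))"

text \<open>The boundary of a simplex without the face opposite to a vertex v is flattened into the
  affine hull of that face by the affine map that fixes the face and sends v to its
  barycentre.\<close>

lemma pl_sphere_chart:
  fixes S :: "'a::euclidean_space set"
  assumes S: "pl_sphere n S" and y: "y \<in> S"
  obtains T O' Q k where "pl_chart n S T O' Q k" "y \<in> k ` O'"
proof -
  obtain \<Delta> :: "'a set" and h where \<Delta>: "(int n + 1) simplex \<Delta>" and h: "pl_map (rel_frontier \<Delta>) h" "bij_betw h (rel_frontier \<Delta>) S"
    using S unfolding pl_sphere_def pl_homeomorphism_def by blast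
  obtain C where C: "finite C" "\<not> affine_dependent C" "int (card C) = int n + 2" "\<Delta> = convex hull C"
    using \<Delta> unfolding simplex by auto
  obtain z where z: "z \<in> rel_frontier \<Delta>" "h z = y" using y h(2) by (auto simp: bij_betw_def)
  then obtain uz where uz: "\<forall>x\<in>C. 0 \<le> uz x" "\<exists>x\<in>C. uz x = 0" "sum uz C = 1" "(\<Sum>x\<in>C. uz x *\<^sub>R x) = z"
    unfolding C(4) rel_frontier_convex_hull_explicit[OF C(2)] by auto
  \<comment> \<open>A positive coordinate at v means that z is not in the face F opposite to v, the
    face to be removed.\<close>
  obtain v where v: "v \<in> C" "uz v > 0"
    using uz(1,3) by (metis less_eq_real_def sum.neutral zero_neq_one)
  define D where "D = C - {v}"
  have D: "finite D" "int (card D) = int n + 1" "D \<noteq> {}" "\<not> affine_dependent D" "v \<notin> D" "C = insert v D"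
  proof -
    show "finite D" "\<not> affine_dependent D" "v \<notin> D" "C = insert v D"
      using C v affine_independent_Diff[OF C(2)] by (auto simp: D_def)
    show card: "int (card D) = int n + 1" using C(1,3) v(1) by (simp add: D_def card_Diff_singleton)
    then show "D \<noteq> {}" by auto
  qed
  define m where "m = real (card D)"
  have m: "m > 0" using D by (simp add: m_def card_gt_0_iff)
  define b where "b = (\<Sum>x\<in>D. x /\<^sub>R m)"
  have "independent ((\<lambda>x. x - v) ` D)"
    using C(2) v affine_dependent_iff_dependent2[OF v(1)] unfolding D_def
    by (metis (no_types, lifting) image_cong uminus_add_conv_diff)
  moreover have "inj_on (\<lambda>x. x - v) D" by (auto intro: inj_onI)
  ultimately obtain g where g: "linear g" "\<And>x. x \<in> D \<Longrightarrow> g (x - v) = x - b"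
  proof -
    assume i: "independent ((\<lambda>x. x - v) ` D)" and "inj_on (\<lambda>x. x - v) D"
    obtain g where "linear g" "\<forall>x\<in>(\<lambda>x. x - v) ` D. g x = (\<lambda>w. w + v - b) x"
      using linear_independent_extend[OF i, of "\<lambda>w. w + v - b"] by blast
    then show ?thesis by (intro that[of g]) auto
  qed
  \<comment> \<open>p is the affine map with p x = x on D and p v = b.\<close>
  define p where "p x = g x + (b - g v)" for x
  have p_eq: "p (\<Sum>x\<in>C. u x *\<^sub>R x) = (\<Sum>x\<in>D. (u x + u v / m) *\<^sub>R x)" if "sum u C = 1" for u
  proof -
    have uv: "u v = 1 - sum u D" using that D(1,5,6) by simp
    have gx: "g x = x - b + g v" if "x \<in> D" for x using g(2)[OF that] by (simp add: linear_diff[OF g(1)] algebra_simps)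
    have "g (\<Sum>x\<in>C. u x *\<^sub>R x) = u v *\<^sub>R g v + (\<Sum>x\<in>D. u x *\<^sub>R g x)"
      using D(1,5,6) by (simp add: linear_add[OF g(1)] linear_scale[OF g(1)] linear_sum[OF g(1)])
    also have "(\<Sum>x\<in>D. u x *\<^sub>R g x) = (\<Sum>x\<in>D. u x *\<^sub>R x + u x *\<^sub>R (g v - b))"
      by (rule sum.cong) (simp_all add: gx algebra_simps)
    also have "\<dots> = (\<Sum>x\<in>D. u x *\<^sub>R x) + sum u D *\<^sub>R (g v - b)" by (simp add: sum.distrib scaleR_left.sum)
    finally have "p (\<Sum>x\<in>C. u x *\<^sub>R x) = (\<Sum>x\<in>D. u x *\<^sub>R x) + u v *\<^sub>R b"
      unfolding p_def uv by (simp add: algebra_simps)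
    moreover have "u v *\<^sub>R b = (\<Sum>x\<in>D. (u v / m) *\<^sub>R x)" unfolding b_def by (simp add: scaleR_sum_right divide_inverse)
    ultimately show ?thesis by (simp add: scaleR_add_left sum.distrib)
  qed
  have p_sum: "(\<Sum>x\<in>D. u x + u v / m) = 1" if "sum u C = 1" for u
    using that D(1,3,5,6) m by (simp add: sum.distrib m_def)
  define F where "F = convex hull D"
  define P where "P = \<Union>((\<lambda>x. convex hull (C - {x})) ` D)"
  define O1 where "O1 = rel_frontier \<Delta> - F"
  have Pcoord: "\<exists>u. (\<forall>x\<in>C. 0 \<le> u x) \<and> (\<exists>x\<in>D. u x = 0) \<and> sum u C = 1 \<and> (\<Sum>x\<in>C. u x *\<^sub>R x) = w" if wP: "w \<in> P" for w
  proof -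
    obtain x where x: "x \<in> D" "w \<in> convex hull (C - {x})" using wP unfolding P_def by blast
    then obtain u where u: "\<forall>a\<in>C-{x}. 0 \<le> u a" "sum u (C-{x}) = 1" "(\<Sum>a\<in>C-{x}. u a *\<^sub>R a) = w"
      using C(1) by (auto simp: convex_hull_finite)
    have xC: "x \<in> C" using x D by auto
    let ?u = "u(x := 0)"
    have "sum ?u C = 1" using u(2) sum.remove[OF C(1) xC, of ?u] by simp
    moreover have "(\<Sum>a\<in>C. ?u a *\<^sub>R a) = w" using u(3) sum.remove[OF C(1) xC, of "\<lambda>a. ?u a *\<^sub>R a"] by simp
    ultimately show ?thesis using u(1) x(1) by (intro exI[of _ ?u]) auto
  qed
  have PF: "P \<subseteq> rel_frontier \<Delta>" unfolding P_def C(4) rel_frontier_convex_hull_cases[OF C(2)] using D by auto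
  have OP: "O1 \<subseteq> P" unfolding O1_def P_def F_def D_def C(4) rel_frontier_convex_hull_cases[OF C(2)] by auto
  have polyP: "compact_polyhedron P" unfolding P_def compact_polyhedron_def
    by (rule exI[of _ "(\<lambda>x. convex hull (C - {x})) ` D"]) (use C(1) D(1) in \<open>auto intro: polytope_convex_hull\<close>)
  have plp: "pl_map P p" unfolding p_def using polyP by (intro pl_map_affine affine_on_linear g)
  \<comment> \<open>On P some coordinate with respect to D vanishes. Hence the least barycentric
    coordinate of the image is \<open>u v / m\<close>, which recovers \<open>u v\<close> and then
    all other coordinates.\<close>
  have injp: "inj_on p P"
  proof (rule inj_onI)
    fix w w' assume w: "w \<in> P" "w' \<in> P" "p w = p w'"
    obtain u where u: "\<forall>x\<in>C. 0 \<le> u x" "\<exists>x\<in>D. u x = 0" "sum u C = 1" "(\<Sum>x\<in>C. u x *\<^sub>R x) = w" using Pcoord[OF w(1)] by auto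
    obtain u' where u': "\<forall>x\<in>C. 0 \<le> u' x" "\<exists>x\<in>D. u' x = 0" "sum u' C = 1" "(\<Sum>x\<in>C. u' x *\<^sub>R x) = w'" using Pcoord[OF w(2)] by auto
    have eq: "u x + u v / m = u' x + u' v / m" if "x \<in> D" for x
      using barycentric_unique[OF D(4,1) p_sum[OF u(3)] p_sum[OF u'(3)] _ that] p_eq[OF u(3)] p_eq[OF u'(3)] u(4) u'(4) w(3) by simp
    obtain x1 where x1: "x1 \<in> D" "u x1 = 0" using u(2) by blast
    obtain x2 where x2: "x2 \<in> D" "u' x2 = 0" using u'(2) by blast
    have "u v / m \<ge> u' v / m" using eq[OF x1(1)] x1 u'(1) D by auto
    moreover have "u v / m \<le> u' v / m" using eq[OF x2(1)] x2 u(1) D by auto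
    ultimately have e: "u v / m = u' v / m" by linarith
    then have "u v = u' v" using m by (metis less_irrefl nonzero_eq_divide_eq times_divide_eq_left)
    moreover have "u x = u' x" if "x \<in> D" for x using eq[OF that] e by simp
    ultimately have "\<And>x. x \<in> C \<Longrightarrow> u x = u' x" using D(6) by auto
    then show "w = w'" using u(4) u'(4) by (metis (no_types, lifting) sum.cong)
  qed
  have zO: "z \<in> O1"
  proof -
    have "z \<notin> F"
    proof
      assume "z \<in> F"
      then obtain u where u: "\<forall>a\<in>D. 0 \<le> u a" "sum u D = 1" "(\<Sum>a\<in>D. u a *\<^sub>R a) = z"
        using D(1) unfolding F_def by (auto simp: convex_hull_finite)
      let ?u = "u(v := 0)"
      have "sum ?u D = sum u D" "(\<Sum>a\<in>D. ?u a *\<^sub>R a) = (\<Sum>a\<in>D. u a *\<^sub>R a)"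
        using D(5) by (intro sum.cong; auto)+
      then have "sum ?u C = 1" "(\<Sum>a\<in>C. ?u a *\<^sub>R a) = z" using u D(1,5,6) by auto
      then have "uz v = ?u v" using barycentric_unique[OF C(2,1) uz(3), of ?u v] uz(4) v by simp
      then show False using v by simp
    qed
    then show ?thesis using z by (simp add: O1_def)
  qed
  define T where "T = affine hull D"
  have T: "affine T" "aff_dim T = int n" using D aff_dim_affine_independent[OF D(4)] by (auto simp: T_def)
  have pT: "p ` P \<subseteq> T"
  proof clarify
    fix w assume "w \<in> P"
    then obtain u where u: "sum u C = 1" "(\<Sum>x\<in>C. u x *\<^sub>R x) = w" using Pcoord by blast
    show "p w \<in> T" unfolding T_def affine_hull_finite[OF D(1)] using p_eq[OF u(1)] p_sum[OF u(1)] u(2)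
      by (auto intro!: exI[of _ "\<lambda>x. u x + u v / m"])
  qed
  have contp: "continuous_on P p" using pl_map_continuous[OF plp] .
  have O1open: "openin (top_of_set (rel_frontier \<Delta>)) O1"
  proof -
    have "closed F" unfolding F_def using D(1) by (simp add: finite_imp_compact_convex_hull compact_imp_closed)
    then show ?thesis unfolding O1_def by (metis Diff_eq openin_open open_Compl)
  qed
  have pO: "openin (top_of_set T) (p ` O1)"
  proof (rule invariance_of_domain_sphere_affine_set_gen[where U=\<Delta> and f=p and S=O1 and T=T])
    show "continuous_on O1 p" using OP contp continuous_on_subset by blast
    show "inj_on p O1" using OP injp inj_on_subset by blast
    show "p \<in> O1 \<rightarrow> T" using OP pT by blast
    show "bounded \<Delta>" using \<Delta> compact_simplex compact_imp_bounded by blast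
    show "convex \<Delta>" using \<Delta> convex_simplex by blast
    show "affine T" by fact
    show "aff_dim T < aff_dim \<Delta>" using T aff_dim_simplex[OF \<Delta>] by simp
    show "openin (top_of_set (rel_frontier \<Delta>)) O1" by fact
  qed
  define k where "k = h \<circ> inv_into P p"
  have plk: "pl_map (p ` P) k" unfolding k_def
  proof (rule pl_map_compose)
    show "pl_map (p ` P) (inv_into P p)" by (rule pl_map_inverse[OF plp]) (use injp in simp)
    show "pl_map P h" by (rule pl_map_subset[OF h(1) polyP PF])
    show "inv_into P p ` p ` P \<subseteq> P" by (auto intro: inv_into_into)
  qed
  have kp: "k (p w) = h w" if "w \<in> P" for w using injp that by (simp add: k_def)
  have injk: "inj_on k (p ` P)"
    using h(2) PF unfolding bij_betw_def inj_on_def by (auto simp: kp)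
  have kP: "k ` p ` P \<subseteq> S" using h(2) PF by (auto simp: kp bij_betw_def)
  have comp: "compact (p ` P)" using contp compact_polyhedron_imp_compact[OF polyP] compact_continuous_image by blast
  \<comment> \<open>The image of \<open>O1\<close> is the complement in S of a compact set, the
    image of the removed face.\<close>
  have hO: "openin (top_of_set S) (k ` p ` O1)"
  proof -
    have "k ` p ` O1 = h ` O1" using kp OP by force
    also have "\<dots> = S - h ` (rel_frontier \<Delta> \<inter> F)" using h(2) unfolding O1_def bij_betw_def inj_on_def by blast
    finally have eq: "k ` p ` O1 = S - h ` (rel_frontier \<Delta> \<inter> F)" .
    have "compact (rel_frontier \<Delta>)" using compact_simplex[OF \<Delta>] by (simp add: compact_rel_frontier_bounded compact_imp_bounded)
    moreover have "closed F" unfolding F_def using D(1) by (simp add: finite_imp_compact_convex_hull compact_imp_closed)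
    ultimately have "compact (rel_frontier \<Delta> \<inter> F)" by (rule compact_Int_closed)
    then have "closed (h ` (rel_frontier \<Delta> \<inter> F))"
      using pl_map_continuous[OF h(1)] by (meson compact_continuous_image compact_imp_closed continuous_on_subset inf_le1)
    then show ?thesis unfolding eq by (metis Diff_eq openin_open open_Compl)
  qed
  show ?thesis
  proof (rule that[of T "p ` O1" "p ` P" k])
    show "y \<in> k ` p ` O1" using zO z(2) OP kp by force
    have "openin (top_of_set S) (k ` U)" if U: "openin (top_of_set T) U" "U \<subseteq> p ` O1" for U
    proof -
      have "openin (top_of_set (p ` P)) U"
        by (rule openin_subset_trans[OF U(1)]) (use U(2) OP pT in auto)
      moreover obtain k' where "homeomorphism (p ` P) (k ` p ` P) k k'"
        using homeomorphism_compact[OF comp pl_map_continuous[OF plk] refl injk] by blast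
      ultimately have "openin (top_of_set (k ` p ` P)) (k ` U)" using homeomorphism_imp_open_map by blast
      then have "openin (top_of_set (k ` p ` O1)) (k ` U)"
        by (rule openin_subset_trans) (use U(2) OP in auto)
      then show ?thesis using hO openin_trans by blast
    qed
    then show "pl_chart n S T (p ` O1) (p ` P) k"
      unfolding pl_chart_def using T pO OP pT plk injk kP by blast
  qed
qed

text \<open>One of the finitely many pieces contains infinitely many terms of a sequence decreasing
  to 0. Being closed and convex, it contains 0 and an initial interval, on which f is
  affine.\<close>

lemma pl_map_real_germ:
  fixes f :: "real \<Rightarrow> 'a::euclidean_space"
  assumes f: "pl_map {0..\<eta>} f" and "\<eta> > 0"
  obtains \<delta> u where "\<delta> > 0" "\<delta> \<le> \<eta>" "\<And>t. 0 \<le> t \<Longrightarrow> t \<le> \<delta> \<Longrightarrow> f t = f 0 + t *\<^sub>R u"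
proof -
  obtain C where C: "finite C" "\<Union>C = {0..\<eta>}" "\<forall>c\<in>C. polytope c \<and> affine_on c f" using f unfolding pl_map_iff by auto
  define s where "s n = \<eta> / real (Suc n)" for n
  have s: "s n > 0" "s n \<le> \<eta>" for n using \<open>\<eta> > 0\<close> by (auto simp: s_def field_simps)
  have "\<forall>n. \<exists>c\<in>C. s n \<in> c" using s C(2) by (metis UnionE atLeastAtMost_iff less_eq_real_def)
  then obtain c where c: "\<And>n. c n \<in> C" "\<And>n. s n \<in> c n" by metis
  have "finite (range c)" using C(1) c(1) by (meson finite_subset image_subsetI)
  then obtain n0 where inf: "infinite {n. c n = c n0}"
    using pigeonhole_infinite[of UNIV c] by auto
  let ?c = "c n0"
  have cl: "closed ?c" "convex ?c" using C(3) c(1) polytope_imp_closed polytope_imp_convex by auto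
  have "s \<longlonglongrightarrow> 0" unfolding s_def using LIMSEQ_Suc[OF lim_const_over_n[of \<eta>]] by simp
  then have "0 \<in> ?c"
  proof -
    assume lim: "s \<longlonglongrightarrow> 0"
    have "\<exists>x\<in>?c. dist x 0 < e" if "e > 0" for e
    proof -
      obtain N where N: "\<And>n. n \<ge> N \<Longrightarrow> dist (s n) 0 < e" using lim \<open>e > 0\<close> unfolding lim_sequentially by blast
      obtain n where "n \<ge> N" "c n = ?c" using inf unfolding infinite_nat_iff_unbounded_le by blast
      then show ?thesis using N[of n] c(2)[of n] by auto
    qed
    then have "0 \<in> closure ?c" unfolding closure_approachable by blast
    then show ?thesis using cl closure_closed by blast
  qed
  then have seg: "{0..s n0} \<subseteq> ?c"
    using cl(2) c(2)[of n0] closed_segment_subset[of 0 ?c "s n0"] s(1)[of n0] closed_segment_eq_real_ivl by simp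
  obtain A b where A: "linear A" "\<And>x. x \<in> ?c \<Longrightarrow> f x = A x + b" using C(3) c(1)[of n0] unfolding affine_on_def by blast
  show ?thesis
  proof (rule that[of "s n0" "A 1"])
    fix t assume t: "0 \<le> t" "t \<le> s n0"
    have "A t = t *\<^sub>R A 1" using linear_scale[OF A(1), of t 1] by simp
    then show "f t = f 0 + t *\<^sub>R A 1" using A(2)[of t] A(2)[OF \<open>0 \<in> ?c\<close>] seg t linear_0[OF A(1)] by auto
  qed (use s in auto)
qed

text \<open>In a chart of the sphere, a link looks near any of its points like two distinct rays.\<close>
definition local_rays :: "'a::euclidean_space set \<Rightarrow> 'a set \<Rightarrow> ('a \<Rightarrow> 'a) \<Rightarrow> 'a \<Rightarrow> 'a \<Rightarrow> 'a \<Rightarrow> real \<Rightarrow> bool" where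
  "local_rays L T k o' u v \<epsilon> \<longleftrightarrow> u \<noteq> 0 \<and> v \<noteq> 0 \<and> (\<forall>c>0. u \<noteq> c *\<^sub>R v) \<and> o' + u \<in> T \<and> o' + v \<in> T \<and>
    (\<forall>z\<in>T \<inter> ball o' \<epsilon>. k z \<in> L \<longleftrightarrow> (\<exists>s\<ge>0. z = o' + s *\<^sub>R u \<or> z = o' + s *\<^sub>R v))"

text \<open>A chart of the component K of the link is a line through the point. Read in the chart k
  it becomes an injective PL curve, whose one-sided germs are the two rays. The other components
  form a closed set that misses the point.\<close>

lemma link_local_rays:
  fixes S :: "'a::euclidean_space set"
  assumes L: "pl_link L" "L \<subseteq> S" and ch: "pl_chart n S T O' Q k"
    and o: "o' \<in> O'" "k o' \<in> L"
  obtains u v \<epsilon> where "\<epsilon> > 0" "T \<inter> ball o' \<epsilon> \<subseteq> O'" "local_rays L T k o' u v \<epsilon>"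
proof -
  have chart: "affine T" "openin (top_of_set T) O'" "O' \<subseteq> Q" "Q \<subseteq> T" "pl_map Q k" "inj_on k Q"
      "openin (top_of_set S) (k ` O')"
    using ch unfolding pl_chart_def by auto
  let ?y = "k o'"
  obtain \<K> where \<K>: "finite \<K>" "\<forall>C\<in>\<K>. pl_sphere 1 C" "pairwise disjnt \<K>" "\<Union>\<K> = L" using L unfolding pl_link_def by auto
  obtain K where K: "K \<in> \<K>" "?y \<in> K" using \<K>(4) o(2) by blast
  define R where "R = \<Union>(\<K> - {K})"
  have closedsph: "closed C" if "C \<in> \<K>" for C
  proof -
    have "pl_sphere 1 C" using \<K> that by blast
    then obtain \<Delta> :: "'a set" and h where \<Delta>: "(int 1 + 1) simplex \<Delta>" "pl_map (rel_frontier \<Delta>) h" "h ` rel_frontier \<Delta> = C"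
      unfolding pl_sphere_def pl_homeomorphism_def bij_betw_def by metis
    have "compact (rel_frontier \<Delta>)" using compact_simplex[OF \<Delta>(1)] by (simp add: compact_rel_frontier_bounded compact_imp_bounded)
    then show ?thesis using pl_map_continuous[OF \<Delta>(2)] \<Delta>(3) compact_continuous_image compact_imp_closed by blast
  qed
  then have Rcl: "closed R" unfolding R_def using \<K>(1) by (intro closed_Union) auto
  have yR: "?y \<notin> R" using K \<K>(3) unfolding R_def pairwise_def disjnt_def by blast
  have LKR: "L = K \<union> R" using K \<K>(4) unfolding R_def by blast
  obtain T1 O1 Q1 k1 where ch1: "pl_chart 1 K T1 O1 Q1 k1" "?y \<in> k1 ` O1"
    using pl_sphere_chart[OF bspec[OF \<K>(2) K(1)] K(2)] by metis
  have c1: "affine T1" "aff_dim T1 = int 1" "openin (top_of_set T1) O1" "O1 \<subseteq> Q1" "Q1 \<subseteq> T1"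
    "pl_map Q1 k1" "inj_on k1 Q1" "k1 ` Q1 \<subseteq> K" "?y \<in> k1 ` O1"
    "\<forall>U. openin (top_of_set T1) U \<longrightarrow> U \<subseteq> O1 \<longrightarrow> openin (top_of_set K) (k1 ` U)"
    using ch1 unfolding pl_chart_def by auto
  obtain o1 where o1: "o1 \<in> O1" "k1 o1 = ?y" using c1(9) by auto
  have o1T: "o1 \<in> T1" using o1 c1 by auto
  obtain d where d: "d \<noteq> 0" "T1 = range (\<lambda>t. o1 + t *\<^sub>R d)"
  proof -
    have "aff_dim T1 \<noteq> 0" using c1(2) by simp
    then obtain w where w: "w \<in> T1" "w \<noteq> o1" using o1T aff_dim_sing[of o1] by (cases "T1 = {o1}") auto
    have "affine hull {o1, w} \<subseteq> T1" using w o1T c1(1) by (simp add: hull_minimal)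
    moreover have "aff_dim (affine hull {o1, w}) = 1" using w by (simp add: aff_dim_2)
    ultimately have "affine hull {o1, w} = T1" using c1(1,2) by (intro affine_dim_equal) auto
    moreover have "affine hull {o1, w} = range (\<lambda>t. o1 + t *\<^sub>R (w - o1))"
    proof -
      have "{u *\<^sub>R o1 + v *\<^sub>R w |u v. u + v = 1} = range (\<lambda>t. o1 + t *\<^sub>R (w - o1))"
      proof (intro equalityI subsetI)
        fix x assume "x \<in> {u *\<^sub>R o1 + v *\<^sub>R w |u v. u + v = 1}"
        then obtain u v where uv: "x = u *\<^sub>R o1 + v *\<^sub>R w" "u + v = 1" by blast
        then have "x = u *\<^sub>R o1 + v *\<^sub>R w" "u = 1 - v" by auto
        then have "x = o1 + v *\<^sub>R (w - o1)" by (simp add: algebra_simps)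
        then show "x \<in> range (\<lambda>t. o1 + t *\<^sub>R (w - o1))" by blast
      next
        fix x assume "x \<in> range (\<lambda>t. o1 + t *\<^sub>R (w - o1))"
        then obtain t where "x = o1 + t *\<^sub>R (w - o1)" by blast
        then have "x = (1 - t) *\<^sub>R o1 + t *\<^sub>R w" by (simp add: algebra_simps)
        then show "x \<in> {u *\<^sub>R o1 + v *\<^sub>R w |u v. u + v = 1}" by (metis (mono_tags, lifting) diff_add_cancel mem_Collect_eq)
      qed
      then show ?thesis by (simp add: affine_hull_2)
    qed
    ultimately show ?thesis using that[of "w - o1"] w by auto
  qed
  define l where "l t = o1 + t *\<^sub>R d" for t
  have lT: "l t \<in> T1" for t using d by (auto simp: l_def)
  have contl: "continuous_on X l" for X unfolding l_def by (intro continuous_intros)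
  have injl: "l s = l t \<longleftrightarrow> s = t" for s t using d by (simp add: l_def)
  have contk1: "continuous_on Q1 k1" using pl_map_continuous[OF c1(6)] .
  have Ksub: "K \<subseteq> S" using K \<K>(4) L(2) by blast
  obtain W where W: "open W" "k ` O' = S \<inter> W" using chart(7) by (auto simp: openin_open)
  obtain \<eta> where \<eta>: "\<eta> > 0" "\<And>t. \<bar>t\<bar> \<le> \<eta> \<Longrightarrow> l t \<in> O1 \<and> k1 (l t) \<in> k ` O'"
  proof -
    have "openin (top_of_set Q1) (Q1 \<inter> k1 -` W)" using contk1 W(1) continuous_openin_preimage_gen by blast
    then have "openin (top_of_set O1) (O1 \<inter> k1 -` W)" using c1(4)
      by (metis (no_types, lifting) inf.absorb_iff2 inf_assoc inf_commute openin_subtopology_Int subtopology_subtopology continuous_on_subset contk1 W(1) continuous_openin_preimage_gen)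
    then have "openin (top_of_set T1) (O1 \<inter> k1 -` W)" using c1(3) openin_trans by blast
    then obtain V where V: "open V" "O1 \<inter> k1 -` W = T1 \<inter> V" by (auto simp: openin_open)
    have "open (l -` V)" using contl[of UNIV] V(1) by (simp add: continuous_on_open_vimage)
    moreover have "k1 o1 \<in> W" using o1(2) o(1) W(2) by auto
    then have "0 \<in> l -` V" using o1 V(2) by (auto simp: l_def)
    ultimately obtain e where e: "e > 0" "ball 0 e \<subseteq> l -` V" using open_contains_ball by blast
    show ?thesis
    proof (rule that[of "e/2"])
      fix t :: real assume "\<bar>t\<bar> \<le> e / 2"
      then have "t \<in> ball 0 e" using e by auto
      then have "l t \<in> T1 \<inter> V" using e lT by auto
      then have "l t \<in> O1" "k1 (l t) \<in> W" using V(2) by auto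
      moreover have "k1 (l t) \<in> S" using c1(4,8) Ksub \<open>l t \<in> O1\<close> by blast
      ultimately show "l t \<in> O1 \<and> k1 (l t) \<in> k ` O'" using W(2) by auto
    qed (use e in auto)
  qed
  \<comment> \<open>This is the arc of the link written in the coordinates of the chart k.\<close>
  define lam where "lam = inv_into Q k \<circ> (k1 \<circ> l)"
  have klam: "k (lam t) = k1 (l t)" "lam t \<in> O'" if t: "\<bar>t\<bar> \<le> \<eta>" for t
  proof -
    have "k1 (l t) \<in> k ` O'" using \<eta>(2)[OF t] by blast
    then obtain z where z: "z \<in> O'" "k z = k1 (l t)" by auto
    then have "lam t = z" using chart(3,6) by (metis lam_def comp_apply inv_into_f_f subsetD)
    then show "k (lam t) = k1 (l t)" "lam t \<in> O'" using z by auto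
  qed
  have injlam: "s = t" if "lam s = lam t" "\<bar>s\<bar> \<le> \<eta>" "\<bar>t\<bar> \<le> \<eta>" for s t
  proof -
    have "k1 (l s) = k1 (l t)" using klam(1)[OF that(2)] klam(1)[OF that(3)] that(1) by simp
    then have "l s = l t" using c1(7) \<eta>(2)[OF that(2)] \<eta>(2)[OF that(3)] c1(4) by (meson inj_onD subsetD)
    then show ?thesis using injl by simp
  qed
  have lam0: "lam 0 = o'" unfolding lam_def l_def using o1 chart(3,6) o(1) by auto
  have pllam: "pl_map {-\<eta>..\<eta>} lam" unfolding lam_def
  proof (rule pl_map_compose)
    have lin: "linear (\<lambda>t. t *\<^sub>R d)" by (rule linearI) (auto simp: algebra_simps)
    have "pl_map {-\<eta>..\<eta>} l" unfolding l_def using affine_on_linear[OF lin, of _ o1]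
      by (intro pl_map_affine) (auto simp: add.commute intro: polytope_imp_compact_polyhedron polytope_real_interval)
    then show "pl_map {-\<eta>..\<eta>} (k1 \<circ> l)" by (rule pl_map_compose[OF _ c1(6)]) (use \<eta>(2) c1(4) in force)
    show "pl_map (k ` Q) (inv_into Q k)" by (rule pl_map_inverse[OF chart(5)]) (use chart(6) in simp)
    show "(k1 \<circ> l) ` {-\<eta>..\<eta>} \<subseteq> k ` Q" using \<eta>(2) chart(3) by force
  qed
  have "pl_map {0..\<eta>} lam" using pl_map_subset[OF pllam polytope_imp_compact_polyhedron[OF polytope_real_interval]] \<eta>(1) by simp
  then obtain \<delta>1 u where \<delta>1: "\<delta>1 > 0" "\<delta>1 \<le> \<eta>" "\<And>t. 0 \<le> t \<Longrightarrow> t \<le> \<delta>1 \<Longrightarrow> lam t = lam 0 + t *\<^sub>R u"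
    using pl_map_real_germ[OF _ \<eta>(1)] by blast
  have "pl_map {0..\<eta>} (lam \<circ> uminus)"
  proof (rule pl_map_compose[OF _ pllam])
    show "pl_map {0..\<eta>} uminus" using affine_on_linear[of "uminus :: real \<Rightarrow> real" _ 0]
      by (intro pl_map_affine polytope_imp_compact_polyhedron polytope_real_interval) (auto intro: linear_uminus)
  qed (use \<eta> in auto)
  then obtain \<delta>2 v where \<delta>2: "\<delta>2 > 0" "\<delta>2 \<le> \<eta>" "\<And>t. 0 \<le> t \<Longrightarrow> t \<le> \<delta>2 \<Longrightarrow> (lam \<circ> uminus) t = (lam \<circ> uminus) 0 + t *\<^sub>R v"
    using pl_map_real_germ[OF _ \<eta>(1)] by blast
  define \<delta> where "\<delta> = min \<delta>1 \<delta>2"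
  have \<delta>: "\<delta> > 0" "\<delta> \<le> \<eta>" "\<And>t. 0 \<le> t \<Longrightarrow> t \<le> \<delta> \<Longrightarrow> lam t = o' + t *\<^sub>R u" "\<And>t. 0 \<le> t \<Longrightarrow> t \<le> \<delta> \<Longrightarrow> lam (- t) = o' + t *\<^sub>R v"
    using \<delta>1 \<delta>2 lam0 by (auto simp: \<delta>_def)
  have u0: "u \<noteq> 0" using injlam[of \<delta> 0] \<delta>(1,2) \<delta>(3)[of \<delta>] lam0 by auto
  have v0: "v \<noteq> 0" using injlam[of "-\<delta>" 0] \<delta>(1,2) \<delta>(4)[of \<delta>] lam0 by auto
  have uv: "u \<noteq> c *\<^sub>R v" if c: "c > 0" for c
  proof
    assume eq: "u = c *\<^sub>R v"
    \<comment> \<open>If u were c times v, the curve would be at the same point at the times t and -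
      t c. The denominator keeps both times within the interval of length \<open>\<delta>\<close> on
      either side.\<close>
    define t where "t = \<delta> / (1 + c)"
    have t: "t > 0" "t \<le> \<delta>" "t * c \<le> \<delta>" "t * c > 0" using c \<delta>(1) by (auto simp: t_def field_simps)
    have "lam t = lam (- (t * c))" using \<delta>(3)[of t] \<delta>(4)[of "t * c"] t eq by simp
    then have "t = - (t * c)" using injlam[of t "- (t * c)"] t \<delta>(2) by auto
    then show False using t by linarith
  qed
  have dirT: "o' + w \<in> T" if "o' + s *\<^sub>R w \<in> T" "s > 0" for w s
  proof -
    have "o' \<in> T" using o chart by auto
    then have "(1 - 1/s) *\<^sub>R o' + (1/s) *\<^sub>R (o' + s *\<^sub>R w) \<in> T" using chart(1) that(1) by (auto simp: affine_def)
    moreover have "(1 - 1/s) *\<^sub>R o' + (1/s) *\<^sub>R (o' + s *\<^sub>R w) = o' + w" using that(2) by (simp add: algebra_simps)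
    ultimately show ?thesis by simp
  qed
  have uT: "o' + u \<in> T" using dirT[of \<delta> u] \<delta>(1,2) \<delta>(3)[of \<delta>] klam(2)[of \<delta>] chart(3,4) by auto
  have vT: "o' + v \<in> T" using dirT[of \<delta> v] \<delta>(1,2) \<delta>(4)[of \<delta>] klam(2)[of "-\<delta>"] chart(3,4) by auto
  \<comment> \<open>near \<open>k o'\<close> the link is the image of a short interval under \<open>k1 \<circ> l\<close>\<close>
  obtain W' where W': "open W'" "?y \<in> W'" "\<And>x. x \<in> L \<inter> W' \<Longrightarrow> \<exists>t. \<bar>t\<bar> < \<delta> \<and> x = k1 (l t)"
  proof -
    define U where "U = l ` {-\<delta><..<\<delta>}"
    have "openin (top_of_set T1) U"
    proof -
      have "U = T1 \<inter> {x. \<bar>(x - o1) \<bullet> d\<bar> < \<delta> * (d \<bullet> d)}"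
      proof -
        have "l t \<in> {x. \<bar>(x - o1) \<bullet> d\<bar> < \<delta> * (d \<bullet> d)} \<longleftrightarrow> \<bar>t\<bar> < \<delta>" for t
          using d(1) by (simp add: l_def abs_mult)
        moreover have "T1 = range l" using d(2) by (simp add: l_def[abs_def])
        moreover have "t \<in> {-\<delta><..<\<delta>} \<longleftrightarrow> \<bar>t\<bar> < \<delta>" for t by (auto simp: abs_less_iff)
        ultimately show ?thesis unfolding U_def by blast
      qed
      moreover have "open {x. \<bar>(x - o1) \<bullet> d\<bar> < \<delta> * (d \<bullet> d)}" by (intro open_Collect_less continuous_intros)
      ultimately show ?thesis by (auto simp: openin_open)
    qed
    moreover have "U \<subseteq> O1" using \<eta>(2) \<delta>(2) by (auto simp: U_def)
    ultimately have "openin (top_of_set K) (k1 ` U)" by (rule c1(10)[rule_format])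
    then obtain V where V: "open V" "k1 ` U = K \<inter> V" by (auto simp: openin_open)
    show ?thesis
    proof (rule that[of "V - R"])
      show "open (V - R)" using V Rcl by (simp add: open_Diff)
      have "?y \<in> k1 ` U" using o1 \<delta>(1) by (force simp: U_def l_def image_iff intro!: bexI[of _ 0])
      then show "?y \<in> V - R" using V yR by auto
      fix x assume "x \<in> L \<inter> (V - R)"
      then have "x \<in> k1 ` U" using LKR V by auto
      then show "\<exists>t. \<bar>t\<bar> < \<delta> \<and> x = k1 (l t)" by (auto simp: U_def abs_less_iff)
    qed
  qed
  have contk: "continuous_on O' k" using pl_map_continuous[OF chart(5)] chart(3) continuous_on_subset by blast
  have "openin (top_of_set O') (O' \<inter> k -` W')" using contk W'(1) continuous_openin_preimage_gen by blast
  then have "openin (top_of_set T) (O' \<inter> k -` W')" using chart(2) openin_trans by blast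
  then obtain \<epsilon>0 where \<epsilon>0: "\<epsilon>0 > 0" "ball o' \<epsilon>0 \<inter> T \<subseteq> O' \<inter> k -` W'"
    using o(1) W'(2) unfolding openin_contains_ball by blast
  \<comment> \<open>The last two terms are the distances from \<open>o'\<close> to the ends of the
    two straight arcs, so a ray point in the ball has parameter below \<open>\<delta>\<close> and
    lies on the curve. The first term keeps the ball inside the region where the link is this curve
    only.\<close>
  define \<epsilon> where "\<epsilon> = min \<epsilon>0 (min (\<delta> * norm u) (\<delta> * norm v))"
  show ?thesis
  proof (rule that[of \<epsilon> u v])
    show "\<epsilon> > 0" using \<epsilon>0 \<delta> u0 v0 by (simp add: \<epsilon>_def)
    show "T \<inter> ball o' \<epsilon> \<subseteq> O'" using \<epsilon>0 by (auto simp: \<epsilon>_def)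
    have "k z \<in> L \<longleftrightarrow> (\<exists>s\<ge>0. z = o' + s *\<^sub>R u \<or> z = o' + s *\<^sub>R v)" if z: "z \<in> T \<inter> ball o' \<epsilon>" for z
    proof -
    have "z \<in> T \<inter> ball o' \<epsilon>" by fact
    then have zO: "z \<in> O'" "k z \<in> W'" using \<epsilon>0 by (auto simp: \<epsilon>_def)
    show ?thesis
    proof
      assume "k z \<in> L"
      then obtain t where t: "\<bar>t\<bar> < \<delta>" "k z = k1 (l t)" using W'(3) zO by blast
      then have "k z = k (lam t)" "lam t \<in> O'" using klam[of t] \<delta>(2) by auto
      then have zt: "z = lam t" using chart(3,6) zO(1) by (meson inj_onD subsetD)
      show "\<exists>s\<ge>0. z = o' + s *\<^sub>R u \<or> z = o' + s *\<^sub>R v"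
      proof (cases "t \<ge> 0")
        case True then show ?thesis using zt \<delta>(3)[of t] t(1) by (intro exI[of _ t]) auto
      next
        case False then show ?thesis using zt \<delta>(4)[of "-t"] t(1) by (intro exI[of _ "-t"]) auto
      qed
    next
      assume "\<exists>s\<ge>0. z = o' + s *\<^sub>R u \<or> z = o' + s *\<^sub>R v"
      then obtain s where s: "s \<ge> 0" "z = o' + s *\<^sub>R u \<or> z = o' + s *\<^sub>R v" by blast
      have "k1 (l t) \<in> L" if "\<bar>t\<bar> \<le> \<eta>" for t using \<eta>(2)[OF that] c1(4,8) LKR by blast
      moreover have "\<exists>t. \<bar>t\<bar> \<le> \<eta> \<and> z = lam t" using s(2)
      proof
        assume e: "z = o' + s *\<^sub>R u"
        then have "s * norm u < \<delta> * norm u" using z s(1) by (auto simp: \<epsilon>_def dist_norm)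
        then have "s < \<delta>" using u0 by simp
        then show ?thesis using \<delta>(2) \<delta>(3)[of s] s(1) e by (intro exI[of _ s]) auto
      next
        assume e: "z = o' + s *\<^sub>R v"
        then have "s * norm v < \<delta> * norm v" using z s(1) by (auto simp: \<epsilon>_def dist_norm)
        then have "s < \<delta>" using v0 by simp
        then show ?thesis using \<delta>(2) \<delta>(4)[of s] s(1) e by (intro exI[of _ "-s"]) auto
      qed
      ultimately show "k z \<in> L" using klam(1) by metis
    qed
    qed
    then show "local_rays L T k o' u v \<epsilon>" unfolding local_rays_def using u0 v0 uT vT uv by blast
  qed
qed

subsection \<open>Meridian charts\<close>

text \<open>The identity on the half-space where \<open>\<nu> \<bullet> z\<close> is nonnegative and
  linear on the opposite one; the two agree on the wall.\<close>

definition shear :: "'a::euclidean_space \<Rightarrow> 'a \<Rightarrow> 'a \<Rightarrow> 'a" where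
  "shear \<nu> w z = z + max 0 (- (\<nu> \<bullet> z)) *\<^sub>R w"

lemma pl_map_shear:
  assumes "compact_polyhedron P"
  shows "pl_map P (shear \<nu> w)"
proof -
  let ?\<theta> = "shear \<nu> w"
  obtain C where C: "finite C" "\<forall>c\<in>C. polytope c" "\<Union>C = P" using assms unfolding compact_polyhedron_def by auto
  let ?E = "(\<lambda>c. c \<inter> {z. \<nu> \<bullet> z \<ge> 0}) ` C \<union> (\<lambda>c. c \<inter> {z. \<nu> \<bullet> z \<le> 0}) ` C"
  have "finite ?E" using C by auto
  moreover have "\<Union>?E = P"
  proof
    show "\<Union>?E \<subseteq> P" using C(3) by blast
    show "P \<subseteq> \<Union>?E" using C(3) linear by fastforce
  qed
  moreover have "polytope e \<and> affine_on e ?\<theta>" if e: "e \<in> ?E" for e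
  proof -
    from e consider c where "c \<in> C" "e = c \<inter> {z. \<nu> \<bullet> z \<ge> 0}" | c where "c \<in> C" "e = c \<inter> {z. \<nu> \<bullet> z \<le> 0}" by blast
    then show ?thesis
    proof cases
      case 1
      have "affine_on e ?\<theta>" by (rule affine_on_cong[OF affine_on_id]) (use 1 in \<open>auto simp: shear_def\<close>)
      then show ?thesis using 1 C(2) by (auto intro: polytope_Int_polyhedron polyhedron_halfspace_ge)
    next
      case 2
      have "linear (\<lambda>z. z + (- (\<nu> \<bullet> z)) *\<^sub>R w)" by (rule linearI) (auto simp: inner_add_right algebra_simps)
      from affine_on_linear[OF this, of e 0] have "affine_on e ?\<theta>" by (rule affine_on_cong) (use 2 in \<open>auto simp: shear_def\<close>)
      then show ?thesis using 2 C(2) by (auto intro: polytope_Int_polyhedron polyhedron_halfspace_le)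
    qed
  qed
  ultimately show ?thesis unfolding pl_map_iff by blast
qed

text \<open>The two rays spanned by \<open>u\<close> and \<open>v\<close> are straightened into a line by a shear of a half-space.\<close>
lemma shear_two_rays:
  fixes u v :: "'a::euclidean_space"
  assumes "u \<noteq> 0" "v \<noteq> 0" "\<forall>c>0. u \<noteq> c *\<^sub>R v"
  obtains \<nu> w where "\<nu> \<in> span {u, v}" "w \<in> span {u, v}" "\<nu> \<bullet> u > 0"
    "inj (shear \<nu> w)" "\<forall>s\<ge>0. shear \<nu> w (s *\<^sub>R u) = s *\<^sub>R u" "\<forall>s\<ge>0. shear \<nu> w ((-s) *\<^sub>R u) = s *\<^sub>R v"
proof -
  \<comment> \<open>The difference of the unit vectors is positive on u and negative on v, so its
    kernel separates the two rays. Strict Cauchy-Schwarz uses that u and v do not point in the same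
    direction.\<close>
  define \<nu> where "\<nu> = u /\<^sub>R norm u - v /\<^sub>R norm v"
  have ne: "norm u * norm v > u \<bullet> v"
  proof -
    have "u \<bullet> v \<noteq> norm u * norm v"
    proof
      assume "u \<bullet> v = norm u * norm v"
      then have "norm u *\<^sub>R v = norm v *\<^sub>R u" using norm_cauchy_schwarz_eq by blast
      then have "(1 / norm v) *\<^sub>R (norm v *\<^sub>R u) = (norm u / norm v) *\<^sub>R v" by (metis scaleR_scaleR times_divide_eq_left mult_1)
      then have "u = (norm u / norm v) *\<^sub>R v" using assms(2) by simp
      moreover have "norm u / norm v > 0" using assms by simp
      ultimately show False using assms(3) by blast
    qed
    then show ?thesis using norm_cauchy_schwarz[of u v] by linarith
  qed
  have \<nu>u: "\<nu> \<bullet> u > 0"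
  proof -
    have "\<nu> \<bullet> u = (norm u * norm v - u \<bullet> v) / norm v"
      using assms by (simp add: \<nu>_def inner_diff_left inner_commute divide_inverse algebra_simps flip: power2_norm_eq_inner) (simp add: power2_eq_square)
    then show ?thesis using ne assms by simp
  qed
  have \<nu>v: "\<nu> \<bullet> v < 0"
  proof -
    have "\<nu> \<bullet> v = (u \<bullet> v - norm u * norm v) / norm u"
      using assms by (simp add: \<nu>_def inner_diff_left inner_commute divide_inverse algebra_simps flip: power2_norm_eq_inner) (simp add: power2_eq_square)
    then show ?thesis using ne assms by (simp add: divide_neg_pos)
  qed
  \<comment> \<open>The factor is chosen such that - u is moved to - u + (u + v) = v.\<close>
  define w where "w = (u + v) /\<^sub>R (\<nu> \<bullet> u)"
  \<comment> \<open>This inequality keeps each side of the wall on its side, so injectivity can be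
    checked on the sides separately.\<close>
  have \<nu>w: "\<nu> \<bullet> w < 1" using \<nu>u \<nu>v by (simp add: w_def inner_add_right field_simps)
  let ?\<theta> = "shear \<nu> w"
  have \<nu>\<theta>: "\<nu> \<bullet> ?\<theta> z = (if \<nu> \<bullet> z \<ge> 0 then \<nu> \<bullet> z else (\<nu> \<bullet> z) * (1 - \<nu> \<bullet> w))" for z
    by (simp add: shear_def inner_add_right max_def algebra_simps)
  show ?thesis
  proof (rule that[of \<nu> w])
    show "\<nu> \<in> span {u, v}" unfolding \<nu>_def by (intro span_diff span_scale) (auto intro: span_base)
    show "w \<in> span {u, v}" unfolding w_def by (intro span_add span_scale) (auto intro: span_base)
    show "\<nu> \<bullet> u > 0" by fact
    show "inj ?\<theta>"
    proof (rule injI)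
      fix x y assume eq: "?\<theta> x = ?\<theta> y"
      then have e: "\<nu> \<bullet> ?\<theta> x = \<nu> \<bullet> ?\<theta> y" by simp
      have pos: "1 - \<nu> \<bullet> w > 0" using \<nu>w by simp
      have "\<nu> \<bullet> x = \<nu> \<bullet> y"
      proof (cases "\<nu> \<bullet> x \<ge> 0"; cases "\<nu> \<bullet> y \<ge> 0")
        assume "\<nu> \<bullet> x \<ge> 0" "\<not> \<nu> \<bullet> y \<ge> 0"
        moreover from this have "(\<nu> \<bullet> y) * (1 - \<nu> \<bullet> w) < 0" using pos by (simp add: mult_neg_pos)
        ultimately show ?thesis using e unfolding \<nu>\<theta> by simp
      next
        assume "\<not> \<nu> \<bullet> x \<ge> 0" "\<nu> \<bullet> y \<ge> 0"
        moreover from this have "(\<nu> \<bullet> x) * (1 - \<nu> \<bullet> w) < 0" using pos by (simp add: mult_neg_pos)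
        ultimately show ?thesis using e unfolding \<nu>\<theta> by simp
      next
        assume "\<not> \<nu> \<bullet> x \<ge> 0" "\<not> \<nu> \<bullet> y \<ge> 0"
        then have "(\<nu> \<bullet> x) * (1 - \<nu> \<bullet> w) = (\<nu> \<bullet> y) * (1 - \<nu> \<bullet> w)" using e unfolding \<nu>\<theta> by simp
        then show ?thesis using pos by simp
      next
        assume "\<nu> \<bullet> x \<ge> 0" "\<nu> \<bullet> y \<ge> 0"
        then show ?thesis using e unfolding \<nu>\<theta> by simp
      qed
      then show "x = y" using eq by (simp add: shear_def)
    qed
    show "\<forall>s\<ge>0. shear \<nu> w (s *\<^sub>R u) = s *\<^sub>R u" using \<nu>u by (simp add: shear_def max_def mult_le_0_iff)
    show "\<forall>s\<ge>0. shear \<nu> w ((-s) *\<^sub>R u) = s *\<^sub>R v"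
    proof (intro allI impI)
    fix s :: real assume s: "s \<ge> 0"
    have "max 0 (- (\<nu> \<bullet> ((-s) *\<^sub>R u))) = s * (\<nu> \<bullet> u)" using s \<nu>u by (simp add: max_def mult_le_0_iff)
    moreover have "(s * (\<nu> \<bullet> u)) *\<^sub>R w = s *\<^sub>R (u + v)" using \<nu>u by (simp add: w_def)
    ultimately show "shear \<nu> w ((-s) *\<^sub>R u) = s *\<^sub>R v" by (simp add: shear_def algebra_simps)
    qed
  qed
qed

lemma triangle_around_0:
  fixes K :: "'a::euclidean_space set"
  assumes K: "subspace K" "dim K = 2"
  obtains \<Delta> where "2 simplex \<Delta>" "0 \<in> rel_interior \<Delta>" "\<Delta> \<subseteq> K" "openin (top_of_set K) (rel_interior \<Delta>)"
proof -
  obtain B where B: "B \<subseteq> K" "independent B" "K \<subseteq> span B" "card B = dim K" using basis_exists by blast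
  then obtain a b where ab: "B = {a, b}" "a \<noteq> b" using K(2) by (metis card_2_iff)
  have lin: "s = 0 \<and> t = 0" if "s *\<^sub>R a + t *\<^sub>R b = 0" for s t
  proof -
    have "(\<Sum>x\<in>{a, b}. (if x = a then s else t) *\<^sub>R x) = 0" using that ab(2) by simp
    then have "\<forall>x\<in>{a, b}. (if x = a then s else t) = 0"
      using B(2)[unfolded ab(1) independent_explicit, THEN conjunct2, rule_format, of "\<lambda>x. if x = a then s else t"] by blast
    then show ?thesis using ab(2) by auto
  qed
  \<comment> \<open>With this third vertex the barycentre of the triangle is 0.\<close>
  define c where "c = - a - b"
  have dist: "a \<noteq> b" "a \<noteq> c" "b \<noteq> c"
    using ab(2) lin[of 2 1] lin[of 1 2] by (auto simp: c_def algebra_simps scaleR_2)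
  have indep: "\<not> affine_dependent {a, b, c}"
  proof
    assume "affine_dependent {a, b, c}"
    then obtain U where U: "sum U {a, b, c} = 0" "\<exists>v\<in>{a, b, c}. U v \<noteq> 0" "(\<Sum>v\<in>{a, b, c}. U v *\<^sub>R v) = 0"
      using affine_dependent_explicit_finite[of "{a, b, c}"] by auto
    have s: "U a + U b + U c = 0" using U(1) dist by simp
    have "(U a - U c) *\<^sub>R a + (U b - U c) *\<^sub>R b = 0" using U(3) dist by (simp add: c_def algebra_simps)
    then have "U a = U c" "U b = U c" using lin[of "U a - U c" "U b - U c"] by simp_all
    then show False using s U(2) by auto
  qed
  have simp: "2 simplex (convex hull {a, b, c})" using simplex_convex_hull[of "{a, b, c}" 2] indep dist by simp
  have "0 \<in> rel_interior (convex hull {a, b, c})"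
    unfolding rel_interior_convex_hull_explicit[OF indep] using dist
    by (auto intro!: exI[of _ "\<lambda>_. 1/3"] simp: c_def algebra_simps)
  moreover have sub: "convex hull {a, b, c} \<subseteq> K"
    using B(1) K(1) ab(1) by (intro hull_minimal) (auto simp: c_def subspace_imp_convex subspace_diff subspace_neg)
  moreover have "affine hull (convex hull {a, b, c}) = K"
  proof (rule affine_dim_equal)
    show "affine hull (convex hull {a, b, c}) \<subseteq> K" using hull_minimal[OF sub, of affine] K(1) subspace_imp_affine by blast
    show "aff_dim (affine hull (convex hull {a, b, c})) = aff_dim K"
      using aff_dim_simplex[OF simp] K by (simp only: aff_dim_affine_hull aff_dim_subspace)
  qed (use K(1) in \<open>auto simp: subspace_imp_affine\<close>)
  moreover from this have "openin (top_of_set K) (rel_interior (convex hull {a, b, c}))" by (metis openin_rel_interior)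
  ultimately show ?thesis using that simp by blast
qed

text \<open>The neighbourhood required in \<open>meridian\<close>, with the additional property that
  its interior part is open in S. It is the neighbourhood of a point of the link on which all local
  arguments take place.\<close>

definition meridian_chart ::
  "'a::euclidean_space set \<Rightarrow> 'a set \<Rightarrow> 'a set \<Rightarrow> 'a \<Rightarrow> ('a \<times> real \<Rightarrow> 'a) \<Rightarrow> bool" where
  "meridian_chart S L \<Delta> c \<phi> \<longleftrightarrow> 2 simplex \<Delta> \<and> c \<in> rel_interior \<Delta> \<and>
     pl_map (\<Delta> \<times> {-1..1}) \<phi> \<and> inj_on \<phi> (\<Delta> \<times> {-1..1}) \<and> \<phi> ` (\<Delta> \<times> {-1..1}) \<subseteq> S \<and>
     {z \<in> \<Delta> \<times> {-1..1}. \<phi> z \<in> L} = {c} \<times> {-1..1} \<and>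
     openin (top_of_set S) (\<phi> ` (rel_interior \<Delta> \<times> {-1<..<1}))"

text \<open>In a chart of the sphere the link is locally a pair of rays. A shear makes them a line,
  along which a triangle in a transverse plane sweeps out a cylinder. This cylinder is mapped back
  by the shear and scaled down to fit into the given neighbourhood.\<close>

theorem meridian_chart_exists:
  fixes S :: "'a::euclidean_space set"
  assumes S: "pl_sphere 3 S" and L: "pl_link L" "L \<subseteq> S" and y: "y \<in> L" and \<Omega>: "openin (top_of_set S) \<Omega>" "y \<in> \<Omega>"
  obtains \<Delta> c \<phi> where "meridian_chart S L \<Delta> c \<phi>" "\<phi> (c, 0) = y" "\<phi> ` (\<Delta> \<times> {-1..1}) \<subseteq> \<Omega>"
proof -
  have yS: "y \<in> S" using y L by auto
  obtain T O' Q k where pc: "pl_chart 3 S T O' Q k" "y \<in> k ` O'"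
    using pl_sphere_chart[OF S yS] by metis
  have ch: "affine T" "aff_dim T = int 3" "openin (top_of_set T) O'" "O' \<subseteq> Q" "Q \<subseteq> T"
    "pl_map Q k" "inj_on k Q" "k ` Q \<subseteq> S" "y \<in> k ` O'"
    "\<forall>U. openin (top_of_set T) U \<longrightarrow> U \<subseteq> O' \<longrightarrow> openin (top_of_set S) (k ` U)"
    using pc unfolding pl_chart_def by auto
  obtain o' where o: "o' \<in> O'" "k o' = y" using ch(9) by auto
  have oT: "o' \<in> T" using o ch by auto
  have kO: "openin (top_of_set S) (k ` O')" using ch(10)[rule_format, OF ch(3)] by simp
  have "k o' \<in> L" using o y by simp
  obtain u v \<epsilon>1 where lr: "\<epsilon>1 > 0" "T \<inter> ball o' \<epsilon>1 \<subseteq> O'" "local_rays L T k o' u v \<epsilon>1"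
    using link_local_rays[OF L pc(1) o(1) \<open>k o' \<in> L\<close>] by metis
  have uv: "\<epsilon>1 > 0" "T \<inter> ball o' \<epsilon>1 \<subseteq> O'" "u \<noteq> 0" "v \<noteq> 0" "\<forall>c>0. u \<noteq> c *\<^sub>R v"
    "o' + u \<in> T" "o' + v \<in> T"
    "\<forall>z\<in>T \<inter> ball o' \<epsilon>1. k z \<in> L \<longleftrightarrow> (\<exists>s\<ge>0. z = o' + s *\<^sub>R u \<or> z = o' + s *\<^sub>R v)"
    using lr unfolding local_rays_def by auto
  obtain \<epsilon> where \<epsilon>: "\<epsilon> > 0" "\<epsilon> \<le> \<epsilon>1" "\<And>z. z \<in> T \<inter> ball o' \<epsilon> \<Longrightarrow> k z \<in> \<Omega>"
  proof -
    have contk: "continuous_on O' k" using pl_map_continuous[OF ch(6)] ch(4) continuous_on_subset by blast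
    obtain W where W: "open W" "\<Omega> = S \<inter> W" using \<Omega>(1) by (auto simp: openin_open)
    have "openin (top_of_set O') (O' \<inter> k -` W)" using contk W(1) continuous_openin_preimage_gen by blast
    then have "openin (top_of_set T) (O' \<inter> k -` W)" using ch(3) openin_trans by blast
    then obtain e where e: "e > 0" "ball o' e \<inter> T \<subseteq> O' \<inter> k -` W"
      using o \<Omega>(2) W unfolding openin_contains_ball by blast
    show ?thesis
    proof (rule that[of "min e \<epsilon>1"])
      fix z assume "z \<in> T \<inter> ball o' (min e \<epsilon>1)"
      then have "z \<in> O'" "k z \<in> W" using e by auto
      then show "k z \<in> \<Omega>" using W ch(4,8) by blast
    qed (use e uv in auto)
  qed
  define D where "D = (\<lambda>z. z - o') ` T"
  have D: "subspace D" "dim D = 3"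
  proof -
    have eq: "(\<lambda>z. z - o') ` T = (+) (- o') ` T" by auto
    then show "subspace D" using affine_diffs_subspace[OF ch(1) oT] by (simp add: D_def)
    moreover have "aff_dim D = 3"
      unfolding D_def eq aff_dim_translation_eq using ch(2) by simp
    ultimately show "dim D = 3" by (simp add: aff_dim_subspace)
  qed
  have inD: "z \<in> D \<longleftrightarrow> o' + z \<in> T" for z unfolding D_def by (force simp: algebra_simps image_iff)
  have uvD: "u \<in> D" "v \<in> D" "span {u, v} \<subseteq> D" using uv inD span_minimal[of "{u, v}" D] D by auto
  obtain \<nu> w where \<nu>w: "\<nu> \<in> span {u, v}" "w \<in> span {u, v}" "\<nu> \<bullet> u > 0"
    "inj (shear \<nu> w)" "\<forall>s\<ge>0. shear \<nu> w (s *\<^sub>R u) = s *\<^sub>R u" "\<forall>s\<ge>0. shear \<nu> w ((-s) *\<^sub>R u) = s *\<^sub>R v"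
    using shear_two_rays[OF uv(3,4,5)] by metis
  define \<theta> where "\<theta> = shear \<nu> w"
  have \<theta>u: "\<theta> (s *\<^sub>R u) = (if s \<ge> 0 then s *\<^sub>R u else (-s) *\<^sub>R v)" for s
    using \<nu>w(5)[rule_format, of s] \<nu>w(6)[rule_format, of "-s"] by (simp add: \<theta>_def)
  have inj\<theta>: "\<theta> x = \<theta> y \<longleftrightarrow> x = y" for x y using \<nu>w(4) by (auto simp: \<theta>_def inj_def)
  \<comment> \<open>The shear moves points along w, which lies in the span of u and v, so it
    preserves the direction space D of the chart.\<close>
  have \<theta>D: "\<theta> z \<in> D" if "z \<in> D" for z
    using that \<nu>w(2) uvD(3) D(1) by (auto simp: \<theta>_def shear_def intro!: subspace_add subspace_scale)
  have \<theta>ray: "(\<exists>s\<ge>0. \<theta> z = s *\<^sub>R u \<or> \<theta> z = s *\<^sub>R v) \<longleftrightarrow> (\<exists>s. z = s *\<^sub>R u)" for z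
  proof
    assume "\<exists>s\<ge>0. \<theta> z = s *\<^sub>R u \<or> \<theta> z = s *\<^sub>R v"
    then obtain s where s: "s \<ge> 0" "\<theta> z = s *\<^sub>R u \<or> \<theta> z = s *\<^sub>R v" by blast
    have "s *\<^sub>R v = \<theta> ((-s) *\<^sub>R u)" using s(1) \<theta>u[of "-s"] by (cases "s = 0") auto
    then have "\<theta> z = \<theta> (s *\<^sub>R u) \<or> \<theta> z = \<theta> ((-s) *\<^sub>R u)" using s \<theta>u[of s] by auto
    then show "\<exists>s. z = s *\<^sub>R u" using inj\<theta> by blast
  next
    assume "\<exists>s. z = s *\<^sub>R u"
    then obtain s where "z = s *\<^sub>R u" by blast
    then show "\<exists>s\<ge>0. \<theta> z = s *\<^sub>R u \<or> \<theta> z = s *\<^sub>R v" using \<theta>u[of s]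
      by (cases "s \<ge> 0") (auto intro: exI[of _ s] exI[of _ "-s"])
  qed
  \<comment> \<open>A plane in D complementary to u, since \<open>\<nu> \<bullet> u\<close> is
    positive. The triangle is taken in it.\<close>
  define K where "K = {z \<in> D. \<nu> \<bullet> z = 0}"
  have K: "subspace K" "dim K = 2"
  proof -
    show "subspace K" using D(1) unfolding K_def subspace_def by (auto simp: inner_add_right)
    have \<nu>0: "\<nu> \<noteq> 0" using \<nu>w(3) by auto
    have "span {\<nu>} \<subseteq> D" using \<nu>w(1) uvD(3) D(1) by (intro span_minimal) auto
    then have "dim {z \<in> D. \<forall>x\<in>span {\<nu>}. orthogonal x z} + dim (span {\<nu>}) = dim D"
      using D(1) by (intro dim_subspace_orthogonal_to_vectors) auto
    moreover have "{z \<in> D. \<forall>x\<in>span {\<nu>}. orthogonal x z} = K"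
      unfolding K_def by (auto simp: span_singleton orthogonal_def)
    moreover have "dim (span {\<nu>}) = 1" using \<nu>0 by (simp add: dim_insert)
    ultimately show "dim K = 2" using D(2) by simp
  qed
  obtain \<Delta> where \<Delta>: "2 simplex \<Delta>" "0 \<in> rel_interior \<Delta>" "\<Delta> \<subseteq> K" "openin (top_of_set K) (rel_interior \<Delta>)"
    using triangle_around_0[OF K] by metis
  define a where "a = (\<lambda>(x, s). x + s *\<^sub>R u)"
  have lina: "linear a" unfolding a_def by (rule linearI) (auto simp: algebra_simps)
  have aD: "a (x, s) \<in> D" if "x \<in> K" for x s
    using that uvD D(1) by (auto simp: a_def K_def intro!: subspace_add subspace_scale)
  have inja: "x = x' \<and> s = s'" if "x \<in> K" "x' \<in> K" "a (x, s) = a (x', s')" for x x' s s'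
  proof -
    have "\<nu> \<bullet> a (x, s) = \<nu> \<bullet> a (x', s')" using that(3) by simp
    then have "s = s'" using that(1,2) \<nu>w(3) by (simp add: a_def K_def inner_add_right)
    then show ?thesis using that(3) by (simp add: a_def)
  qed
  have polyP: "compact_polyhedron (\<Delta> \<times> {-1..1::real})"
    using simplex_imp_polytope[OF \<Delta>(1)]
    by (intro compact_polyhedron_Times polytope_imp_compact_polyhedron polytope_real_interval) auto
  have pla: "pl_map (\<Delta> \<times> {-1..1}) a" using pl_map_affine[OF polyP affine_on_linear[OF lina, of _ 0]] by simp
  have pl\<theta>a: "pl_map (\<Delta> \<times> {-1..1}) (\<theta> \<circ> a)" unfolding \<theta>_def
    by (rule pl_map_compose[OF pla pl_map_shear[OF pl_map_image_polyhedron[OF pla]]]) simp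
  have "bounded ((\<theta> \<circ> a) ` (\<Delta> \<times> {-1..1}))"
    using pl_map_continuous[OF pl\<theta>a] compact_polyhedron_imp_compact[OF polyP] compact_continuous_image compact_imp_bounded by blast
  then obtain B where B: "B > 0" "\<And>z. z \<in> \<Delta> \<times> {-1..1} \<Longrightarrow> norm ((\<theta> \<circ> a) z) \<le> B" unfolding bounded_pos by auto
  \<comment> \<open>B bounds the sheared cylinder, so after scaling its radius is at most half of
    \<open>\<epsilon>\<close>.\<close>
  define r where "r = \<epsilon> / (2 * B)"
  have r: "r > 0" "r * B < \<epsilon>" using B(1) \<epsilon>(1) by (auto simp: r_def)
  define \<psi> where "\<psi> z = r *\<^sub>R (\<theta> \<circ> a) z + o'" for z
  have lr: "linear (\<lambda>x::'a. r *\<^sub>R x)" by (rule linearI) (auto simp: algebra_simps)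
  have pl\<psi>: "pl_map (\<Delta> \<times> {-1..1}) \<psi>"
  proof -
    have "pl_map (\<Delta> \<times> {-1..1}) ((\<lambda>x. r *\<^sub>R x + o') \<circ> (\<theta> \<circ> a))"
      by (rule pl_map_compose[OF pl\<theta>a pl_map_affine[OF pl_map_image_polyhedron[OF pl\<theta>a] affine_on_linear[OF lr]]]) simp
    then show ?thesis by (rule pl_map_cong) (simp add: \<psi>_def)
  qed
  have \<psi>T: "\<psi> (x, s) \<in> T" if "x \<in> K" for x s
  proof -
    have "r *\<^sub>R (\<theta> \<circ> a) (x, s) \<in> D" using \<theta>D[OF aD[OF that, of s]] D(1) by (simp add: subspace_scale)
    then show ?thesis using inD by (simp add: \<psi>_def add.commute)
  qed
  have \<psi>ball: "\<psi> z \<in> T \<inter> ball o' \<epsilon>" if z: "z \<in> \<Delta> \<times> {-1..1}" for z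
  proof -
    have "norm (r *\<^sub>R (\<theta> \<circ> a) z) \<le> r * B" using B(2)[OF z] r(1) by simp
    then have "\<psi> z \<in> ball o' \<epsilon>" using r(2) by (simp add: \<psi>_def dist_norm)
    then show ?thesis using \<psi>T z \<Delta>(3) by auto
  qed
  have \<psi>inj: "x = x' \<and> s = s'" if "x \<in> K" "x' \<in> K" "\<psi> (x, s) = \<psi> (x', s')" for x x' s s'
  proof -
    have "\<theta> (a (x, s)) = \<theta> (a (x', s'))" using that(3) r(1) by (simp add: \<psi>_def)
    then show ?thesis using inj\<theta> inja that by blast
  qed
  have \<psi>O: "\<psi> z \<in> O'" if "z \<in> \<Delta> \<times> {-1..1}" for z using \<psi>ball[OF that] uv(2) \<epsilon>(2) by auto
  define \<phi> where "\<phi> = k \<circ> \<psi>"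
  have "meridian_chart S L \<Delta> 0 \<phi>" unfolding meridian_chart_def
  proof (intro conjI)
    show "2 simplex \<Delta>" "0 \<in> rel_interior \<Delta>" by fact+
    show "pl_map (\<Delta> \<times> {-1..1}) \<phi>" unfolding \<phi>_def by (rule pl_map_compose[OF pl\<psi> ch(6)]) (use \<psi>O ch(4) in blast)
    show "inj_on \<phi> (\<Delta> \<times> {-1..1})"
    proof (rule inj_onI)
      fix z z' assume z: "z \<in> \<Delta> \<times> {-1..1}" "z' \<in> \<Delta> \<times> {-1..1}" "\<phi> z = \<phi> z'"
      then have "\<psi> z = \<psi> z'" using \<psi>O ch(4,7) unfolding \<phi>_def by (metis comp_apply inj_onD subsetD)
      moreover have "fst z \<in> K" "fst z' \<in> K" using z \<Delta>(3) by (auto simp: mem_Times_iff)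
      ultimately show "z = z'" using \<psi>inj[of "fst z" "fst z'" "snd z" "snd z'"] by (simp add: prod_eq_iff)
    qed
    show "\<phi> ` (\<Delta> \<times> {-1..1}) \<subseteq> S" using \<psi>O ch(4,8) unfolding \<phi>_def image_comp[symmetric] by blast
    have "\<phi> (x, s) \<in> L \<longleftrightarrow> x = 0" if "x \<in> \<Delta>" "s \<in> {-1..1}" for x s
    proof -
      have xK: "x \<in> K" using that \<Delta> by auto
      have "\<psi> (x, s) \<in> T \<inter> ball o' \<epsilon>1" using \<psi>ball[of "(x, s)"] that \<epsilon>(2) by auto
      then have "\<phi> (x, s) \<in> L \<longleftrightarrow> (\<exists>t\<ge>0. \<psi> (x, s) = o' + t *\<^sub>R u \<or> \<psi> (x, s) = o' + t *\<^sub>R v)"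
        unfolding \<phi>_def using uv(8) by simp
      \<comment> \<open>The union of the two rays is invariant under scaling, so the factor r does
        not matter for membership in the link.\<close>
      also have "\<dots> \<longleftrightarrow> (\<exists>t\<ge>0. \<theta> (a (x, s)) = t *\<^sub>R u \<or> \<theta> (a (x, s)) = t *\<^sub>R v)"
      proof
        assume "\<exists>t\<ge>0. \<psi> (x, s) = o' + t *\<^sub>R u \<or> \<psi> (x, s) = o' + t *\<^sub>R v"
        then obtain t where t: "t \<ge> 0" "r *\<^sub>R \<theta> (a (x, s)) = t *\<^sub>R u \<or> r *\<^sub>R \<theta> (a (x, s)) = t *\<^sub>R v"
          by (auto simp: \<psi>_def add.commute)
        moreover have "\<theta> (a (x, s)) = (1 / r) *\<^sub>R (r *\<^sub>R \<theta> (a (x, s)))" using r(1) by simp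
        ultimately have "\<theta> (a (x, s)) = (t / r) *\<^sub>R u \<or> \<theta> (a (x, s)) = (t / r) *\<^sub>R v"
          by (metis scaleR_scaleR times_divide_eq_left mult_1)
        then show "\<exists>t\<ge>0. \<theta> (a (x, s)) = t *\<^sub>R u \<or> \<theta> (a (x, s)) = t *\<^sub>R v"
          using t(1) r(1) by (intro exI[of _ "t / r"]) auto
      next
        assume "\<exists>t\<ge>0. \<theta> (a (x, s)) = t *\<^sub>R u \<or> \<theta> (a (x, s)) = t *\<^sub>R v"
        then obtain t where "t \<ge> 0" "\<theta> (a (x, s)) = t *\<^sub>R u \<or> \<theta> (a (x, s)) = t *\<^sub>R v" by blast
        then show "\<exists>t\<ge>0. \<psi> (x, s) = o' + t *\<^sub>R u \<or> \<psi> (x, s) = o' + t *\<^sub>R v"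
          using r(1) by (intro exI[of _ "r * t"]) (auto simp: \<psi>_def add.commute)
      qed
      also have "\<dots> \<longleftrightarrow> (\<exists>t. a (x, s) = t *\<^sub>R u)" by (rule \<theta>ray)
      also have "\<dots> \<longleftrightarrow> x = 0"
      proof
        assume "\<exists>t. a (x, s) = t *\<^sub>R u"
        then obtain t where "a (x, s) = a (0, t)" by (auto simp: a_def)
        then show "x = 0" using inja xK K(1) subspace_0 by blast
      qed (auto simp: a_def)
      finally show ?thesis .
    qed
    moreover have "0 \<in> \<Delta>" using \<Delta>(2) rel_interior_subset by blast
    ultimately show "{z \<in> \<Delta> \<times> {-1..1}. \<phi> z \<in> L} = {0} \<times> {-1..1}" by auto
    \<comment> \<open>Invariance of domain applies since the product of the plane K with a line and
      the affine space T both have dimension 3.\<close>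
    have "openin (top_of_set T) (\<psi> ` (rel_interior \<Delta> \<times> {-1<..<1}))"
    proof (rule invariance_of_domain_affine_sets[where U = "K \<times> (UNIV :: real set)" and f = \<psi> and V = T and S = "rel_interior \<Delta> \<times> {-1<..<1}"])
      have "openin (top_of_set (UNIV :: real set)) {-1<..<1}" by simp
      then show "openin (top_of_set (K \<times> UNIV)) (rel_interior \<Delta> \<times> {-1<..<1::real})" using \<Delta>(4) by (rule openin_Times[rotated])
      have sK: "subspace (K \<times> (UNIV :: real set))" using K(1) by (simp add: subspace_Times)
      then show "affine (K \<times> (UNIV :: real set))" by (rule subspace_imp_affine)
      show "affine T" by fact
      have "dim (K \<times> (UNIV :: real set)) = 3" using dim_Times[OF K(1) subspace_UNIV, where 'b=real] K(2) by simp
      then show "aff_dim T \<le> aff_dim (K \<times> (UNIV :: real set))" using ch(2) by (simp add: aff_dim_subspace[OF sK])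
      have sub: "rel_interior \<Delta> \<times> {-1<..<1} \<subseteq> \<Delta> \<times> {-1..1::real}" using rel_interior_subset[of \<Delta>] by auto
      show "continuous_on (rel_interior \<Delta> \<times> {-1<..<1}) \<psi>"
        by (rule continuous_on_subset[OF pl_map_continuous[OF pl\<psi>] sub])
      show "\<psi> \<in> rel_interior \<Delta> \<times> {-1<..<1} \<rightarrow> T" using \<psi>ball sub by blast
      show "inj_on \<psi> (rel_interior \<Delta> \<times> {-1<..<1})"
      proof (rule inj_onI)
        fix z z' assume z: "z \<in> rel_interior \<Delta> \<times> {-1<..<1}" "z' \<in> rel_interior \<Delta> \<times> {-1<..<1}" "\<psi> z = \<psi> z'"
        then have "fst z \<in> K" "fst z' \<in> K" using \<Delta>(3) rel_interior_subset by (auto simp: mem_Times_iff)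
        then show "z = z'" using \<psi>inj[of "fst z" "fst z'" "snd z" "snd z'"] z(3) by (auto simp: prod_eq_iff)
      qed
    qed
    moreover have "\<psi> ` (rel_interior \<Delta> \<times> {-1<..<1}) \<subseteq> O'"
    proof -
      have "rel_interior \<Delta> \<times> {-1<..<1} \<subseteq> \<Delta> \<times> {-1..1::real}" using rel_interior_subset[of \<Delta>] by auto
      then show ?thesis using \<psi>O by blast
    qed
    ultimately have "openin (top_of_set S) (k ` \<psi> ` (rel_interior \<Delta> \<times> {-1<..<1}))" by (rule ch(10)[rule_format])
    then show "openin (top_of_set S) (\<phi> ` (rel_interior \<Delta> \<times> {-1<..<1}))" by (simp add: \<phi>_def image_comp)
  qed
  moreover have "\<phi> (0, 0) = y" using \<theta>u[of 0] o by (simp add: \<phi>_def \<psi>_def a_def)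
  moreover have "\<phi> z \<in> \<Omega>" if "z \<in> \<Delta> \<times> {-1..1}" for z using \<epsilon>(3)[OF \<psi>ball[OF that]] by (simp add: \<phi>_def)
  then have "\<phi> ` (\<Delta> \<times> {-1..1}) \<subseteq> \<Omega>" by blast
  ultimately show ?thesis by (rule that)
qed

subsection \<open>Polar coordinates in a meridian chart\<close>

text \<open>\<open>\<tau>\<close> is the universal covering of the boundary circle of the triangle,
  normalised to period 1.\<close>

definition angular :: "'a::euclidean_space set \<Rightarrow> (real \<Rightarrow> 'a) \<Rightarrow> bool" where
  "angular \<Delta> \<tau> \<longleftrightarrow> continuous_on UNIV \<tau> \<and> (\<forall>s t. \<tau> s = \<tau> t \<longleftrightarrow> s - t \<in> \<int>) \<and> range \<tau> = rel_frontier \<Delta>"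

lemma angular_exists:
  fixes \<Delta> :: "'a::euclidean_space set"
  assumes "2 simplex \<Delta>"
  obtains \<tau> where "angular \<Delta> \<tau>"
proof -
  have "rel_frontier (cball (0::complex) 1) homeomorphic rel_frontier \<Delta>"
    using assms aff_dim_simplex[OF assms] compact_simplex[OF assms] convex_simplex[OF assms]
    by (intro homeomorphic_rel_frontiers_convex_bounded_sets) (auto simp: compact_imp_bounded aff_dim_cball)
  then obtain h k where h: "homeomorphism (sphere (0::complex) 1) (rel_frontier \<Delta>) h k"
    by (auto simp: homeomorphic_def)
  define e where "e t = exp (complex_of_real (2 * pi * t) * \<i>)" for t
  have e: "e s = e t \<longleftrightarrow> s - t \<in> \<int>" for s t
  proof -
    have "e s = e t \<longleftrightarrow> (\<exists>n. complex_of_real (2 * pi * s) * \<i> = complex_of_real (2 * pi * t) * \<i> + complex_of_real (real_of_int (2 * n) * pi) * \<i>)"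
      unfolding e_def exp_eq ..
    also have "\<dots> \<longleftrightarrow> (\<exists>n::int. 2 * pi * s = 2 * pi * t + real_of_int (2 * n) * pi)"
      by (simp only: distrib_right[symmetric] of_real_add[symmetric] mult_cancel_right of_real_eq_iff) simp
    also have "\<dots> \<longleftrightarrow> (\<exists>n::int. s = t + real_of_int n)"
    proof -
      have "2 * pi * s = 2 * pi * t + real_of_int (2 * n) * pi \<longleftrightarrow> s = t + real_of_int n" for n :: int
      proof -
        have "2 * pi * s = 2 * pi * t + real_of_int (2 * n) * pi \<longleftrightarrow> (2 * pi) * s = (2 * pi) * (t + real_of_int n)"
          by (simp add: algebra_simps)
        then show ?thesis by simp
      qed
      then show ?thesis by (simp only:)
    qed
    also have "\<dots> \<longleftrightarrow> s - t \<in> \<int>" by (auto simp: Ints_def algebra_simps)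
    finally show ?thesis .
  qed
  have en: "e t \<in> sphere 0 1" for t by (simp add: e_def)
  have es: "range e = sphere 0 1"
  proof
    show "sphere 0 1 \<subseteq> range e"
    proof
      fix z :: complex assume "z \<in> sphere 0 1"
      then obtain t where t: "z = Complex (cos t) (sin t)" using complex_unimodular_polar[of z] by auto
      then have "z = e (t / (2 * pi))" by (simp add: e_def mult.commute[of _ \<i>] cis_conv_exp[symmetric] cis.ctr)
      then show "z \<in> range e" by blast
    qed
  qed (use en in auto)
  show ?thesis
  proof (rule that[of "h \<circ> e"], unfold angular_def, intro conjI allI)
    show "continuous_on UNIV (h \<circ> e)"
      by (rule continuous_on_compose) (use h es in \<open>auto simp: e_def homeomorphism_def intro!: continuous_intros\<close>)
    show "(h \<circ> e) s = (h \<circ> e) t \<longleftrightarrow> s - t \<in> \<int>" for s t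
      using h en e[of s t] unfolding homeomorphism_def comp_def by metis
    show "range (h \<circ> e) = rel_frontier \<Delta>" using h es unfolding homeomorphism_def by (metis image_comp)
  qed
qed

text \<open>The coordinates are the radius relative to the boundary of the triangle, the angle as a
  real number, and the position along the link.\<close>

definition polar :: "'a::euclidean_space \<Rightarrow> (real \<Rightarrow> 'a) \<Rightarrow> real \<times> real \<times> real \<Rightarrow> 'a \<times> real" where
  "polar c \<tau> = (\<lambda>(r, t, s). (c + r *\<^sub>R (\<tau> t - c), s))"

text \<open>The domain of polar coordinates is convex, hence simply connected. Radius 0, that is the
  link, is excluded, and radius 1 is included because the meridian itself lies there.\<close>

definition strip :: "(real \<times> real \<times> real) set" where "strip = {0<..1} \<times> UNIV \<times> {-1<..<1}"
definition open_strip :: "(real \<times> real \<times> real) set" where "open_strip = {0<..<1} \<times> UNIV \<times> {-1<..<1}"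
text \<open>The generator of the covering translations: once around the link.\<close>

definition turn :: "real \<times> real \<times> real \<Rightarrow> real \<times> real \<times> real" where "turn = (\<lambda>(r, t, s). (r, t + 1, s))"

lemma convex_strip: "convex strip" "convex open_strip"
  unfolding strip_def open_strip_def by (intro convex_Times convex_UNIV; simp)+

lemma open_open_strip: "open open_strip"
  unfolding open_strip_def by (intro open_Times) auto

lemma open_strip_subset: "open_strip \<subseteq> strip" unfolding strip_def open_strip_def by auto

lemma turn_in [simp]: "turn z \<in> strip \<longleftrightarrow> z \<in> strip" "turn z \<in> open_strip \<longleftrightarrow> z \<in> open_strip"
  by (auto simp: turn_def strip_def open_strip_def split: prod.split)

lemma continuous_turn: "continuous_on X turn"
  unfolding turn_def case_prod_unfold by (intro continuous_intros)

lemma funpow_turn: "(turn ^^ k) (r, t, s) = (r, t + real k, s)"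
  by (induction k) (auto simp: turn_def)

context
  fixes \<Delta> :: "'a::euclidean_space set" and c :: 'a and \<tau> :: "real \<Rightarrow> 'a"
  assumes \<Delta>: "2 simplex \<Delta>" "c \<in> rel_interior \<Delta>" and \<tau>: "angular \<Delta> \<tau>"
begin

lemma continuous_polar: "continuous_on X (polar c \<tau>)"
proof -
  have c: "continuous_on UNIV \<tau>" using \<tau> by (simp add: angular_def)
  have "continuous_on X (\<lambda>z. \<tau> (fst (snd z)))"
    by (rule continuous_on_compose2[OF c]) (auto intro!: continuous_intros)
  then show ?thesis unfolding polar_def case_prod_unfold by (intro continuous_intros)
qed

lemma tau_frontier: "\<tau> t \<in> rel_frontier \<Delta>" using \<tau> unfolding angular_def by blast

lemma tau_simplex: "\<tau> t \<in> \<Delta>" "\<tau> t \<notin> rel_interior \<Delta>"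
  using tau_frontier[of t] closed_simplex[OF \<Delta>(1)] unfolding rel_frontier_def by auto

lemma radial_interior: "0 \<le> r \<Longrightarrow> r < 1 \<Longrightarrow> c + r *\<^sub>R (\<tau> t - c) \<in> rel_interior \<Delta>"
  using rel_interior_closure_convex_shrink[OF convex_simplex[OF \<Delta>(1)] \<Delta>(2), of "\<tau> t" "1 - r"]
    closure_subset tau_simplex[of t] by (force simp: algebra_simps)

lemma tau_ne: "\<tau> t \<noteq> c" using tau_simplex \<Delta> by metis

text \<open>If two points on rays from c coincide with radii r < r', then the frontier point on the
  second ray is the point at the fraction r / r' on the first ray and hence lies in the relative
  interior. So the radii, and then the frontier points, are equal.\<close>

lemma polar_eq_iff:
  assumes "(r, t, s) \<in> strip" "(r', t', s') \<in> strip"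
  shows "polar c \<tau> (r, t, s) = polar c \<tau> (r', t', s') \<longleftrightarrow> r = r' \<and> t - t' \<in> \<int> \<and> s = s'"
proof -
  have le: False if "c + r *\<^sub>R (\<tau> t - c) = c + r' *\<^sub>R (\<tau> t' - c)" "0 < r" "r < r'" for r t r' t'
  proof -
    have "r *\<^sub>R (\<tau> t - c) = r' *\<^sub>R (\<tau> t' - c)" using that(1) by simp
    then have "(1/r') *\<^sub>R (r *\<^sub>R (\<tau> t - c)) = (1/r') *\<^sub>R (r' *\<^sub>R (\<tau> t' - c))" by simp
    then have "\<tau> t' = c + (r / r') *\<^sub>R (\<tau> t - c)" using that by (simp add: algebra_simps)
    then show False using radial_interior[of "r / r'" t] tau_simplex(2)[of t'] that by simp
  qed
  have r: "0 < r" "0 < r'" using assms by (auto simp: strip_def)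
  have "r = r' \<and> \<tau> t = \<tau> t'" if "c + r *\<^sub>R (\<tau> t - c) = c + r' *\<^sub>R (\<tau> t' - c)"
  proof -
    have "r = r'" using le[OF that] le[OF that[symmetric]] r linorder_less_linear by blast
    then show ?thesis using that r by simp
  qed
  moreover have "\<tau> t = \<tau> t' \<longleftrightarrow> t - t' \<in> \<int>" using \<tau> by (simp add: angular_def)
  ultimately show ?thesis by (auto simp: polar_def)
qed

lemma polar_in: "z \<in> strip \<Longrightarrow> polar c \<tau> z \<in> (\<Delta> - {c}) \<times> {-1<..<1}"
proof -
  assume z: "z \<in> strip"
  obtain r t s where [simp]: "z = (r, t, s)" by (cases z)
  have r: "0 < r" "r \<le> 1" "-1 < s" "s < 1" using z by (auto simp: strip_def)
  have "c + r *\<^sub>R (\<tau> t - c) \<in> \<Delta>"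
    using radial_interior[of r t] tau_simplex(1)[of t] r rel_interior_subset by (cases "r = 1") auto
  then show ?thesis using r tau_ne[of t] by (simp add: polar_def)
qed

lemma polar_image: "polar c \<tau> ` open_strip = (rel_interior \<Delta> - {c}) \<times> {-1<..<1}"
proof
  show "polar c \<tau> ` open_strip \<subseteq> (rel_interior \<Delta> - {c}) \<times> {-1<..<1}"
    using radial_interior tau_ne by (auto simp: polar_def open_strip_def)
  show "(rel_interior \<Delta> - {c}) \<times> {-1<..<1} \<subseteq> polar c \<tau> ` open_strip"
  proof
    fix z assume "z \<in> (rel_interior \<Delta> - {c}) \<times> {-1<..<(1::real)}"
    then obtain x s where z: "z = (x, s)" and x: "x \<in> rel_interior \<Delta>" "x \<noteq> c" and s: "s \<in> {-1<..<1}" by blast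
    have "bounded \<Delta>" using compact_simplex[OF \<Delta>(1)] compact_imp_bounded by blast
    moreover have "x \<in> affine hull \<Delta>" using x(1) rel_interior_subset hull_subset[of \<Delta> affine] by blast
    then have "c + (x - c) \<in> affine hull \<Delta>" by simp
    moreover have "x - c \<noteq> 0" using x by simp
    ultimately have "\<exists>d>0. c + d *\<^sub>R (x - c) \<in> rel_frontier \<Delta>"
      by (rule ray_to_rel_frontier[OF _ \<Delta>(2)]) blast
    then obtain d where d: "d > 0" "c + d *\<^sub>R (x - c) \<in> rel_frontier \<Delta>" by blast
    have "d > 1"
    proof (rule ccontr)
      assume "\<not> d > 1"
      have "c + d *\<^sub>R (x - c) = (1 - d) *\<^sub>R c + d *\<^sub>R x" by (simp add: algebra_simps)
      also have "\<dots> \<in> rel_interior \<Delta>"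
        using convex_rel_interior[OF convex_simplex[OF \<Delta>(1)]] \<Delta>(2) x(1) d(1) \<open>\<not> d > 1\<close> by (intro convexD) auto
      finally show False using d(2) unfolding rel_frontier_def by auto
    qed
    obtain t where t: "\<tau> t = c + d *\<^sub>R (x - c)" using d(2) \<tau> unfolding angular_def by (metis imageE)
    have "(x, s) = polar c \<tau> (1/d, t, s)" using d(1) by (simp add: polar_def t)
    moreover have "(1/d, t, s) \<in> open_strip" using \<open>d > 1\<close> s by (auto simp: open_strip_def)
    ultimately show "z \<in> polar c \<tau> ` open_strip" unfolding z by blast
  qed
qed

lemma polar_turn: "polar c \<tau> (turn z) = polar c \<tau> z"
proof -
  obtain r t s where [simp]: "z = (r, t, s)" by (cases z)
  have "\<tau> (t + 1) = \<tau> t" using \<tau> by (simp add: angular_def)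
  then show ?thesis by (simp add: polar_def turn_def)
qed

text \<open>Polar coordinates are injective on slabs of angular width less than 1, where invariance
  of domain applies; the slabs cover the strip.\<close>

lemma polar_open_map:
  assumes U: "open U" "U \<subseteq> open_strip"
  shows "openin (top_of_set ((affine hull \<Delta>) \<times> UNIV)) (polar c \<tau> ` U)"
proof -
  \<comment> \<open>Width 1/2 leaves 0 as the only integral difference of two angles.\<close>
  define Y where "Y a = {0::real<..<1} \<times> {a<..<a+1/2} \<times> {-1<..<(1::real)}" for a :: real
  have Yopen: "open (Y a)" for a unfolding Y_def by (intro open_Times) auto
  have "openin (top_of_set ((affine hull \<Delta>) \<times> UNIV)) (polar c \<tau> ` (U \<inter> Y a))" for a
  proof (rule invariance_of_domain_affine_sets[where U = UNIV])
    show "openin (top_of_set UNIV) (U \<inter> Y a)" using U Yopen by (simp add: open_Int)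
    show "affine (UNIV :: (real \<times> real \<times> real) set)" by simp
    show "affine ((affine hull \<Delta>) \<times> (UNIV :: real set))" using affine_affine_hull[of \<Delta>] by (auto simp: affine_def)
    have "aff_dim ((affine hull \<Delta>) \<times> (UNIV :: real set)) = 3"
    proof -
      have cA: "c \<in> affine hull \<Delta>" using \<Delta>(2) rel_interior_subset hull_subset[of \<Delta> affine] by blast
      define D where "D = (+) (- c) ` (affine hull \<Delta>)"
      have D: "subspace D" unfolding D_def using affine_diffs_subspace[OF affine_affine_hull cA] by simp
      have "aff_dim D = 2" unfolding D_def aff_dim_translation_eq using aff_dim_simplex[OF \<Delta>(1)] by simp
      then have "dim (D \<times> (UNIV :: real set)) = 3" using dim_Times[OF D subspace_UNIV, where 'b=real] D by (simp add: aff_dim_subspace)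
      moreover have "(+) (- c, 0) ` ((affine hull \<Delta>) \<times> (UNIV :: real set)) = D \<times> UNIV" unfolding D_def by force
      ultimately show ?thesis
        using aff_dim_translation_eq[of "(- c, 0)" "(affine hull \<Delta>) \<times> (UNIV :: real set)"] D
        by (simp add: aff_dim_subspace subspace_Times)
    qed
    then show "aff_dim ((affine hull \<Delta>) \<times> (UNIV :: real set)) \<le> aff_dim (UNIV :: (real \<times> real \<times> real) set)" by simp
    show "continuous_on (U \<inter> Y a) (polar c \<tau>)" by (rule continuous_polar)
    have "polar c \<tau> z \<in> (affine hull \<Delta>) \<times> UNIV" if "z \<in> U" for z
      using polar_in[of z] that U(2) open_strip_subset hull_subset[of \<Delta> affine] by (force simp: mem_Times_iff)
    then show "polar c \<tau> \<in> U \<inter> Y a \<rightarrow> (affine hull \<Delta>) \<times> UNIV" by blast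
    show "inj_on (polar c \<tau>) (U \<inter> Y a)"
    proof (rule inj_onI)
      fix z z' assume z: "z \<in> U \<inter> Y a" "z' \<in> U \<inter> Y a" "polar c \<tau> z = polar c \<tau> z'"
      obtain r t s r' t' s' where [simp]: "z = (r, t, s)" "z' = (r', t', s')" by (cases z, cases z') auto
      have "(r, t, s) \<in> strip" "(r', t', s') \<in> strip" using z U(2) open_strip_subset by auto
      then have e: "r = r'" "t - t' \<in> \<int>" "s = s'" using polar_eq_iff z(3) by auto
      have "\<bar>t - t'\<bar> < 1" using z(1,2) by (auto simp: Y_def)
      moreover obtain k :: int where k: "t - t' = real_of_int k" using e(2) by (auto elim!: Ints_cases)
      ultimately have "k = 0" by (simp flip: of_int_abs)
      then have "t = t'" using k by simp
      then show "z = z'" using e by simp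
    qed
  qed
  then have "openin (top_of_set ((affine hull \<Delta>) \<times> UNIV)) (\<Union>a. polar c \<tau> ` (U \<inter> Y a))" by blast
  moreover have "(\<Union>a. U \<inter> Y a) = U"
  proof -
    have "z \<in> (\<Union>a. U \<inter> Y a)" if "z \<in> U" for z
    proof -
      obtain r t s where [simp]: "z = (r, t, s)" by (cases z)
      have "z \<in> Y (t - 1/4)" using that U(2) by (auto simp: Y_def open_strip_def)
      then show ?thesis using that by blast
    qed
    then show ?thesis by blast
  qed
  ultimately show ?thesis by (metis image_UN)
qed

end

subsection \<open>Lifting meridian charts to the double cover\<close>

lemma pl_sphere_homeomorphic:
  fixes S :: "'a::euclidean_space set"
  assumes "pl_sphere n S"
  obtains \<Delta> :: "'a set" and h k where "(int n + 1) simplex \<Delta>" "homeomorphism (rel_frontier \<Delta>) S h k"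
proof -
  obtain \<Delta> :: "'a set" and h where \<Delta>: "(int n + 1) simplex \<Delta>" and h: "pl_map (rel_frontier \<Delta>) h" "bij_betw h (rel_frontier \<Delta>) S"
    using assms unfolding pl_sphere_def pl_homeomorphism_def by blast
  have "compact (rel_frontier \<Delta>)" using compact_simplex[OF \<Delta>] by (simp add: compact_rel_frontier_bounded compact_imp_bounded)
  then obtain k where "homeomorphism (rel_frontier \<Delta>) S h k"
    using homeomorphism_compact[of "rel_frontier \<Delta>" h S] pl_map_continuous[OF h(1)] h(2) unfolding bij_betw_def by blast
  then show ?thesis using that \<Delta> by blast
qed

text \<open>On the compact cylinder \<open>\<phi>\<close> is a homeomorphism onto its image, and the
  image of the open cylinder is open in S by definition of the chart.\<close>

lemma meridian_chart_open_map:
  assumes mc: "meridian_chart S L \<Delta> c \<phi>"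
    and V: "openin (top_of_set ((affine hull \<Delta>) \<times> UNIV)) V" "V \<subseteq> rel_interior \<Delta> \<times> {-1<..<1}"
  shows "openin (top_of_set S) (\<phi> ` V)"
proof -
  let ?D = "\<Delta> \<times> {-1..1::real}"
  have \<Delta>: "2 simplex \<Delta>" and pl: "pl_map ?D \<phi>" and inj: "inj_on \<phi> ?D"
    and N: "openin (top_of_set S) (\<phi> ` (rel_interior \<Delta> \<times> {-1<..<1}))"
    using mc unfolding meridian_chart_def by auto
  have "rel_interior \<Delta> \<times> {-1<..<1} \<subseteq> ?D" using rel_interior_subset[of \<Delta>] by auto
  then have sub: "V \<subseteq> ?D" using V(2) by blast
  have D: "?D \<subseteq> (affine hull \<Delta>) \<times> UNIV" using hull_subset[of \<Delta> affine] by auto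
  have cD: "compact ?D" using compact_polyhedron_imp_compact[OF pl_map_imp_polyhedron[OF pl]] .
  have 1: "openin (top_of_set ?D) V" by (rule openin_subset_trans[OF V(1) sub D])
  obtain k where "homeomorphism ?D (\<phi> ` ?D) \<phi> k"
    using homeomorphism_compact[OF cD pl_map_continuous[OF pl] refl inj] by blast
  then have "openin (top_of_set (\<phi> ` ?D)) (\<phi> ` V)" using homeomorphism_imp_open_map 1 by blast
  then have "openin (top_of_set (\<phi> ` (rel_interior \<Delta> \<times> {-1<..<1}))) (\<phi> ` V)"
    by (rule openin_subset_trans) (use V(2) rel_interior_subset[of \<Delta>] in auto)
  then show ?thesis using N openin_trans by blast
qed

text \<open>That L is nonempty is what makes M connected: a double covering of the sphere without
  branching would be two copies of it.\<close>

locale branched_double_cover =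
  fixes S3 L :: "'a::euclidean_space set" and M :: "'b::euclidean_space set" and q :: "'b \<Rightarrow> 'a"
  assumes sphere: "pl_sphere 3 S3" and link: "pl_link L" and L_sub: "L \<subseteq> S3" and L_ne: "L \<noteq> {}"
    and cover: "double_branched_cover M q S3 L"
begin

definition M' where "M' = {x \<in> M. q x \<notin> L}"

lemma M'_sub: "M' \<subseteq> M" by (auto simp: M'_def)

lemma pl_q: "pl_map M q" and q_image: "q ` M = S3" and covering: "covering_space M' q (S3 - L)"
  and manifold: "closed_pl_manifold 3 M"
  using cover unfolding double_branched_cover_def M'_def by auto

lemma finite_fibre: "finite {x \<in> M. q x = y}"
proof (cases "y \<in> S3")
  case True then show ?thesis using cover unfolding double_branched_cover_def by auto
next
  case False
  then have "{x \<in> M. q x = y} = {}" using q_image by auto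
  then show ?thesis by (metis finite.emptyI)
qed

lemma q_in: "x \<in> M \<Longrightarrow> q x \<in> S3" using q_image by auto

lemma image_preimage: assumes "A \<subseteq> S3" shows "q ` {z \<in> M. q z \<in> A} = A"
proof
  show "A \<subseteq> q ` {z \<in> M. q z \<in> A}"
  proof
    fix y assume y: "y \<in> A"
    then have "y \<in> q ` M" using assms q_image by blast
    then show "y \<in> q ` {z \<in> M. q z \<in> A}" using y by (elim imageE) (auto intro: imageI)
  qed
qed auto

lemma cont_q: "continuous_on M q" using pl_map_continuous[OF pl_q] .

lemma compact_M: "compact M" using compact_polyhedron_imp_compact[OF pl_map_imp_polyhedron[OF pl_q]] .

lemma compact_S3: "compact S3" using compact_continuous_image[OF cont_q compact_M] q_image by simp

lemma fibre_two:
  assumes "x \<in> M'" "x1 \<in> M" "x2 \<in> M" "q x1 = q x" "q x2 = q x" "x1 \<noteq> x2"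
  shows "x = x1 \<or> x = x2"
proof -
  have "card {z \<in> M. q z = q x} = 2"
    using cover assms(1) q_in unfolding double_branched_cover_def M'_def by auto
  moreover have "{x1, x2} \<subseteq> {z \<in> M. q z = q x}" using assms by auto
  moreover have "card {x1, x2} = 2" using assms by simp
  ultimately have "{z \<in> M. q z = q x} = {x1, x2}" by (metis card_subset_eq finite_fibre)
  moreover have "x \<in> {z \<in> M. q z = q x}" using assms M'_def by auto
  ultimately show ?thesis by auto
qed

lemma q_M': "x \<in> M' \<Longrightarrow> q x \<in> S3 - L" using q_in by (auto simp: M'_def)

lemma closed_L: "closed L"
proof -
  obtain K where K: "finite K" "\<forall>C\<in>K. pl_sphere 1 C" "\<Union>K = L" using link unfolding pl_link_def by auto
  have "closed C" if C: "C \<in> K" for C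
  proof -
    have "pl_sphere 1 C" using K(2) C by blast
    then obtain \<Delta> :: "'a set" and h k where \<Delta>: "(int 1 + 1) simplex \<Delta>" "homeomorphism (rel_frontier \<Delta>) C h k"
      using pl_sphere_homeomorphic by metis
    have "compact (rel_frontier \<Delta>)" using compact_simplex[OF \<Delta>(1)] by (simp add: compact_rel_frontier_bounded compact_imp_bounded)
    then show ?thesis using \<Delta>(2) unfolding homeomorphism_def by (metis compact_continuous_image compact_imp_closed)
  qed
  then show ?thesis using K by (metis closed_Union)
qed

lemma open_S3_L: "openin (top_of_set S3) (S3 - L)"
  using closed_L by (metis Diff_eq openin_open open_Compl)

lemma open_M': "openin (top_of_set M) M'"
proof -
  have "M' = M \<inter> q -` (- L)" by (auto simp: M'_def)
  then show ?thesis using closed_L continuous_openin_preimage_gen[OF cont_q, of "- L"] by (simp add: open_Compl)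
qed

text \<open>The last clause is nontrivial monodromy: a turn around the link changes the
  sheet.\<close>

definition chart_lift where
  "chart_lift c \<tau> \<phi> h \<longleftrightarrow> continuous_on strip h \<and> (\<forall>z\<in>strip. h z \<in> M' \<and> q (h z) = \<phi> (polar c \<tau> z)) \<and>
    (\<forall>z\<in>strip. h (turn z) \<noteq> h z)"

context
  fixes \<Delta> c \<phi> \<tau>
  assumes mc: "meridian_chart S3 L \<Delta> c \<phi>" and \<tau>: "angular \<Delta> \<tau>"
begin

lemma chart_facts: "2 simplex \<Delta>" "c \<in> rel_interior \<Delta>" "pl_map (\<Delta> \<times> {-1..1}) \<phi>" "inj_on \<phi> (\<Delta> \<times> {-1..1})"
  "\<phi> ` (\<Delta> \<times> {-1..1}) \<subseteq> S3" "{z \<in> \<Delta> \<times> {-1..1}. \<phi> z \<in> L} = {c} \<times> {-1..1}"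
  "openin (top_of_set S3) (\<phi> ` (rel_interior \<Delta> \<times> {-1<..<1}))"
  using mc unfolding meridian_chart_def by auto

lemmas polar_facts = continuous_polar[OF chart_facts(1,2) \<tau>] polar_in[OF chart_facts(1,2) \<tau>]
  polar_eq_iff[OF chart_facts(1,2) \<tau>] polar_image[OF chart_facts(1,2) \<tau>] polar_turn[OF chart_facts(1,2) \<tau>]

lemma chart_polar_in: assumes "z \<in> strip" shows "\<phi> (polar c \<tau> z) \<in> S3 - L" "polar c \<tau> z \<in> \<Delta> \<times> {-1..1}"
proof -
  have "polar c \<tau> z \<in> (\<Delta> - {c}) \<times> {-1<..<1}" by (rule polar_facts(2)[OF assms])
  then show 1: "polar c \<tau> z \<in> \<Delta> \<times> {-1..1}" by auto
  have "polar c \<tau> z \<notin> {c} \<times> {-1..1}" using \<open>polar c \<tau> z \<in> (\<Delta> - {c}) \<times> {-1<..<1}\<close> by auto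
  then have "\<phi> (polar c \<tau> z) \<notin> L" using 1 chart_facts(6) by (metis (mono_tags, lifting) mem_Collect_eq)
  moreover have "\<phi> (polar c \<tau> z) \<in> S3" using subsetD[OF chart_facts(5) imageI[OF 1]] .
  ultimately show "\<phi> (polar c \<tau> z) \<in> S3 - L" by simp
qed

lemma continuous_chart_polar: "continuous_on strip (\<lambda>z. \<phi> (polar c \<tau> z))"
  by (rule continuous_on_compose2[OF pl_map_continuous[OF chart_facts(3)] polar_facts(1)])
    (rule image_subsetI, rule chart_polar_in(2))

text \<open>The lift exists since the strip is simply connected. If a turn fixed its value at one
  point, it would do so everywhere by uniqueness of lifts, and a lift of the meridian would be
  closed.\<close>

lemma chart_lift_exists:
  assumes z0: "z0 \<in> strip" and a: "a \<in> M" "q a = \<phi> (polar c \<tau> z0)"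
  obtains h where "chart_lift c \<tau> \<phi> h" "h z0 = a"
proof -
  have aM: "a \<in> M'" using a chart_polar_in(1)[OF z0] by (auto simp: M'_def)
  have fim: "(\<lambda>z. \<phi> (polar c \<tau> z)) \<in> strip \<rightarrow> S3 - L" using chart_polar_in by blast
  obtain h where h: "continuous_on strip h" "h \<in> strip \<rightarrow> M'" "h z0 = a" "\<And>z. z \<in> strip \<Longrightarrow> q (h z) = \<phi> (polar c \<tau> z)"
    using covering_space_lift_strong[OF covering aM z0 convex_imp_simply_connected[OF convex_strip(1)]
      convex_imp_locally_path_connected[OF convex_strip(1)] continuous_chart_polar fim a(2)[symmetric]] by blast
  have ct: "continuous_on strip (h \<circ> turn)"
    by (rule continuous_on_compose[OF continuous_turn]) (rule continuous_on_subset[OF h(1)], auto)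
  have "h (turn z) \<noteq> h z" if z: "z \<in> strip" for z
  proof
    assume eq: "h (turn z) = h z"
    have all: "(h \<circ> turn) w = h w" if w: "w \<in> strip" for w
    proof (rule covering_space_lift_unique[OF covering _ continuous_chart_polar fim ct _ _ h(1,2)])
      show "(h \<circ> turn) z = h z" using eq by simp
      show "h \<circ> turn \<in> strip \<rightarrow> M'" using h(2) by auto
      show "\<phi> (polar c \<tau> x) = q ((h \<circ> turn) x)" if "x \<in> strip" for x
        using h(4)[of "turn x"] that polar_facts(5) by simp
      show "\<phi> (polar c \<tau> x) = q (h x)" if "x \<in> strip" for x using h(4)[OF that] by simp
      show "connected strip" using convex_strip convex_connected by blast
    qed (fact z w)+
    \<comment> \<open>The path runs once along the boundary of the triangle at height 0, so q maps
      it to a simple closed parametrisation of the meridian.\<close>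
    define g where "g u = h (1, u, 0)" for u :: real
    have st: "(1, u, 0) \<in> strip" for u by (auto simp: strip_def)
    have qg: "q (g u) = \<phi> (\<tau> u, 0)" for u using h(4)[OF st] by (simp add: g_def polar_def)
    have phi_eq: "\<phi> (\<tau> u, 0) = \<phi> (\<tau> v, 0) \<longleftrightarrow> u - v \<in> \<int>" for u v
    proof -
      have "polar c \<tau> (1, u, 0) = (\<tau> u, 0)" for u by (simp add: polar_def)
      then have "\<phi> (\<tau> u, 0) = \<phi> (\<tau> v, 0) \<longleftrightarrow> polar c \<tau> (1, u, 0) = polar c \<tau> (1, v, 0)"
        using inj_on_eq_iff[OF chart_facts(4) chart_polar_in(2)[OF st] chart_polar_in(2)[OF st], of u v] by metis
      then show ?thesis using polar_facts(3)[OF st st] by simp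
    qed
    have "path g" unfolding path_def g_def
      by (rule continuous_on_compose2[OF h(1)]) (use st in \<open>auto intro!: continuous_intros\<close>)
    moreover have im: "path_image g \<subseteq> M'" unfolding path_image_def g_def using h(2) st by auto
    then have "path_image g \<subseteq> M" using M'_sub by auto
    moreover have "simple_path (q \<circ> g)"
    proof -
      have "path (q \<circ> g)" unfolding path_def
        by (rule continuous_on_compose[OF \<open>path g\<close>[unfolded path_def]])
          (rule continuous_on_subset[OF cont_q], use \<open>path_image g \<subseteq> M\<close> in \<open>simp add: path_image_def\<close>)
      moreover have "x = y \<or> x = 0 \<and> y = 1 \<or> x = 1 \<and> y = 0"
        if xy: "x \<in> {0..1}" "y \<in> {0..1}" "(q \<circ> g) x = (q \<circ> g) y" for x y
      proof -
        have "x - y \<in> \<int>" using xy(3) qg phi_eq by simp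
        then obtain k :: int where k: "x - y = real_of_int k" by (auto elim!: Ints_cases)
        have "\<bar>real_of_int k\<bar> \<le> 1" using xy(1,2) k by auto
        then have "\<bar>k\<bar> \<le> 1" by (metis of_int_1 of_int_abs of_int_le_iff)
        then have "k = 0 \<or> k = 1 \<or> k = -1" by linarith
        then show ?thesis using k xy(1,2) by auto
      qed
      ultimately show ?thesis unfolding simple_path_def loop_free_def by blast
    qed
    moreover have "pathfinish (q \<circ> g) = pathstart (q \<circ> g)"
      unfolding pathfinish_def pathstart_def comp_def qg phi_eq by simp
    moreover have "path_image (q \<circ> g) = \<phi> ` (rel_frontier \<Delta> \<times> {0})"
    proof -
      have "path_image (q \<circ> g) = (\<lambda>u. \<phi> (\<tau> u, 0)) ` {0..1}" unfolding path_image_def using qg by auto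
      also have "\<dots> = (\<lambda>u. \<phi> (\<tau> u, 0)) ` UNIV"
      proof -
        have "\<phi> (\<tau> u, 0) \<in> (\<lambda>u. \<phi> (\<tau> u, 0)) ` {0..1}" for u
        proof (rule image_eqI)
          show "\<phi> (\<tau> u, 0) = \<phi> (\<tau> (frac u), 0)" unfolding phi_eq by (simp add: frac_def)
          show "frac u \<in> {0..1}" using frac_lt_1[of u] by (simp add: less_imp_le)
        qed
        then show ?thesis by blast
      qed
      also have "\<dots> = \<phi> ` (range \<tau> \<times> {0})" by auto
      finally show ?thesis using \<tau> by (simp add: angular_def)
    qed
    moreover have "meridian S3 L (\<phi> ` (rel_frontier \<Delta> \<times> {0}))"
      unfolding meridian_def using chart_facts(1-6) by blast
    ultimately have "pathfinish g \<noteq> pathstart g"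
      using cover unfolding double_branched_cover_def by blast
    then show False using all[OF st[of 0]] by (simp add: g_def pathfinish_def pathstart_def turn_def)
  qed
  then show ?thesis using that[of h] h unfolding chart_lift_def by auto
qed

context
  fixes h assumes h: "chart_lift c \<tau> \<phi> h"
begin

lemma lift_facts: "continuous_on strip h" "\<And>z. z \<in> strip \<Longrightarrow> h z \<in> M'"
  "\<And>z. z \<in> strip \<Longrightarrow> q (h z) = \<phi> (polar c \<tau> z)" "\<And>z. z \<in> strip \<Longrightarrow> h (turn z) \<noteq> h z"
  using h unfolding chart_lift_def by auto

lemma lift_fibre:
  assumes "x \<in> M" "z \<in> strip" "q x = \<phi> (polar c \<tau> z)" shows "x = h z \<or> x = h (turn z)"
proof (rule fibre_two)
  show "x \<in> M'" using assms chart_polar_in(1)[OF assms(2)] by (auto simp: M'_def)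
  show "h z \<in> M" "h (turn z) \<in> M" using lift_facts(2)[of z] lift_facts(2)[of "turn z"] assms(2) M'_sub by auto
  show "q (h z) = q x" using lift_facts(3)[OF assms(2)] assms(3) by simp
  show "q (h (turn z)) = q x" using lift_facts(3)[of "turn z"] assms(2,3) polar_facts(5) by simp
  show "h z \<noteq> h (turn z)" using lift_facts(4)[OF assms(2)] by metis
qed

text \<open>Two turns return to the initial sheet since there are only two sheets and each turn
  leaves the current one.\<close>

lemma lift_turn2: assumes "z \<in> strip" shows "h (turn (turn z)) = h z"
proof -
  have "h (turn (turn z)) \<in> M" "q (h (turn (turn z))) = \<phi> (polar c \<tau> z)"
    using lift_facts(2,3)[of "turn (turn z)"] assms M'_sub polar_facts(5) by auto
  then show ?thesis using lift_fibre[of "h (turn (turn z))" z] lift_facts(4)[of "turn z"] assms by auto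
qed

lemma funpow_turn_in: "z \<in> strip \<Longrightarrow> (turn ^^ k) z \<in> strip"
  by (induction k) auto

lemma lift_funpow: "z \<in> strip \<Longrightarrow> h ((turn ^^ k) z) = (if even k then h z else h (turn z))"
proof (induction k rule: less_induct)
  case (less k)
  consider "k = 0" | "k = 1" | m where "k = Suc (Suc m)" by (metis One_nat_def old.nat.exhaust)
  then show ?case
  proof cases
    case 3
    then have "h ((turn ^^ k) z) = h ((turn ^^ m) z)" using lift_turn2[OF funpow_turn_in[OF less.prems]] by simp
    then show ?thesis using less 3 by simp
  qed auto
qed

text \<open>Equal values have equal projections, so the polar coordinates differ by an integral
  number of turns. An odd number would change the sheet. The alternative in the conclusion reflects
  that \<open>turn\<close> is iterated forwards only.\<close>

lemma lift_eq_imp: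
  assumes z: "z \<in> strip" "z' \<in> strip" "h z = h z'"
  obtains k where "even k" "z' = (turn ^^ k) z \<or> z = (turn ^^ k) z'"
proof -
  obtain r t s r' t' s' where zz [simp]: "z = (r, t, s)" "z' = (r', t', s')" by (cases z, cases z') auto
  have "\<phi> (polar c \<tau> z) = \<phi> (polar c \<tau> z')" using lift_facts(3) z by metis
  then have "polar c \<tau> z = polar c \<tau> z'" using chart_facts(4) chart_polar_in(2) z(1,2) by (metis inj_onD)
  then have e: "r = r'" "t - t' \<in> \<int>" "s = s'" using polar_facts(3) z by auto
  obtain j :: int where j: "t - t' = real_of_int j" using e(2) by (auto elim!: Ints_cases)
  have key: "even k" if "w' = (turn ^^ k) w" "w \<in> strip" "h w = h w'" for w w' k
    using lift_funpow[OF that(2), of k] lift_facts(4)[OF that(2)] that(1,3) by (auto split: if_splits)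
  show ?thesis
  proof (cases "j \<ge> 0")
    case True
    then have "z = (turn ^^ nat j) z'" using e j by (simp add: funpow_turn)
    then show ?thesis using that key z by metis
  next
    case False
    then have "z' = (turn ^^ nat (- j)) z" using e j by (simp add: funpow_turn)
    then show ?thesis using that key z by metis
  qed
qed

text \<open>Both sheets are reached: the second point over a value is found one turn
  further.\<close>

lemma lift_image: "h ` open_strip = {x \<in> M. q x \<in> \<phi> ` (rel_interior \<Delta> \<times> {-1<..<1}) - L}"
proof
  show "h ` open_strip \<subseteq> {x \<in> M. q x \<in> \<phi> ` (rel_interior \<Delta> \<times> {-1<..<1}) - L}"
  proof clarify
    fix r t s assume z: "(r, t, s) \<in> open_strip"
    then have zs: "(r, t, s) \<in> strip" using open_strip_subset by auto
    have "polar c \<tau> (r, t, s) \<in> (rel_interior \<Delta> - {c}) \<times> {-1<..<1}"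
      unfolding polar_facts(4)[symmetric] using z by (rule imageI)
    then have "polar c \<tau> (r, t, s) \<in> rel_interior \<Delta> \<times> {-1<..<1}" by auto
    then show "h (r, t, s) \<in> M \<and> q (h (r, t, s)) \<in> \<phi> ` (rel_interior \<Delta> \<times> {-1<..<1}) - L"
      using lift_facts(2,3)[OF zs] chart_polar_in(1)[OF zs] M'_sub by auto
  qed
  show "{x \<in> M. q x \<in> \<phi> ` (rel_interior \<Delta> \<times> {-1<..<1}) - L} \<subseteq> h ` open_strip"
  proof
    fix x assume "x \<in> {x \<in> M. q x \<in> \<phi> ` (rel_interior \<Delta> \<times> {-1<..<1}) - L}"
    then obtain a b where x: "x \<in> M" "q x = \<phi> (a, b)" "\<phi> (a, b) \<notin> L" "a \<in> rel_interior \<Delta>" "b \<in> {-1<..<1}"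
      by auto
    have "a \<in> \<Delta>" using x rel_interior_subset by blast
    have "c \<in> \<Delta>" using chart_facts(2) rel_interior_subset by blast
    have "(a, b) \<notin> {c} \<times> {-1..1}" using chart_facts(6) x(3,5) by (metis (no_types, lifting) mem_Collect_eq)
    then have "(a, b) \<in> (rel_interior \<Delta> - {c}) \<times> {-1<..<1}" using x by auto
    then obtain z where z: "z \<in> open_strip" "polar c \<tau> z = (a, b)" using polar_facts(4) by (metis imageE)
    then have zs: "z \<in> strip" using open_strip_subset by auto
    have "x = h z \<or> x = h (turn z)" using lift_fibre[OF x(1) zs] x(2) z(2) by simp
    then show "x \<in> h ` open_strip" using z(1) by auto
  qed
qed

text \<open>Locally q is a homeomorphism on M', and composed with h it is the open map given by the
  chart in polar coordinates; hence h is open.\<close>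

lemma lift_open_map:
  assumes U: "open U" "U \<subseteq> open_strip" shows "openin (top_of_set M') (h ` U)"
proof (subst openin_subopen, clarify)
  fix r t s assume z: "(r, t, s) \<in> U"
  let ?z = "(r, t, s)"
  have Us: "U \<subseteq> strip" using U open_strip_subset by auto
  have zs: "?z \<in> strip" using z Us by auto
  obtain T u k where T: "h ?z \<in> T" "openin (top_of_set M') T" "openin (top_of_set (S3 - L)) u" "homeomorphism T u q k"
    using covering_space_local_homeomorphism[OF covering lift_facts(2)[OF zs]] by metis
  obtain W where W: "open W" "T = M' \<inter> W" using T(2) by (auto simp: openin_open)
  define U' where "U' = U \<inter> h -` W"
  have "openin (top_of_set U) U'" unfolding U'_def
    using continuous_on_subset[OF lift_facts(1) Us] W(1) continuous_openin_preimage_gen by blast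
  then have U': "open U'" "U' \<subseteq> open_strip" using U by (auto simp: openin_open_eq U'_def)
  have U's: "U' \<subseteq> strip" using U' open_strip_subset by auto
  let ?V = "(\<lambda>z. \<phi> (polar c \<tau> z)) ` U'"
  have "polar c \<tau> ` U' \<subseteq> (rel_interior \<Delta> - {c}) \<times> {-1<..<1}"
    unfolding polar_facts(4)[symmetric] using U'(2) by (rule image_mono)
  then have "polar c \<tau> ` U' \<subseteq> rel_interior \<Delta> \<times> {-1<..<1}" by auto
  then have "openin (top_of_set S3) (\<phi> ` polar c \<tau> ` U')"
    by (rule meridian_chart_open_map[OF mc polar_open_map[OF chart_facts(1,2) \<tau> U']])
  then have Vo: "openin (top_of_set S3) ?V" by (simp add: image_image)
  obtain V where V: "open V" "?V = S3 \<inter> V" using Vo by (auto simp: openin_open)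
  have hT: "h ` U' = T \<inter> (M' \<inter> q -` V)"
  proof
    show "h ` U' \<subseteq> T \<inter> (M' \<inter> q -` V)"
    proof clarify
      fix r t s assume w: "(r, t, s) \<in> U'"
      then have ws: "(r, t, s) \<in> strip" using U's by auto
      have "q (h (r, t, s)) \<in> ?V" using lift_facts(3)[OF ws] w by auto
      then have "q (h (r, t, s)) \<in> V" using V(2) by blast
      then show "h (r, t, s) \<in> T \<inter> (M' \<inter> q -` V)" using lift_facts(2)[OF ws] w W(2) by (auto simp: U'_def)
    qed
    show "T \<inter> (M' \<inter> q -` V) \<subseteq> h ` U'"
    proof
      fix x assume x: "x \<in> T \<inter> (M' \<inter> q -` V)"
      then have "q x \<in> ?V" using V(2) q_M' by auto
      then obtain w where w: "w \<in> U'" "q x = \<phi> (polar c \<tau> w)" by auto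
      have ws: "w \<in> strip" using w U's by auto
      have "h w \<in> T" using w(1) W(2) lift_facts(2)[OF ws] by (auto simp: U'_def)
      moreover have "q (h w) = q x" using w lift_facts(3)[OF ws] by simp
      ultimately have "h w = x" using x T(4) unfolding homeomorphism_def by (metis IntD1)
      then show "x \<in> h ` U'" using w by auto
    qed
  qed
  have "openin (top_of_set M') (M' \<inter> q -` V)"
    using continuous_openin_preimage_gen[OF continuous_on_subset[OF cont_q M'_sub] V(1)] .
  then have "openin (top_of_set M') (h ` U')" unfolding hT using T(2) by (rule openin_Int[rotated])
  moreover have "h ?z \<in> h ` U'" using z T(1) W(2) by (auto simp: U'_def)
  moreover have "h ` U' \<subseteq> h ` U" by (auto simp: U'_def)
  ultimately show "\<exists>T. openin (top_of_set M') T \<and> h ?z \<in> T \<and> T \<subseteq> h ` U" by blast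
qed

text \<open>Connected as a continuous image of the convex open strip. This expresses that the double
  covering of a punctured meridian chart is not split.\<close>

lemma connected_chart_preimage: "connected {x \<in> M. q x \<in> \<phi> ` (rel_interior \<Delta> \<times> {-1<..<1}) - L}"
  unfolding lift_image[symmetric]
  by (rule connected_continuous_image[OF continuous_on_subset[OF lift_facts(1) open_strip_subset]])
    (simp add: convex_connected convex_strip)

end

end

end

subsection \<open>Connectedness of complements of the branch set\<close>

text \<open>A finite form of the Baire property. By induction, either P is contained in c, or P
  without c is nonempty, open and covered by the remaining sets.\<close>

lemma finite_closed_cover_open:
  assumes "finite C" "\<And>c. c \<in> C \<Longrightarrow> closed c" "openin (top_of_set T) P" "P \<noteq> {}" "P \<subseteq> \<Union>C"
  shows "\<exists>c\<in>C. \<exists>P'. openin (top_of_set T) P' \<and> P' \<noteq> {} \<and> P' \<subseteq> c \<and> P' \<subseteq> P"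
  using assms
proof (induction C arbitrary: P rule: finite_induct)
  case empty then show ?case by auto
next
  case (insert c C)
  show ?case
  proof (cases "P \<subseteq> c")
    case True then show ?thesis using insert.prems by blast
  next
    case False
    have "openin (top_of_set T) (P - c)"
      using insert.prems(1)[of c] insert.prems(2) by (metis Diff_eq insertI1 open_Compl openin_Int_open)
    then obtain c' P' where "c' \<in> C" "openin (top_of_set T) P'" "P' \<noteq> {}" "P' \<subseteq> c'" "P' \<subseteq> P - c"
      using insert.IH[of "P - c"] insert.prems False by blast
    then show ?thesis by blast
  qed
qed

text \<open>A dense subset A that remains connected in arbitrarily small neighbourhoods is not
  disconnected inside a connected open set: a separation of the A-part would spread to a separation
  of W.\<close>

lemma connected_Int_dense:
  fixes X A :: "'a::topological_space set"
  assumes loc: "\<And>x \<Omega>. openin (top_of_set X) \<Omega> \<Longrightarrow> x \<in> \<Omega> \<Longrightarrow>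
      \<exists>U. openin (top_of_set X) U \<and> x \<in> U \<and> U \<subseteq> \<Omega> \<and> connected (U \<inter> A)"
    and dense: "\<And>U. openin (top_of_set X) U \<Longrightarrow> U \<noteq> {} \<Longrightarrow> U \<inter> A \<noteq> {}"
    and W: "openin (top_of_set X) W" "connected W"
  shows "connected (W \<inter> A)"
proof (rule ccontr)
  assume "\<not> connected (W \<inter> A)"
  then obtain V1 V2 where V: "open V1" "open V2" "W \<inter> A \<subseteq> V1 \<union> V2" "V1 \<inter> V2 \<inter> (W \<inter> A) = {}"
    "V1 \<inter> (W \<inter> A) \<noteq> {}" "V2 \<inter> (W \<inter> A) \<noteq> {}" unfolding connected_def by blast
  \<comment> \<open>\<open>E V\<close> is the union of all open subsets of W whose points in A lie
    on the side V. Density makes the two such unions disjoint, and the small neighbourhoods make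
    them cover W.\<close>
  define E where "E V = \<Union>{U. openin (top_of_set X) U \<and> U \<subseteq> W \<and> U \<inter> A \<subseteq> V}" for V
  have Eo: "openin (top_of_set W) (E V)" for V
  proof -
    have "openin (top_of_set X) (E V)" unfolding E_def by blast
    moreover have "E V \<subseteq> W" unfolding E_def by blast
    ultimately show ?thesis using openin_imp_subset[OF W(1)] openin_subset_trans by blast
  qed
  have in_E: "x \<in> E V1 \<or> x \<in> E V2" "x \<in> A \<Longrightarrow> x \<in> V \<Longrightarrow> (V = V1 \<or> V = V2) \<Longrightarrow> x \<in> E V" if x: "x \<in> W" for x V
  proof -
    obtain U where U: "openin (top_of_set X) U" "x \<in> U" "U \<subseteq> W" "connected (U \<inter> A)" using loc[OF W(1) x] by blast
    have or: "U \<inter> A \<subseteq> V1 \<or> U \<inter> A \<subseteq> V2"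
    proof (rule ccontr)
      assume "\<not> ?thesis"
      then have "V1 \<inter> (U \<inter> A) \<noteq> {}" "V2 \<inter> (U \<inter> A) \<noteq> {}" using V(3) U(3) by blast+
      moreover have "V1 \<inter> V2 \<inter> (U \<inter> A) = {}" "U \<inter> A \<subseteq> V1 \<union> V2" using V(3,4) U(3) by blast+
      ultimately show False using U(4) V(1,2) unfolding connected_def by blast
    qed
    then show "x \<in> E V1 \<or> x \<in> E V2" using U unfolding E_def by blast
    assume xA: "x \<in> A" "x \<in> V" "V = V1 \<or> V = V2"
    then have "U \<inter> A \<subseteq> V" using or U(2) V(4) x by blast
    then show "x \<in> E V" using U unfolding E_def by blast
  qed
  have disj: "E V1 \<inter> E V2 = {}"
  proof (rule ccontr)
    assume "E V1 \<inter> E V2 \<noteq> {}"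
    then obtain U1 U2 where U: "openin (top_of_set X) U1" "U1 \<subseteq> W" "U1 \<inter> A \<subseteq> V1" "openin (top_of_set X) U2" "U2 \<inter> A \<subseteq> V2" "U1 \<inter> U2 \<noteq> {}"
      unfolding E_def by blast
    then have "U1 \<inter> U2 \<inter> A \<noteq> {}" using dense[of "U1 \<inter> U2"] openin_Int by blast
    then show False using U V(4) by blast
  qed
  have "W \<subseteq> E V1 \<union> E V2" using in_E(1) by blast
  moreover have "E V1 \<noteq> {}" "E V2 \<noteq> {}" using V(5,6) in_E(2) by blast+
  ultimately show False using W(2) Eo disj unfolding connected_openin by blast
qed

section \<open>Density of the unbranched part, fibres over the link and connectedness of the
  cover\<close>

context branched_double_cover
begin

lemma L_chart:
  assumes y: "y \<in> L" and \<Omega>: "openin (top_of_set S3) \<Omega>" "y \<in> \<Omega>"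
  obtains \<Delta> c \<phi> \<tau> where "meridian_chart S3 L \<Delta> c \<phi>" "angular \<Delta> \<tau>" "y \<in> \<phi> ` (rel_interior \<Delta> \<times> {-1<..<1})"
    "\<phi> ` (\<Delta> \<times> {-1..1}) \<subseteq> \<Omega>"
proof -
  obtain \<Delta> c \<phi> where mc: "meridian_chart S3 L \<Delta> c \<phi>" "\<phi> (c, 0) = y" "\<phi> ` (\<Delta> \<times> {-1..1}) \<subseteq> \<Omega>"
    using meridian_chart_exists[OF sphere link L_sub y \<Omega>] by metis
  have "2 simplex \<Delta>" "c \<in> rel_interior \<Delta>" using mc(1) unfolding meridian_chart_def by auto
  then obtain \<tau> where "angular \<Delta> \<tau>" using angular_exists by blast
  moreover have "y \<in> \<phi> ` (rel_interior \<Delta> \<times> {-1<..<1})"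
    using mc(2) \<open>c \<in> rel_interior \<Delta>\<close> by (intro image_eqI[of _ _ "(c, 0)"]) auto
  ultimately show ?thesis using that mc by blast
qed

lemma chart_point_off_L:
  assumes mc: "meridian_chart S3 L \<Delta> c \<phi>" and \<tau>: "angular \<Delta> \<tau>"
  obtains z where "z \<in> open_strip" "\<phi> (polar c \<tau> z) \<in> \<phi> ` (rel_interior \<Delta> \<times> {-1<..<1}) - L"
proof -
  have z: "(1/2, 0, 0) \<in> open_strip" by (auto simp: open_strip_def)
  then have zs: "(1/2, 0, 0) \<in> strip" using open_strip_subset by blast
  have "polar c \<tau> (1/2, 0, 0) \<in> (rel_interior \<Delta> - {c}) \<times> {-1<..<1}"
    unfolding polar_image[OF chart_facts(1,2)[OF mc \<tau>] \<tau>, symmetric] using z by (rule imageI)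
  then have "polar c \<tau> (1/2, 0, 0) \<in> rel_interior \<Delta> \<times> {-1<..<1}" by auto
  then have "\<phi> (polar c \<tau> (1/2, 0, 0)) \<in> \<phi> ` (rel_interior \<Delta> \<times> {-1<..<1})" by (rule imageI)
  moreover have "\<phi> (polar c \<tau> (1/2, 0, 0)) \<notin> L" using chart_polar_in(1)[OF mc \<tau> zs] by simp
  ultimately show ?thesis by (rule that[OF z, OF DiffI])
qed

text \<open>Every neighbourhood of a point of L contains a meridian chart, and points of the chart
  with positive radius are off L.\<close>

lemma S3_minus_L_dense:
  assumes "openin (top_of_set S3) U" "U \<noteq> {}" shows "U \<inter> (S3 - L) \<noteq> {}"
proof (cases "U \<inter> L = {}")
  case True then show ?thesis using assms openin_imp_subset[OF assms(1)] by blast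
next
  case False
  then obtain y where y: "y \<in> U" "y \<in> L" by blast
  obtain \<Delta> c \<phi> \<tau> where mc: "meridian_chart S3 L \<Delta> c \<phi>" "angular \<Delta> \<tau>" and sub: "\<phi> ` (\<Delta> \<times> {-1..1}) \<subseteq> U"
    using L_chart[OF y(2) assms(1) y(1)] by metis
  obtain z where "z \<in> open_strip" "\<phi> (polar c \<tau> z) \<in> \<phi> ` (rel_interior \<Delta> \<times> {-1<..<1}) - L"
    using chart_point_off_L[OF mc] by metis
  moreover have "rel_interior \<Delta> \<times> {-1<..<1} \<subseteq> \<Delta> \<times> {-1..1::real}" using rel_interior_subset[of \<Delta>] by auto
  ultimately have "\<phi> (polar c \<tau> z) \<in> U" "\<phi> (polar c \<tau> z) \<notin> L" using sub by blast+
  then show ?thesis using openin_imp_subset[OF assms(1)] by blast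
qed

text \<open>Suppose that an open part of M lies over L. A piece on which q is affine and injective
  contains a smaller open set, whose image is open in the sphere by invariance of domain. But L
  contains no nonempty open set.\<close>

lemma M'_dense:
  assumes W: "openin (top_of_set M) W" "W \<noteq> {}" shows "W \<inter> M' \<noteq> {}"
proof
  assume WM: "W \<inter> M' = {}"
  have WL: "q ` W \<subseteq> L" using WM openin_imp_subset[OF W(1)] by (auto simp: M'_def)
  obtain x where x: "x \<in> W" using W(2) by blast
  then have "x \<in> M" using openin_imp_subset[OF W(1)] by blast
  then obtain B D where B: "pl_ball 3 B D" "B \<subseteq> M" "x \<in> B - D"
    using manifold unfolding closed_pl_manifold_def by blast
  then obtain \<Delta> :: "'b set" and h where \<Delta>: "int 3 simplex \<Delta>" and h: "pl_map \<Delta> h" "bij_betw h \<Delta> B" "h ` rel_frontier \<Delta> = D"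
    unfolding pl_ball_def pl_homeomorphism_def by blast
  let ?A = "affine hull \<Delta>"
  obtain V where V: "open V" "W = M \<inter> V" using W(1) by (auto simp: openin_open)
  define P where "P = rel_interior \<Delta> \<inter> h -` V"
  have ri: "rel_interior \<Delta> \<subseteq> \<Delta>" by (rule rel_interior_subset)
  have "openin (top_of_set (rel_interior \<Delta>)) P" unfolding P_def
    using continuous_on_subset[OF pl_map_continuous[OF h(1)] ri] V(1) continuous_openin_preimage_gen by blast
  then have P: "openin (top_of_set ?A) P" using openin_rel_interior openin_trans by blast
  have hM: "h p \<in> M" if "p \<in> \<Delta>" for p using h(2) B(2) that unfolding bij_betw_def by blast
  have PW: "h p \<in> W" if "p \<in> P" for p using that V(2) hM ri unfolding P_def by blast
  have "P \<noteq> {}"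
  proof -
    obtain p where p: "p \<in> \<Delta>" "h p = x" using h(2) B(3) unfolding bij_betw_def by blast
    have "p \<notin> rel_frontier \<Delta>" using p B(3) h(3) by blast
    then have "p \<in> rel_interior \<Delta>" using p closed_simplex[OF \<Delta>] unfolding rel_frontier_def by simp
    then show ?thesis using p x V(2) unfolding P_def by blast
  qed
  have plqh: "pl_map \<Delta> (q \<circ> h)" by (rule pl_map_compose[OF h(1) pl_q]) (use hM in blast)
  have "finite {p \<in> \<Delta>. (q \<circ> h) p = y}" for y
  proof (rule finite_imageD)
    show "finite (h ` {p \<in> \<Delta>. (q \<circ> h) p = y})" by (rule finite_subset[OF _ finite_fibre[of y]]) (use hM in auto)
    show "inj_on h {p \<in> \<Delta>. (q \<circ> h) p = y}" using h(2) unfolding bij_betw_def by (auto intro: inj_on_subset)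
  qed
  then obtain C where C: "finite C" "\<Union>C = \<Delta>" "\<And>c. c \<in> C \<Longrightarrow> polytope c \<and> affine_on c (q \<circ> h) \<and> inj_on (q \<circ> h) c"
    using pl_map_finite_fibres_pieces[OF plqh] by metis
  have "\<And>c. c \<in> C \<Longrightarrow> closed c" using C(3) polytope_imp_closed by blast
  moreover have "P \<subseteq> \<Union>C" using C(2) ri unfolding P_def by blast
  ultimately obtain c P' where P': "c \<in> C" "openin (top_of_set ?A) P'" "P' \<noteq> {}" "P' \<subseteq> c" "P' \<subseteq> P"
    using finite_closed_cover_open[OF C(1) _ P \<open>P \<noteq> {}\<close>] by metis
  obtain p1 where p1: "p1 \<in> P'" using P'(3) by blast
  have P'\<Delta>: "P' \<subseteq> \<Delta>" using P'(5) ri unfolding P_def by blast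
  have "q (h p1) \<in> S3" using q_in hM P'\<Delta> p1 by blast
  then obtain T O' Q k where pc: "pl_chart 3 S3 T O' Q k" "q (h p1) \<in> k ` O'"
    using pl_sphere_chart[OF sphere] by metis
  have ch: "affine T" "aff_dim T = int 3" "openin (top_of_set T) O'" "O' \<subseteq> Q" "Q \<subseteq> T" "pl_map Q k" "inj_on k Q"
    "\<And>U. openin (top_of_set T) U \<Longrightarrow> U \<subseteq> O' \<Longrightarrow> openin (top_of_set S3) (k ` U)"
    using pc(1) unfolding pl_chart_def by auto
  obtain k' where k': "homeomorphism Q (k ` Q) k k'"
    using homeomorphism_compact[OF compact_polyhedron_imp_compact[OF pl_map_imp_polyhedron[OF ch(6)]] pl_map_continuous[OF ch(6)] refl ch(7)] by blast
  have kO: "openin (top_of_set S3) (k ` O')" using ch(8)[OF ch(3)] by simp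
  then obtain V' where V': "open V'" "k ` O' = S3 \<inter> V'" by (auto simp: openin_open)
  \<comment> \<open>Shrinking to points whose images lie in one chart of the sphere makes both sides
    subsets of affine 3-spaces, as invariance of domain requires.\<close>
  define P'' where "P'' = P' \<inter> (q \<circ> h) -` V'"
  have cont: "continuous_on P' (q \<circ> h)" using continuous_on_subset[OF pl_map_continuous[OF plqh] P'\<Delta>] .
  have "openin (top_of_set P') P''" unfolding P''_def using cont V'(1) continuous_openin_preimage_gen by blast
  then have P''o: "openin (top_of_set ?A) P''" using P'(2) openin_trans by blast
  have P''O: "(q \<circ> h) p \<in> k ` O'" if "p \<in> P''" for p
    using that V'(2) q_in hM P'\<Delta> unfolding P''_def by auto
  have P''P: "P'' \<subseteq> P'" unfolding P''_def by blast
  let ?f = "k' \<circ> (q \<circ> h)"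
  have k'k: "k' (k w) = w" if "w \<in> Q" for w using k' that unfolding homeomorphism_def by blast
  have fO: "?f p \<in> O'" "k (?f p) = (q \<circ> h) p" if p: "p \<in> P''" for p
  proof -
    obtain w where w: "w \<in> O'" "(q \<circ> h) p = k w" using P''O[OF p] by blast
    then have "?f p = w" using k'k ch(4) by auto
    then show "?f p \<in> O'" "k (?f p) = (q \<circ> h) p" using w by auto
  qed
  have "openin (top_of_set T) (?f ` P'')"
  proof (rule invariance_of_domain_affine_sets[where U = ?A])
    show "aff_dim T \<le> aff_dim ?A" using ch(2) aff_dim_simplex[OF \<Delta>] by simp
    show "continuous_on P'' ?f"
    proof (rule continuous_on_compose)
      show "continuous_on P'' (q \<circ> h)" using cont P''P continuous_on_subset by blast
      have "(q \<circ> h) ` P'' \<subseteq> k ` Q" using P''O ch(4) by blast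
      then show "continuous_on ((q \<circ> h) ` P'') k'" using k' unfolding homeomorphism_def by (meson continuous_on_subset)
    qed
    show "?f \<in> P'' \<rightarrow> T" using fO(1) ch(4,5) by blast
    show "inj_on ?f P''"
    proof (rule inj_onI)
      fix a b assume ab: "a \<in> P''" "b \<in> P''" "?f a = ?f b"
      then have "(q \<circ> h) a = (q \<circ> h) b" using fO(2) by metis
      then show "a = b" using C(3)[OF P'(1)] ab P''P P'(4) by (meson inj_onD subsetD)
    qed
  qed (use P''o ch(1) in auto)
  then have "openin (top_of_set S3) (k ` ?f ` P'')" by (rule ch(8)) (use fO(1) in blast)
  moreover have "p1 \<in> P''" using p1 pc(2) V'(2) unfolding P''_def by auto
  then have "k ` ?f ` P'' \<noteq> {}" by blast
  ultimately have "k ` ?f ` P'' \<inter> (S3 - L) \<noteq> {}" by (rule S3_minus_L_dense)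
  moreover have "k ` ?f ` P'' \<subseteq> L"
  proof clarify
    fix p assume p: "p \<in> P''"
    then have "h p \<in> W" using PW P''P P'(5) by blast
    then show "k (?f p) \<in> L" using fO(2)[OF p] WL by auto
  qed
  ultimately show False by blast
qed

text \<open>M is compact, so q is a closed map: the complement of the image of the closed set M - U
  is the required neighbourhood.\<close>

lemma small_preimage:
  assumes U: "openin (top_of_set M) U" and y: "y \<in> S3" "{x \<in> M. q x = y} \<subseteq> U"
  obtains \<Omega> where "openin (top_of_set S3) \<Omega>" "y \<in> \<Omega>" "{x \<in> M. q x \<in> \<Omega>} \<subseteq> U"
proof
  let ?\<Omega> = "S3 - q ` (M - U)"
  have "closedin (top_of_set M) (M - U)" using U by (metis closedin_diff closedin_topspace topspace_euclidean_subtopology)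
  then have "compact (M - U)" using compact_M closedin_compact by blast
  then have "closed (q ` (M - U))" using cont_q by (meson Diff_subset compact_continuous_image compact_imp_closed continuous_on_subset)
  then show "openin (top_of_set S3) ?\<Omega>" by (metis Diff_eq openin_open open_Compl)
  show "y \<in> ?\<Omega>" using y by auto
  show "{x \<in> M. q x \<in> ?\<Omega>} \<subseteq> U" by auto
qed

lemma openin_preimage:
  assumes "openin (top_of_set S3) \<Omega>" shows "openin (top_of_set M) {x \<in> M. q x \<in> \<Omega>}"
proof -
  obtain V where V: "open V" "\<Omega> = S3 \<inter> V" using assms by (auto simp: openin_open)
  have "{x \<in> M. q x \<in> \<Omega>} = M \<inter> q -` V" using V q_in by auto
  then show ?thesis using continuous_openin_preimage_gen[OF cont_q V(1)] by simp
qed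

text \<open>Separate one point of the fibre from the others by disjoint open sets. The preimage of a
  small punctured meridian chart lies in their union, meets both since \<open>M'\<close> is dense,
  and yet is connected.\<close>

lemma fibre_L_single:
  assumes y: "q x \<in> L" and x: "x \<in> M" "x' \<in> M" "q x' = q x" shows "x' = x"
proof (rule ccontr)
  assume ne: "x' \<noteq> x"
  define F where "F = {z \<in> M. q z = q x} - {x}"
  have "finite F" using finite_fibre[of "q x"] by (simp add: F_def)
  then have "closed F" by (rule finite_imp_closed)
  moreover have "compact {x}" "{x} \<inter> F = {}" by (auto simp: F_def)
  ultimately obtain U1 U2 where U': "open U1" "open U2" "{x} \<subseteq> U1" "F \<subseteq> U2" "U1 \<inter> U2 = {}"
    using separation_normal_compact[of "{x}" F] by metis
  then have U: "open U1" "open U2" "x \<in> U1" "F \<subseteq> U2" "U1 \<inter> U2 = {}" by simp_all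
  have "{z \<in> M. q z = q x} \<subseteq> M \<inter> (U1 \<union> U2)" using U by (auto simp: F_def)
  moreover have "openin (top_of_set M) (M \<inter> (U1 \<union> U2))" using U by (simp add: openin_open_Int open_Un)
  ultimately obtain \<Omega> where \<Omega>: "openin (top_of_set S3) \<Omega>" "q x \<in> \<Omega>" "{z \<in> M. q z \<in> \<Omega>} \<subseteq> M \<inter> (U1 \<union> U2)"
    using small_preimage[of "M \<inter> (U1 \<union> U2)" "q x"] q_in[OF x(1)] by metis
  obtain \<Delta> c \<phi> \<tau> where mc: "meridian_chart S3 L \<Delta> c \<phi>" "angular \<Delta> \<tau>" and yN: "q x \<in> \<phi> ` (rel_interior \<Delta> \<times> {-1<..<1})"
    and sub: "\<phi> ` (\<Delta> \<times> {-1..1}) \<subseteq> \<Omega>"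
    using L_chart[OF y \<Omega>(1,2)] by metis
  let ?N = "\<phi> ` (rel_interior \<Delta> \<times> {-1<..<1})"
  have N\<Omega>: "?N \<subseteq> \<Omega>"
  proof -
    have "rel_interior \<Delta> \<times> {-1<..<1} \<subseteq> \<Delta> \<times> {-1..1::real}" using rel_interior_subset[of \<Delta>] by auto
    then show ?thesis using sub by blast
  qed
  have zs: "(1/2, 0, 0) \<in> strip" by (auto simp: strip_def)
  obtain a where a: "a \<in> M" "q a = \<phi> (polar c \<tau> (1/2, 0, 0))"
    using chart_polar_in(1)[OF mc zs] q_image by (metis DiffD1 imageE)
  obtain h where h: "chart_lift c \<tau> \<phi> h" using chart_lift_exists[OF mc zs a] by metis
  have conn: "connected {z \<in> M. q z \<in> ?N - L}" by (rule connected_chart_preimage[OF mc h])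
  have meet: "V \<inter> {z \<in> M. q z \<in> ?N - L} \<noteq> {}" if V: "open V" "v \<in> V" "v \<in> M" "q v = q x" for V v
  proof -
    have "openin (top_of_set M) ({z \<in> M. q z \<in> ?N} \<inter> V)"
      using openin_preimage[OF chart_facts(7)[OF mc]] V(1) by (simp add: openin_Int_open)
    then have "{z \<in> M. q z \<in> ?N} \<inter> V \<inter> M' \<noteq> {}" by (rule M'_dense) (use V yN in auto)
    then show ?thesis by (auto simp: M'_def)
  qed
  have "x' \<in> F" using x ne by (auto simp: F_def)
  then have "U1 \<inter> {z \<in> M. q z \<in> ?N - L} \<noteq> {}" "U2 \<inter> {z \<in> M. q z \<in> ?N - L} \<noteq> {}"
    using meet[of U1 x] meet[of U2 x'] U x by auto
  moreover have "{z \<in> M. q z \<in> ?N - L} \<subseteq> U1 \<union> U2" using \<Omega>(3) N\<Omega> by blast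
  moreover have "U1 \<inter> U2 \<inter> {z \<in> M. q z \<in> ?N - L} = {}" using U(5) by blast
  ultimately show False using conn U(1,2) unfolding connected_def by blast
qed

text \<open>Collects all that is needed later about the local structure at L: the punctured
  neighbourhood is connected upstairs and hence also downstairs.\<close>

lemma L_nbhd:
  assumes y: "y \<in> L" and \<Omega>: "openin (top_of_set S3) \<Omega>" "y \<in> \<Omega>"
  obtains N where "openin (top_of_set S3) N" "y \<in> N" "N \<subseteq> \<Omega>" "connected {x \<in> M. q x \<in> N - L}" "connected (N - L)"
proof -
  obtain \<Delta> c \<phi> \<tau> where mc: "meridian_chart S3 L \<Delta> c \<phi>" "angular \<Delta> \<tau>" and yN: "y \<in> \<phi> ` (rel_interior \<Delta> \<times> {-1<..<1})"
    and sub: "\<phi> ` (\<Delta> \<times> {-1..1}) \<subseteq> \<Omega>"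
    using L_chart[OF y \<Omega>(1,2)] by metis
  let ?N = "\<phi> ` (rel_interior \<Delta> \<times> {-1<..<1})"
  have N\<Omega>: "?N \<subseteq> \<Omega>"
  proof -
    have "rel_interior \<Delta> \<times> {-1<..<1} \<subseteq> \<Delta> \<times> {-1..1::real}" using rel_interior_subset[of \<Delta>] by auto
    then show ?thesis using sub by blast
  qed
  have zs: "(1/2, 0, 0) \<in> strip" by (auto simp: strip_def)
  obtain a where a: "a \<in> M" "q a = \<phi> (polar c \<tau> (1/2, 0, 0))"
    using chart_polar_in(1)[OF mc zs] q_image by (metis DiffD1 imageE)
  obtain h where h: "chart_lift c \<tau> \<phi> h" using chart_lift_exists[OF mc zs a] by metis
  have conn: "connected {z \<in> M. q z \<in> ?N - L}" by (rule connected_chart_preimage[OF mc h])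
  moreover have "q ` {z \<in> M. q z \<in> ?N - L} = ?N - L"
  proof (rule image_preimage)
    show "?N - L \<subseteq> S3" using openin_imp_subset[OF chart_facts(7)[OF mc]] by (rule subset_trans[OF Diff_subset])
  qed
  then have "connected (?N - L)" using connected_continuous_image[OF continuous_on_subset[OF cont_q] conn] by auto
  ultimately show ?thesis using that[OF chart_facts(7)[OF mc] yN N\<Omega>] by blast
qed

lemma locally_connected_S3: "locally connected S3" and connected_S3: "connected S3"
proof -
  obtain \<Delta> :: "'a set" and h k where \<Delta>: "(int 3 + 1) simplex \<Delta>" "homeomorphism (rel_frontier \<Delta>) S3 h k"
    using pl_sphere_homeomorphic[OF sphere] by metis
  have b: "bounded \<Delta>" "convex \<Delta>" using compact_simplex[OF \<Delta>(1)] convex_simplex[OF \<Delta>(1)] compact_imp_bounded by auto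
  show "locally connected S3"
  proof -
    have "\<And>S T. homeomorphism S T h k \<Longrightarrow> connected S = connected T"
      by (rule homeomorphic_connectedness) (auto simp: homeomorphic_def)
    from homeomorphism_locally[OF \<Delta>(2), of connected connected, OF this]
    show ?thesis using locally_connected_sphere_gen[OF b] by simp
  qed
  have "connected (rel_frontier \<Delta>)"
    by (rule connected_sphere_gen[OF b(2,1)]) (use aff_dim_simplex[OF \<Delta>(1)] in simp)
  then show "connected S3" using \<Delta>(2) unfolding homeomorphism_def by (metis connected_continuous_image)
qed

lemma connected_Int_S3_L:
  assumes "openin (top_of_set S3) W" "connected W" shows "connected (W - L)"
proof -
  have "connected (W \<inter> (S3 - L))"
  proof (rule connected_Int_dense[OF _ S3_minus_L_dense assms])
    fix x \<Omega> assume \<Omega>: "openin (top_of_set S3) \<Omega>" "x \<in> \<Omega>"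
    show "\<exists>U. openin (top_of_set S3) U \<and> x \<in> U \<and> U \<subseteq> \<Omega> \<and> connected (U \<inter> (S3 - L))"
    proof (cases "x \<in> L")
      case True
      obtain N where N: "openin (top_of_set S3) N" "x \<in> N" "N \<subseteq> \<Omega>" "connected (N - L)" using L_nbhd[OF True \<Omega>] by metis
      have "N \<inter> (S3 - L) = N - L" using openin_imp_subset[OF N(1)] by blast
      then show ?thesis using N by auto
    next
      case False
      have "openin (top_of_set S3) (\<Omega> - L)" using \<Omega>(1) closed_L by (metis Diff_eq open_Compl openin_Int_open)
      then obtain U where U: "openin (top_of_set S3) U" "connected U" "x \<in> U" "U \<subseteq> \<Omega> - L"
        using locally_connected_S3 False \<Omega>(2) unfolding locally_connected by (metis DiffI)
      have "U \<inter> (S3 - L) = U" using U(4) openin_imp_subset[OF U(1)] by blast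
      then show ?thesis using U by auto
    qed
  qed auto
  moreover have "W \<inter> (S3 - L) = W - L" using openin_imp_subset[OF assms(1)] by blast
  ultimately show ?thesis by simp
qed

lemma connected_S3_L: "connected (S3 - L)"
  by (rule connected_Int_S3_L[OF _ connected_S3]) simp

lemma locally_connected_M': "locally connected M'"
proof -
  have "locally connected (S3 - L)" using locally_open_subset[OF locally_connected_S3 open_S3_L] .
  then show ?thesis using covering_space_locally_connected_eq[OF covering] by blast
qed

lemma connected_Int_M':
  assumes "openin (top_of_set M) W" "connected W" shows "connected (W \<inter> M')"
proof (rule connected_Int_dense[OF _ M'_dense assms])
  fix x \<Omega> assume \<Omega>: "openin (top_of_set M) \<Omega>" "x \<in> \<Omega>"
  then have xM: "x \<in> M" using openin_imp_subset[OF \<Omega>(1)] by blast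
  show "\<exists>U. openin (top_of_set M) U \<and> x \<in> U \<and> U \<subseteq> \<Omega> \<and> connected (U \<inter> M')"
  proof (cases "q x \<in> L")
    case True
    have "{z \<in> M. q z = q x} \<subseteq> \<Omega>" using fibre_L_single[OF True xM] \<Omega>(2) by auto
    then obtain \<Omega>' where \<Omega>': "openin (top_of_set S3) \<Omega>'" "q x \<in> \<Omega>'" "{z \<in> M. q z \<in> \<Omega>'} \<subseteq> \<Omega>"
      using small_preimage[OF \<Omega>(1) q_in[OF xM]] by metis
    obtain N where N: "openin (top_of_set S3) N" "q x \<in> N" "N \<subseteq> \<Omega>'" "connected {x \<in> M. q x \<in> N - L}"
      using L_nbhd[OF True \<Omega>'(1,2)] by metis
    have "{z \<in> M. q z \<in> N} \<inter> M' = {x \<in> M. q x \<in> N - L}" by (auto simp: M'_def)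
    then show ?thesis using openin_preimage[OF N(1)] N \<Omega>'(3) xM by (intro exI[of _ "{z \<in> M. q z \<in> N}"]) auto
  next
    case False
    then have "openin (top_of_set M') (\<Omega> \<inter> M')" "x \<in> \<Omega> \<inter> M'"
      using \<Omega> xM openin_subset_trans[of M "\<Omega> \<inter> M'" M'] openin_Int[OF \<Omega>(1) open_M'] M'_sub by (auto simp: M'_def)
    then obtain U where U: "openin (top_of_set M') U" "connected U" "x \<in> U" "U \<subseteq> \<Omega> \<inter> M'"
      using locally_connected_M' unfolding locally_connected by metis
    have "U \<inter> M' = U" using U(4) by blast
    then show ?thesis using U openin_trans[OF U(1) open_M'] by auto
  qed
qed

text \<open>On a nonempty open and closed part of M' the image under q is open and closed in the
  connected complement of L, hence everything. Two complementary parts would then both meet the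
  connected preimage of a punctured chart.\<close>

lemma connected_M': "connected M'"
proof (rule ccontr)
  assume "\<not> connected M'"
  then obtain E1 E2 where E: "openin (top_of_set M') E1" "openin (top_of_set M') E2" "E1 \<union> E2 = M'" "E1 \<inter> E2 = {}" "E1 \<noteq> {}" "E2 \<noteq> {}"
    unfolding connected_openin_eq by blast
  have all: "q ` E = S3 - L" if E: "openin (top_of_set M') E" "closedin (top_of_set M') E" "E \<noteq> {}" for E
  proof -
    have o: "openin (top_of_set (S3 - L)) (q ` E)" using covering_space_open_map[OF covering E(1)] .
    obtain K where K: "closed K" "E = M' \<inter> K" using E(2) by (auto simp: closedin_closed)
    have "compact (q ` (M \<inter> K))" using compact_M K(1) cont_q
      by (meson Int_lower1 compact_Int_closed compact_continuous_image continuous_on_subset)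
    then have "closed (q ` (M \<inter> K))" using compact_imp_closed by blast
    moreover have "q ` E = (S3 - L) \<inter> q ` (M \<inter> K)" using K(2) q_in by (auto simp: M'_def)
    ultimately have "closedin (top_of_set (S3 - L)) (q ` E)" by (auto simp: closedin_closed)
    then show ?thesis using connected_S3_L o E(3) unfolding connected_clopen by blast
  qed
  have cl: "closedin (top_of_set M') E1" "closedin (top_of_set M') E2"
  proof -
    have "E1 = M' - E2" "E2 = M' - E1" using E(3,4) by auto
    then show "closedin (top_of_set M') E1" "closedin (top_of_set M') E2" using E(1,2) by (metis closedin_diff closedin_topspace topspace_euclidean_subtopology)+
  qed
  obtain y where y: "y \<in> L" using L_ne by blast
  obtain N where N: "openin (top_of_set S3) N" "y \<in> N" "connected {x \<in> M. q x \<in> N - L}"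
    using L_nbhd[OF y, of S3] openin_subtopology_self subsetD[OF L_sub y] by metis
  let ?X = "{x \<in> M. q x \<in> N - L}"
  obtain w where w: "w \<in> N" "w \<in> S3 - L" using S3_minus_L_dense[OF N(1)] N(2) by blast
  obtain x1 x2 where x: "x1 \<in> E1" "x2 \<in> E2" "q x1 = w" "q x2 = w"
    using all[OF E(1) cl(1) E(5)] all[OF E(2) cl(2) E(6)] w(2) by (metis imageE)
  have X: "?X \<subseteq> M'" by (auto simp: M'_def)
  have "x1 \<in> ?X" "x2 \<in> ?X" using x w E(3) M'_sub by auto
  moreover have "openin (top_of_set ?X) (?X \<inter> E1)" "openin (top_of_set ?X) (?X \<inter> E2)"
    using E(1,2) X by (auto simp: openin_open)
  moreover have "?X \<subseteq> (?X \<inter> E1) \<union> (?X \<inter> E2)" using X E(3) by blast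
  moreover have "(?X \<inter> E1) \<inter> (?X \<inter> E2) = {}" using E(4) by blast
  ultimately show False using N(3) x(1,2) unfolding connected_openin by blast
qed

lemma connected_M: "connected M"
proof -
  have "M \<subseteq> closure M'"
  proof
    fix x assume x: "x \<in> M"
    show "x \<in> closure M'"
    proof (rule ccontr)
      assume "x \<notin> closure M'"
      then have "M \<inter> (- closure M') \<noteq> {}" using x by blast
      moreover have "openin (top_of_set M) (M \<inter> (- closure M'))" by (simp add: openin_open_Int open_Compl)
      ultimately show False using M'_dense closure_subset by blast
    qed
  qed
  then show ?thesis using connected_M' M'_sub connected_intermediate_closure by blast
qed

end

section \<open>The deck transformation as the exchange of the two points of a fibre\<close>

locale branched_deck = branched_double_cover S3 L M q
  for S3 L :: "'a::euclidean_space set" and M :: "'b::euclidean_space set" and q :: "'b \<Rightarrow> 'a" +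
  fixes T
  assumes deck: "deck_transformation M q T" and T_nontrivial: "T \<noteq> (\<lambda>x\<in>M. x)"
begin

lemma T_Bij: "T \<in> Bij M" and pl_T: "pl_map M T" and q_T [simp]: "x \<in> M \<Longrightarrow> q (T x) = q x"
  using deck unfolding deck_transformation_def by auto

lemma T_in [simp]: "x \<in> M \<Longrightarrow> T x \<in> M" using Bij_imp_funcset[OF T_Bij] by blast

lemma T_M': "x \<in> M' \<Longrightarrow> T x \<in> M'" by (auto simp: M'_def)

lemma cont_T: "continuous_on M T" using pl_map_continuous[OF pl_T] .

text \<open>With one fixed point off L, T is the identity on the connected set M' by uniqueness of
  lifts, and on M by density, against the assumption on T.\<close>

lemma T_ne: assumes "x \<in> M'" shows "T x \<noteq> x"
proof
  assume eq: "T x = x"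
  have id: "T w = id w" if w: "w \<in> M'" for w
  proof (rule covering_space_lift_unique[OF covering, of T x id M' q w])
    show "T x = id x" using eq by simp
    show "continuous_on M' q" "continuous_on M' T" using cont_q cont_T M'_sub continuous_on_subset by blast+
    show "q \<in> M' \<rightarrow> S3 - L" using q_M' by blast
    show "T \<in> M' \<rightarrow> M'" using T_M' by blast
    show "\<And>x. x \<in> M' \<Longrightarrow> q x = q (T x)" using M'_sub by auto
    show "connected M'" by (rule connected_M')
  qed (use assms w in auto)
  have "openin (top_of_set M) {x \<in> M. T x - x \<noteq> 0}"
  proof -
    have "continuous_on M (\<lambda>x. T x - x)" using cont_T by (intro continuous_intros)
    then have "openin (top_of_set M) (M \<inter> (\<lambda>x. T x - x) -` (- {0}))" by (rule continuous_openin_preimage_gen) auto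
    moreover have "M \<inter> (\<lambda>x. T x - x) -` (- {0}) = {x \<in> M. T x - x \<noteq> 0}" by auto
    ultimately show ?thesis by simp
  qed
  then have "{x \<in> M. T x - x \<noteq> 0} = {}" using M'_dense id by fastforce
  then have "T x = (\<lambda>x\<in>M. x) x" for x using Bij_imp_extensional[OF T_Bij] by (auto simp: extensional_def restrict_def)
  then show False using T_nontrivial by blast
qed

lemma T_L: "x \<in> M \<Longrightarrow> q x \<in> L \<Longrightarrow> T x = x" using fibre_L_single[of x "T x"] by simp

lemma fibre_cases: assumes "x \<in> M" "x' \<in> M" "q x' = q x" shows "x' = x \<or> x' = T x"
proof (cases "q x \<in> L")
  case True then show ?thesis using fibre_L_single assms by blast
next
  case False
  then have "x' \<in> M'" "x \<in> M'" using assms by (auto simp: M'_def)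
  then show ?thesis using fibre_two[of x' x "T x"] T_ne[of x] assms by auto
qed

lemma T_T: "x \<in> M \<Longrightarrow> T (T x) = x"
  using fibre_cases[of x "T (T x)"] T_ne[of "T x"] T_L[of x] by (cases "q x \<in> L") (auto simp: M'_def)

end

subsection \<open>Lifting homeomorphisms\<close>

context branched_deck
begin

definition over where "over W = {x \<in> M. q x \<in> W - L}"

text \<open>Only points off L are considered. Equivariance rigidifies the notion: over an evenly
  covered set the sheets could otherwise be mapped independently of each other.\<close>

definition lifts where
  "lifts g W f \<longleftrightarrow> continuous_on (over W) f \<and>
     (\<forall>x\<in>over W. f x \<in> M' \<and> q (f x) = g (q x) \<and> f (T x) = T (f x))"

lemma over_sub: "over W \<subseteq> M'" "over W \<subseteq> M" by (auto simp: over_def M'_def)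

lemma over_mono: "W \<subseteq> W' \<Longrightarrow> over W \<subseteq> over W'" by (auto simp: over_def)

lemma over_Int: "over (W \<inter> W') = over W \<inter> over W'" by (auto simp: over_def)

lemma over_T [simp]: "x \<in> over W \<Longrightarrow> T x \<in> over W" by (auto simp: over_def)

lemma openin_over:
  assumes "openin (top_of_set S3) W" shows "openin (top_of_set M') (over W)"
proof -
  have "openin (top_of_set M) {x \<in> M. q x \<in> W}" by (rule openin_preimage[OF assms])
  then have "openin (top_of_set M) ({x \<in> M. q x \<in> W} \<inter> M')" using open_M' by (rule openin_Int)
  moreover have "{x \<in> M. q x \<in> W} \<inter> M' = over W" by (auto simp: over_def M'_def)
  ultimately show ?thesis using openin_subset_trans[OF _ over_sub(1) M'_sub] by simp
qed

lemma over_nonempty: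
  assumes "openin (top_of_set S3) W" "W \<noteq> {}" obtains x where "x \<in> over W"
proof -
  obtain y where y: "y \<in> W" "y \<in> S3 - L" using S3_minus_L_dense[OF assms] by blast
  then obtain x where "x \<in> M" "q x = y" using q_image by blast
  then show ?thesis using that y by (auto simp: over_def)
qed

lemma lifts_mono: "lifts g W f \<Longrightarrow> W' \<subseteq> W \<Longrightarrow> lifts g W' f"
  unfolding lifts_def using over_mono[of W' W] continuous_on_subset by blast

lemma lifts_T:
  assumes f: "lifts g W f" shows "lifts g W (\<lambda>x. T (f x))"
proof -
  have "continuous_on (over W) (\<lambda>x. T (f x))"
    by (rule continuous_on_compose2[OF cont_T]) (use f M'_sub in \<open>auto simp: lifts_def\<close>)
  then show ?thesis using f T_M' M'_sub unfolding lifts_def by auto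
qed

lemma lifts_unique:
  assumes W: "openin (top_of_set S3) W" "connected W" and f: "lifts g W f" "lifts g W f'"
    and x0: "x0 \<in> over W" "f x0 = f' x0" and x: "x \<in> over W"
  shows "f x = f' x"
proof -
  let ?P = "over W"
  define A where "A = {x \<in> ?P. f x = f' x}"
  define B where "B = {x \<in> ?P. f x = T (f' x)}"
  have cf: "continuous_on ?P f" "continuous_on ?P f'" "continuous_on ?P (\<lambda>x. T (f' x))"
    using f lifts_T[OF f(2)] by (auto simp: lifts_def)
  have cover: "A \<union> B = ?P"
  proof -
    have "f x = f' x \<or> f x = T (f' x)" if "x \<in> ?P" for x
      using fibre_cases[of "f' x" "f x"] f that M'_sub unfolding lifts_def by auto
    then show ?thesis unfolding A_def B_def by blast
  qed
  have disj: "A \<inter> B = {}"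
  proof -
    have "T (f' x) \<noteq> f' x" if "x \<in> ?P" for x using T_ne f(2) that unfolding lifts_def by blast
    then show ?thesis unfolding A_def B_def by auto
  qed
  have "closedin (top_of_set ?P) A" "closedin (top_of_set ?P) B"
  proof -
    have "closedin (top_of_set ?P) (?P \<inter> (\<lambda>x. f x - f' x) -` {0})"
      using cf by (intro continuous_closedin_preimage continuous_intros) auto
    moreover have "?P \<inter> (\<lambda>x. f x - f' x) -` {0} = A" by (auto simp: A_def)
    ultimately show "closedin (top_of_set ?P) A" by simp
    have "closedin (top_of_set ?P) (?P \<inter> (\<lambda>x. f x - T (f' x)) -` {0})"
      using cf by (intro continuous_closedin_preimage continuous_intros) auto
    moreover have "?P \<inter> (\<lambda>x. f x - T (f' x)) -` {0} = B" by (auto simp: B_def)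
    ultimately show "closedin (top_of_set ?P) B" by simp
  qed
  then have "openin (top_of_set ?P) (?P - A)" "openin (top_of_set ?P) (?P - B)"
    by (metis openin_diff openin_topspace topspace_euclidean_subtopology)+
  moreover have "?P - A = B" "?P - B = A" using cover disj by auto
  ultimately have "openin (top_of_set M') A" "openin (top_of_set M') B"
    using openin_trans openin_over[OF W(1)] by metis+
  then have qo: "openin (top_of_set (S3 - L)) (q ` A)" "openin (top_of_set (S3 - L)) (q ` B)"
    using covering_space_open_map[OF covering] by auto
  have sub: "W - L \<subseteq> S3 - L" using openin_imp_subset[OF W(1)] by blast
  have qP: "q ` ?P = W - L" unfolding over_def using sub by (intro image_preimage) auto
  have "q ` A \<union> q ` B = W - L" using qP by (simp flip: cover add: image_Un)
  then have AB: "q ` A \<subseteq> W - L" "q ` B \<subseteq> W - L" "q ` A \<union> q ` B = W - L" by blast+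
  have qd: "q ` A \<inter> q ` B = {}"
  proof (rule ccontr)
    assume "q ` A \<inter> q ` B \<noteq> {}"
    then obtain a b where ab: "a \<in> A" "b \<in> B" "q a = q b" by auto
    have P: "a \<in> ?P" "b \<in> ?P" using ab by (auto simp: A_def B_def)
    then have "b = a \<or> b = T a" using fibre_cases[of a b] ab(3) over_sub by auto
    moreover have "T a \<in> A" using ab(1) P(1) f by (auto simp: A_def lifts_def)
    ultimately show False using ab disj by auto
  qed
  have "connected (W - L)" using connected_Int_S3_L[OF W] .
  moreover have "openin (top_of_set (W - L)) (q ` A)" "openin (top_of_set (W - L)) (q ` B)"
    using openin_subset_trans[OF qo(1) AB(1) sub] openin_subset_trans[OF qo(2) AB(2) sub] by auto
  moreover have "q ` A \<noteq> {}" using x0 by (auto simp: A_def)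
  ultimately have "q ` B = {}" using AB(3) qd unfolding connected_openin_eq by blast
  then show ?thesis using x cover by (auto simp: A_def)
qed

lemma lifts_glue:
  assumes I: "\<And>i. i \<in> I \<Longrightarrow> openin (top_of_set S3) (W i)" "\<And>i. i \<in> I \<Longrightarrow> lifts g (W i) (f i)"
    and agree: "\<And>i j x. i \<in> I \<Longrightarrow> j \<in> I \<Longrightarrow> x \<in> over (W i) \<Longrightarrow> x \<in> over (W j) \<Longrightarrow> f i x = f j x"
  obtains F where "lifts g (\<Union>i\<in>I. W i) F" "\<And>i x. i \<in> I \<Longrightarrow> x \<in> over (W i) \<Longrightarrow> F x = f i x"
proof -
  define F where "F x = f (SOME i. i \<in> I \<and> x \<in> over (W i)) x" for x
  have F: "F x = f i x" if i: "i \<in> I" "x \<in> over (W i)" for i x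
  proof -
    have "(SOME i. i \<in> I \<and> x \<in> over (W i)) \<in> I \<and> x \<in> over (W (SOME i. i \<in> I \<and> x \<in> over (W i)))"
      by (rule someI[of _ i]) (use i in blast)
    then show ?thesis unfolding F_def using agree i by blast
  qed
  have U: "over (\<Union>i\<in>I. W i) = (\<Union>i\<in>I. over (W i))" by (auto simp: over_def)
  have "continuous_on (\<Union>i\<in>I. over (W i)) F"
    unfolding continuous_on_topological
  proof (intro ballI allI impI)
    fix x B assume x: "x \<in> (\<Union>i\<in>I. over (W i))" and B: "open B" "F x \<in> B"
    then obtain i where i: "i \<in> I" "x \<in> over (W i)" by blast
    have "continuous_on (over (W i)) (f i)" using I(2)[OF i(1)] by (simp add: lifts_def)
    then obtain A where A: "open A" "x \<in> A" "\<forall>y\<in>over (W i). y \<in> A \<longrightarrow> f i y \<in> B"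
      using i B F[OF i] unfolding continuous_on_topological by metis
    obtain V where V: "open V" "over (W i) = M' \<inter> V" using openin_over[OF I(1)[OF i(1)]] by (auto simp: openin_open)
    have "F y \<in> B" if y: "y \<in> (\<Union>i\<in>I. over (W i))" "y \<in> A \<inter> V" for y
    proof -
      have "y \<in> M'" using y(1) over_sub by blast
      then have "y \<in> over (W i)" using V y by blast
      then show ?thesis using F[OF i(1)] A(3) y by auto
    qed
    moreover have "x \<in> A \<inter> V" "open (A \<inter> V)" using A V i by auto
    ultimately show "\<exists>A. open A \<and> x \<in> A \<and> (\<forall>y\<in>\<Union>i\<in>I. over (W i). y \<in> A \<longrightarrow> F y \<in> B)" by blast
  qed
  moreover have "F x \<in> M' \<and> q (F x) = g (q x) \<and> F (T x) = T (F x)" if x: "x \<in> (\<Union>i\<in>I. over (W i))" for x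
  proof -
    obtain i where i: "i \<in> I" "x \<in> over (W i)" using x by blast
    then show ?thesis using F[OF i] F[OF i(1) over_T[OF i(2)]] I(2)[OF i(1)] by (simp add: lifts_def)
  qed
  ultimately have "lifts g (\<Union>i\<in>I. W i) F" unfolding lifts_def U by blast
  then show ?thesis using that F by blast
qed

lemma lifts_adjust:
  assumes f: "lifts g W f" "lifts g W' f'" and x: "x \<in> over W" "x \<in> over W'"
  obtains f'' where "lifts g W' f''" "f'' x = f x"
proof -
  have "f x = f' x \<or> f x = T (f' x)"
    using fibre_cases[of "f' x" "f x"] f x M'_sub unfolding lifts_def by auto
  then show ?thesis using that[OF f(2)] that[OF lifts_T[OF f(2)]] by metis
qed

text \<open>After composing one lift with T if necessary, the two agree at a point over the
  intersection, and then over all of it because it is connected.\<close>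

lemma lifts_Un:
  assumes W: "openin (top_of_set S3) W" "openin (top_of_set S3) W'" "connected (W \<inter> W')" "W \<inter> W' \<noteq> {}"
    and f: "lifts g W f" "lifts g W' f'"
  obtains F where "lifts g (W \<union> W') F"
proof -
  have o: "openin (top_of_set S3) (W \<inter> W')" using W by (simp add: openin_Int)
  obtain x where x: "x \<in> over (W \<inter> W')" using over_nonempty[OF o W(4)] by blast
  then have "x \<in> over W" "x \<in> over W'" by (auto simp: over_Int)
  then obtain f'' where f'': "lifts g W' f''" "f'' x = f x" using lifts_adjust[OF f] by blast
  have eq: "f z = f'' z" if "z \<in> over W" "z \<in> over W'" for z
    using lifts_unique[OF o W(3) lifts_mono[OF f(1)] lifts_mono[OF f''(1)] x] f''(2) that by (auto simp: over_Int)
  define WW where "WW b = (if b then W else W')" for b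
  define ff where "ff b = (if b then f else f'')" for b
  obtain F where "lifts g (\<Union>b\<in>UNIV. WW b) F"
    by (rule lifts_glue[of UNIV WW g ff]) (use W f f'' eq in \<open>auto simp: WW_def ff_def split: if_splits\<close>)
  moreover have "(\<Union>b\<in>UNIV. WW b) = W \<union> W'" by (auto simp: WW_def)
  ultimately show ?thesis using that by simp
qed

text \<open>
  A homeomorphism of the sphere preserving the link carries meridian charts to meridian charts,
  so it lifts near each point of the link; away from the link q is a local homeomorphism.
\<close>
context
  fixes g assumes g: "pl_map S3 g" "bij_betw g S3 S3" "g ` L = L"
begin

lemma g_L: "y \<in> S3 \<Longrightarrow> g y \<in> L \<longleftrightarrow> y \<in> L"
  using g(2,3) L_sub unfolding bij_betw_def by (metis image_eqI inj_on_image_mem_iff)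

lemma g_S3: "y \<in> S3 \<Longrightarrow> g y \<in> S3" using g(2) unfolding bij_betw_def by blast

lemma meridian_chart_image:
  assumes mc: "meridian_chart S3 L \<Delta> c \<phi>" shows "meridian_chart S3 L \<Delta> c (g \<circ> \<phi>)"
proof -
  let ?D = "\<Delta> \<times> {-1..1::real}"
  have m: "2 simplex \<Delta>" "c \<in> rel_interior \<Delta>" "pl_map ?D \<phi>" "inj_on \<phi> ?D" "\<phi> ` ?D \<subseteq> S3"
    "{z \<in> ?D. \<phi> z \<in> L} = {c} \<times> {-1..1}" "openin (top_of_set S3) (\<phi> ` (rel_interior \<Delta> \<times> {-1<..<1}))"
    using mc unfolding meridian_chart_def by auto
  show ?thesis unfolding meridian_chart_def
  proof (intro conjI)
    show "pl_map ?D (g \<circ> \<phi>)" by (rule pl_map_compose[OF m(3) g(1) m(5)])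
    show "inj_on (g \<circ> \<phi>) ?D" using m(4,5) g(2) unfolding bij_betw_def by (meson comp_inj_on inj_on_subset)
    show "(g \<circ> \<phi>) ` ?D \<subseteq> S3" using m(5) g_S3 by (auto simp: image_subset_iff)
    have "\<phi> z \<in> S3" if "z \<in> ?D" for z using m(5) that by blast
    then have "{z \<in> ?D. (g \<circ> \<phi>) z \<in> L} = {z \<in> ?D. \<phi> z \<in> L}" using g_L by auto
    then show "{z \<in> ?D. (g \<circ> \<phi>) z \<in> L} = {c} \<times> {-1..1}" using m(6) by simp
    obtain k where "homeomorphism S3 S3 g k"
      using homeomorphism_compact[OF compact_S3 pl_map_continuous[OF g(1)]] g(2) unfolding bij_betw_def by metis
    then have "openin (top_of_set S3) (g ` \<phi> ` (rel_interior \<Delta> \<times> {-1<..<1}))" using homeomorphism_imp_open_map m(7) by blast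
    then show "openin (top_of_set S3) ((g \<circ> \<phi>) ` (rel_interior \<Delta> \<times> {-1<..<1}))" by (simp add: image_comp)
  qed (use m in auto)
qed

text \<open>Let h and h' lift the polar coordinates of the chart and of its image under g. The lift
  of g is h' after the inverse of h. It is well defined because h identifies only points that differ
  by an even number of turns, and h' identifies these too. It commutes with T because T is one turn
  on both sides.\<close>

lemma local_lift_at_L:
  assumes y: "y \<in> L"
  obtains W f where "openin (top_of_set S3) W" "y \<in> W" "lifts g W f"
proof -
  have "y \<in> S3" using y L_sub by blast
  then obtain \<Delta> c \<phi> \<tau> where mc: "meridian_chart S3 L \<Delta> c \<phi>" "angular \<Delta> \<tau>" and yN: "y \<in> \<phi> ` (rel_interior \<Delta> \<times> {-1<..<1})"
    using L_chart[OF y openin_subtopology_self] by metis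
  let ?N = "\<phi> ` (rel_interior \<Delta> \<times> {-1<..<1})"
  note mc' = meridian_chart_image[OF mc(1)] mc(2)
  have zs: "(1/2, 0, 0) \<in> strip" by (auto simp: strip_def)
  obtain a where a: "a \<in> M" "q a = \<phi> (polar c \<tau> (1/2, 0, 0))"
    using chart_polar_in(1)[OF mc zs] q_image by (metis DiffD1 imageE)
  obtain h where h: "chart_lift c \<tau> \<phi> h" using chart_lift_exists[OF mc zs a] by metis
  obtain a' where a': "a' \<in> M" "q a' = (g \<circ> \<phi>) (polar c \<tau> (1/2, 0, 0))"
    using chart_polar_in(1)[OF mc' zs] q_image by (metis DiffD1 imageE)
  obtain h' where h': "chart_lift c \<tau> (g \<circ> \<phi>) h'" using chart_lift_exists[OF mc' zs a'] by metis
  note hf = lift_facts[OF mc h] and hf' = lift_facts[OF mc' h']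
  have ov: "h ` open_strip = over ?N" unfolding over_def by (rule lift_image[OF mc h])
  have os: "z \<in> strip" if "z \<in> open_strip" for z using that open_strip_subset by blast
  have welldef: "h' z = h' w" if zw: "z \<in> strip" "w \<in> strip" "h z = h w" for z w
  proof -
    obtain k where k: "even k" "w = (turn ^^ k) z \<or> z = (turn ^^ k) w" using lift_eq_imp[OF mc h zw] by metis
    then show ?thesis using lift_funpow[OF mc' h' zw(1), of k] lift_funpow[OF mc' h' zw(2), of k] by auto
  qed
  define f where "f x = h' (SOME z. z \<in> open_strip \<and> h z = x)" for x
  have f: "f (h z) = h' z" if z: "z \<in> open_strip" for z
  proof -
    have "(SOME w. w \<in> open_strip \<and> h w = h z) \<in> open_strip \<and> h (SOME w. w \<in> open_strip \<and> h w = h z) = h z"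
      by (rule someI[of _ z]) (use z in blast)
    then show ?thesis unfolding f_def using welldef os z by blast
  qed
  have "continuous_on (over ?N) f"
    \<comment> \<open>Continuity of the quotient map f comes from continuity of h' and openness of
      h.\<close>
    unfolding continuous_on_open_gen[of f "over ?N" UNIV, simplified]
  proof (intro allI impI)
    fix V :: "'b set" assume V: "open V"
    have co: "continuous_on open_strip h'" using continuous_on_subset[OF hf'(1) open_strip_subset] .
    have "open (open_strip \<inter> h' -` V)" using continuous_open_preimage[OF co open_open_strip V] .
    then have "openin (top_of_set M') (h ` (open_strip \<inter> h' -` V))" by (rule lift_open_map[OF mc h]) simp
    moreover have "h ` (open_strip \<inter> h' -` V) = over ?N \<inter> f -` V"
    proof
      show "h ` (open_strip \<inter> h' -` V) \<subseteq> over ?N \<inter> f -` V" using f ov by auto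
      show "over ?N \<inter> f -` V \<subseteq> h ` (open_strip \<inter> h' -` V)" using f unfolding ov[symmetric] by auto
    qed
    ultimately have "openin (top_of_set M') (over ?N \<inter> f -` V)" by simp
    then show "openin (top_of_set (over ?N)) (over ?N \<inter> f -` V)"
      by (rule openin_subset_trans) (use over_sub in auto)
  qed
  moreover have "f x \<in> M' \<and> q (f x) = g (q x) \<and> f (T x) = T (f x)" if x: "x \<in> over ?N" for x
  proof -
    obtain z where z: "z \<in> open_strip" "x = h z" using x unfolding ov[symmetric] by blast
    have zst: "z \<in> strip" using os z by blast
    have turnT: "k (turn z) = T (k z)" if k: "k z \<in> M'" "k (turn z) \<in> M'" "q (k (turn z)) = q (k z)" "k (turn z) \<noteq> k z" for k :: "_ \<Rightarrow> 'b"
      using fibre_cases[of "k z" "k (turn z)"] k M'_sub by auto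
    have e1: "h (turn z) = T (h z)"
      by (rule turnT) (use hf(2-4)[of z] hf(2,3)[of "turn z"] zst polar_facts(5)[OF mc] in auto)
    have e2: "h' (turn z) = T (h' z)"
      by (rule turnT) (use hf'(2-4)[of z] hf'(2,3)[of "turn z"] zst polar_facts(5)[OF mc] in auto)
    have "f (T x) = h' (turn z)" using f[of "turn z"] e1 z by simp
    then show ?thesis using f[OF z(1)] z hf'(2,3)[OF zst] hf(3)[OF zst] e2 by simp
  qed
  ultimately have "lifts g ?N f" unfolding lifts_def by blast
  then show ?thesis using that chart_facts(7)[OF mc] yN by blast
qed

text \<open>The composition of q, g and a local inverse of q is constant on fibres and thus not
  injective. It is kept on one sheet and composed with T on the other.\<close>

lemma local_lift_off_L:
  assumes y: "y \<in> S3 - L"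
  obtains W f where "openin (top_of_set S3) W" "y \<in> W" "lifts g W f"
proof -
  obtain x1 where x1: "x1 \<in> M'" "q x1 = y" using y q_image by (force simp: M'_def)
  have gy: "g y \<in> S3 - L" using y g_L g_S3 by blast
  then obtain x2 where x2: "x2 \<in> M'" "q x2 = g y" using q_image by (force simp: M'_def)
  obtain T1 u1 k1 where 1: "x1 \<in> T1" "openin (top_of_set M') T1" "q x1 \<in> u1" "openin (top_of_set (S3 - L)) u1" "homeomorphism T1 u1 q k1"
    using covering_space_local_homeomorphism[OF covering x1(1)] by metis
  obtain T2 u2 k2 where 2: "x2 \<in> T2" "openin (top_of_set M') T2" "q x2 \<in> u2" "openin (top_of_set (S3 - L)) u2" "homeomorphism T2 u2 q k2"
    using covering_space_local_homeomorphism[OF covering x2(1)] by metis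
  have T1M: "T1 \<subseteq> M'" "T2 \<subseteq> M'" using openin_imp_subset[OF 1(2)] openin_imp_subset[OF 2(2)] by auto
  have u2L: "u2 \<subseteq> S3 - L" using openin_imp_subset[OF 2(4)] .
  have u1S: "openin (top_of_set S3) u1" "openin (top_of_set S3) u2"
    using 1(4) 2(4) open_S3_L openin_trans by blast+
  define W where "W = u1 \<inter> (S3 \<inter> g -` u2)"
  have gpre: "openin (top_of_set S3) (S3 \<inter> g -` u2)"
  proof -
    obtain V where V: "open V" "u2 = S3 \<inter> V" using u1S(2) by (auto simp: openin_open)
    have "S3 \<inter> g -` u2 = S3 \<inter> g -` V" using V g_S3 by auto
    then show ?thesis using continuous_openin_preimage_gen[OF pl_map_continuous[OF g(1)] V(1)] by simp
  qed
  have W: "openin (top_of_set S3) W" unfolding W_def using u1S(1) gpre by (rule openin_Int)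
  have yW: "y \<in> W" using 1(3) 2(3) x1 x2 y by (simp add: W_def)
  define s where "s x = k2 (g (q x))" for x
  define f where "f x = (if x \<in> T1 then s x else T (s x))" for x
  have s: "s x \<in> M'" "q (s x) = g (q x)" if "x \<in> over W" for x
  proof -
    have "g (q x) \<in> u2" using that by (auto simp: over_def W_def)
    then show "s x \<in> M'" "q (s x) = g (q x)" using 2(5) T1M unfolding s_def homeomorphism_def by auto
  qed
  \<comment> \<open>The sheet \<open>T1\<close> contains exactly one point of each fibre over
    W.\<close>
  have one: "x \<in> T1 \<longleftrightarrow> T x \<notin> T1" if x: "x \<in> over W" for x
  proof -
    have "q x \<in> u1" using x by (auto simp: over_def W_def)
    then obtain x' where x': "x' \<in> T1" "q x' = q x" using 1(5) unfolding homeomorphism_def by (metis imageE)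
    have xM: "x \<in> M'" "x \<in> M" using x over_sub by auto
    then have "x' = x \<or> x' = T x" using fibre_cases[of x x'] x' T1M M'_sub by auto
    moreover have "\<not> (x \<in> T1 \<and> T x \<in> T1)"
    proof
      assume "x \<in> T1 \<and> T x \<in> T1"
      then have "x = T x" using 1(5) q_T[OF xM(2)] unfolding homeomorphism_def by metis
      then show False using T_ne[OF xM(1)] by simp
    qed
    ultimately show ?thesis using x' by blast
  qed
  have cs: "continuous_on (over W) s" unfolding s_def
  proof (rule continuous_on_compose2[of u2 k2])
    show "continuous_on u2 k2" using 2(5) by (simp add: homeomorphism_def)
    show "continuous_on (over W) (\<lambda>x. g (q x))"
      by (rule continuous_on_compose2[OF pl_map_continuous[OF g(1)] continuous_on_subset[OF cont_q over_sub(2)]])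
        (use q_in over_sub in blast)
    show "(\<lambda>x. g (q x)) ` over W \<subseteq> u2" by (auto simp: over_def W_def)
  qed
  have cTs: "continuous_on (over W) (\<lambda>x. T (s x))"
    by (rule continuous_on_compose2[OF cont_T cs]) (use s M'_sub in blast)
  have cT: "continuous_on (over W) T" using cont_T over_sub continuous_on_subset by blast
  obtain V1 where V1: "open V1" "T1 = M' \<inter> V1" using 1(2) by (auto simp: openin_open)
  have o1: "openin (top_of_set (over W)) (over W \<inter> T1)" using V1 over_sub by (auto simp: openin_open)
  \<comment> \<open>The other sheet is the preimage of the first under T and therefore open as well,
    so the definition by cases is continuous.\<close>
  have o2: "openin (top_of_set (over W)) (over W \<inter> T -` V1)" using continuous_openin_preimage_gen[OF cT V1(1)] .
  have in2: "x \<in> over W \<inter> T -` V1 \<longleftrightarrow> x \<in> over W \<and> x \<notin> T1" for x using one V1 over_sub T_M' by blast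
  have "continuous_on ((over W \<inter> T1) \<union> (over W \<inter> T -` V1)) (\<lambda>x. if x \<in> T1 then s x else T (s x))"
  proof (rule continuous_on_cases_local_open)
    have "(over W \<inter> T1) \<union> (over W \<inter> T -` V1) = over W" using in2 by auto
    then show "openin (top_of_set ((over W \<inter> T1) \<union> (over W \<inter> T -` V1))) (over W \<inter> T1)"
      "openin (top_of_set ((over W \<inter> T1) \<union> (over W \<inter> T -` V1))) (over W \<inter> T -` V1)" using o1 o2 by auto
    show "continuous_on (over W \<inter> T1) s" using cs continuous_on_subset by blast
    show "continuous_on (over W \<inter> T -` V1) (\<lambda>x. T (s x))" using cTs continuous_on_subset by blast
    show "\<And>x. x \<in> over W \<inter> T1 \<and> x \<notin> T1 \<or> x \<in> over W \<inter> T -` V1 \<and> x \<in> T1 \<Longrightarrow> s x = T (s x)" using in2 by blast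
  qed
  moreover have "(over W \<inter> T1) \<union> (over W \<inter> T -` V1) = over W" using in2 by auto
  ultimately have "continuous_on (over W) f" unfolding f_def by simp
  moreover have "f x \<in> M' \<and> q (f x) = g (q x) \<and> f (T x) = T (f x)" if x: "x \<in> over W" for x
  proof -
    have xM: "x \<in> M" using x over_sub by blast
    have "s (T x) = s x" using xM by (simp add: s_def)
    then show ?thesis using one[OF x] s[OF x] T_M'[OF s(1)[OF x]] T_T[of "s x"] M'_sub by (auto simp: f_def)
  qed
  ultimately have "lifts g W f" unfolding lifts_def by blast
  then show ?thesis using that W yW by blast
qed

lemma local_lift:
  assumes "y \<in> S3" obtains W f where "openin (top_of_set S3) W" "y \<in> W" "lifts g W f"
  using assms local_lift_at_L local_lift_off_L by (metis DiffI)

text \<open>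
  Over a cell, local lifts are continued along the segments issuing from the origin; two
  continuations agree since intersections of convex sets are connected.
\<close>
lemma lift_over_cell:
  fixes e :: "'c::euclidean_space \<Rightarrow> 'a"
  assumes D: "openin (top_of_set S3) D" and e: "homeomorphism UNIV D e e'"
  obtains f where "lifts g D f"
proof -
  have eo: "openin (top_of_set S3) (e ` C)" if "open C" for C
  proof -
    have "openin (top_of_set D) (e ` C)" using homeomorphism_imp_open_map[OF e, of C] that by simp
    then show ?thesis using D openin_trans by blast
  qed
  have ec: "connected (e ` C)" if "convex C" for C
    using convex_connected[OF that] e unfolding homeomorphism_def
    by (meson connected_continuous_image continuous_on_subset subset_UNIV)
  have ei: "e ` (C \<inter> C') = e ` C \<inter> e ` C'" for C C' using e unfolding homeomorphism_def by (metis UNIV_I image_Int inj_on_inverseI)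
  have loc: "\<exists>C f. open C \<and> convex C \<and> v \<in> C \<and> lifts g (e ` C) f" for v
  proof -
    have "e v \<in> S3" using e openin_imp_subset[OF D] unfolding homeomorphism_def by blast
    then obtain W f where W: "openin (top_of_set S3) W" "e v \<in> W" "lifts g W f" using local_lift by metis
    obtain V where V: "open V" "W = S3 \<inter> V" using W(1) by (auto simp: openin_open)
    have "open (e -` V)" using e V(1) unfolding homeomorphism_def by (simp add: continuous_on_open_vimage)
    then obtain r where r: "r > 0" "ball v r \<subseteq> e -` V" using W(2) V(2) open_contains_ball by blast
    have "e ` ball v r \<subseteq> W" using r(2) V(2) openin_imp_subset[OF D] e unfolding homeomorphism_def by blast
    then have "lifts g (e ` ball v r) f" using lifts_mono[OF W(3)] by blast
    then show ?thesis using r(1) by (intro exI[of _ "ball v r"]) auto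
  qed
  have glue: "\<exists>f. lifts g (e ` (C1 \<union> C2)) f"
    if C: "open C1" "convex C1" "lifts g (e ` C1) f1" "open C2" "convex C2" "lifts g (e ` C2) f2" "C1 \<inter> C2 \<noteq> {}" for C1 C2 f1 f2
  proof -
    have "connected (e ` C1 \<inter> e ` C2)" unfolding ei[symmetric] using C by (intro ec convex_Int)
    moreover have "e ` C1 \<inter> e ` C2 \<noteq> {}" unfolding ei[symmetric] using C(7) by simp
    ultimately obtain F where "lifts g (e ` C1 \<union> e ` C2) F"
      using lifts_Un[OF eo[OF C(1)] eo[OF C(4)] _ _ C(3,6)] by metis
    then show ?thesis by (auto simp: image_Un)
  qed
  have seg: "\<exists>C f. open C \<and> convex C \<and> (\<lambda>s. s *\<^sub>R v) ` {0..1} \<subseteq> C \<and> lifts g (e ` C) f" for v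
  proof -
    \<comment> \<open>A bisection argument: the property holds for short intervals and passes to the
      union of adjacent ones.\<close>
    define P where "P a b \<longleftrightarrow> (\<exists>C f. open C \<and> convex C \<and> (\<lambda>s. s *\<^sub>R v) ` {a..b} \<subseteq> C \<and> lifts g (e ` C) f)" for a b :: real
    have "P 0 1"
    proof (rule Bolzano)
      show "(0::real) \<le> 1" by simp
      fix a b c assume ab: "P a b" "P b c" "a \<le> b" "b \<le> c"
      obtain C1 f1 where C1: "open C1" "convex C1" "(\<lambda>s. s *\<^sub>R v) ` {a..b} \<subseteq> C1" "lifts g (e ` C1) f1" using ab(1) unfolding P_def by blast
      obtain C2 f2 where C2: "open C2" "convex C2" "(\<lambda>s. s *\<^sub>R v) ` {b..c} \<subseteq> C2" "lifts g (e ` C2) f2" using ab(2) unfolding P_def by blast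
      have "b *\<^sub>R v \<in> C1 \<inter> C2" using subsetD[OF C1(3), OF imageI, of b] subsetD[OF C2(3), OF imageI, of b] ab(3,4) by simp
      then obtain F where F: "lifts g (e ` (C1 \<union> C2)) F" using glue[OF C1(1,2,4) C2(1,2,4)] by blast
      let ?S = "(\<lambda>s. s *\<^sub>R v) ` {a..c}"
      have "{a..c} = {a..b} \<union> {b..c}" using ab(3,4) by auto
      then have sub: "?S \<subseteq> C1 \<union> C2" using C1(3) C2(3) by auto
      have comp: "compact ?S" by (intro compact_continuous_image continuous_intros) auto
      \<comment> \<open>The union of the two convex sets is not convex. A uniform neighbourhood of
        the segment inside it is, being the Minkowski sum of a segment and a ball.\<close>
      obtain r where r: "r > 0" "(\<Union>x\<in>?S. ball x r) \<subseteq> C1 \<union> C2"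
        using compact_subset_open_imp_ball_epsilon_subset[OF comp open_Un[OF C1(1) C2(1)] sub] by metis
      have "convex (\<Union>x\<in>?S. ball x r)"
      proof -
        have "(\<Union>x\<in>?S. ball x r) = (\<Union>x\<in>?S. \<Union>y\<in>ball 0 r. {x + y})"
        proof -
          have "ball x r = (\<Union>y\<in>ball 0 r. {x + y})" for x :: 'c
          proof
            show "ball x r \<subseteq> (\<Union>y\<in>ball 0 r. {x + y})"
            proof
              fix z assume "z \<in> ball x r"
              then have "z - x \<in> ball 0 r" by (simp add: dist_norm norm_minus_commute)
              then show "z \<in> (\<Union>y\<in>ball 0 r. {x + y})" by (intro UN_I[of "z - x"]) auto
            qed
            show "(\<Union>y\<in>ball 0 r. {x + y}) \<subseteq> ball x r" by (auto simp: dist_norm)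
          qed
          then show ?thesis by (intro SUP_cong refl)
        qed
        moreover have "convex ?S"
          by (rule convex_linear_image) (auto intro: linearI simp: algebra_simps)
        ultimately show ?thesis using convex_sums[of ?S "ball 0 r"] by simp
      qed
      moreover have "open (\<Union>x\<in>?S. ball x r)" by auto
      moreover have "?S \<subseteq> (\<Union>x\<in>?S. ball x r)" using r(1) by auto
      moreover have "lifts g (e ` (\<Union>x\<in>?S. ball x r)) F" using lifts_mono[OF F image_mono[OF r(2)]] .
      ultimately show "P a c" unfolding P_def by blast
    next
      fix x :: real
      obtain C f where C: "open C" "convex C" "x *\<^sub>R v \<in> C" "lifts g (e ` C) f" using loc by blast
      have "open ((\<lambda>s. s *\<^sub>R v) -` C)" using C(1) by (intro continuous_open_vimage continuous_intros) 
      then obtain d where d: "d > 0" "ball x d \<subseteq> (\<lambda>s. s *\<^sub>R v) -` C" using C(3) open_contains_ball by blast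
      have "P a b" if "a \<le> x" "x \<le> b" "b - a < d" for a b
      proof -
        have "{a..b} \<subseteq> ball x d" using that by (auto simp: dist_real_def)
        then have "(\<lambda>s. s *\<^sub>R v) ` {a..b} \<subseteq> C" using d(2) by blast
        then show ?thesis using C unfolding P_def by blast
      qed
      then show "\<exists>d>0. \<forall>a b. a \<le> x \<and> x \<le> b \<and> b - a < d \<longrightarrow> P a b" using d(1) by blast
    qed
    then show ?thesis unfolding P_def .
  qed
  obtain C0 f0 where C0: "open C0" "convex C0" "0 \<in> C0" "lifts g (e ` C0) f0" using loc by blast
  \<comment> \<open>All continuations are normalised to start with the same lift \<open>f0\<close>
    near the origin.\<close>
  have pt: "\<exists>C f. open C \<and> convex C \<and> 0 \<in> C \<and> v \<in> C \<and> lifts g (e ` C) f \<and> (\<forall>x\<in>over (e ` (C \<inter> C0)). f x = f0 x)" for v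
  proof -
    obtain C f where C: "open C" "convex C" "(\<lambda>s. s *\<^sub>R v) ` {0..1} \<subseteq> C" "lifts g (e ` C) f" using seg by blast
    have "0 *\<^sub>R v \<in> C" "1 *\<^sub>R v \<in> C" using C(3) by (meson atLeastAtMost_iff image_subset_iff order_refl zero_le_one)+
    then have in_C: "0 \<in> C" "v \<in> C" by auto
    have o: "open (C \<inter> C0)" "convex (C \<inter> C0)" using C C0 by (auto intro: convex_Int)
    have "e ` (C \<inter> C0) \<noteq> {}" using in_C C0(3) by blast
    then obtain x where x: "x \<in> over (e ` (C \<inter> C0))" using over_nonempty[OF eo[OF o(1)]] by metis
    then have "x \<in> over (e ` C0)" "x \<in> over (e ` C)" using over_mono[of "e ` (C \<inter> C0)"] by (auto simp: image_mono)
    then obtain f' where f': "lifts g (e ` C) f'" "f' x = f0 x" using lifts_adjust[OF C0(4) C(4)] by metis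
    have "f' z = f0 z" if "z \<in> over (e ` (C \<inter> C0))" for z
      by (rule lifts_unique[OF eo[OF o(1)] ec[OF o(2)] lifts_mono[OF f'(1)] lifts_mono[OF C0(4)] x f'(2) that]) auto
    then show ?thesis using C(1,2) in_C f'(1) by blast
  qed
  then obtain C f where C: "\<And>v. open (C v)" "\<And>v. convex (C v)" "\<And>v. 0 \<in> C v" "\<And>v. v \<in> C v"
    "\<And>v. lifts g (e ` C v) (f v)" "\<And>v x. x \<in> over (e ` (C v \<inter> C0)) \<Longrightarrow> f v x = f0 x" by metis
  \<comment> \<open>The intersection of the two convex sets contains the origin, where both lifts
    restrict to \<open>f0\<close>; being connected, it carries the agreement along.\<close>
  have agree: "f v x = f w x" if x: "x \<in> over (e ` C v)" "x \<in> over (e ` C w)" for v w x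
  proof -
    have o: "open (C v \<inter> C w)" "convex (C v \<inter> C w)" using C by (auto intro: convex_Int)
    have "0 \<in> C v \<inter> C w \<inter> C0" using C(3) C0(3) by blast
    then have "e ` (C v \<inter> C w \<inter> C0) \<noteq> {}" by blast
    moreover have "open (C v \<inter> C w \<inter> C0)" using C(1) C0(1) by (intro open_Int)
    ultimately obtain z where z: "z \<in> over (e ` (C v \<inter> C w \<inter> C0))" using over_nonempty[OF eo] by metis
    have zz: "z \<in> over (e ` (C v \<inter> C0))" "z \<in> over (e ` (C w \<inter> C0))" "z \<in> over (e ` (C v \<inter> C w))"
      by (rule subsetD[OF over_mono[OF image_mono] z]; blast)+
    have "f v z = f w z" using C(6)[OF zz(1)] C(6)[OF zz(2)] by simp
    moreover have "x \<in> over (e ` (C v \<inter> C w))" using x by (simp add: ei over_Int)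
    ultimately show ?thesis
      using lifts_unique[OF eo[OF o(1)] ec[OF o(2)] lifts_mono[OF C(5)[of v] image_mono[OF Int_lower1]]
        lifts_mono[OF C(5)[of w] image_mono[OF Int_lower2]] zz(3)] by metis
  qed
  have "openin (top_of_set S3) (e ` C v)" for v by (rule eo[OF C(1)])
  moreover have "f v x = f w x" if "v \<in> UNIV" "w \<in> UNIV" "x \<in> over (e ` C v)" "x \<in> over (e ` C w)" for v w x
    by (rule agree[OF that(3,4)])
  ultimately obtain F where F: "lifts g (\<Union>v\<in>UNIV. e ` C v) F"
    using lifts_glue[of UNIV "\<lambda>v. e ` C v" g f] C(5) by metis
  have "D \<subseteq> (\<Union>v\<in>UNIV. e ` C v)" using e C(4) unfolding homeomorphism_def by blast
  then show ?thesis using that lifts_mono[OF F] by blast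
qed

text \<open>The sphere is covered by the complements of two points. Both are cells, and they meet in
  a punctured cell, which is connected in dimension 3.\<close>

lemma lift_off_L:
  obtains f where "lifts g S3 f"
proof -
  obtain \<Delta> :: "'a set" and h k where \<Delta>: "(int 3 + 1) simplex \<Delta>" "homeomorphism (rel_frontier \<Delta>) S3 h k"
    using pl_sphere_homeomorphic[OF sphere] by metis
  have b: "bounded \<Delta>" "convex \<Delta>" using compact_simplex[OF \<Delta>(1)] convex_simplex[OF \<Delta>(1)] compact_imp_bounded by auto
  have cell: "\<exists>e e'. homeomorphism (UNIV :: (real^3) set) (S3 - {p}) e e'" if p: "p \<in> S3" for p
  proof -
    have kp: "k p \<in> rel_frontier \<Delta>" "h (k p) = p" using \<Delta>(2) p unfolding homeomorphism_def by auto
    have "rel_frontier \<Delta> - {k p} homeomorphic (UNIV :: (real^3) set)"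
      by (rule homeomorphic_punctured_sphere_affine_gen[OF b(2,1) kp(1)])
        (use aff_dim_simplex[OF \<Delta>(1)] in auto)
    moreover have "homeomorphism (rel_frontier \<Delta> - {k p}) (S3 - {p}) h k"
    proof -
      have "h ` (rel_frontier \<Delta> - {k p}) = S3 - {p}" using \<Delta>(2) kp unfolding homeomorphism_def by force
      then show ?thesis using homeomorphism_of_subsets[OF \<Delta>(2), of "rel_frontier \<Delta> - {k p}" "S3 - {p}"] by auto
    qed
    then have "rel_frontier \<Delta> - {k p} homeomorphic S3 - {p}" unfolding homeomorphic_def by blast
    ultimately have "(UNIV :: (real^3) set) homeomorphic S3 - {p}" using homeomorphic_sym homeomorphic_trans by blast
    then show ?thesis unfolding homeomorphic_def .
  qed
  have op: "openin (top_of_set S3) (S3 - {p})" for p by (metis Diff_eq finite.emptyI finite.insertI finite_imp_closed open_Compl openin_open_Int)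
  obtain p1 where p1: "p1 \<in> S3" using L_ne L_sub by blast
  obtain e1 e1' where e1: "homeomorphism (UNIV :: (real^3) set) (S3 - {p1}) e1 e1'" using cell[OF p1] by blast
  obtain p2 where p2: "p2 \<in> S3" "p2 \<noteq> p1" using e1 unfolding homeomorphism_def by (metis DiffE UNIV_I image_eqI singletonI)
  obtain e2 e2' where e2: "homeomorphism (UNIV :: (real^3) set) (S3 - {p2}) e2 e2'" using cell[OF p2(1)] by blast
  obtain f1 where f1: "lifts g (S3 - {p1}) f1" using lift_over_cell[OF op e1] by metis
  obtain f2 where f2: "lifts g (S3 - {p2}) f2" using lift_over_cell[OF op e2] by metis
  have int: "(S3 - {p1}) \<inter> (S3 - {p2}) = e1 ` (- {e1' p2})"
  proof -
    have e: "e1 (e1' p2) = p2" "range e1 = S3 - {p1}" "\<And>x. e1' (e1 x) = x"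
      using e1 p2 unfolding homeomorphism_def by auto
    have "e1 x = p2 \<longleftrightarrow> x = e1' p2" for x using e(1) e(3)[of x] by auto
    then have "e1 ` (- {e1' p2}) = range e1 - {p2}" by blast
    then show ?thesis using e(2) by blast
  qed
  have "connected ((S3 - {p1}) \<inter> (S3 - {p2}))" unfolding int
  proof (rule connected_continuous_image)
    show "continuous_on (- {e1' p2}) e1" using e1 unfolding homeomorphism_def by (meson continuous_on_subset subset_UNIV)
    show "connected (- {e1' p2})" by (rule connected_punctured_universe) simp
  qed
  moreover have "(S3 - {p1}) \<inter> (S3 - {p2}) \<noteq> {}"
  proof -
    have "e1' p2 + 1 \<in> - {e1' p2}" by simp
    then show ?thesis unfolding int by blast
  qed
  ultimately obtain F where "lifts g ((S3 - {p1}) \<union> (S3 - {p2})) F" using lifts_Un[OF op op _ _ f1 f2] by metis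
  moreover have "(S3 - {p1}) \<union> (S3 - {p2}) = S3" using p2 by auto
  ultimately show ?thesis using that by simp
qed

end

end

subsection \<open>Local homology of three-dimensional manifolds\<close>

definition gen :: "('a, 'b) monoid_scheme \<Rightarrow> 'a \<Rightarrow> bool" where
  "gen G a \<longleftrightarrow> a \<in> carrier G \<and> generate G {a} = carrier G"

text \<open>An isomorphism carries the subgroup generated by an element onto the one generated by
  its image, so generators can be tested on either side.\<close>

lemma gen_iso:
  assumes "group G" "group H" "f \<in> iso G H" "a \<in> carrier G"
  shows "gen H (f a) \<longleftrightarrow> gen G a"
proof -
  interpret group_hom G H f using assms(1-3) by (simp add: group_hom_def group_hom_axioms_def iso_def)
  have b: "bij_betw f (carrier G) (carrier H)" using assms(3) by (simp add: iso_def)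
  have g: "generate H {f a} = f ` generate G {a}" using generate_img[of "{a}"] assms(4) by simp
  have sub: "generate G {a} \<subseteq> carrier G" using G.generate_incl[of "{a}"] assms(4) by simp
  have "f ` generate G {a} = f ` carrier G \<longleftrightarrow> generate G {a} = carrier G"
    by (rule inj_on_image_eq_iff[OF _ sub order_refl]) (use b in \<open>simp add: bij_betw_def\<close>)
  then show ?thesis using b g assms(4) unfolding gen_def bij_betw_def by auto
qed

lemma gen_integer_group: "gen integer_group n \<longleftrightarrow> n = 1 \<or> n = -1"
proof -
  interpret Z: group integer_group by (rule group_integer_group)
  have gp: "generate integer_group {n} = {k * n |k. k \<in> UNIV}"
    using Z.generate_pow[of n] by (simp add: carrier_integer_group group_int_pow_integer_group)
  show ?thesis
  proof
    assume "gen integer_group n"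
    then have "generate integer_group {n} = UNIV" by (simp add: gen_def carrier_integer_group)
    then have "1 \<in> {k * n |k. k \<in> UNIV}" using gp by simp
    then obtain k where "k * n = 1" by auto
    then show "n = 1 \<or> n = -1" using zmult_eq_1_iff by auto
  next
    assume "n = 1 \<or> n = -1"
    then have "m = (m * n) * n" for m by auto
    then have "{k * n |k. k \<in> UNIV} = UNIV" by blast
    then show "gen integer_group n" using gp by (simp add: gen_def carrier_integer_group)
  qed
qed

lemma infinite_cyclic_gen:
  assumes G: "group G" and iso: "G \<cong> integer_group"
  shows "\<exists>a. gen G a" and "gen G a \<Longrightarrow> gen G b \<Longrightarrow> b = a \<or> b = inv\<^bsub>G\<^esub> a" and "gen G a \<Longrightarrow> gen G (inv\<^bsub>G\<^esub> a)"
    and "gen G a \<Longrightarrow> a \<noteq> inv\<^bsub>G\<^esub> a"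
proof -
  obtain f where f: "f \<in> iso G integer_group" using iso unfolding is_iso_def by blast
  interpret group_hom G integer_group f
    using G f group_integer_group by (simp add: group_hom_def group_hom_axioms_def iso_def)
  have b: "bij_betw f (carrier G) UNIV" using f by (simp add: iso_def carrier_integer_group)
  have gf: "gen G a \<longleftrightarrow> a \<in> carrier G \<and> (f a = 1 \<or> f a = -1)" for a
    using gen_iso[OF G group_integer_group f, of a] gen_integer_group by (auto simp: gen_def)
  have inv: "f (inv\<^bsub>G\<^esub> a) = - f a" if "a \<in> carrier G" for a using hom_inv[OF that] by (simp add: inv_integer_group)
  obtain a0 where "a0 \<in> carrier G" "f a0 = 1" using b unfolding bij_betw_def by (metis UNIV_I imageE)
  then show "\<exists>a. gen G a" using gf by blast
  show "b = a \<or> b = inv\<^bsub>G\<^esub> a" if "gen G a" "gen G b"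
  proof -
    have c: "a \<in> carrier G" "b \<in> carrier G" "inv\<^bsub>G\<^esub> a \<in> carrier G" using that gf by auto
    have "f b = f a \<or> f b = f (inv\<^bsub>G\<^esub> a)" using that gf inv[OF c(1)] by auto
    then show ?thesis using b c unfolding bij_betw_def by (meson inj_onD)
  qed
  show "gen G (inv\<^bsub>G\<^esub> a)" if "gen G a" using that gf inv by auto
  show "a \<noteq> inv\<^bsub>G\<^esub> a" if "gen G a" using that gf inv[of a] by (metis neg_equal_zero one_neq_zero zero_neq_neg_one)
qed

text \<open>In the exact sequence of the triple the homology of the pair (S, T) vanishes on both
  sides of the map.\<close>

lemma iso_hom_induced_relativization:
  assumes "T \<subseteq> S" "\<And>p. trivial_group (relative_homology_group p (subtopology X S) T)"
  shows "hom_induced p X T X S id \<in> iso (relative_homology_group p X T) (relative_homology_group p X S)"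
proof (rule very_short_exact_sequence)
  show "exact_seq
         ([relative_homology_group(p - 1) (subtopology X S) T, relative_homology_group p X S, relative_homology_group p X T, relative_homology_group p (subtopology X S) T],
          [hom_relboundary p X S T, hom_induced p X T X S id, hom_induced p (subtopology X S) T X T id])"
    using homology_exactness_triple_1 [OF assms(1)] homology_exactness_triple_3 [OF assms(1)] by fastforce
qed (rule assms(2))+

section \<open>Local homology of Euclidean space at points and at balls\<close>

abbreviation R3 :: "(real^3) topology" where "R3 \<equiv> euclidean"

text \<open>The complement of p deforms onto the complement of the ball by pushing points radially
  outwards, so the homology of this pair is trivial.\<close>

lemma iso_complement_ball_center:
  fixes p :: "real^3"
  assumes r: "r > 0"
  shows "hom_induced n R3 (- ball p r) R3 (- {p}) id \<in> iso (relative_homology_group n R3 (- ball p r)) (relative_homology_group n R3 (- {p}))"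
proof (rule iso_hom_induced_relativization)
  \<comment> \<open>The map pushes points of the ball to its boundary sphere and fixes all
    others.\<close>
  let ?f = "\<lambda>z. p + max 1 (r / norm (z - p)) *\<^sub>R (z - p)"
  show "- ball p r \<subseteq> - {p}" using r by auto
  have cont: "continuous_on (- {p}) ?f" by (intro continuous_intros) auto
  have im: "?f z \<in> - ball p r" if "z \<in> - {p}" for z
  proof -
    have pos: "norm (z - p) > 0" using that by auto
    have "dist p (?f z) = max 1 (r / norm (z - p)) * norm (z - p)" by (simp add: dist_norm)
    moreover have "max 1 (r / norm (z - p)) * norm (z - p) \<ge> (r / norm (z - p)) * norm (z - p)"
      by (rule mult_right_mono) auto
    ultimately show ?thesis using pos by simp
  qed
  have id: "?f z = z" if "z \<in> - ball p r" for z
  proof -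
    have "norm (z - p) \<ge> r" using that by (simp add: dist_norm norm_minus_commute)
    then have "r / norm (z - p) \<le> 1" using r by (simp add: divide_le_eq_1)
    then show ?thesis by (simp add: max_def)
  qed
  have sub: "subtopology (top_of_set (- {p})) (- ball p r) = top_of_set (- ball p r)"
  proof -
    have "- ball p r \<subseteq> - {p}" using r by auto
    then show ?thesis by (metis subtopology_subtopology inf.absorb2)
  qed
  show "trivial_group (relative_homology_group n (subtopology R3 (- {p})) (- ball p r))" for n
  proof (rule trivial_relative_homology_group_gen[where f = ?f])
    show "continuous_map (top_of_set (- {p})) (subtopology (top_of_set (- {p})) (- ball p r)) ?f"
      unfolding sub using cont im by (auto simp: continuous_map_in_subtopology)
    show "homotopic_with (\<lambda>h. True) (subtopology (top_of_set (- {p})) (- ball p r)) (subtopology (top_of_set (- {p})) (- ball p r)) ?f id"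
      unfolding sub
    proof (rule homotopic_with_equal)
      have "continuous_on (- ball p r) ?f" using cont by (rule continuous_on_subset) (use r in auto)
      then show "continuous_map (top_of_set (- ball p r)) (top_of_set (- ball p r)) ?f"
        using id by (auto simp: continuous_map_in_subtopology)
      show "?f x = id x" if "x \<in> topspace (top_of_set (- ball p r))" for x using id that by simp
    qed auto
    have "homotopic_with_canon (\<lambda>z. True) (- {p}) (- {p}) ?f id"
    proof (rule homotopic_with_linear)
      fix x assume x: "x \<in> - {p}"
      show "closed_segment (?f x) (id x) \<subseteq> - {p}"
      proof
        fix w assume "w \<in> closed_segment (?f x) (id x)"
        then obtain u where u: "0 \<le> u" "u \<le> 1" "w = (1 - u) *\<^sub>R ?f x + u *\<^sub>R x" by (auto simp: in_segment)
        have "w = p + ((1 - u) * max 1 (r / norm (x - p)) + u) *\<^sub>R (x - p)" unfolding u(3) by (simp add: algebra_simps)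
        moreover have "(1 - u) * max 1 (r / norm (x - p)) + u > 0"
        proof -
          define m where "m = max 1 (r / norm (x - p))"
          have "(1 - u) * (m - 1) \<ge> 0" using u by (intro mult_nonneg_nonneg) (auto simp: m_def)
          moreover have "(1 - u) * m + u = 1 + (1 - u) * (m - 1)" by (simp add: algebra_simps)
          ultimately show ?thesis unfolding m_def[symmetric] by linarith
        qed
        ultimately show "w \<in> - {p}" using x by auto
      qed
    qed (use cont in \<open>auto intro: continuous_on_id\<close>)
    then show "homotopic_with (\<lambda>k. True) (top_of_set (- {p})) (top_of_set (- {p})) ?f id" .
  qed
qed

lemma bij_betw_two_of_six:
  assumes "a ` A \<subseteq> B" "b ` B \<subseteq> C" "bij_betw (b \<circ> a) A C" "bij_betw (c \<circ> b) B D"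
  shows "bij_betw c C D"
proof -
  have "C \<subseteq> b ` B" using assms(1,3) unfolding bij_betw_def by (metis image_comp image_mono)
  moreover have "inj_on b B" using assms(4) unfolding bij_betw_def by (metis inj_on_imageI2)
  ultimately have "bij_betw b B C" using assms(2) unfolding bij_betw_def by blast
  then show ?thesis using bij_betw_comp_iff[of b B C c D] assms(4) by blast
qed

text \<open>For y off the centre the radial argument does not apply directly. Complements of balls
  centred alternately at p and y are nested; the composites joining sets with a common centre are
  isomorphisms, and two-out-of-six leaves the desired map bijective.\<close>

lemma iso_complement_ball:
  fixes p y :: "real^3"
  assumes y: "y \<in> ball p r"
  shows "hom_induced n R3 (- ball p r) R3 (- {y}) id \<in> iso (relative_homology_group n R3 (- ball p r)) (relative_homology_group n R3 (- {y}))"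
proof -
  have r: "r > 0" using y by (metis ball_eq_empty empty_iff not_le)
  let ?H = "\<lambda>A. relative_homology_group n R3 A"
  let ?i = "\<lambda>A B. hom_induced n R3 A R3 B id"
  have comp: "?i B C (?i A B x) = ?i A C x" if "A \<subseteq> B" "B \<subseteq> C" for A B C x
  proof -
    have "id \<in> A \<rightarrow> B" "id \<in> B \<rightarrow> C" using that by auto
    then show ?thesis using hom_induced_compose'[of R3 R3 id A B R3 id C n x] by simp
  qed
  have maps: "?i A B x \<in> carrier (?H B)" for A B x by (rule hom_induced_carrier)
  \<comment> \<open>The radii come from the triangle inequality: if y is within r of p, the ball of
    radius r about p lies in that of radius 2 r about y, and this in that of radius 3 r about
    p.\<close>
  let ?A = "- ball p (3 * r)" and ?B = "- ball y (2 * r)" and ?C = "- ball p r" and ?D = "- {y}"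
  have AB: "?A \<subseteq> ?B" "?B \<subseteq> ?C" "?C \<subseteq> ?D" "?C \<subseteq> - {p}"
  proof -
    have "ball y (2 * r) \<subseteq> ball p (3 * r)"
    proof
      fix z assume "z \<in> ball y (2 * r)"
      then show "z \<in> ball p (3 * r)" using y dist_triangle[of p z y] by simp
    qed
    then show "?A \<subseteq> ?B" by blast
    have "ball p r \<subseteq> ball y (2 * r)"
    proof
      fix z assume "z \<in> ball p r"
      then show "z \<in> ball y (2 * r)" using y dist_triangle[of y z p] by (simp add: dist_commute)
    qed
    then show "?B \<subseteq> ?C" by blast
  qed (use y r in auto)
  have bij: "bij_betw f (carrier (?H A)) (carrier (?H B))" if "f \<in> iso (?H A) (?H B)" for f A B using that by (simp add: iso_def)
  have bBD: "bij_betw (?i ?B ?D) (carrier (?H ?B)) (carrier (?H ?D))" by (rule bij, rule iso_complement_ball_center) (use r in simp)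
  have bAp: "bij_betw (?i ?A (- {p})) (carrier (?H ?A)) (carrier (?H (- {p})))" by (rule bij, rule iso_complement_ball_center) (use r in simp)
  have bCp: "bij_betw (?i ?C (- {p})) (carrier (?H ?C)) (carrier (?H (- {p})))" by (rule bij, rule iso_complement_ball_center) (use r in simp)
  have cAC: "?i ?B ?C \<circ> ?i ?A ?B = ?i ?A ?C" using comp[OF AB(1,2)] by (auto simp: comp_def)
  have "?A \<subseteq> ?C" using AB by blast
  have "?i ?C (- {p}) \<circ> ?i ?A ?C = ?i ?A (- {p})" using comp[OF \<open>?A \<subseteq> ?C\<close> AB(4)] by (auto simp: comp_def)
  then have "bij_betw (?i ?A ?C) (carrier (?H ?A)) (carrier (?H ?C))"
    using bij_betw_comp_iff2[OF bCp, of "?i ?A ?C" "carrier (?H ?A)"] bAp maps by (simp add: image_subset_iff)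
  then have ba: "bij_betw (?i ?B ?C \<circ> ?i ?A ?B) (carrier (?H ?A)) (carrier (?H ?C))" using cAC by simp
  have cb: "bij_betw (?i ?C ?D \<circ> ?i ?B ?C) (carrier (?H ?B)) (carrier (?H ?D))"
  proof -
    have "?i ?C ?D \<circ> ?i ?B ?C = ?i ?B ?D" using comp[OF AB(2,3)] by (auto simp: comp_def)
    then show ?thesis using bBD by simp
  qed
  have "bij_betw (?i ?C ?D) (carrier (?H ?C)) (carrier (?H ?D))"
    by (rule bij_betw_two_of_six[OF _ _ ba cb]) (use maps in auto)
  then show ?thesis unfolding iso_def using hom_induced_hom by blast
qed

section \<open>Topological charts modelled on three-space and the homology transported by
  them\<close>

definition chart3 :: "'a::euclidean_space set \<Rightarrow> (real^3 \<Rightarrow> 'a) \<Rightarrow> bool" where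
  "chart3 X e \<longleftrightarrow> openin (top_of_set X) (range e) \<and> (\<exists>e'. homeomorphism UNIV (range e) e e')"

abbreviation LH :: "'a::euclidean_space set \<Rightarrow> 'a set \<Rightarrow> 'a chain set monoid" where
  "LH X A \<equiv> relative_homology_group 3 (top_of_set X) A"

lemma chart3_facts:
  assumes "chart3 X e"
  shows "inj e" "continuous_on UNIV e" "range e \<subseteq> X" "openin (top_of_set X) (range e)"
  using assms openin_imp_subset unfolding chart3_def homeomorphism_def by (auto intro: inj_on_inverseI dest!: openin_imp_subset)

lemma chart3_open: assumes "chart3 X e" "open U" shows "openin (top_of_set X) (e ` U)"
proof -
  obtain e' where "homeomorphism UNIV (range e) e e'" using assms unfolding chart3_def by blast
  then have "openin (top_of_set (range e)) (e ` U)" using homeomorphism_imp_open_map assms(2) by fastforce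
  then show ?thesis using chart3_facts(4)[OF assms(1)] openin_trans by blast
qed

text \<open>A homeomorphism onto the range is followed by excision of the complement of the range.
  Boundedness of K places it in a compact ball, whose image is closed, and so provides the room that
  excision requires.\<close>

lemma chart3_iso:
  assumes e: "chart3 X e" and K: "bounded K"
  shows "hom_induced 3 R3 (- K) (top_of_set X) (X - e ` K) e \<in> iso (relative_homology_group 3 R3 (- K)) (LH X (X - e ` K))"
proof -
  note ef = chart3_facts[OF e]
  obtain e' where h: "homeomorphism UNIV (range e) e e'" using e unfolding chart3_def by blast
  have "homeomorphic_map R3 (top_of_set (range e)) e"
    using h homeomorphic_maps_iff_homeomorphism[of UNIV "range e" e e'] homeomorphic_map_maps by (metis subtopology_UNIV)
  moreover have "e ` (- K) = range e - e ` K" using ef(1) by (simp add: Compl_eq_Diff_UNIV image_set_diff)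
  ultimately have 1: "hom_induced 3 R3 (- K) (top_of_set (range e)) (range e - e ` K) e
      \<in> iso (relative_homology_group 3 R3 (- K)) (LH (range e) (range e - e ` K))"
    by (intro homeomorphic_map_relative_homology_iso) auto
  have 2: "hom_induced 3 (top_of_set (range e)) (range e - e ` K) (top_of_set X) (X - e ` K) id
      \<in> iso (LH (range e) (range e - e ` K)) (LH X (X - e ` K))"
  proof -
    obtain B where B: "K \<subseteq> cball 0 B" using K unfolding bounded_iff by (metis mem_cball_0 subsetI)
    have cc: "closed (e ` cball 0 B)" by (intro compact_imp_closed compact_continuous_image continuous_on_subset[OF ef(2)]) auto
    have "closedin (top_of_set X) (X - range e)" using ef(4) by (metis closedin_diff closedin_topspace topspace_euclidean_subtopology)
    then have "(top_of_set X) closure_of (X - range e) = X - range e" by (simp add: closure_of_eq)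
    moreover have "X - e ` cball 0 B \<subseteq> (top_of_set X) interior_of (X - e ` K)"
      by (rule interior_of_maximal) (use B cc in \<open>auto simp: Diff_eq intro!: openin_open_Int\<close>)
    ultimately have "(top_of_set X) closure_of (X - range e) \<subseteq> (top_of_set X) interior_of (X - e ` K)" by auto
    from homology_excision_axiom[OF this, of X 3]
    have "hom_induced 3 (subtopology (top_of_set X) (X - (X - range e))) ((X - e ` K) - (X - range e)) (subtopology (top_of_set X) X) (X - e ` K) id
      \<in> iso (relative_homology_group 3 (subtopology (top_of_set X) (X - (X - range e))) ((X - e ` K) - (X - range e)))
          (relative_homology_group 3 (subtopology (top_of_set X) X) (X - e ` K))" by auto
    moreover have "X - (X - range e) = range e" "(X - e ` K) - (X - range e) = range e - e ` K" using ef(3) by auto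
    moreover have "subtopology (top_of_set X) (range e) = top_of_set (range e)" using ef(3) by (simp add: subtopology_subtopology Int_absorb1)
    moreover have "subtopology (top_of_set X) X = top_of_set X" by (simp add: subtopology_subtopology)
    ultimately show ?thesis by simp
  qed
  have "hom_induced 3 (top_of_set (range e)) (range e - e ` K) (top_of_set X) (X - e ` K) id \<circ>
      hom_induced 3 R3 (- K) (top_of_set (range e)) (range e - e ` K) e = hom_induced 3 R3 (- K) (top_of_set X) (X - e ` K) (id \<circ> e)"
  proof (rule hom_induced_compose[symmetric])
    show "continuous_map R3 (top_of_set (range e)) e" using ef(2) by (auto simp: continuous_map_in_subtopology)
    show "e \<in> - K \<rightarrow> range e - e ` K" using ef(1) by (auto simp: inj_def)
    show "continuous_map (top_of_set (range e)) (top_of_set X) id" using ef(3) by (auto simp: continuous_map_in_subtopology)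
    show "id \<in> range e - e ` K \<rightarrow> X - e ` K" using ef(3) by auto
  qed
  then show ?thesis using iso_set_trans[OF 1 2] by simp
qed

lemma chart3_iso_point:
  assumes e: "chart3 X e"
  shows "hom_induced 3 R3 (- {p}) (top_of_set X) (X - {e p}) e \<in> iso (relative_homology_group 3 R3 (- {p})) (LH X (X - {e p}))"
  using chart3_iso[OF e, of "{p}"] by simp

lemma chart3_square:
  assumes e: "chart3 X e" and AB: "A \<subseteq> B"
  shows "hom_induced 3 (top_of_set X) (X - e ` B) (top_of_set X) (X - e ` A) id (hom_induced 3 R3 (- B) (top_of_set X) (X - e ` B) e c)
    = hom_induced 3 R3 (- A) (top_of_set X) (X - e ` A) e (hom_induced 3 R3 (- B) R3 (- A) id c)"
proof -
  note ef = chart3_facts[OF e]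
  have ce: "continuous_map R3 (top_of_set X) e" using ef(2,3) by (auto simp: continuous_map_in_subtopology)
  have eB: "e \<in> - B \<rightarrow> X - e ` B" and eA: "e \<in> - A \<rightarrow> X - e ` A" using ef(1,3) by (auto simp: inj_def)
  have "hom_induced 3 (top_of_set X) (X - e ` B) (top_of_set X) (X - e ` A) id (hom_induced 3 R3 (- B) (top_of_set X) (X - e ` B) e c)
    = hom_induced 3 R3 (- B) (top_of_set X) (X - e ` A) (id \<circ> e) c"
    by (rule hom_induced_compose'[OF ce eB]) (use AB in auto)
  moreover have "hom_induced 3 R3 (- A) (top_of_set X) (X - e ` A) e (hom_induced 3 R3 (- B) R3 (- A) id c)
    = hom_induced 3 R3 (- B) (top_of_set X) (X - e ` A) (e \<circ> id) c"
    by (rule hom_induced_compose'[OF _ _ ce eA]) (use AB in auto)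
  ultimately show ?thesis by simp
qed

definition locally_R3 :: "'a::euclidean_space set \<Rightarrow> bool" where
  "locally_R3 X \<longleftrightarrow> (\<forall>x\<in>X. \<exists>e. chart3 X e \<and> e 0 = x)"

lemma chart3_compose_ball:
  assumes e: "chart3 X e" and r: "r > 0"
  obtains d where "chart3 X d" "d 0 = e p" "range d = e ` ball p r"
proof -
  obtain j' j where j: "homeomorphism (UNIV :: (real^3) set) (ball p r) j' j"
    using homeomorphic_ball_UNIV[OF r, of p] homeomorphic_sym unfolding homeomorphic_def by metis
  \<comment> \<open>The translation by \<open>j p\<close> makes the origin the parameter of the
    chosen point.\<close>
  define d where "d z = e (j' (z + j p))" for z
  have pb: "p \<in> ball p r" using r by simp
  have rj: "range (\<lambda>z. j' (z + j p)) = ball p r"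
  proof -
    have "range (\<lambda>z. j' (z + j p)) = j' ` range (\<lambda>z. z + j p)" unfolding image_image ..
    also have "range (\<lambda>z. z + j p) = UNIV" by (rule surjI[of _ "\<lambda>w. w - j p"]) simp
    finally show ?thesis using j by (simp add: homeomorphism_def)
  qed
  have rd: "range d = e ` ball p r" unfolding d_def rj[symmetric] by auto
  obtain e' where h: "homeomorphism UNIV (range e) e e'" using e unfolding chart3_def by blast
  have "homeomorphism UNIV (range d) d (\<lambda>w. j (e' w) - j p)"
    unfolding homeomorphism_def
  proof (intro conjI ballI)
    have ee: "e' (e z) = z" for z using h by (simp add: homeomorphism_def)
    have jj: "j (j' z) = z" for z using j by (simp add: homeomorphism_def)
    show "j (e' (d x)) - j p = x" for x by (simp add: d_def ee jj)
    show "d (j (e' y) - j p) = y" if "y \<in> range d" for y using that by (auto simp: d_def ee jj)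
    show "(\<lambda>w. j (e' w) - j p) ` range d = UNIV"
    proof -
      have "z \<in> (\<lambda>w. j (e' w) - j p) ` range d" for z by (rule image_eqI[of _ _ "d z"]) (simp_all add: d_def ee jj)
      then show ?thesis by blast
    qed
    show "continuous_on UNIV d" unfolding d_def
    proof (rule continuous_on_compose2[OF chart3_facts(2)[OF e]])
      show "continuous_on UNIV (\<lambda>z. j' (z + j p))"
        by (rule continuous_on_compose2[of UNIV j']) (use j in \<open>auto simp: homeomorphism_def intro!: continuous_intros\<close>)
    qed auto
    have "continuous_on (range d) (\<lambda>w. j (e' w))"
    proof (rule continuous_on_compose2[of "ball p r" j])
      show "continuous_on (ball p r) j" using j by (simp add: homeomorphism_def)
      show "continuous_on (range d) e'" using h rd unfolding homeomorphism_def by (metis continuous_on_subset image_mono subset_UNIV)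
      show "e' ` range d \<subseteq> ball p r" unfolding rd using ee by auto
    qed
    then show "continuous_on (range d) (\<lambda>w. j (e' w) - j p)" by (intro continuous_intros)
  qed simp
  moreover have "openin (top_of_set X) (range d)" unfolding rd by (rule chart3_open[OF e]) simp
  ultimately have "chart3 X d" unfolding chart3_def by blast
  moreover have "d 0 = e p" using j pb by (simp add: d_def homeomorphism_def)
  ultimately show ?thesis using that rd by blast
qed

lemma small_chart3:
  assumes "locally_R3 X" "openin (top_of_set X) \<Omega>" "x \<in> \<Omega>"
  obtains e where "chart3 X e" "e 0 = x" "range e \<subseteq> \<Omega>"
proof -
  have "x \<in> X" using assms openin_imp_subset by blast
  then obtain e where e: "chart3 X e" "e 0 = x" using assms unfolding locally_R3_def by blast
  obtain V where V: "open V" "\<Omega> = X \<inter> V" using assms(2) by (auto simp: openin_open)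
  have "open (e -` V)" using chart3_facts(2)[OF e(1)] V(1) by (simp add: continuous_on_open_vimage)
  then obtain r where r: "r > 0" "ball 0 r \<subseteq> e -` V" using e(2) V(2) assms(3) open_contains_ball by blast
  obtain d where d: "chart3 X d" "d 0 = e 0" "range d = e ` ball 0 r" using chart3_compose_ball[OF e(1) r(1)] by metis
  have "range d \<subseteq> \<Omega>"
  proof
    fix w assume "w \<in> range d"
    then obtain z where "z \<in> ball 0 r" "w = e z" unfolding d(3) by (elim imageE)
    then show "w \<in> \<Omega>" using subsetD[OF r(2)] V(2) subsetD[OF chart3_facts(3)[OF e(1)] rangeI] by simp
  qed
  then show ?thesis using that d e(2) by simp
qed

abbreviation res :: "'a::euclidean_space set \<Rightarrow> 'a set \<Rightarrow> 'a set \<Rightarrow> 'a chain set \<Rightarrow> 'a chain set" where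
  "res X A B \<equiv> hom_induced 3 (top_of_set X) A (top_of_set X) B id"

lemma res_res: "A \<subseteq> B \<Longrightarrow> B \<subseteq> C \<Longrightarrow> res X B C (res X A B x) = res X A C x"
proof -
  assume "A \<subseteq> B" "B \<subseteq> C"
  then have "id \<in> A \<rightarrow> B" "id \<in> B \<rightarrow> C" by auto
  then show ?thesis using hom_induced_compose'[of "top_of_set X" "top_of_set X" id A B "top_of_set X" id C 3 x] by simp
qed

text \<open>Sets on which local homology is visibly constant: a class relative to the complement of
  U is determined by its value at any one point.\<close>

definition good :: "'a::euclidean_space set \<Rightarrow> 'a set \<Rightarrow> bool" where
  "good X U \<longleftrightarrow> openin (top_of_set X) U \<and> connected U \<and>
     (\<forall>y\<in>U. res X (X - U) (X - {y}) \<in> iso (LH X (X - U)) (LH X (X - {y})))"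

text \<open>Through the chart the restriction to a point becomes the restriction from the complement
  of a ball in Euclidean space.\<close>

lemma chart3_good: assumes e: "chart3 X e" shows "good X (e ` ball p r)"
  unfolding good_def
proof (intro conjI ballI)
  let ?U = "e ` ball p r"
  show "openin (top_of_set X) ?U" by (rule chart3_open[OF e]) simp
  show "connected ?U" by (rule connected_continuous_image[OF continuous_on_subset[OF chart3_facts(2)[OF e]]]) auto
  fix y assume "y \<in> ?U"
  then obtain z where z: "z \<in> ball p r" "y = e z" by blast
  let ?f = "hom_induced 3 R3 (- ball p r) (top_of_set X) (X - ?U) e"
  let ?g = "hom_induced 3 R3 (- {z}) (top_of_set X) (X - {y}) e"
  let ?i = "hom_induced 3 R3 (- ball p r) R3 (- {z}) id"
  have f: "?f \<in> iso (relative_homology_group 3 R3 (- ball p r)) (LH X (X - ?U))" by (rule chart3_iso[OF e]) simp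
  have g: "?g \<in> iso (relative_homology_group 3 R3 (- {z})) (LH X (X - {y}))" using chart3_iso_point[OF e] z by simp
  have i: "?i \<in> iso (relative_homology_group 3 R3 (- ball p r)) (relative_homology_group 3 R3 (- {z}))" by (rule iso_complement_ball[OF z(1)])
  have sq: "res X (X - ?U) (X - {y}) (?f c) = ?g (?i c)" for c
    using chart3_square[OF e, of "{z}" "ball p r" c] z by simp
  have gi: "bij_betw (?g \<circ> ?i) (carrier (relative_homology_group 3 R3 (- ball p r))) (carrier (LH X (X - {y})))"
    using iso_set_trans[OF i g] by (simp add: iso_def)
  have "bij_betw (res X (X - ?U) (X - {y}) \<circ> ?f) (carrier (relative_homology_group 3 R3 (- ball p r))) (carrier (LH X (X - {y})))"
    using gi by (simp add: sq comp_def)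
  then have "bij_betw (res X (X - ?U) (X - {y})) (carrier (LH X (X - ?U))) (carrier (LH X (X - {y})))"
    using bij_betw_comp_iff[of ?f, THEN iffD2] f unfolding iso_def by blast
  then show "res X (X - ?U) (X - {y}) \<in> iso (LH X (X - ?U)) (LH X (X - {y}))"
    unfolding iso_def using hom_induced_hom by blast
qed

lemma good_nbhd:
  assumes "locally_R3 X" "openin (top_of_set X) \<Omega>" "x \<in> \<Omega>"
  obtains U where "good X U" "x \<in> U" "U \<subseteq> \<Omega>"
proof -
  obtain e where e: "chart3 X e" "e 0 = x" "range e \<subseteq> \<Omega>" using small_chart3[OF assms] by metis
  have "good X (e ` ball 0 1)" by (rule chart3_good[OF e(1)])
  then show ?thesis using that e by force
qed

section \<open>Cells and homology of the three-sphere\<close>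

lemma sphere_cell:
  fixes \<Delta> :: "'a::euclidean_space set" and S :: "'b::euclidean_space set"
  assumes \<Delta>: "convex \<Delta>" "bounded \<Delta>" "aff_dim \<Delta> = 4" and h: "homeomorphism (rel_frontier \<Delta>) S h k" and p: "p \<in> S"
  shows "\<exists>e. chart3 S e \<and> range e = S - {p}"
proof -
  have kp: "k p \<in> rel_frontier \<Delta>" "h (k p) = p" using h p unfolding homeomorphism_def by auto
  have "rel_frontier \<Delta> - {k p} homeomorphic (UNIV :: (real^3) set)"
    by (rule homeomorphic_punctured_sphere_affine_gen[OF \<Delta>(1,2) kp(1)]) (use \<Delta>(3) in auto)
  moreover have "homeomorphism (rel_frontier \<Delta> - {k p}) (S - {p}) h k"
  proof -
    have "h ` (rel_frontier \<Delta> - {k p}) = S - {p}" using h kp unfolding homeomorphism_def by force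
    then show ?thesis using homeomorphism_of_subsets[OF h, of "rel_frontier \<Delta> - {k p}" "S - {p}"] by auto
  qed
  then have "rel_frontier \<Delta> - {k p} homeomorphic S - {p}" unfolding homeomorphic_def by blast
  ultimately have "(UNIV :: (real^3) set) homeomorphic S - {p}" using homeomorphic_sym homeomorphic_trans by blast
  then obtain e e' where e: "homeomorphism (UNIV :: (real^3) set) (S - {p}) e e'" unfolding homeomorphic_def by blast
  then have "range e = S - {p}" by (simp add: homeomorphism_def)
  moreover have "openin (top_of_set S) (S - {p})" by (metis Diff_eq finite.emptyI finite.insertI finite_imp_closed open_Compl openin_open_Int)
  ultimately show ?thesis using e unfolding chart3_def by metis
qed

lemma sphere_locally_R3:
  fixes \<Delta> :: "'a::euclidean_space set" and S :: "'b::euclidean_space set"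
  assumes \<Delta>: "convex \<Delta>" "bounded \<Delta>" "aff_dim \<Delta> = 4" and h: "homeomorphism (rel_frontier \<Delta>) S h k"
  shows "locally_R3 S"
  unfolding locally_R3_def
proof
  fix x assume x: "x \<in> S"
  obtain e0 where e0: "chart3 S e0" "range e0 = S - {x}" using sphere_cell[OF assms x] by blast
  then have p: "e0 0 \<in> S" "e0 0 \<noteq> x" by auto
  obtain e where e: "chart3 S e" "range e = S - {e0 0}" using sphere_cell[OF assms p(1)] by blast
  then obtain z where z: "x = e z" using x p by (metis DiffI imageE singletonD)
  obtain d where "chart3 S d" "d 0 = e z" using chart3_compose_ball[OF e(1) zero_less_one, of z] by metis
  then show "\<exists>e. chart3 S e \<and> e 0 = x" using z by blast
qed

text \<open>The first part reduces to the standard sphere. For the second, the complement of a point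
  is a cell and contractible, so passing to the relative group loses nothing; in degree 3 reduced
  and unreduced homology agree.\<close>

lemma sphere_homology:
  fixes \<Delta> :: "'a::euclidean_space set" and S :: "'b::euclidean_space set"
  assumes \<Delta>: "convex \<Delta>" "bounded \<Delta>" "aff_dim \<Delta> = 4" and h: "homeomorphism (rel_frontier \<Delta>) S h k"
  shows "homology_group 3 (top_of_set S) \<cong> integer_group"
    and "x \<in> S \<Longrightarrow> res S {} (S - {x}) \<in> iso (homology_group 3 (top_of_set S)) (LH S (S - {x}))"
proof -
  obtain f g where fg: "homeomorphic_maps (nsphere (4 - 1)) (top_of_set (sphere 0 1 \<inter> span (Basis :: (real^4) set))) f g"
    by (rule homeomorphic_maps_nsphere_euclidean_sphere[of "Basis :: (real^4) set" 4])
      (auto simp: independent_Basis pairwise_def orthogonal_def inner_not_same_Basis)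
  have "rel_frontier \<Delta> homeomorphic rel_frontier (cball (0::real^4) 1)"
    by (rule homeomorphic_rel_frontiers_convex_bounded_sets) (use \<Delta> in \<open>auto simp: aff_dim_cball\<close>)
  then have "rel_frontier \<Delta> homeomorphic sphere (0::real^4) 1" by simp
  moreover have "rel_frontier \<Delta> homeomorphic S" using h unfolding homeomorphic_def by blast
  ultimately have "S homeomorphic sphere (0::real^4) 1" using homeomorphic_sym homeomorphic_trans by blast
  then have "top_of_set S homeomorphic_space top_of_set (sphere (0::real^4) 1)" by simp
  moreover have "nsphere 3 homeomorphic_space top_of_set (sphere (0::real^4) 1)"
    using fg unfolding homeomorphic_space_def by (auto simp: span_Basis)
  ultimately have "top_of_set S homeomorphic_space nsphere 3" using homeomorphic_space_sym homeomorphic_space_trans by blast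
  then have "reduced_homology_group 3 (top_of_set S) \<cong> reduced_homology_group 3 (nsphere 3)"
    by (rule homeomorphic_space_imp_isomorphic_reduced_homology_groups)
  moreover have "reduced_homology_group 3 (nsphere 3) \<cong> integer_group" using reduced_homology_group_nsphere(1)[of 3] by simp
  ultimately have "reduced_homology_group 3 (top_of_set S) \<cong> integer_group" using iso_trans by blast
  then show "homology_group 3 (top_of_set S) \<cong> integer_group" by (simp add: un_reduced_homology_group)
  assume x: "x \<in> S"
  obtain e where e: "chart3 S e" "range e = S - {x}" using sphere_cell[OF assms x] by blast
  then have "(UNIV :: (real^3) set) homeomorphic S - {x}" unfolding chart3_def homeomorphic_def by auto
  then have "contractible (S - {x})" using homeomorphic_contractible[OF convex_imp_contractible[OF convex_UNIV]] by blast
  moreover have "subtopology (top_of_set S) (S - {x}) = top_of_set (S - {x})" by (simp add: subtopology_subtopology Int_absorb1)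
  ultimately have "contractible_space (subtopology (top_of_set S) (S - {x}))" by (simp add: contractible_space_top_of_set)
  moreover have "topspace (top_of_set S) \<inter> (S - {x}) \<noteq> {}" using e(2) by auto
  ultimately have "res S {} (S - {x}) \<in> iso (reduced_homology_group 3 (top_of_set S)) (LH S (S - {x}))"
    by (rule iso_reduced_homology_by_contractible)
  then show "res S {} (S - {x}) \<in> iso (homology_group 3 (top_of_set S)) (LH S (S - {x}))" by (simp add: un_reduced_homology_group)
qed

text \<open>Euclidean space is a punctured sphere, so its local homology is that of the sphere,
  which equals the global homology of the sphere.\<close>

lemma R3_local_homology: "relative_homology_group 3 R3 (- {p}) \<cong> integer_group"
proof -
  let ?D = "cball (0::real^4) 1" and ?S = "sphere (0::real^4) 1"
  have D: "convex ?D" "bounded ?D" "aff_dim ?D = 4" by (auto simp: aff_dim_cball)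
  have h: "homeomorphism (rel_frontier ?D) ?S id id" by (auto simp: homeomorphism_def intro: continuous_on_id)
  obtain u :: "real^4" where "u \<in> Basis" using nonempty_Basis by blast
  then have u: "u \<in> ?S" by simp
  obtain e where e: "chart3 ?S e" "range e = ?S - {u}" using sphere_cell[OF D h u] by blast
  have ep: "e p \<in> ?S" using chart3_facts(3)[OF e(1)] by blast
  have 1: "relative_homology_group 3 R3 (- {p}) \<cong> LH ?S (?S - {e p})" by (rule is_isoI[OF chart3_iso_point[OF e(1)]])
  have 2: "LH ?S (?S - {e p}) \<cong> homology_group 3 (top_of_set ?S)"
    using group.iso_sym[OF _ is_isoI[OF sphere_homology(2)[OF D h ep]]] by simp
  show ?thesis by (rule iso_trans[OF iso_trans[OF 1 2] sphere_homology(1)[OF D h]])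
qed

lemma local_homology:
  assumes "locally_R3 X" "x \<in> X" shows "LH X (X - {x}) \<cong> integer_group"
proof -
  obtain e where e: "chart3 X e" "e 0 = x" using assms unfolding locally_R3_def by blast
  have 1: "relative_homology_group 3 R3 (- {0}) \<cong> LH X (X - {x})" using is_isoI[OF chart3_iso_point[OF e(1), of 0]] e(2) by simp
  have "LH X (X - {x}) \<cong> relative_homology_group 3 R3 (- {0})" by (rule group.iso_sym[OF _ 1]) simp
  then show ?thesis by (rule iso_trans[OF _ R3_local_homology])
qed

subsection \<open>Lifting and descending homeomorphisms and isotopies\<close>

context branched_deck
begin

text \<open>At a point over L the fibre is a single point, so preimages of small sets under q form a
  neighbourhood basis and continuity of the projection suffices. The domain type is arbitrary in
  order to serve both homeomorphisms and isotopies.\<close>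

lemma continuous_over_L:
  fixes f :: "'c::topological_space \<Rightarrow> 'b"
  assumes f: "f ` Z \<subseteq> M" and qf: "continuous_on Z (\<lambda>z. q (f z))" and off: "continuous_on {z \<in> Z. q (f z) \<notin> L} f"
  shows "continuous_on Z f"
  unfolding continuous_on_topological
proof (intro ballI allI impI)
  fix x B assume x: "x \<in> Z" and B: "open B" "f x \<in> B"
  have fM: "f x \<in> M" using f x by blast
  note nb = qf[unfolded continuous_on_topological, rule_format, OF x]
  show "\<exists>A. open A \<and> x \<in> A \<and> (\<forall>y\<in>Z. y \<in> A \<longrightarrow> f y \<in> B)"
  proof (cases "q (f x) \<in> L")
    case True
    have o: "openin (top_of_set M) (M \<inter> B)" using B(1) by (simp add: openin_open_Int)
    have s: "{w \<in> M. q w = q (f x)} \<subseteq> M \<inter> B"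
    proof fix w assume "w \<in> {w \<in> M. q w = q (f x)}" then show "w \<in> M \<inter> B" using fibre_L_single[OF True fM] B(2) by auto qed
    obtain \<Omega> where \<Omega>: "openin (top_of_set S3) \<Omega>" "q (f x) \<in> \<Omega>" "{w \<in> M. q w \<in> \<Omega>} \<subseteq> M \<inter> B"
      by (rule small_preimage[OF o q_in[OF fM] s])
    obtain V where V: "open V" "\<Omega> = S3 \<inter> V" using \<Omega>(1) by (auto simp: openin_open)
    have "q (f x) \<in> V" using \<Omega>(2) V(2) by simp
    from nb[OF V(1) this] obtain A where A: "open A" "x \<in> A" "\<forall>y\<in>Z. y \<in> A \<longrightarrow> q (f y) \<in> V" by auto
    have "f y \<in> B" if "y \<in> Z" "y \<in> A" for y
    proof -
      have "f y \<in> M" using f that by blast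
      moreover from this have "q (f y) \<in> \<Omega>" using A(3) that V(2) q_in by blast
      ultimately show ?thesis using \<Omega>(3) by blast
    qed
    then show ?thesis using A by blast
  next
    case False
    have "x \<in> {z \<in> Z. q (f z) \<notin> L}" using x False by simp
    from off[unfolded continuous_on_topological, rule_format, OF this B]
    obtain A1 where A1: "open A1" "x \<in> A1" "\<forall>y\<in>{z \<in> Z. q (f z) \<notin> L}. y \<in> A1 \<longrightarrow> f y \<in> B" by auto
    have "open (- L)" using closed_L by (simp add: open_Compl)
    from nb[OF this] obtain A2 where A2: "open A2" "x \<in> A2" "\<forall>y\<in>Z. y \<in> A2 \<longrightarrow> q (f y) \<in> - L"
      using False by auto
    show ?thesis using A1 A2 by (intro exI[of _ "A1 \<inter> A2"]) auto
  qed
qed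

section \<open>Lifting homeomorphisms and isotopies to the whole cover\<close>

definition link_homeo where
  "link_homeo g \<longleftrightarrow> pl_map S3 g \<and> bij_betw g S3 S3 \<and> g ` L = L"

definition equi_lift where
  "equi_lift g f \<longleftrightarrow> f \<in> Bij M \<and> pl_map M f \<and> (\<forall>x\<in>M. q (f x) = g (q x)) \<and> (\<forall>x\<in>M. f (T x) = T (f x))"

lemma link_homeo_L: "link_homeo g \<Longrightarrow> y \<in> S3 \<Longrightarrow> g y \<in> L \<longleftrightarrow> y \<in> L"
  using g_L unfolding link_homeo_def by blast

lemma link_homeo_S3: "link_homeo g \<Longrightarrow> y \<in> S3 \<Longrightarrow> g y \<in> S3"
  using g_S3 unfolding link_homeo_def by blast

text \<open>Injectivity can only fail between x and T x; then T fixes f x, so f x and hence x lie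
  over L, where x = T x. For surjectivity, the points over a value of g are f x and T (f x) = f (T
  x).\<close>

lemma equivariant_bij:
  assumes g: "link_homeo g" and f: "f ` M \<subseteq> M" "\<And>x. x \<in> M \<Longrightarrow> q (f x) = g (q x)" "\<And>x. x \<in> M \<Longrightarrow> f (T x) = T (f x)"
  shows "bij_betw f M M"
  unfolding bij_betw_def
proof
  have gb: "bij_betw g S3 S3" using g by (simp add: link_homeo_def)
  show "inj_on f M"
  proof (rule inj_onI)
    fix x x' assume x: "x \<in> M" "x' \<in> M" "f x = f x'"
    have "g (q x) = g (q x')" using f(2) x by metis
    then have qq: "q x' = q x" using gb q_in x unfolding bij_betw_def by (metis inj_onD)
    then consider "x' = x" | "x' = T x" using fibre_cases x by blast
    then show "x = x'"
    proof cases
      case 2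
      then have "T (f x) = f x" using f(3) x by metis
      then have "q (f x) \<in> L" using T_ne[of "f x"] f(1) x by (auto simp: M'_def)
      then have "q x \<in> L" using f(2) x link_homeo_L[OF g q_in] by metis
      then show ?thesis using 2 T_L x by simp
    qed simp
  qed
  show "f ` M = M"
  proof
    show "M \<subseteq> f ` M"
    proof
      fix w assume w: "w \<in> M"
      then obtain y where y: "y \<in> S3" "q w = g y" using q_in gb unfolding bij_betw_def by (metis imageE)
      then obtain x where x: "x \<in> M" "q x = y" using q_image by blast
      have fx: "f x \<in> M" using f(1) x by blast
      then have "w = f x \<or> w = T (f x)" using fibre_cases[OF fx w] f(2)[OF x(1)] x y by simp
      then have "w = f x \<or> w = f (T x)" using f(3) x by metis
      then show "w \<in> f ` M" using x by auto
    qed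
  qed (rule f(1))
qed

lemma equi_lift_exists:
  assumes g: "link_homeo g" obtains f where "equi_lift g f"
proof -
  have g': "pl_map S3 g" "bij_betw g S3 S3" "g ` L = L" using g by (auto simp: link_homeo_def)
  obtain f0 where f0: "lifts g S3 f0" using lift_off_L[OF g'] by metis
  \<comment> \<open>Over L the value is forced, the fibre being a single point. Outside M the value
    is \<open>undefined\<close> because elements of \<open>Bij M\<close> are extensional.\<close>
  define f where "f x = (if x \<in> M then (if q x \<in> L then (SOME w. w \<in> M \<and> q w = g (q x)) else f0 x) else undefined)" for x
  have over: "over S3 = M'" using q_in by (auto simp: over_def M'_def)
  have fL: "f x \<in> M" "q (f x) = g (q x)" if "x \<in> M" "q x \<in> L" for x
  proof -
    have "g (q x) \<in> q ` M" using link_homeo_S3[OF g q_in[OF that(1)]] q_image by simp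
    then have "\<exists>w. w \<in> M \<and> q w = g (q x)" by auto
    then have "(SOME w. w \<in> M \<and> q w = g (q x)) \<in> M \<and> q (SOME w. w \<in> M \<and> q w = g (q x)) = g (q x)" by (rule someI_ex)
    then show "f x \<in> M" "q (f x) = g (q x)" using that by (simp_all add: f_def)
  qed
  have fM': "f x = f0 x" "f0 x \<in> M'" "q (f0 x) = g (q x)" "f0 (T x) = T (f0 x)" if "x \<in> M'" for x
    using that f0 over unfolding lifts_def f_def M'_def by auto
  have ff: "f x \<in> M \<and> q (f x) = g (q x)" if x: "x \<in> M" for x
  proof (cases "q x \<in> L")
    case False
    then have xM': "x \<in> M'" using x by (simp add: M'_def)
    show ?thesis using fM'(1-3)[OF xM'] M'_sub by auto
  qed (use fL x in blast)
  then have f1: "f ` M \<subseteq> M" and f2: "\<And>x. x \<in> M \<Longrightarrow> q (f x) = g (q x)" by auto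
  have f3: "f (T x) = T (f x)" if x: "x \<in> M" for x
  proof (cases "q x \<in> L")
    case True
    then have "q (f x) \<in> L" using fL(2)[OF x] link_homeo_L[OF g q_in[OF x]] by simp
    then show ?thesis using T_L[OF x True] T_L[of "f x"] fL(1)[OF x True] by simp
  next
    case False
    then have xM': "x \<in> M'" "T x \<in> M'" using x T_M' by (auto simp: M'_def)
    then show ?thesis using fM' by simp
  qed
  have plqf: "pl_map M (q \<circ> f)"
  proof -
    have "pl_map M (g \<circ> q)" by (rule pl_map_compose[OF pl_q g'(1)]) (simp add: q_image)
    then show ?thesis by (rule pl_map_cong) (simp add: f2)
  qed
  have "continuous_on M f"
  proof (rule continuous_over_L[OF f1])
    show "continuous_on M (\<lambda>z. q (f z))" using pl_map_continuous[OF plqf] by (simp add: comp_def)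
    have "{z \<in> M. q (f z) \<notin> L} = M'" using f2 link_homeo_L[OF g q_in] by (auto simp: M'_def)
    moreover have "continuous_on M' f" using f0 fM'(1) over unfolding lifts_def by (simp cong: continuous_on_cong)
    ultimately show "continuous_on {z \<in> M. q (f z) \<notin> L} f" by simp
  qed
  then have "pl_map M f" using pl_map_lift[OF pl_q finite_fibre _ f1 plqf] by blast
  moreover have "f \<in> extensional M" by (simp add: f_def extensional_def)
  then have "f \<in> Bij M" using equivariant_bij[OF g f1 f2 f3] by (simp add: Bij_def)
  ultimately show ?thesis using that f2 f3 unfolding equi_lift_def by blast
qed

text \<open>The homotopy of maps from M' to the complement of L that sends x at time t to G t (q x)
  begins with the projection of f, so the covering homotopy property lifts it from f. As in the case
  of one homeomorphism, the lift extends over L and is PL.\<close>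

lemma isotopy_lift:
  fixes G :: "real \<Rightarrow> 'a \<Rightarrow> 'a"
  assumes G: "pl_map (S3 \<times> {0..1}) (\<lambda>(y, t). G t y)" "\<And>t. t \<in> {0..1} \<Longrightarrow> bij_betw (G t) S3 S3 \<and> G t ` L = L"
    and f: "equi_lift (G 0) f"
  obtains H where "pl_map (M \<times> {0..1}) (\<lambda>(x, t). H t x)" "\<And>t. t \<in> {0..1} \<Longrightarrow> equi_lift (G t) (H t)" "H (0::real) = f"
proof -
  have polyS: "compact_polyhedron S3" using pl_map_image_polyhedron[OF pl_q] q_image by simp
  have polyM: "compact_polyhedron M" by (rule pl_map_imp_polyhedron[OF pl_q])
  have gt: "link_homeo (G t)" if t: "t \<in> {0..1}" for t
    using pl_map_slice[OF G(1) t polyS] G(2)[OF t] by (simp add: link_homeo_def)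
  have fB: "f \<in> Bij M" "pl_map M f" and fq: "\<And>x. x \<in> M \<Longrightarrow> q (f x) = G 0 (q x)" and fT: "\<And>x. x \<in> M \<Longrightarrow> f (T x) = T (f x)"
    using f unfolding equi_lift_def by auto
  have fM: "f x \<in> M" if "x \<in> M" for x using Bij_imp_funcset[OF fB(1)] that by blast
  have z01: "(0::real) \<in> {0..1}" by simp
  have fM': "f x \<in> M'" if "x \<in> M'" for x
    using that fM fq link_homeo_L[OF gt[OF z01] q_in] by (auto simp: M'_def)
  have plGq: "pl_map (M \<times> {0..1}) ((\<lambda>(y, t). G t y) \<circ> (\<lambda>(x, t). (q x, t)))"
    by (rule pl_map_compose[OF pl_map_Times_id[OF pl_q polytope_real_interval] G(1)]) (use q_in in auto)
  have contGq: "continuous_on (M \<times> {0..1}) (\<lambda>(x, t). G t (q x))"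
    using pl_map_continuous[OF plGq] by (simp add: comp_def case_prod_unfold)
  \<comment> \<open>Time comes first here, the form in which homotopy lifting is stated, whereas
    isotopies have it as the second coordinate.\<close>
  define h where "h = (\<lambda>(t, x). G t (q x))"
  have ch: "continuous_on ({0..1} \<times> M') h"
  proof -
    have "continuous_on ({0..1} \<times> M') (\<lambda>z. (\<lambda>(x, t). G t (q x)) (prod.swap z))"
      by (rule continuous_on_compose2[OF contGq]) (use M'_sub in \<open>auto intro!: continuous_intros simp: prod.swap_def\<close>)
    then show ?thesis by (simp add: h_def case_prod_unfold)
  qed
  have him: "h \<in> {0..1} \<times> M' \<rightarrow> S3 - L"
  proof
    fix z :: "real \<times> 'b" assume "z \<in> {0..1} \<times> M'"
    then obtain t x where z: "z = (t, x)" "t \<in> {0..1}" "x \<in> M'" by blast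
    then have "q x \<in> S3 - L" using q_M' by blast
    then show "h z \<in> S3 - L" using z(1) link_homeo_L[OF gt[OF z(2)]] link_homeo_S3[OF gt[OF z(2)]] by (simp add: h_def)
  qed
  have heq: "h (0, y) = q (f y)" if "y \<in> M'" for y using fq that M'_sub by (auto simp: h_def)
  have contf: "continuous_on M' f" using pl_map_continuous[OF fB(2)] M'_sub continuous_on_subset by blast
  have fim: "f \<in> M' \<rightarrow> M'" using fM' by blast
  obtain k where k: "continuous_on ({0..1} \<times> M') k" "k \<in> {0..1} \<times> M' \<rightarrow> M'" "\<And>y. y \<in> M' \<Longrightarrow> k (0, y) = f y"
    "\<And>z. z \<in> {0..1} \<times> M' \<Longrightarrow> h z = q (k z)"
    using covering_space_lift_homotopy[OF covering ch him heq contf fim] by metis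
  define H where "H t x = (if x \<in> M then (if q x \<in> L then (SOME w. w \<in> M \<and> q w = G t (q x)) else k (t, x)) else undefined)" for t x
  have HL: "H t x \<in> M" "q (H t x) = G t (q x)" if "x \<in> M" "q x \<in> L" "t \<in> {0..1}" for t x
  proof -
    have "G t (q x) \<in> q ` M" using link_homeo_S3[OF gt[OF that(3)] q_in[OF that(1)]] q_image by simp
    then have "\<exists>w. w \<in> M \<and> q w = G t (q x)" by auto
    then have "(SOME w. w \<in> M \<and> q w = G t (q x)) \<in> M \<and> q (SOME w. w \<in> M \<and> q w = G t (q x)) = G t (q x)" by (rule someI_ex)
    then show "H t x \<in> M" "q (H t x) = G t (q x)" using that by (simp_all add: H_def)
  qed
  have HM': "H t x = k (t, x)" if "x \<in> M'" for t x using that unfolding H_def M'_def by auto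
  have kM': "k (t, x) \<in> M'" "q (k (t, x)) = G t (q x)" if "x \<in> M'" "t \<in> {0..1}" for t x
    using k(2) k(4)[of "(t, x)"] that by (auto simp: h_def)
  have H1: "H t x \<in> M" and H2: "q (H t x) = G t (q x)" if "x \<in> M" "t \<in> {0..1}" for t x
    using HL[OF that(1) _ that(2)] HM'[of x t] kM'[OF _ that(2), of x] that(1) M'_sub by (cases "q x \<in> L"; auto simp: M'_def)+
  have H3: "H t (T x) = T (H t x)" if x: "x \<in> M" and t: "t \<in> {0..1}" for t x
  proof (cases "q x \<in> L")
    case True
    then have "q (H t x) \<in> L" using HL(2)[OF x _ t] link_homeo_L[OF gt[OF t] q_in[OF x]] by simp
    then show ?thesis using T_L[OF x True] T_L[of "H t x"] H1[OF x t] by simp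
  next
    case False
    then have xM': "x \<in> M'" "T x \<in> M'" using x T_M' by (auto simp: M'_def)
    have ck: "continuous_on {0..1} (\<lambda>s. k (s, w))" if "w \<in> M'" for w
      by (rule continuous_on_compose2[OF k(1)]) (use that in \<open>auto intro!: continuous_intros\<close>)
    \<comment> \<open>Equivariance persists in time: both sides are lifts of the path of G s (q x),
      and they agree at time 0 because f is equivariant.\<close>
    have "k (t, T x) = T (k (t, x))"
    proof (rule covering_space_lift_unique[OF covering, of "\<lambda>s. k (s, T x)" 0 "\<lambda>s. T (k (s, x))" "{0..1}" "\<lambda>s. G s (q x)" t])
      show "k (0, T x) = T (k (0, x))" using k(3) xM' fT x by simp
      have "continuous_on {0..1} (\<lambda>s. h (s, x))"
        by (rule continuous_on_compose2[OF ch]) (use xM' in \<open>auto intro!: continuous_intros\<close>)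
      then show "continuous_on {0..1} (\<lambda>s. G s (q x))" by (simp add: h_def)
      show "(\<lambda>s. G s (q x)) \<in> {0..1} \<rightarrow> S3 - L" using him xM' by (auto simp: h_def Pi_iff)
      show "continuous_on {0..1} (\<lambda>s. k (s, T x))" by (rule ck[OF xM'(2)])
      show "(\<lambda>s. k (s, T x)) \<in> {0..1} \<rightarrow> M'" using kM' xM' by blast
      show "G s (q x) = q (k (s, T x))" if "s \<in> {0..1}" for s using kM'(2)[OF xM'(2) that] x by simp
      show "continuous_on {0..1} (\<lambda>s. T (k (s, x)))"
        by (rule continuous_on_compose2[OF cont_T ck[OF xM'(1)]]) (use kM' xM' M'_sub in blast)
      show "(\<lambda>s. T (k (s, x))) \<in> {0..1} \<rightarrow> M'" using kM' xM' T_M' by blast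
      show "G s (q x) = q (T (k (s, x)))" if "s \<in> {0..1}" for s
        using kM'[OF xM'(1) that] M'_sub by (metis q_T subsetD)
    qed (use t in auto)
    then show ?thesis using HM' xM' by simp
  qed
  let ?F = "\<lambda>(x, t). H t x"
  have F1: "?F ` (M \<times> {0..1}) \<subseteq> M" using H1 by auto
  have plqF: "pl_map (M \<times> {0..1}) (q \<circ> ?F)" by (rule pl_map_cong[OF plGq]) (use H2 in auto)
  have "continuous_on (M \<times> {0..1}) ?F"
  proof (rule continuous_over_L[OF F1])
    show "continuous_on (M \<times> {0..1}) (\<lambda>z. q (?F z))" using pl_map_continuous[OF plqF] by (simp add: comp_def)
    have "{z \<in> M \<times> {0..1}. q (?F z) \<notin> L} = M' \<times> {0..1}"
    proof -
      have "q (H t x) \<in> L \<longleftrightarrow> q x \<in> L" if "x \<in> M" "t \<in> {0..1}" for x t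
        using H2[OF that] link_homeo_L[OF gt[OF that(2)] q_in[OF that(1)]] by simp
      then show ?thesis by (auto simp: M'_def)
    qed
    moreover have "continuous_on (M' \<times> {0..1}) ?F"
    proof -
      have "continuous_on (M' \<times> {0..1}) (\<lambda>z. k (prod.swap z))"
        by (rule continuous_on_compose2[OF k(1)]) (auto intro!: continuous_intros simp: prod.swap_def)
      then show ?thesis by (rule continuous_on_eq) (use HM' in auto)
    qed
    ultimately show "continuous_on {z \<in> M \<times> {0..1}. q (?F z) \<notin> L} ?F" by simp
  qed
  then have plF: "pl_map (M \<times> {0..1}) ?F" using pl_map_lift[OF pl_q finite_fibre _ F1 plqF] by blast
  have "equi_lift (G t) (H t)" if t: "t \<in> {0..1}" for t
  proof -
    have "H t ` M \<subseteq> M" using H1[OF _ t] by blast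
    then have "bij_betw (H t) M M" by (rule equivariant_bij[OF gt[OF t] _ H2[OF _ t] H3[OF _ t]])
    moreover have "pl_map M (H t)" using pl_map_slice[OF plF t polyM] by simp
    ultimately show ?thesis using H2[OF _ t] H3[OF _ t] unfolding equi_lift_def by (auto simp: Bij_def H_def extensional_def)
  qed
  moreover have "H 0 = f"
  proof
    fix x show "H 0 x = f x"
    proof (cases "x \<in> M")
      case False then show ?thesis using Bij_imp_extensional[OF fB(1)] by (simp add: H_def extensional_def)
    next
      case x: True
      show ?thesis
      proof (cases "q x \<in> L")
        case True
        have "q (f x) \<in> L" using fq[OF x] link_homeo_L[OF gt[OF z01] q_in[OF x]] True by simp
        then show ?thesis using fibre_L_single[of "f x" "H 0 x"] fM[OF x] H1[OF x z01] H2[OF x z01] fq[OF x] by simp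
      next
        case False
        then have "x \<in> M'" using x by (simp add: M'_def)
        then show ?thesis using HM' k(3) by simp
      qed
    qed
  qed
  ultimately show ?thesis using that plF by blast
qed

section \<open>Descending fiber-preserving homeomorphisms and isotopies\<close>

definition desc :: "('b \<Rightarrow> 'b) \<Rightarrow> 'a \<Rightarrow> 'a" where
  "desc f = (\<lambda>y\<in>S3. q (f (SOME x. x \<in> M \<and> q x = y)))"

lemma fiber_preserving_imp:
  assumes f: "f \<in> Bij M" "fiber_preserving M q f" and x: "x \<in> M"
  shows "f ` {z \<in> M. q z = q x} = {z \<in> M. q z = q (f x)}"
proof -
  obtain y' where y': "f ` {z \<in> M. q z = q x} = {z \<in> M. q z = y'}"
    using f(2) x unfolding fiber_preserving_def by blast
  then have "q (f x) = y'" using x by blast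
  then show ?thesis using y' by simp
qed

lemma desc_q:
  assumes f: "f \<in> Bij M" "fiber_preserving M q f" and x: "x \<in> M" shows "desc f (q x) = q (f x)"
proof -
  let ?x = "SOME z. z \<in> M \<and> q z = q x"
  have "?x \<in> M \<and> q ?x = q x" by (rule someI[of _ x]) (use x in simp)
  then have "f ?x \<in> {z \<in> M. q z = q (f x)}" using fiber_preserving_imp[OF f x] by blast
  then show ?thesis using q_in[OF x] by (simp add: desc_def)
qed

text \<open>f maps each fibre bijectively onto a fibre, so it preserves the cardinality of fibres.
  Points over L are those alone in their fibre, and on a fibre with two points f must respect their
  exchange.\<close>

lemma fiber_preserving_T:
  assumes f: "f \<in> Bij M" "fiber_preserving M q f" and x: "x \<in> M"
  shows "f (T x) = T (f x)" and "q (f x) \<in> L \<longleftrightarrow> q x \<in> L"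
proof -
  have b: "bij_betw f M M" using f(1) by (simp add: Bij_def)
  have fx: "f x \<in> M" "f (T x) \<in> M" using b x T_in unfolding bij_betw_def by blast+
  have fib: "f ` {z \<in> M. q z = q x} = {z \<in> M. q z = q (f x)}" by (rule fiber_preserving_imp[OF f x])
  have "f (T x) \<in> {z \<in> M. q z = q (f x)}" unfolding fib[symmetric] using x by (intro imageI) simp
  then have c: "f (T x) = f x \<or> f (T x) = T (f x)" using fibre_cases[OF fx(1)] by blast
  have "T (f x) \<in> f ` {z \<in> M. q z = q x}" unfolding fib using fx by simp
  then obtain w where w: "w \<in> M" "q w = q x" "T (f x) = f w" by blast
  have Tx: "T x = x \<longleftrightarrow> q x \<in> L" if "x \<in> M" for x using T_L[OF that] T_ne[of x] that by (auto simp: M'_def)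
  have iff: "T x = x \<longleftrightarrow> T (f x) = f x"
  proof
    assume e: "T x = x"
    then have "w = x" using fibre_cases[OF x w(1,2)] by auto
    then show "T (f x) = f x" using w by simp
  next
    assume e: "T (f x) = f x"
    then have "f (T x) = f x" using c by auto
    then show "T x = x" using b x T_in unfolding bij_betw_def by (metis inj_onD)
  qed
  show "f (T x) = T (f x)"
  proof (cases "T x = x")
    case True then show ?thesis using iff by simp
  next
    case False
    then have "f (T x) \<noteq> f x" using b x T_in unfolding bij_betw_def by (metis inj_onD)
    then show ?thesis using c by blast
  qed
  show "q (f x) \<in> L \<longleftrightarrow> q x \<in> L" using iff Tx x fx by blast
qed

text \<open>L is characterised by the size of the fibres, so preservation of L comes for free from
  preservation of the fibres.\<close>

lemma desc_link_homeo:
  assumes f: "f \<in> Bij M" "fiber_preserving M q f" "pl_map M f"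
  shows "link_homeo (desc f)" "desc f \<in> Bij S3"
proof -
  have b: "bij_betw f M M" using f(1) by (simp add: Bij_def)
  have fM: "f x \<in> M" if "x \<in> M" for x using b that unfolding bij_betw_def by blast
  note dq = desc_q[OF f(1,2)]
  have lift: "\<exists>x\<in>M. q x = y" if "y \<in> S3" for y using that q_image by blast
  have inj: "inj_on (desc f) S3"
  proof (rule inj_onI)
    fix y y' assume y: "y \<in> S3" "y' \<in> S3" "desc f y = desc f y'"
    obtain x x' where x: "x \<in> M" "q x = y" "x' \<in> M" "q x' = y'" using lift y by metis
    have "q (f x') = q (f x)" using dq x y(3) by metis
    then have "f x' \<in> f ` {z \<in> M. q z = q x}" using fiber_preserving_imp[OF f(1,2) x(1)] fM[OF x(3)] by blast
    then obtain w where "w \<in> M" "q w = q x" "f x' = f w" by blast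
    then show "y = y'" using b x unfolding bij_betw_def by (metis inj_onD)
  qed
  have surj: "desc f ` S3 = S3"
  proof
    show "desc f ` S3 \<subseteq> S3"
    proof clarify
      fix y assume "y \<in> S3"
      then obtain x where x: "x \<in> M" "q x = y" using lift by metis
      then show "desc f y \<in> S3" using dq[OF x(1)] q_in[OF fM[OF x(1)]] by simp
    qed
    show "S3 \<subseteq> desc f ` S3"
    proof
      fix y assume "y \<in> S3"
      then obtain x where x: "x \<in> M" "q x = y" using lift by metis
      then obtain x' where x': "x' \<in> M" "f x' = x" using b unfolding bij_betw_def by (metis imageE)
      then have "desc f (q x') = y" using dq[OF x'(1)] x by simp
      then show "y \<in> desc f ` S3" using q_in[OF x'(1)] by blast
    qed
  qed
  have L: "desc f y \<in> L \<longleftrightarrow> y \<in> L" if y: "y \<in> S3" for y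
  proof -
    obtain x where x: "x \<in> M" "q x = y" using lift y by metis
    then show ?thesis using dq[OF x(1)] fiber_preserving_T(2)[OF f(1,2) x(1)] by simp
  qed
  have "desc f ` L = L"
  proof
    show "desc f ` L \<subseteq> L" using L L_sub by blast
    show "L \<subseteq> desc f ` L"
    proof
      fix y assume y: "y \<in> L"
      then obtain y' where "y' \<in> S3" "y = desc f y'" using surj L_sub by blast
      then show "y \<in> desc f ` L" using L y by blast
    qed
  qed
  moreover have "pl_map (q ` M) (desc f)"
  proof (rule pl_map_descend[OF pl_q finite_fibre])
    show "pl_map M (q \<circ> f)" by (rule pl_map_compose[OF f(3) pl_q]) (use fM in blast)
  qed (use dq in simp)
  ultimately show "link_homeo (desc f)" using inj surj q_image unfolding link_homeo_def bij_betw_def by simp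
  show "desc f \<in> Bij S3" using inj surj by (simp add: Bij_def bij_betw_def desc_def)
qed

text \<open>The isotopy descends along the product of q with the identity of the time interval,
  which is again PL with finite fibres.\<close>

lemma desc_isotopy:
  fixes H :: "real \<Rightarrow> 'b \<Rightarrow> 'b"
  assumes H: "pl_map (M \<times> {0..1}) (\<lambda>(x, t). H t x)" "\<And>t. t \<in> {0..1} \<Longrightarrow> H t \<in> Bij M \<and> fiber_preserving M q (H t)"
  shows "pl_map (S3 \<times> {0..1}) (\<lambda>(y, t). desc (H t) y)"
proof -
  have HM: "H t x \<in> M" if "t \<in> {0..1}" "x \<in> M" for t x using H(2)[OF that(1)] Bij_imp_funcset that(2) by blast
  have "pl_map ((\<lambda>(x, t). (q x, t)) ` (M \<times> {0..1})) (\<lambda>(y, t). desc (H t) y)"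
  proof (rule pl_map_descend)
    show "pl_map (M \<times> {0..1}) (\<lambda>(x, t). (q x, t::real))" by (rule pl_map_Times_id[OF pl_q polytope_real_interval])
    show "pl_map (M \<times> {0..1}) (q \<circ> (\<lambda>(x, t). H t x))" by (rule pl_map_compose[OF H(1) pl_q]) (use HM in auto)
    show "finite {z \<in> M \<times> {0..1}. (case z of (x, t) \<Rightarrow> (q x, t::real)) = y}" for y
    proof (rule finite_subset)
      show "{z \<in> M \<times> {0..1}. (case z of (x, t) \<Rightarrow> (q x, t::real)) = y} \<subseteq> {x \<in> M. q x = fst y} \<times> {snd y}" by auto
      show "finite ({x \<in> M. q x = fst y} \<times> {snd y})" using finite_fibre by simp
    qed
    show "(case (case z of (x, t) \<Rightarrow> (q x, t)) of (y, t) \<Rightarrow> desc (H t) y) = (q \<circ> (\<lambda>(x, t). H t x)) z"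
      if "z \<in> M \<times> {0..1}" for z using that H(2) desc_q by auto
  qed
  moreover have "(\<lambda>(x, t). (q x, t)) ` (M \<times> {0..1::real}) = S3 \<times> {0..1}" using q_image by force
  ultimately show ?thesis by simp
qed

lemma desc_eq:
  assumes f: "f \<in> Bij M" "fiber_preserving M q f" and g: "\<And>x. x \<in> M \<Longrightarrow> q (f x) = g (q x)" "g \<in> extensional S3"
  shows "desc f = g"
proof
  fix y show "desc f y = g y"
  proof (cases "y \<in> S3")
    case True
    then obtain x where x: "x \<in> M" "q x = y" using q_image by blast
    then show ?thesis using desc_q[OF f x(1)] g(1)[OF x(1)] by simp
  next
    case False then show ?thesis using g(2) by (simp add: desc_def extensional_def)
  qed
qed

lemma equi_lift_fiber_preserving:
  assumes g: "link_homeo g" and f: "equi_lift g f" shows "fiber_preserving M q f"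
  unfolding fiber_preserving_def
proof
  fix y assume "y \<in> q ` M"
  then obtain x where x: "x \<in> M" "y = q x" by blast
  have b: "bij_betw f M M" and fq: "\<And>x. x \<in> M \<Longrightarrow> q (f x) = g (q x)" using f by (auto simp: equi_lift_def Bij_def)
  have fM: "f x \<in> M" if "x \<in> M" for x using b that unfolding bij_betw_def by blast
  have "f ` {z \<in> M. q z = y} = {z \<in> M. q z = q (f x)}"
  proof
    show "f ` {z \<in> M. q z = y} \<subseteq> {z \<in> M. q z = q (f x)}" using fq fM x by auto
    show "{z \<in> M. q z = q (f x)} \<subseteq> f ` {z \<in> M. q z = y}"
    proof
      fix z assume z: "z \<in> {z \<in> M. q z = q (f x)}"
      then obtain w where w: "w \<in> M" "z = f w" using b unfolding bij_betw_def by blast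
      then have "g (q w) = g (q x)" using z fq x by auto
      then have "q w = q x" using g q_in w x unfolding link_homeo_def bij_betw_def by (metis inj_onD)
      then show "z \<in> f ` {z \<in> M. q z = y}" using w x by blast
    qed
  qed
  then show "\<exists>y'\<in>q ` M. f ` {x \<in> M. q x = y} = {x \<in> M. q x = y'}" using fM[OF x(1)] by blast
qed

text \<open>f, the identity and T all lift the identity of the sphere, and there are only two lifts
  over the connected sphere.\<close>

lemma deck_unique:
  assumes f: "f \<in> Bij M" "pl_map M f" "fiber_preserving M q f" and qf: "\<And>x. x \<in> M \<Longrightarrow> q (f x) = q x"
  shows "f = (\<lambda>x\<in>M. x) \<or> f = T"
proof -
  have fM: "f x \<in> M" if "x \<in> M" for x using Bij_imp_funcset[OF f(1)] that by blast
  have over: "over S3 = M'" using q_in by (auto simp: over_def M'_def)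
  have fM': "f x \<in> M'" if "x \<in> M'" for x using that fM qf by (auto simp: M'_def)
  have l1: "lifts (\<lambda>y. y) S3 f" unfolding lifts_def over
    using continuous_on_subset[OF pl_map_continuous[OF f(2)] M'_sub] fM' qf M'_sub fiber_preserving_T(1)[OF f(1,3)] by blast
  have l2: "lifts (\<lambda>y. y) S3 (\<lambda>x. x)" unfolding lifts_def over by (auto intro: continuous_on_id)
  note l3 = lifts_T[OF l2]
  have S3: "openin (top_of_set S3) S3" by simp
  have "S3 \<noteq> {}" using L_ne L_sub by blast
  then obtain x0 where x0: "x0 \<in> over S3" using over_nonempty[OF S3] by blast
  then have x0M: "x0 \<in> M" using over_sub by blast
  have ext: "f = h" if h: "h \<in> extensional M" "\<And>x. x \<in> M' \<Longrightarrow> f x = h x" "\<And>x. x \<in> M \<Longrightarrow> q x \<in> L \<Longrightarrow> h x = x" for h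
  proof
    fix x show "f x = h x"
    proof (cases "x \<in> M")
      case True
      then show ?thesis using h(2)[of x] h(3)[OF True] fibre_L_single[of x "f x"] fM qf by (cases "q x \<in> L") (auto simp: M'_def)
    next
      case False then show ?thesis using h(1) Bij_imp_extensional[OF f(1)] by (simp add: extensional_def)
    qed
  qed
  consider "f x0 = x0" | "f x0 = T x0" using fibre_cases[OF x0M fM[OF x0M]] qf[OF x0M] by blast
  then show ?thesis
  proof cases
    case 1
    have eq: "f x = x" if "x \<in> M'" for x
      by (rule lifts_unique[OF S3 connected_S3 l1 l2 x0 1]) (use that over in simp)
    have "f = (\<lambda>x\<in>M. x)" by (rule ext) (use M'_sub eq in auto)
    then show ?thesis ..
  next
    case 2
    have eq: "f x = T x" if "x \<in> M'" for x
      by (rule lifts_unique[OF S3 connected_S3 l1 l3 x0 2]) (use that over in simp)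
    have "f = T" by (rule ext) (use T_L eq Bij_imp_extensional[OF T_Bij] in auto)
    then show ?thesis ..
  qed
qed

lemma T_equi_lift: "equi_lift (\<lambda>y\<in>S3. y) T"
  unfolding equi_lift_def using T_Bij pl_T q_in by auto

lemma image_preimage_desc:
  assumes f: "f \<in> Bij M" "fiber_preserving M q f" and B: "B \<subseteq> S3"
  shows "f ` {x \<in> M. q x \<in> B} = {x \<in> M. q x \<in> B} \<longleftrightarrow> desc f ` B = B"
proof -
  have b: "bij_betw f M M" using f(1) by (simp add: Bij_def)
  note dq = desc_q[OF f]
  have qV: "q ` {x \<in> M. q x \<in> A} = A" if "A \<subseteq> S3" for A by (rule image_preimage[OF that])
  have qfV: "q ` f ` {x \<in> M. q x \<in> B} = desc f ` B"
  proof -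
    have "q ` f ` {x \<in> M. q x \<in> B} = desc f ` q ` {x \<in> M. q x \<in> B}"
      unfolding image_image by (rule image_cong) (use dq in auto)
    then show ?thesis using qV[OF B] by simp
  qed
  show ?thesis
  proof
    assume "f ` {x \<in> M. q x \<in> B} = {x \<in> M. q x \<in> B}"
    then show "desc f ` B = B" using qfV qV[OF B] by simp
  next
    assume d: "desc f ` B = B"
    show "f ` {x \<in> M. q x \<in> B} = {x \<in> M. q x \<in> B}"
    proof
      show "f ` {x \<in> M. q x \<in> B} \<subseteq> {x \<in> M. q x \<in> B}"
        using d dq b unfolding bij_betw_def by (auto simp flip: dq)
      show "{x \<in> M. q x \<in> B} \<subseteq> f ` {x \<in> M. q x \<in> B}"
      proof
        fix x assume x: "x \<in> {x \<in> M. q x \<in> B}"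
        then obtain w where w: "w \<in> M" "x = f w" using b unfolding bij_betw_def by blast
        then have "q x \<in> desc f ` B" using x d by simp
        then obtain y where y: "y \<in> B" "q x = desc f y" by blast
        obtain v where v: "v \<in> M" "q v = y" using y(1) B q_image by blast
        have "q (f v) = q (f w)" using dq[OF v(1)] v y w by simp
        then have "f w \<in> f ` {z \<in> M. q z = q v}" using fiber_preserving_imp[OF f v(1)] b w unfolding bij_betw_def by auto
        then obtain u where "u \<in> M" "q u = q v" "f w = f u" by blast
        then have "w = u" "q u = y" using b w v unfolding bij_betw_def by (metis inj_onD, simp)
        then show "x \<in> f ` {x \<in> M. q x \<in> B}" using w y by blast
      qed
    qed
  qed
qed

end

subsection \<open>Comparing local orientations through local homeomorphisms\<close>

abbreviation HR :: "real^3 \<Rightarrow> (real^3) chain set monoid" where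
  "HR p \<equiv> relative_homology_group 3 R3 (- {p})"

abbreviation push :: "'a::euclidean_space set \<Rightarrow> (real^3 \<Rightarrow> 'a) \<Rightarrow> real^3 \<Rightarrow> (real^3) chain set \<Rightarrow> 'a chain set" where
  "push X e p \<equiv> hom_induced 3 R3 (- {p}) (top_of_set X) (X - {e p}) e"

lemma push_iso: "chart3 X e \<Longrightarrow> push X e p \<in> iso (HR p) (LH X (X - {e p}))"
  by (rule chart3_iso_point)

lemma push_surj: assumes "chart3 X e" "a \<in> carrier (LH X (X - {e p}))" obtains c where "c \<in> carrier (HR p)" "push X e p c = a"
proof -
  have "push X e p ` carrier (HR p) = carrier (LH X (X - {e p}))"
    using push_iso[OF assms(1), of p] by (simp add: iso_def bij_betw_def)
  then have "a \<in> push X e p ` carrier (HR p)" using assms(2) by simp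
  then show ?thesis using that by (elim imageE) simp
qed

lemma chart3_surj:
  assumes "chart3 X e" "bounded K" "a \<in> carrier (LH X (X - e ` K))"
  obtains c where "c \<in> carrier (relative_homology_group 3 R3 (- K))" "hom_induced 3 R3 (- K) (top_of_set X) (X - e ` K) e c = a"
proof -
  have "hom_induced 3 R3 (- K) (top_of_set X) (X - e ` K) e ` carrier (relative_homology_group 3 R3 (- K)) = carrier (LH X (X - e ` K))"
    using chart3_iso[OF assms(1,2)] by (simp add: iso_def bij_betw_def)
  then have "a \<in> hom_induced 3 R3 (- K) (top_of_set X) (X - e ` K) e ` carrier (relative_homology_group 3 R3 (- K))" using assms(3) by simp
  then show ?thesis using that by (elim imageE) simp
qed

lemma push_inj: "chart3 X e \<Longrightarrow> c \<in> carrier (HR p) \<Longrightarrow> c' \<in> carrier (HR p) \<Longrightarrow> push X e p c = push X e p c' \<Longrightarrow> c = c'"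
  using push_iso[of X e p] unfolding iso_def bij_betw_def by (auto dest: inj_onD)

lemma push_comp:
  assumes e: "chart3 X e" and s: "continuous_on UNIV s" "inj s"
  shows "push X (e \<circ> s) p c = push X e (s p) (hom_induced 3 R3 (- {p}) R3 (- {s p}) s c)"
proof -
  note ef = chart3_facts[OF e]
  have "push X e (s p) (hom_induced 3 R3 (- {p}) R3 (- {s p}) s c)
    = hom_induced 3 R3 (- {p}) (top_of_set X) (X - {e (s p)}) (e \<circ> s) c"
  proof (rule hom_induced_compose')
    show "continuous_map R3 R3 s" using s by simp
    show "s \<in> - {p} \<rightarrow> - {s p}" using s(2) by (auto simp: inj_def)
    show "continuous_map R3 (top_of_set X) e" using ef by (auto simp: continuous_map_in_subtopology)
    show "e \<in> - {s p} \<rightarrow> X - {e (s p)}" using ef(1,3) by (auto simp: inj_def)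
  qed
  then show ?thesis by simp
qed

text \<open>The graph of the isomorphism of local homology induced by the germ of h at z. It is
  defined through a chart since h need not map the complement of z into that of h z: the covering q
  takes the second point of the fibre to q z.\<close>

definition corr where
  "corr X Y h z a b \<longleftrightarrow> (\<exists>e p. chart3 X e \<and> chart3 Y (h \<circ> e) \<and> e p = z \<and>
     (\<exists>c\<in>carrier (HR p). a = push X e p c \<and> b = push Y (h \<circ> e) p c))"

lemma chart3_factor:
  assumes e: "chart3 X e" and d: "chart3 X d" "range d \<subseteq> range e"
  obtains s where "continuous_on UNIV s" "inj s" "d = e \<circ> s"
proof -
  obtain e' where e': "homeomorphism UNIV (range e) e e'" using e unfolding chart3_def by blast
  have des: "e (e' (d z)) = d z" for z using e' d(2) unfolding homeomorphism_def by blast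
  have "continuous_on UNIV (e' \<circ> d)"
    using continuous_on_compose[OF chart3_facts(2)[OF d(1)]] e' d(2) continuous_on_subset unfolding homeomorphism_def by blast
  moreover have "inj (e' \<circ> d)" using chart3_facts(1)[OF d(1)] des unfolding inj_def by (metis comp_apply)
  moreover have "d = e \<circ> (e' \<circ> d)" using des by auto
  ultimately show ?thesis by (rule that)
qed

text \<open>The relation does not depend on the chart: two charts around z contain a common smaller
  one, through which the classes of both are compared.\<close>

lemma corr_chart:
  assumes X: "locally_R3 X" and r: "corr X Y h z a b" and e: "chart3 X e" "chart3 Y (h \<circ> e)" "e p = z"
  obtains c where "c \<in> carrier (HR p)" "a = push X e p c" "b = push Y (h \<circ> e) p c"
proof -
  obtain e1 p1 c1 where 1: "chart3 X e1" "chart3 Y (h \<circ> e1)" "e1 p1 = z" "c1 \<in> carrier (HR p1)"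
    "a = push X e1 p1 c1" "b = push Y (h \<circ> e1) p1 c1" using r unfolding corr_def by blast
  have "openin (top_of_set X) (range e \<inter> range e1)" using chart3_facts(4)[OF e(1)] chart3_facts(4)[OF 1(1)] by (rule openin_Int)
  moreover have "z \<in> range e \<inter> range e1" using e(3) 1(3) by (metis IntI rangeI)
  ultimately obtain d where d: "chart3 X d" "d 0 = z" "range d \<subseteq> range e \<inter> range e1" using small_chart3[OF X] by metis
  obtain s where s: "continuous_on UNIV s" "inj s" "d = e \<circ> s" using chart3_factor[OF e(1) d(1)] d(3) by auto
  obtain t where t: "continuous_on UNIV t" "inj t" "d = e1 \<circ> t" using chart3_factor[OF 1(1) d(1)] d(3) by auto
  have s0: "s 0 = p" using s(3) e(1,3) d(2) chart3_facts(1) by (auto simp: inj_def)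
  have t0: "t 0 = p1" using t(3) 1(1,3) d(2) chart3_facts(1) by (auto simp: inj_def)
  have "a \<in> carrier (LH X (X - {d 0}))" unfolding 1(5) using 1(3) d(2) by (simp add: hom_induced_carrier)
  then obtain c where c: "c \<in> carrier (HR 0)" "push X d 0 c = a" by (rule push_surj[OF d(1)])
  define cs where "cs = hom_induced 3 R3 (- {0}) R3 (- {p}) s c"
  define ct where "ct = hom_induced 3 R3 (- {0}) R3 (- {p1}) t c"
  have as: "a = push X e p cs" using push_comp[OF e(1) s(1,2), of 0 c] c(2) s(3) s0 by (simp add: cs_def)
  have at: "a = push X e1 p1 ct" using push_comp[OF 1(1) t(1,2), of 0 c] c(2) t(3) t0 by (simp add: ct_def)
  have "ct = c1"
    by (rule push_inj[OF 1(1), of _ p1]) (use at 1(4,5) in \<open>auto simp: ct_def hom_induced_carrier\<close>)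
  then have "b = push Y (h \<circ> e1) p1 ct" using 1(6) by simp
  also have "\<dots> = push Y ((h \<circ> e1) \<circ> t) 0 c" using push_comp[OF 1(2) t(1,2), of 0 c] t0 by (simp add: ct_def)
  also have "(h \<circ> e1) \<circ> t = (h \<circ> e) \<circ> s" using s(3) t(3) by (metis comp_assoc)
  also have "push Y ((h \<circ> e) \<circ> s) 0 c = push Y (h \<circ> e) p cs" using push_comp[OF e(2) s(1,2), of 0 c] s0 by (simp add: cs_def)
  finally have b: "b = push Y (h \<circ> e) p cs" .
  show ?thesis by (rule that[of cs, OF _ as b]) (simp add: cs_def hom_induced_carrier)
qed

lemma corr_unique:
  assumes X: "locally_R3 X" and r: "corr X Y h z a b" "corr X Y h z a' b'"
  shows "a = a' \<longleftrightarrow> b = b'"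
proof -
  obtain e p c where 1: "chart3 X e" "chart3 Y (h \<circ> e)" "e p = z" "c \<in> carrier (HR p)"
    "a = push X e p c" "b = push Y (h \<circ> e) p c" using r(1) unfolding corr_def by blast
  obtain c' where c': "c' \<in> carrier (HR p)" "a' = push X e p c'" "b' = push Y (h \<circ> e) p c'"
    by (rule corr_chart[OF X r(2) 1(1-3)])
  show ?thesis using push_inj[OF 1(1) 1(4) c'(1)] push_inj[OF 1(2) 1(4) c'(1)] 1 c' by auto
qed

lemma corr_ex:
  assumes "chart3 X e" "chart3 Y (h \<circ> e)" "e p = z"
  shows "a \<in> carrier (LH X (X - {z})) \<Longrightarrow> \<exists>b. corr X Y h z a b"
    and "b \<in> carrier (LH Y (Y - {h z})) \<Longrightarrow> \<exists>a. corr X Y h z a b"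
proof -
  show "\<exists>b. corr X Y h z a b" if a: "a \<in> carrier (LH X (X - {z}))"
  proof -
    have "a \<in> carrier (LH X (X - {e p}))" using a assms(3) by simp
    then obtain c where "c \<in> carrier (HR p)" "push X e p c = a" by (rule push_surj[OF assms(1)])
    then show ?thesis using assms unfolding corr_def by blast
  qed
  show "\<exists>a. corr X Y h z a b" if b: "b \<in> carrier (LH Y (Y - {h z}))"
  proof -
    have "b \<in> carrier (LH Y (Y - {(h \<circ> e) p}))" using b assms(3) by simp
    then obtain c where "c \<in> carrier (HR p)" "push Y (h \<circ> e) p c = b" by (rule push_surj[OF assms(2)])
    then show ?thesis using assms unfolding corr_def by blast
  qed
qed

lemma corr_carrier: "corr X Y h z a b \<Longrightarrow> a \<in> carrier (LH X (X - {z})) \<and> b \<in> carrier (LH Y (Y - {h z}))"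
  unfolding corr_def by (auto simp: hom_induced_carrier)

lemma corr_gen:
  assumes "corr X Y h z a b" shows "gen (LH X (X - {z})) a \<longleftrightarrow> gen (LH Y (Y - {h z})) b"
proof -
  obtain e p c where 1: "chart3 X e" "chart3 Y (h \<circ> e)" "e p = z" "c \<in> carrier (HR p)"
    "a = push X e p c" "b = push Y (h \<circ> e) p c" using assms unfolding corr_def by blast
  show ?thesis using gen_iso[OF _ _ push_iso[OF 1(1)] 1(4)] gen_iso[OF _ _ push_iso[OF 1(2)] 1(4)] 1(3,5,6) by simp
qed

lemma hom_induced_inv:
  "c \<in> carrier (relative_homology_group n A B) \<Longrightarrow>
   hom_induced n A B C D f (inv\<^bsub>relative_homology_group n A B\<^esub> c) = inv\<^bsub>relative_homology_group n C D\<^esub> (hom_induced n A B C D f c)"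
  by (intro group_hom.hom_inv) (simp_all add: group_hom_def group_hom_axioms_def hom_induced_hom)

lemma corr_inv:
  assumes "corr X Y h z a b" shows "corr X Y h z (inv\<^bsub>LH X (X - {z})\<^esub> a) (inv\<^bsub>LH Y (Y - {h z})\<^esub> b)"
proof -
  obtain e p c where 1: "chart3 X e" "chart3 Y (h \<circ> e)" "e p = z" "c \<in> carrier (HR p)"
    "a = push X e p c" "b = push Y (h \<circ> e) p c" using assms unfolding corr_def by blast
  have "inv\<^bsub>HR p\<^esub> c \<in> carrier (HR p)" using 1(4) by (simp add: group.inv_closed)
  moreover have "inv\<^bsub>LH X (X - {z})\<^esub> a = push X e p (inv\<^bsub>HR p\<^esub> c)" using 1(3,5) by (simp add: hom_induced_inv[OF 1(4)])
  moreover have "inv\<^bsub>LH Y (Y - {h z})\<^esub> b = push Y (h \<circ> e) p (inv\<^bsub>HR p\<^esub> c)" using 1(3,6) by (auto simp: hom_induced_inv[OF 1(4)])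
  ultimately show ?thesis using 1 unfolding corr_def by blast
qed

lemma chart3_compose_homeo:
  assumes e: "chart3 X e" "range e \<subseteq> t" and h: "homeomorphism t u h k" "t \<subseteq> X" "openin (top_of_set Y) u"
  shows "chart3 Y (h \<circ> e)"
proof -
  obtain e' where e': "homeomorphism UNIV (range e) e e'" using e(1) unfolding chart3_def by blast
  have "homeomorphism (range e) (h ` range e) h k" by (rule homeomorphism_of_subsets[OF h(1) e(2)]) (use e(2) h(1) in \<open>auto simp: homeomorphism_def\<close>)
  then have "homeomorphism UNIV (range (h \<circ> e)) (h \<circ> e) (e' \<circ> k)" using homeomorphism_compose[OF e'] by (simp add: image_comp)
  moreover have "openin (top_of_set t) (range e)" by (rule openin_subset_trans[OF chart3_facts(4)[OF e(1)] e(2) h(2)])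
  then have "openin (top_of_set u) (h ` range e)" by (rule homeomorphism_imp_open_map[OF h(1)])
  then have "openin (top_of_set Y) (range (h \<circ> e))" using openin_trans[OF _ h(3)] by (simp add: image_comp)
  ultimately show ?thesis unfolding chart3_def by blast
qed

lemma push_homeo:
  assumes e: "chart3 X e" and f: "homeomorphism X Y f k"
  shows "chart3 Y (f \<circ> e)"
    and "push Y (f \<circ> e) p c = hom_induced 3 (top_of_set X) (X - {e p}) (top_of_set Y) (Y - {f (e p)}) f (push X e p c)"
proof -
  note ef = chart3_facts[OF e]
  show "chart3 Y (f \<circ> e)" by (rule chart3_compose_homeo[OF e ef(3) f]) auto
  have "hom_induced 3 (top_of_set X) (X - {e p}) (top_of_set Y) (Y - {f (e p)}) f (push X e p c) = hom_induced 3 R3 (- {p}) (top_of_set Y) (Y - {f (e p)}) (f \<circ> e) c"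
  proof (rule hom_induced_compose')
    show "continuous_map R3 (top_of_set X) e" using ef by (auto simp: continuous_map_in_subtopology)
    show "e \<in> - {p} \<rightarrow> X - {e p}" using ef(1,3) by (auto simp: inj_def)
    show "continuous_map (top_of_set X) (top_of_set Y) f" using f by (auto simp: continuous_map_in_subtopology homeomorphism_def)
    have k: "k (f x) = x" "f x \<in> Y" if "x \<in> X" for x using f that by (auto simp: homeomorphism_def)
    have p: "e p \<in> X" using ef(3) by auto
    show "f \<in> X - {e p} \<rightarrow> Y - {f (e p)}"
    proof
      fix x assume x: "x \<in> X - {e p}"
      then have "f x \<noteq> f (e p)" using k(1)[of x] k(1)[OF p] by auto
      then show "f x \<in> Y - {f (e p)}" using k(2)[of x] x by simp
    qed
  qed
  then show "push Y (f \<circ> e) p c = hom_induced 3 (top_of_set X) (X - {e p}) (top_of_set Y) (Y - {f (e p)}) f (push X e p c)" by simp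
qed

text \<open>For a homeomorphism an induced map exists and the relation is its graph. This is the
  link to the definition of orientation preserving maps.\<close>

lemma corr_homeo:
  assumes X: "locally_R3 X" and f: "homeomorphism X Y f k" and z: "z \<in> X"
  shows "corr X Y f z a b \<longleftrightarrow> a \<in> carrier (LH X (X - {z})) \<and> b = hom_induced 3 (top_of_set X) (X - {z}) (top_of_set Y) (Y - {f z}) f a"
proof -
  obtain e where e: "chart3 X e" "e 0 = z" using X z unfolding locally_R3_def by blast
  have imp: "b = hom_induced 3 (top_of_set X) (X - {z}) (top_of_set Y) (Y - {f z}) f a" if c: "corr X Y f z a b" for a b
  proof -
    obtain c where "c \<in> carrier (HR 0)" "a = push X e 0 c" "b = push Y (f \<circ> e) 0 c"
      by (rule corr_chart[OF X c e(1) push_homeo(1)[OF e(1) f] e(2)])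
    then show ?thesis using push_homeo(2)[OF e(1) f, of 0 c] e(2) by simp
  qed
  show ?thesis using imp corr_carrier corr_ex(1)[OF e(1) push_homeo(1)[OF e(1) f] e(2)] by metis
qed

lemma corr_equivariant:
  assumes f: "homeomorphism X X f f'" and g: "homeomorphism Y Y g g'" and h: "\<And>x. x \<in> X \<Longrightarrow> h (f x) = g (h x)"
    and c: "corr X Y h z a b"
  shows "corr X Y h (f z) (hom_induced 3 (top_of_set X) (X - {z}) (top_of_set X) (X - {f z}) f a)
    (hom_induced 3 (top_of_set Y) (Y - {h z}) (top_of_set Y) (Y - {g (h z)}) g b)"
proof -
  obtain e p c where 1: "chart3 X e" "chart3 Y (h \<circ> e)" "e p = z" "c \<in> carrier (HR p)"
    "a = push X e p c" "b = push Y (h \<circ> e) p c" using c unfolding corr_def by blast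
  have eq: "h \<circ> (f \<circ> e) = g \<circ> (h \<circ> e)" using h subsetD[OF chart3_facts(3)[OF 1(1)] rangeI] by (simp add: fun_eq_iff)
  note F = push_homeo[OF 1(1) f] and G = push_homeo[OF 1(2) g]
  have "chart3 Y (h \<circ> (f \<circ> e))" unfolding eq by (rule G)
  moreover have "push Y (h \<circ> (f \<circ> e)) p c = hom_induced 3 (top_of_set Y) (Y - {h z}) (top_of_set Y) (Y - {g (h z)}) g b"
    unfolding eq using G(2)[of p c] 1(3,6) by auto
  moreover have "push X (f \<circ> e) p c = hom_induced 3 (top_of_set X) (X - {z}) (top_of_set X) (X - {f z}) f a" using F(2)[of p c] 1(3,5) by simp
  ultimately show ?thesis using F(1) 1(3,4) unfolding corr_def by (metis comp_apply)
qed

text \<open>An orientation along a subset C, with local homology still taken in X. It allows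
  orientations to be considered on the part of M off the branch locus.\<close>

definition oriented where
  "oriented X C \<mu> \<longleftrightarrow> (\<forall>x\<in>C. gen (LH X (X - {x})) (\<mu> x) \<and>
     (\<exists>U. x \<in> U \<and> openin (top_of_set X) U \<and> (\<exists>\<alpha>\<in>carrier (LH X (X - U)). \<forall>y\<in>U. res X (X - U) (X - {y}) \<alpha> = \<mu> y)))"

lemma orientation_iff: "orientation 3 X \<mu> \<longleftrightarrow> oriented X X \<mu>"
proof -
  have i: "(\<lambda>z::'a. z) = id" by auto
  show ?thesis unfolding orientation_def oriented_def gen_def i by auto
qed

lemma oriented_inv:
  assumes X: "locally_R3 X" "C \<subseteq> X" and o: "oriented X C \<mu>" shows "oriented X C (\<lambda>x. inv\<^bsub>LH X (X - {x})\<^esub> \<mu> x)"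
  unfolding oriented_def
proof
  fix x assume x: "x \<in> C"
  then obtain U \<alpha> where U: "x \<in> U" "openin (top_of_set X) U" "\<alpha> \<in> carrier (LH X (X - U))" "\<forall>y\<in>U. res X (X - U) (X - {y}) \<alpha> = \<mu> y"
    and g: "gen (LH X (X - {x})) (\<mu> x)" using o unfolding oriented_def by metis
  have "gen (LH X (X - {x})) (inv\<^bsub>LH X (X - {x})\<^esub> \<mu> x)"
    by (rule infinite_cyclic_gen(3)[OF _ local_homology g]) (use X x in auto)
  moreover have "inv\<^bsub>LH X (X - U)\<^esub> \<alpha> \<in> carrier (LH X (X - U))" using U(3) by (simp add: group.inv_closed)
  moreover have "\<forall>y\<in>U. res X (X - U) (X - {y}) (inv\<^bsub>LH X (X - U)\<^esub> \<alpha>) = inv\<^bsub>LH X (X - {y})\<^esub> \<mu> y" using U(4) by (simp add: hom_induced_inv[OF U(3)])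
  ultimately show "gen (LH X (X - {x})) (inv\<^bsub>LH X (X - {x})\<^esub> \<mu> x) \<and>
     (\<exists>U. x \<in> U \<and> openin (top_of_set X) U \<and> (\<exists>\<alpha>\<in>carrier (LH X (X - U)). \<forall>y\<in>U. res X (X - U) (X - {y}) \<alpha> = inv\<^bsub>LH X (X - {y})\<^esub> \<mu> y))"
    using U(1,2) by blast
qed

text \<open>A local homeomorphism, in the form that arbitrarily small charts of X are carried by h
  to charts of Y.\<close>

definition charted where
  "charted X Y C h \<longleftrightarrow> continuous_on C h \<and> openin (top_of_set X) C \<and> (\<forall>x\<in>C. \<forall>\<Omega>. openin (top_of_set X) \<Omega> \<and> x \<in> \<Omega> \<longrightarrow>
     (\<exists>e. chart3 X e \<and> chart3 Y (h \<circ> e) \<and> e 0 = x \<and> range e \<subseteq> \<Omega> \<inter> C))"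

text \<open>In a small chart both classes come from classes of the Euclidean space relative to the
  complement of a ball. These coincide at the centre, hence coincide, hence correspond at every
  point of the ball.\<close>

lemma corr_open:
  assumes X: "locally_R3 X" and h: "charted X Y C h" and x: "x \<in> C"
    and U: "x \<in> U" "openin (top_of_set X) U" "\<alpha> \<in> carrier (LH X (X - U))"
    and V: "h x \<in> V" "openin (top_of_set Y) V" "\<beta> \<in> carrier (LH Y (Y - V))"
    and r: "corr X Y h x (res X (X - U) (X - {x}) \<alpha>) (res Y (Y - V) (Y - {h x}) \<beta>)"
  shows "\<exists>W. openin (top_of_set X) W \<and> x \<in> W \<and> W \<subseteq> C \<inter> U \<and> (\<forall>y\<in>W. h y \<in> V \<and> corr X Y h y (res X (X - U) (X - {y}) \<alpha>) (res Y (Y - V) (Y - {h y}) \<beta>))"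
proof -
  obtain V' where V': "open V'" "V = Y \<inter> V'" using V(2) by (auto simp: openin_open)
  have hC: "continuous_on C h" "openin (top_of_set X) C" using h by (auto simp: charted_def)
  have "openin (top_of_set C) (C \<inter> h -` V')" by (rule continuous_openin_preimage_gen[OF hC(1) V'(1)])
  then have "openin (top_of_set X) (C \<inter> h -` V')" using hC(2) openin_trans by blast
  then have "openin (top_of_set X) (U \<inter> (C \<inter> h -` V'))" using U(2) openin_Int by blast
  moreover have "x \<in> U \<inter> (C \<inter> h -` V')" using x U(1) V(1) V' by auto
  ultimately obtain e where e: "chart3 X e" "chart3 Y (h \<circ> e)" "e 0 = x" "range e \<subseteq> U \<inter> (C \<inter> h -` V') \<inter> C"
    using h x unfolding charted_def by meson
  have hV: "range (h \<circ> e) \<subseteq> V" using e(4) chart3_facts(3)[OF e(2)] V' by auto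
  let ?B = "ball (0::real^3) 1"
  have bB: "bounded ?B" by simp
  have BU: "e ` ?B \<subseteq> U" using e(4) by auto
  have BV: "(h \<circ> e) ` ?B \<subseteq> V" using hV by auto
  obtain c where c: "c \<in> carrier (relative_homology_group 3 R3 (- ?B))"
    "hom_induced 3 R3 (- ?B) (top_of_set X) (X - e ` ?B) e c = res X (X - U) (X - e ` ?B) \<alpha>"
    by (rule chart3_surj[OF e(1) bB hom_induced_carrier])
  obtain c' where c': "c' \<in> carrier (relative_homology_group 3 R3 (- ?B))"
    "hom_induced 3 R3 (- ?B) (top_of_set Y) (Y - (h \<circ> e) ` ?B) (h \<circ> e) c' = res Y (Y - V) (Y - (h \<circ> e) ` ?B) \<beta>"
    by (rule chart3_surj[OF e(2) bB hom_induced_carrier])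
  let ?i = "\<lambda>p. hom_induced 3 R3 (- ?B) R3 (- {p}) id"
  have ex: "push X e p (?i p c) = res X (X - U) (X - {e p}) \<alpha>" if p: "p \<in> ?B" for p
  proof -
    have "push X e p (?i p c) = res X (X - e ` ?B) (X - {e p}) (hom_induced 3 R3 (- ?B) (top_of_set X) (X - e ` ?B) e c)"
      using chart3_square[OF e(1), of "{p}" ?B c] p by simp
    also have "\<dots> = res X (X - U) (X - {e p}) \<alpha>" unfolding c(2) by (rule res_res) (use BU p in auto)
    finally show ?thesis .
  qed
  have ey: "push Y (h \<circ> e) p (?i p c') = res Y (Y - V) (Y - {h (e p)}) \<beta>" if p: "p \<in> ?B" for p
  proof -
    have "push Y (h \<circ> e) p (?i p c') = res Y (Y - (h \<circ> e) ` ?B) (Y - {h (e p)}) (hom_induced 3 R3 (- ?B) (top_of_set Y) (Y - (h \<circ> e) ` ?B) (h \<circ> e) c')"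
      using chart3_square[OF e(2), of "{p}" ?B c'] p by simp
    also have "\<dots> = res Y (Y - V) (Y - {h (e p)}) \<beta>" unfolding c'(2) by (rule res_res) (use BV p in auto)
    finally show ?thesis .
  qed
  have cc: "c = c'"
  proof -
    have 0: "(0::real^3) \<in> ?B" by simp
    obtain c0 where c0: "c0 \<in> carrier (HR 0)" "res X (X - U) (X - {x}) \<alpha> = push X e 0 c0" "res Y (Y - V) (Y - {h x}) \<beta> = push Y (h \<circ> e) 0 c0"
      by (rule corr_chart[OF X r e(1-3)])
    have "?i 0 c = c0" by (rule push_inj[OF e(1) _ c0(1)]) (use ex[OF 0] c0(2) e(3) in \<open>auto simp: hom_induced_carrier\<close>)
    moreover have "?i 0 c' = c0" by (rule push_inj[OF e(2) _ c0(1)]) (use ey[OF 0] c0(3) e(3) in \<open>auto simp: hom_induced_carrier\<close>)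
    ultimately show ?thesis using iso_complement_ball[OF 0] c(1) c'(1) unfolding iso_def bij_betw_def by (auto dest: inj_onD)
  qed
  show ?thesis
  proof (intro exI[of _ "e ` ?B"] conjI ballI)
    show "openin (top_of_set X) (e ` ?B)" by (rule chart3_open[OF e(1)]) simp
    show "x \<in> e ` ?B" using e(3) by force
    show "e ` ?B \<subseteq> C \<inter> U" using e(4) by auto
    fix y assume "y \<in> e ` ?B"
    then obtain p where p: "p \<in> ?B" "y = e p" by blast
    show "h y \<in> V" using hV p by auto
    show "corr X Y h y (res X (X - U) (X - {y}) \<alpha>) (res Y (Y - V) (Y - {h y}) \<beta>)"
      unfolding corr_def using e(1,2) ex[OF p(1)] ey[OF p(1)] p(2) cc hom_induced_carrier by metis
  qed
qed

text \<open>The local groups are infinite cyclic, so a generator has exactly two possible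
  counterparts, inverse to and distinct from each other.\<close>

lemma gen_corr_dichotomy:
  assumes X: "locally_R3 X" "locally_R3 Y" and h: "charted X Y C h" and x: "x \<in> C"
    and g: "gen (LH X (X - {x})) a" "gen (LH Y (Y - {h x})) b"
  shows "corr X Y h x a b \<or> corr X Y h x a (inv\<^bsub>LH Y (Y - {h x})\<^esub> b)"
    and "\<not> (corr X Y h x a b \<and> corr X Y h x a (inv\<^bsub>LH Y (Y - {h x})\<^esub> b))"
proof -
  have CX: "C \<subseteq> X" using h openin_imp_subset unfolding charted_def by blast
  have "openin (top_of_set X) X" by simp
  then obtain e where e: "chart3 X e" "chart3 Y (h \<circ> e)" "e 0 = x" using h x CX unfolding charted_def by blast
  have hx: "h x \<in> Y" using chart3_facts(3)[OF e(2)] e(3) by auto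
  note iY = infinite_cyclic_gen[OF _ local_homology[OF X(2) hx]]
  have a: "a \<in> carrier (LH X (X - {x}))" using g(1) by (simp add: gen_def)
  obtain b' where b': "corr X Y h x a b'" using corr_ex(1)[OF e a] by blast
  have gb: "gen (LH Y (Y - {h x})) b'" using corr_gen[OF b'] g(1) by simp
  show "corr X Y h x a b \<or> corr X Y h x a (inv\<^bsub>LH Y (Y - {h x})\<^esub> b)"
    using iY(2)[OF _ g(2) gb] b' by auto
  show "\<not> (corr X Y h x a b \<and> corr X Y h x a (inv\<^bsub>LH Y (Y - {h x})\<^esub> b))"
  proof
    assume "corr X Y h x a b \<and> corr X Y h x a (inv\<^bsub>LH Y (Y - {h x})\<^esub> b)"
    then have "b = inv\<^bsub>LH Y (Y - {h x})\<^esub> b" using corr_unique[OF X(1)] by blast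
    then show False using infinite_cyclic_gen(4)[OF _ local_homology[OF X(2) hx] g(2)] by simp
  qed
qed

text \<open>Agreement with \<open>\<nu>\<close> and agreement with its inverse are both open
  conditions, and exactly one holds at each point; so the sign is constant on the connected set
  C.\<close>

lemma corr_constant:
  assumes X: "locally_R3 X" "locally_R3 Y" and h: "charted X Y C h" "connected C"
    and \<mu>: "oriented X C \<mu>" and \<nu>: "oriented Y (h ` C) \<nu>" and xy: "x \<in> C" "y \<in> C"
  shows "corr X Y h x (\<mu> x) (\<nu> (h x)) \<longleftrightarrow> corr X Y h y (\<mu> y) (\<nu> (h y))"
proof -
  let ?inv = "\<lambda>z. inv\<^bsub>LH Y (Y - {z})\<^esub> \<nu> z"
  have CX: "C \<subseteq> X" using h(1) openin_imp_subset unfolding charted_def by blast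
  have hCY: "h ` C \<subseteq> Y"
  proof
    fix w assume "w \<in> h ` C"
    then obtain x where x: "x \<in> C" "w = h x" by blast
    have "openin (top_of_set X) X" by simp
    then obtain e where e: "chart3 Y (h \<circ> e)" "e 0 = x" using h x CX unfolding charted_def by blast
    then show "w \<in> Y" using chart3_facts(3)[OF e(1)] x by auto
  qed
  have loc: "\<exists>W. openin (top_of_set X) W \<and> a \<in> W \<and> W \<subseteq> C \<and> (\<forall>y\<in>W. corr X Y h y (\<mu> y) (\<nu>' (h y)))"
    if \<nu>': "oriented Y (h ` C) \<nu>'" and a: "a \<in> C" and r: "corr X Y h a (\<mu> a) (\<nu>' (h a))" for \<nu>' a
  proof -
    obtain U \<alpha> where U: "a \<in> U" "openin (top_of_set X) U" "\<alpha> \<in> carrier (LH X (X - U))" "\<forall>y\<in>U. res X (X - U) (X - {y}) \<alpha> = \<mu> y"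
      using \<mu> a unfolding oriented_def by metis
    obtain V \<beta> where V: "h a \<in> V" "openin (top_of_set Y) V" "\<beta> \<in> carrier (LH Y (Y - V))" "\<forall>y\<in>V. res Y (Y - V) (Y - {y}) \<beta> = \<nu>' y"
      using \<nu>' a unfolding oriented_def by (metis imageI)
    have "corr X Y h a (res X (X - U) (X - {a}) \<alpha>) (res Y (Y - V) (Y - {h a}) \<beta>)" using r U V by simp
    from corr_open[OF X(1) h(1) a U(1-3) V(1-3) this]
    obtain W where W: "openin (top_of_set X) W" "a \<in> W" "W \<subseteq> C \<inter> U"
      "\<forall>y\<in>W. h y \<in> V \<and> corr X Y h y (res X (X - U) (X - {y}) \<alpha>) (res Y (Y - V) (Y - {h y}) \<beta>)" by blast
    have "corr X Y h y (\<mu> y) (\<nu>' (h y))" if "y \<in> W" for y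
    proof -
      have "y \<in> U" "h y \<in> V" using W that by auto
      then have "res X (X - U) (X - {y}) \<alpha> = \<mu> y" "res Y (Y - V) (Y - {h y}) \<beta> = \<nu>' (h y)" using U(4) V(4) by blast+
      then show ?thesis using bspec[OF W(4) that] by metis
    qed
    then show ?thesis using W by blast
  qed
  note di = gen_corr_dichotomy[OF X h(1)]
  have gens: "gen (LH X (X - {a})) (\<mu> a)" "gen (LH Y (Y - {h a})) (\<nu> (h a))" if "a \<in> C" for a using \<mu> \<nu> that unfolding oriented_def by auto
  have "\<exists>W. openin (top_of_set C) W \<and> a \<in> W \<and> (\<forall>y\<in>W. corr X Y h y (\<mu> y) (\<nu> (h y)) = corr X Y h a (\<mu> a) (\<nu> (h a)))" if a: "a \<in> C" for a
  proof (cases "corr X Y h a (\<mu> a) (\<nu> (h a))")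
    case True
    obtain W where W: "openin (top_of_set X) W" "a \<in> W" "W \<subseteq> C" "\<forall>y\<in>W. corr X Y h y (\<mu> y) (\<nu> (h y))" using loc[OF \<nu> a True] by blast
    then show ?thesis using True openin_subset_trans[OF W(1,3) CX] by blast
  next
    case False
    then have "corr X Y h a (\<mu> a) (?inv (h a))" using di(1)[OF a gens[OF a]] by blast
    from loc[OF oriented_inv[OF X(2) hCY \<nu>] a this]
    obtain W where W: "openin (top_of_set X) W" "a \<in> W" "W \<subseteq> C" "\<forall>y\<in>W. corr X Y h y (\<mu> y) (?inv (h y))" by blast
    have "\<not> corr X Y h y (\<mu> y) (\<nu> (h y))" if y: "y \<in> W" for y
      using di(2)[OF _ gens] bspec[OF W(4) y] subsetD[OF W(3) y] by blast
    then show ?thesis using False W openin_subset_trans[OF W(1,3) CX] by blast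
  qed
  from locally_constant_imp_constant[OF h(2) this]
  show ?thesis using xy unfolding constant_on_def by metis
qed

lemma charted_homeo:
  assumes X: "locally_R3 X" and f: "homeomorphism X Y f k" shows "charted X Y X f"
proof -
  have "\<exists>e. chart3 X e \<and> chart3 Y (f \<circ> e) \<and> e 0 = x \<and> range e \<subseteq> \<Omega> \<inter> X" if O: "openin (top_of_set X) \<Omega>" "x \<in> \<Omega>" for x \<Omega>
  proof -
    obtain e where e: "chart3 X e" "e 0 = x" "range e \<subseteq> \<Omega>" using small_chart3[OF X O] by metis
    then show ?thesis using push_homeo(1)[OF e(1) f] chart3_facts(3)[OF e(1)] by blast
  qed
  then show ?thesis using f unfolding charted_def homeomorphism_def by auto
qed

text \<open>Since the sign of f is constant, one point suffices. For another orientation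
  \<open>\<mu>'\<close> the identity map shows that it is \<open>\<mu>\<close> everywhere or its
  inverse everywhere, and the induced homomorphisms respect inverses.\<close>

lemma orientation_preserving_iff:
  assumes X: "locally_R3 X" "connected X" and f: "homeomorphism X X f k" and \<mu>: "orientation 3 X \<mu>" and x: "x \<in> X"
  shows "orientation_preserving 3 X f \<longleftrightarrow>
    hom_induced 3 (top_of_set X) (X - {x}) (top_of_set X) (X - {f x}) f (\<mu> x) = \<mu> (f x)"
proof
  let ?f = "\<lambda>x. hom_induced 3 (top_of_set X) (X - {x}) (top_of_set X) (X - {f x}) f"
  show "orientation_preserving 3 X f \<Longrightarrow> ?f x (\<mu> x) = \<mu> (f x)" using \<mu> x unfolding orientation_preserving_def by auto
  assume e: "?f x (\<mu> x) = \<mu> (f x)"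
  have fX: "f ` X = X" using f by (simp add: homeomorphism_def)
  have id: "homeomorphism X X id id" by (simp add: homeomorphism_def)
  have or: "oriented X X \<mu>'" if "orientation 3 X \<mu>'" for \<mu>' using that orientation_iff by blast
  have car: "\<mu>' y \<in> carrier (LH X (X - {y}))" if "orientation 3 X \<mu>'" "y \<in> X" for y \<mu>'
    using or[OF that(1)] that(2) unfolding oriented_def gen_def by blast
  have crf: "corr X X f y (\<mu>' y) (\<mu>' (f y)) \<longleftrightarrow> ?f y (\<mu>' y) = \<mu>' (f y)" if "orientation 3 X \<mu>'" "y \<in> X" for y \<mu>'
    using corr_homeo[OF X(1) f that(2)] car[OF that] by auto
  have all: "?f y (\<mu> y) = \<mu> (f y)" if y: "y \<in> X" for y
    using corr_constant[OF X(1,1) charted_homeo[OF X(1) f] X(2) or[OF \<mu>], of \<mu> x y] fX or[OF \<mu>] x y e crf[OF \<mu>] by simp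
  show "orientation_preserving 3 X f" unfolding orientation_preserving_def
  proof (intro allI impI ballI)
    fix \<mu>' y assume \<mu>': "orientation 3 X \<mu>'" and y: "y \<in> X"
    then have m': "orientation 3 X \<mu>'" by simp
    have ci: "corr X X id z (\<mu>' z) b \<longleftrightarrow> b = \<mu>' z" if "z \<in> X" for z b
      using corr_homeo[OF X(1) id that] car[OF m' that] hom_induced_id[OF car[OF m' that]] by auto
    note con = corr_constant[OF X(1,1) charted_homeo[OF X(1) id] X(2) or[OF m']]
    have fy: "f y \<in> X" using fX y by blast
    have goal: "?f y (\<mu>' y) = \<mu>' (f y)"
    proof (cases "\<mu>' y = \<mu> y")
      case True
      have "\<mu> (f y) = \<mu>' (f y)" using con[of \<mu> y "f y"] or[OF \<mu>] ci[OF y] ci[OF fy] y fy True by simp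
      then show ?thesis using True all[OF y] by simp
    next
      case False
      have gy: "gen (LH X (X - {y})) (\<mu>' y)" "gen (LH X (X - {y})) (\<mu> y)" using or[OF m'] or[OF \<mu>] y unfolding oriented_def by auto
      have inv: "inv\<^bsub>LH X (X - {y})\<^esub> \<mu> y = \<mu>' y"
        using infinite_cyclic_gen(2)[OF _ local_homology[OF X(1) y] gy(2,1)] False by simp
      have inv': "inv\<^bsub>LH X (X - {f y})\<^esub> \<mu> (f y) = \<mu>' (f y)"
        using con[of "\<lambda>z. inv\<^bsub>LH X (X - {z})\<^esub> \<mu> z" y "f y"] oriented_inv[OF X(1) _ or[OF \<mu>]] ci[OF y] ci[OF fy] y fy inv by simp
      show ?thesis using hom_induced_inv[OF car[OF \<mu> y]] inv inv' all[OF y] by metis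
    qed
    then show "hom_induced (int 3) (top_of_set X) (X - {y}) (top_of_set X) (X - {f y}) f (\<mu>' y) = \<mu>' (f y)" by simp
  qed
qed

subsection \<open>Orientations of the sphere and of its double cover\<close>

lemma oriented_subset: "oriented X C \<mu> \<Longrightarrow> D \<subseteq> C \<Longrightarrow> oriented X D \<mu>"
  unfolding oriented_def by (meson subsetD)

lemma charted_subset:
  assumes "charted X Y C h" "openin (top_of_set X) D" "D \<subseteq> C" shows "charted X Y D h"
proof -
  have "\<exists>e. chart3 X e \<and> chart3 Y (h \<circ> e) \<and> e 0 = x \<and> range e \<subseteq> \<Omega> \<inter> D" if O: "openin (top_of_set X) \<Omega>" "x \<in> \<Omega>" "x \<in> D" for x \<Omega>
  proof -
    have "openin (top_of_set X) (\<Omega> \<inter> D)" "x \<in> \<Omega> \<inter> D" "x \<in> C" using O assms by auto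
    then obtain e where e: "chart3 X e" "chart3 Y (h \<circ> e)" "e 0 = x" "range e \<subseteq> (\<Omega> \<inter> D) \<inter> C" using assms(1) unfolding charted_def by meson
    have "range e \<subseteq> \<Omega> \<inter> D" using e(4) by (rule order_trans) auto
    then show ?thesis using e(1-3) by metis
  qed
  moreover have "continuous_on D h" using assms(1,3) continuous_on_subset unfolding charted_def by metis
  ultimately show ?thesis using assms(2) unfolding charted_def by metis
qed

lemma good_gen:
  assumes "good X U" "y \<in> U" "\<alpha> \<in> carrier (LH X (X - U))"
  shows "gen (LH X (X - {y})) (res X (X - U) (X - {y}) \<alpha>) \<longleftrightarrow> gen (LH X (X - U)) \<alpha>"
  by (rule gen_iso[OF _ _ _ assms(3)]) (use assms in \<open>simp_all add: good_def del: id_apply\<close>)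

lemma simplex_rel_interior_R3:
  fixes \<Delta> :: "'a::euclidean_space set" assumes "3 simplex \<Delta>"
  shows "(UNIV :: (real^3) set) homeomorphic rel_interior \<Delta>"
proof -
  have \<Delta>: "convex \<Delta>" "compact \<Delta>" "aff_dim \<Delta> = 3" using assms convex_simplex compact_simplex aff_dim_simplex by blast+
  let ?B = "cball (0::real^3) 1"
  have B: "aff_dim ?B = 3" by (subst aff_dim_cball) auto
  have "?B homeomorphic \<Delta>" by (rule homeomorphic_convex_compact_sets) (use \<Delta> B in auto)
  then have "rel_interior ?B homeomorphic rel_interior \<Delta>" using B \<Delta>(3) homeomorphic_rel_interiors_same_dimension by metis
  then have "ball (0::real^3) 1 homeomorphic rel_interior \<Delta>" by (simp add: rel_interior_nonempty_interior)
  moreover have "(UNIV :: (real^3) set) homeomorphic ball (0::real^3) 1" using homeomorphic_ball_UNIV[OF zero_less_one, of "0::real^3"] homeomorphic_sym by metis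
  ultimately show ?thesis using homeomorphic_trans by blast
qed

lemma closed_pl_manifold_locally_R3:
  fixes M :: "'a::euclidean_space set"
  assumes "closed_pl_manifold 3 M" shows "locally_R3 M"
  unfolding locally_R3_def
proof
  fix x assume "x \<in> M"
  then obtain B D where B: "pl_ball 3 B D" "B \<subseteq> M" "x \<in> B - D" "openin (top_of_set M) (B - D)"
    using assms unfolding closed_pl_manifold_def by blast
  then obtain \<Delta> :: "'a set" and f where \<Delta>: "int 3 simplex \<Delta>" and f: "pl_map \<Delta> f" "bij_betw f \<Delta> B" "f ` rel_frontier \<Delta> = D"
    unfolding pl_ball_def pl_homeomorphism_def by blast
  have s: "3 simplex \<Delta>" using \<Delta> by simp
  have cl: "compact \<Delta>" "closure \<Delta> = \<Delta>" using compact_simplex[OF s] by (auto simp: compact_imp_closed)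
  have fi: "inj_on f \<Delta>" "f ` \<Delta> = B" using f(2) by (auto simp: bij_betw_def)
  obtain k where k: "homeomorphism \<Delta> B f k" using homeomorphism_compact[OF cl(1) pl_map_continuous[OF f(1)] fi(2,1)] by blast
  have sub: "rel_interior \<Delta> \<subseteq> \<Delta>" by (rule rel_interior_subset)
  have "f ` (\<Delta> - rel_frontier \<Delta>) = f ` \<Delta> - f ` rel_frontier \<Delta>"
    by (rule inj_on_image_set_diff[OF fi(1)]) (auto simp: rel_frontier_def cl(2))
  moreover have "\<Delta> - rel_frontier \<Delta> = rel_interior \<Delta>" using sub by (auto simp: rel_frontier_def cl(2))
  ultimately have im: "f ` rel_interior \<Delta> = B - D" using fi(2) f(3) by simp
  have "homeomorphism (rel_interior \<Delta>) (B - D) f k" by (rule homeomorphism_of_subsets[OF k sub]) (use im in auto)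
  then have "(UNIV :: (real^3) set) homeomorphic B - D" using simplex_rel_interior_R3[OF s] homeomorphic_trans unfolding homeomorphic_def by blast
  then obtain e e' where e: "homeomorphism (UNIV :: (real^3) set) (B - D) e e'" unfolding homeomorphic_def by blast
  then have r: "range e = B - D" by (simp add: homeomorphism_def)
  have c: "chart3 M e" unfolding chart3_def r using B(4) e by blast
  obtain p where p: "e p = x" using B(3) unfolding r[symmetric] by blast
  show "\<exists>e. chart3 M e \<and> e 0 = x" using chart3_compose_ball[OF c zero_less_one, of p] p by metis
qed

section \<open>Existence of orientations and their transfer along q\<close>

context branched_double_cover
begin

lemma locally_R3_M: "locally_R3 M" by (rule closed_pl_manifold_locally_R3[OF manifold])

lemma S3_simplex:
  obtains \<Delta> :: "'a set" and h k where "convex \<Delta>" "bounded \<Delta>" "aff_dim \<Delta> = 4" "homeomorphism (rel_frontier \<Delta>) S3 h k"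
proof -
  obtain \<Delta> :: "'a set" and h k where \<Delta>: "(int 3 + 1) simplex \<Delta>" "homeomorphism (rel_frontier \<Delta>) S3 h k"
    using pl_sphere_homeomorphic[OF sphere] by metis
  have "convex \<Delta>" "bounded \<Delta>" "aff_dim \<Delta> = 4"
    using compact_simplex[OF \<Delta>(1)] convex_simplex[OF \<Delta>(1)] aff_dim_simplex[OF \<Delta>(1)] compact_imp_bounded by auto
  then show ?thesis using that \<Delta>(2) by blast
qed

lemma locally_R3_S3: "locally_R3 S3"
proof -
  obtain \<Delta> :: "'a set" and h k where \<Delta>: "convex \<Delta>" "bounded \<Delta>" "aff_dim \<Delta> = 4" "homeomorphism (rel_frontier \<Delta>) S3 h k"
    by (rule S3_simplex)
  show ?thesis by (rule sphere_locally_R3[OF \<Delta>])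
qed

lemma orientation_S3_exists: obtains \<nu> where "orientation 3 S3 \<nu>"
proof -
  obtain \<Delta> :: "'a set" and h k where \<Delta>: "convex \<Delta>" "bounded \<Delta>" "aff_dim \<Delta> = 4" "homeomorphism (rel_frontier \<Delta>) S3 h k"
    by (rule S3_simplex)
  note H = sphere_homology[OF \<Delta>]
  obtain \<sigma> where \<sigma>: "gen (homology_group 3 (top_of_set S3)) \<sigma>" using infinite_cyclic_gen(1)[OF _ H(1)] by auto
  then have \<sigma>c: "\<sigma> \<in> carrier (homology_group 3 (top_of_set S3))" by (simp add: gen_def)
  have g: "gen (LH S3 (S3 - {x})) (res S3 {} (S3 - {x}) \<sigma>)" if x: "x \<in> S3" for x
    using gen_iso[OF _ _ H(2)[OF x] \<sigma>c] \<sigma> by simp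
  have "oriented S3 S3 (\<lambda>x. res S3 {} (S3 - {x}) \<sigma>)" unfolding oriented_def
  proof (intro ballI conjI)
    fix x assume x: "x \<in> S3"
    show "gen (LH S3 (S3 - {x})) (res S3 {} (S3 - {x}) \<sigma>)" by (rule g[OF x])
    show "\<exists>U. x \<in> U \<and> openin (top_of_set S3) U \<and> (\<exists>\<alpha>\<in>carrier (LH S3 (S3 - U)). \<forall>y\<in>U. res S3 (S3 - U) (S3 - {y}) \<alpha> = res S3 {} (S3 - {y}) \<sigma>)"
      by (rule exI[of _ S3]) (use x \<sigma>c in auto)
  qed
  then show ?thesis using that orientation_iff by blast
qed

lemma charted_q: "charted M S3 M' q"
  unfolding charted_def
proof (intro conjI ballI allI impI)
  show "continuous_on M' q" using cont_q M'_sub continuous_on_subset by blast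
  show "openin (top_of_set M) M'" by (rule open_M')
  fix x \<Omega> assume x: "x \<in> M'" and \<Omega>: "openin (top_of_set M) \<Omega> \<and> x \<in> \<Omega>"
  obtain t u k where t: "x \<in> t" "openin (top_of_set M') t" "openin (top_of_set (S3 - L)) u" "homeomorphism t u q k"
    using covering_space_local_homeomorphism[OF covering x] by metis
  have tM: "openin (top_of_set M) t" using t(2) open_M' openin_trans by blast
  have uS: "openin (top_of_set S3) u" using t(3) open_S3_L openin_trans by blast
  have "openin (top_of_set M) (\<Omega> \<inter> t)" "x \<in> \<Omega> \<inter> t" using \<Omega> tM t(1) by auto
  then obtain e where e: "chart3 M e" "e 0 = x" "range e \<subseteq> \<Omega> \<inter> t" using small_chart3[OF locally_R3_M] by metis
  have "chart3 S3 (q \<circ> e)" by (rule chart3_compose_homeo[OF e(1) _ t(4) openin_imp_subset[OF tM] uS]) (use e(3) in auto)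
  moreover have "t \<subseteq> M'" using t(2) openin_imp_subset by blast
  ultimately show "\<exists>e. chart3 M e \<and> chart3 S3 (q \<circ> e) \<and> e 0 = x \<and> range e \<subseteq> \<Omega> \<inter> M'" using e by blast
qed

text \<open>The complement of the branch locus carries the orientation pulled back from the sphere;
  it extends over the branch locus because small balls stay connected when the latter is removed.\<close>
definition pulled_back where
  "pulled_back \<nu> U \<alpha> \<longleftrightarrow> good M U \<and> gen (LH M (M - U)) \<alpha> \<and>
     (\<forall>y\<in>U \<inter> M'. corr M S3 q y (res M (M - U) (M - {y}) \<alpha>) (\<nu> (q y)))"

text \<open>The part of U off the branch locus is connected, so the sign of a generator over U
  relative to the pulled back orientation is constant there. If it is wrong, the inverse generator
  is taken.\<close>

lemma pulled_back_ex:
  assumes \<nu>: "oriented S3 S3 \<nu>" and x: "x \<in> M"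
  shows "\<exists>U \<alpha>. x \<in> U \<and> pulled_back \<nu> U \<alpha>"
proof -
  have "openin (top_of_set M) M" by simp
  then obtain U where U: "good M U" "x \<in> U" using good_nbhd[OF locally_R3_M _ x] by metis
  have Uo: "openin (top_of_set M) U" "connected U" using U(1) by (auto simp: good_def)
  have UM: "U \<subseteq> M" using Uo(1) openin_imp_subset by blast
  have UM': "openin (top_of_set M) (U \<inter> M')" "connected (U \<inter> M')"
    using Uo(1) open_M' connected_Int_M'[OF Uo] by auto
  note ch = charted_subset[OF charted_q UM'(1) Int_lower2]
  have qU: "q ` (U \<inter> M') \<subseteq> S3" using q_in UM by auto
  have xiso: "res M (M - U) (M - {x}) \<in> iso (LH M (M - U)) (LH M (M - {x}))" using U by (simp add: good_def)
  have infc: "LH M (M - U) \<cong> integer_group" by (rule iso_trans[OF is_isoI[OF xiso] local_homology[OF locally_R3_M x]])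
  note cyc = infinite_cyclic_gen[OF _ infc]
  obtain y0 where y0: "y0 \<in> U \<inter> M'" using M'_dense[OF Uo(1)] U(2) by blast
  have car: "\<alpha> \<in> carrier (LH M (M - U))" if "gen (LH M (M - U)) \<alpha>" for \<alpha> using that by (simp add: gen_def)
  have spread: "pulled_back \<nu> U \<alpha>"
    if \<alpha>: "gen (LH M (M - U)) \<alpha>" and c: "corr M S3 q y0 (res M (M - U) (M - {y0}) \<alpha>) (\<nu> (q y0))" for \<alpha>
  proof -
    have "oriented M (U \<inter> M') (\<lambda>y. res M (M - U) (M - {y}) \<alpha>)" unfolding oriented_def
    proof (intro ballI conjI)
      fix y assume y: "y \<in> U \<inter> M'"
      show "gen (LH M (M - {y})) (res M (M - U) (M - {y}) \<alpha>)" using good_gen[OF U(1) _ car[OF \<alpha>]] \<alpha> y by blast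
      show "\<exists>W. y \<in> W \<and> openin (top_of_set M) W \<and> (\<exists>\<beta>\<in>carrier (LH M (M - W)). \<forall>z\<in>W. res M (M - W) (M - {z}) \<beta> = res M (M - U) (M - {z}) \<alpha>)"
        using y Uo(1) car[OF \<alpha>] by blast
    qed
    from corr_constant[OF locally_R3_M locally_R3_S3 ch UM'(2) this oriented_subset[OF \<nu> qU] y0]
    show ?thesis using c U(1) \<alpha> unfolding pulled_back_def by blast
  qed
  obtain \<alpha>0 where \<alpha>0: "gen (LH M (M - U)) \<alpha>0" using cyc(1) by auto
  have y0': "y0 \<in> U" "q y0 \<in> S3" using y0 UM q_in by auto
  have gy: "gen (LH M (M - {y0})) (res M (M - U) (M - {y0}) \<alpha>0)" using good_gen[OF U(1) y0'(1) car[OF \<alpha>0]] \<alpha>0 by blast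
  have g\<nu>: "gen (LH S3 (S3 - {q y0})) (\<nu> (q y0))" using \<nu> y0'(2) unfolding oriented_def by blast
  consider "corr M S3 q y0 (res M (M - U) (M - {y0}) \<alpha>0) (\<nu> (q y0))"
    | "corr M S3 q y0 (res M (M - U) (M - {y0}) \<alpha>0) (inv\<^bsub>LH S3 (S3 - {q y0})\<^esub> \<nu> (q y0))"
    using gen_corr_dichotomy(1)[OF locally_R3_M locally_R3_S3 ch y0 gy g\<nu>] by blast
  then show ?thesis
  proof cases
    case 1 then show ?thesis using spread[OF \<alpha>0] U(2) by blast
  next
    case 2
    let ?i = "inv\<^bsub>LH M (M - U)\<^esub> \<alpha>0"
    have "res M (M - U) (M - {y0}) ?i = inv\<^bsub>LH M (M - {y0})\<^esub> (res M (M - U) (M - {y0}) \<alpha>0)" by (rule hom_induced_inv[OF car[OF \<alpha>0]])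
    moreover have "inv\<^bsub>LH S3 (S3 - {q y0})\<^esub> (inv\<^bsub>LH S3 (S3 - {q y0})\<^esub> \<nu> (q y0)) = \<nu> (q y0)"
      using g\<nu> by (simp add: group.inv_inv gen_def)
    ultimately have "corr M S3 q y0 (res M (M - U) (M - {y0}) ?i) (\<nu> (q y0))" using corr_inv[OF 2] by simp
    moreover have "gen (LH M (M - U)) ?i" using cyc(3) \<alpha>0 by auto
    ultimately show ?thesis using spread U(2) by blast
  qed
qed

text \<open>The point x may lie over L, where no comparison with the sphere is possible. But in a
  good neighbourhood of x inside both sets there is a point off L at which the classes agree, and
  this determines them on the neighbourhood.\<close>

lemma pulled_back_unique:
  assumes "pulled_back \<nu> U \<alpha>" "pulled_back \<nu> U' \<alpha>'" and x: "x \<in> U" "x \<in> U'"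
  shows "res M (M - U) (M - {x}) \<alpha> = res M (M - U') (M - {x}) \<alpha>'"
proof -
  have U: "good M U" "good M U'" using assms by (auto simp: pulled_back_def)
  then have "openin (top_of_set M) (U \<inter> U')" by (auto simp: good_def)
  then obtain V where V: "good M V" "x \<in> V" "V \<subseteq> U \<inter> U'" using good_nbhd[OF locally_R3_M, of "U \<inter> U'" x] x by blast
  have "openin (top_of_set M) V" using V(1) by (simp add: good_def)
  then obtain y where y: "y \<in> V" "y \<in> M'" using M'_dense V(2) by blast
  let ?a = "res M (M - U) (M - V) \<alpha>" and ?a' = "res M (M - U') (M - V) \<alpha>'"
  have r: "res M (M - V) (M - {z}) ?a = res M (M - U) (M - {z}) \<alpha>" "res M (M - V) (M - {z}) ?a' = res M (M - U') (M - {z}) \<alpha>'"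
    if z: "z \<in> V" for z by (rule res_res; use V(3) z in auto)+
  have "y \<in> U \<inter> M'" "y \<in> U' \<inter> M'" using y V(3) by auto
  then have "res M (M - U) (M - {y}) \<alpha> = res M (M - U') (M - {y}) \<alpha>'"
    using corr_unique[OF locally_R3_M, of S3 q y] assms(1,2) unfolding pulled_back_def by metis
  then have "res M (M - V) (M - {y}) ?a = res M (M - V) (M - {y}) ?a'" using r[OF y(1)] by simp
  moreover have "inj_on (res M (M - V) (M - {y})) (carrier (LH M (M - V)))" using V(1) y(1) unfolding good_def iso_def bij_betw_def by blast
  ultimately have "?a = ?a'" by (meson inj_onD hom_induced_carrier)
  then show ?thesis using r[OF V(2)] by simp
qed

lemma orientation_pull_back:
  assumes \<nu>: "orientation 3 S3 \<nu>"
  obtains \<mu> where "orientation 3 M \<mu>" "\<And>x. x \<in> M' \<Longrightarrow> corr M S3 q x (\<mu> x) (\<nu> (q x))"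
proof -
  have o\<nu>: "oriented S3 S3 \<nu>" using \<nu> orientation_iff by blast
  define \<mu> where "\<mu> x = (SOME a. \<exists>U \<alpha>. x \<in> U \<and> pulled_back \<nu> U \<alpha> \<and> a = res M (M - U) (M - {x}) \<alpha>)" for x
  have \<mu>: "\<mu> x = res M (M - U) (M - {x}) \<alpha>" if U: "x \<in> U" "pulled_back \<nu> U \<alpha>" for x U \<alpha>
  proof -
    have "\<exists>a U \<alpha>. x \<in> U \<and> pulled_back \<nu> U \<alpha> \<and> a = res M (M - U) (M - {x}) \<alpha>" using U by blast
    then have "\<exists>U \<alpha>. x \<in> U \<and> pulled_back \<nu> U \<alpha> \<and> \<mu> x = res M (M - U) (M - {x}) \<alpha>" unfolding \<mu>_def by (rule someI_ex)
    then show ?thesis using pulled_back_unique U by metis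
  qed
  have "oriented M M \<mu>" unfolding oriented_def
  proof
    fix x assume "x \<in> M"
    then obtain U \<alpha> where U: "x \<in> U" "pulled_back \<nu> U \<alpha>" using pulled_back_ex[OF o\<nu>] by blast
    then have g: "good M U" "gen (LH M (M - U)) \<alpha>" "\<alpha> \<in> carrier (LH M (M - U))" by (auto simp: pulled_back_def gen_def)
    have "gen (LH M (M - {x})) (\<mu> x)" using good_gen[OF g(1) U(1) g(3)] g(2) \<mu>[OF U] by simp
    moreover have "openin (top_of_set M) U" using g(1) by (simp add: good_def)
    ultimately show "gen (LH M (M - {x})) (\<mu> x) \<and>
     (\<exists>U. x \<in> U \<and> openin (top_of_set M) U \<and> (\<exists>\<alpha>\<in>carrier (LH M (M - U)). \<forall>y\<in>U. res M (M - U) (M - {y}) \<alpha> = \<mu> y))"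
      using U g(3) \<mu>[OF _ U(2)] by metis
  qed
  moreover have "corr M S3 q x (\<mu> x) (\<nu> (q x))" if x: "x \<in> M'" for x
  proof -
    obtain U \<alpha> where U: "x \<in> U" "pulled_back \<nu> U \<alpha>" using pulled_back_ex[OF o\<nu>] M'_sub x by blast
    then show ?thesis using \<mu>[OF U] x unfolding pulled_back_def by simp
  qed
  ultimately show ?thesis using that orientation_iff by blast
qed

text \<open>By connectedness both properties can be tested at one point off L. There the relation
  along q is one-to-one between local classes of M and of the sphere and is compatible with f and
  g.\<close>

lemma orientation_preserving_lift:
  assumes f: "homeomorphism M M f f'" and g: "homeomorphism S3 S3 g g'" and qf: "\<And>x. x \<in> M \<Longrightarrow> q (f x) = g (q x)"
    and gL: "\<And>y. y \<in> S3 \<Longrightarrow> g y \<in> L \<longleftrightarrow> y \<in> L"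
  shows "orientation_preserving 3 M f \<longleftrightarrow> orientation_preserving 3 S3 g"
proof -
  obtain \<nu> where \<nu>: "orientation 3 S3 \<nu>" by (rule orientation_S3_exists)
  obtain \<mu> where \<mu>: "orientation 3 M \<mu>" "\<And>x. x \<in> M' \<Longrightarrow> corr M S3 q x (\<mu> x) (\<nu> (q x))" using orientation_pull_back[OF \<nu>] by metis
  have "M \<noteq> {}" using L_ne L_sub q_image by auto
  moreover have "openin (top_of_set M) M" by simp
  ultimately obtain x where x: "x \<in> M'" using M'_dense by blast
  then have xM: "x \<in> M" "q x \<in> S3" using M'_sub q_in by auto
  have fx: "f x \<in> M'" using x xM f qf gL by (auto simp: M'_def homeomorphism_def)
  have c1: "corr M S3 q (f x) (\<mu> (f x)) (\<nu> (g (q x)))" using \<mu>(2)[OF fx] qf[OF xM(1)] by simp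
  note c2 = corr_equivariant[OF f g qf \<mu>(2)[OF x]]
  show ?thesis
    using orientation_preserving_iff[OF locally_R3_M connected_M f \<mu>(1) xM(1)]
      orientation_preserving_iff[OF locally_R3_S3 connected_S3 g \<nu> xM(2)] corr_unique[OF locally_R3_M c2 c1] by simp
qed

end

lemma orientation_preserving_id:
  fixes X :: "'a::euclidean_space set" shows "orientation_preserving 3 X (\<lambda>x\<in>X. x)"
proof -
  have "hom_induced 3 (top_of_set X) (X - {x}) (top_of_set X) (X - {x}) (\<lambda>x\<in>X. x) (\<mu> x) = \<mu> x"
    if o: "orientation 3 X \<mu>" and x: "x \<in> X" for \<mu> x
  proof (rule hom_induced_id_gen)
    show "continuous_map (top_of_set X) (top_of_set X) (restrict (\<lambda>x. x) X)" using continuous_map_eq[OF continuous_map_id] by fastforce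
    show "\<mu> x \<in> carrier (LH X (X - {x}))" using o x unfolding orientation_def by auto
  qed simp
  then show ?thesis unfolding orientation_preserving_def by simp
qed

subsection \<open>The homeomorphism groups\<close>

abbreviation Bij_inv where "Bij_inv X f \<equiv> (\<lambda>x\<in>X. inv_into X f x)"

lemma Bij_inv:
  assumes "f \<in> Bij X" "x \<in> X"
  shows "Bij_inv X f (f x) = x" "f (Bij_inv X f x) = x" "f x \<in> X" "Bij_inv X f x \<in> X"
proof -
  have b: "inj_on f X" "f ` X = X" using assms(1) by (auto simp: Bij_def bij_betw_def)
  then show "f x \<in> X" using assms(2) by blast
  then show "Bij_inv X f (f x) = x" using b assms(2) by simp
  show "f (Bij_inv X f x) = x" using b assms(2) by (simp add: f_inv_into_f)
  show "Bij_inv X f x \<in> X" using b assms(2) by (simp add: inv_into_into)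
qed

lemma subgroup_BijGroupI:
  assumes "X \<subseteq> Bij M" "(\<lambda>x\<in>M. x) \<in> X" "\<And>f g. f \<in> X \<Longrightarrow> g \<in> X \<Longrightarrow> compose M f g \<in> X" "\<And>f. f \<in> X \<Longrightarrow> Bij_inv M f \<in> X"
  shows "subgroup X (BijGroup M)"
proof
  show "X \<subseteq> carrier (BijGroup M)" using assms(1) by (simp add: BijGroup_def)
  show "x \<otimes>\<^bsub>BijGroup M\<^esub> y \<in> X" if "x \<in> X" "y \<in> X" for x y
    using assms(3)[OF that] subsetD[OF assms(1)] that by (simp add: BijGroup_def)
  show "\<one>\<^bsub>BijGroup M\<^esub> \<in> X" using assms(2) by (simp add: BijGroup_def)
  show "inv\<^bsub>BijGroup M\<^esub> x \<in> X" if "x \<in> X" for x using assms(4)[OF that] inv_BijGroup[OF subsetD[OF assms(1) that]] by simp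
qed

lemma Bij_pl_inverse:
  assumes f: "f \<in> Bij X" "pl_map X f"
  shows "pl_map X (Bij_inv X f)" "homeomorphism X X f (Bij_inv X f)"
proof -
  have im: "f ` X = X" using f(1) by (auto simp: Bij_def bij_betw_def)
  show pl: "pl_map X (Bij_inv X f)" using pl_map_inverse[OF f(2), of "Bij_inv X f"] Bij_inv(1)[OF f(1)] im by simp
  have "Bij_inv X f ` X = X"
  proof
    show "Bij_inv X f ` X \<subseteq> X" using Bij_inv(4)[OF f(1)] by blast
    show "X \<subseteq> Bij_inv X f ` X" using Bij_inv(1,3)[OF f(1)] by (metis image_eqI subsetI)
  qed
  then show "homeomorphism X X f (Bij_inv X f)"
    unfolding homeomorphism_def using pl_map_continuous[OF pl] pl_map_continuous[OF f(2)] im Bij_inv(1,2)[OF f(1)] by blast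
qed

lemma local_homology_compose:
  assumes f: "homeomorphism X X f f'" and g: "homeomorphism X X g g'" and x: "x \<in> X"
  shows "hom_induced 3 (top_of_set X) (X - {g x}) (top_of_set X) (X - {f (g x)}) f
      (hom_induced 3 (top_of_set X) (X - {x}) (top_of_set X) (X - {g x}) g c)
    = hom_induced 3 (top_of_set X) (X - {x}) (top_of_set X) (X - {f (g x)}) (f \<circ> g) c"
proof (rule hom_induced_compose')
  have Pi: "h \<in> X - {y} \<rightarrow> X - {h y}" if h: "homeomorphism X X h h'" and y: "y \<in> X" for h h' y
  proof
    fix z assume z: "z \<in> X - {y}"
    have "h' (h z) = z" "h' (h y) = y" "h z \<in> X" using h y z by (auto simp: homeomorphism_def)
    then show "h z \<in> X - {h y}" using z by auto
  qed
  show "g \<in> X - {x} \<rightarrow> X - {g x}" by (rule Pi[OF g x])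
  show "f \<in> X - {g x} \<rightarrow> X - {f (g x)}" by (rule Pi[OF f]) (use g x in \<open>auto simp: homeomorphism_def\<close>)
qed (use f g in \<open>auto simp: homeomorphism_def continuous_map_in_subtopology\<close>)

lemma orientation_preserving_compose:
  fixes X :: "'a::euclidean_space set"
  assumes f: "homeomorphism X X f f'" "orientation_preserving 3 X f" and g: "homeomorphism X X g g'" "orientation_preserving 3 X g"
  shows "orientation_preserving 3 X (compose X f g)"
proof -
  have "hom_induced 3 (top_of_set X) (X - {x}) (top_of_set X) (X - {compose X f g x}) (compose X f g) (\<mu> x) = \<mu> (compose X f g x)"
    if o: "orientation 3 X \<mu>" and x: "x \<in> X" for \<mu> x
  proof -
    have "g x \<in> X" using g(1) x by (auto simp: homeomorphism_def)
    moreover have "hom_induced 3 (top_of_set X) (X - {x}) (top_of_set X) (X - {f (g x)}) (compose X f g)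
      = hom_induced 3 (top_of_set X) (X - {x}) (top_of_set X) (X - {f (g x)}) (f \<circ> g)"
      by (rule hom_induced_eq) (simp add: compose_def)
    ultimately show ?thesis
      using local_homology_compose[OF f(1) g(1) x, of "\<mu> x"] f(2) g(2) o x unfolding orientation_preserving_def by (simp add: compose_eq)
  qed
  then show ?thesis unfolding orientation_preserving_def by simp
qed

lemma orientation_preserving_inverse:
  fixes X :: "'a::euclidean_space set"
  assumes f: "homeomorphism X X f f'" "orientation_preserving 3 X f"
  shows "orientation_preserving 3 X f'"
proof -
  have "hom_induced 3 (top_of_set X) (X - {y}) (top_of_set X) (X - {f' y}) f' (\<mu> y) = \<mu> (f' y)"
    if o: "orientation 3 X \<mu>" and y: "y \<in> X" for \<mu> y
  proof -
    have x: "f' y \<in> X" "f (f' y) = y" using f(1) y by (auto simp: homeomorphism_def)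
    have "\<mu> (f' y) \<in> carrier (LH X (X - {f' y}))" using o x(1) unfolding orientation_def by auto
    then have "hom_induced 3 (top_of_set X) (X - {f' y}) (top_of_set X) (X - {f' y}) (f' \<circ> f) (\<mu> (f' y)) = \<mu> (f' y)"
    proof (rule hom_induced_id_gen[rotated 2])
      show "(f' \<circ> f) x = x" if "x \<in> topspace (top_of_set X)" for x using f(1) that by (simp add: homeomorphism_def)
      show "continuous_map (top_of_set X) (top_of_set X) (f' \<circ> f)"
        using homeomorphism_compose[OF f(1) homeomorphism_symD[OF f(1)]] by (auto simp: homeomorphism_def continuous_map_in_subtopology)
    qed
    moreover have "hom_induced 3 (top_of_set X) (X - {f' y}) (top_of_set X) (X - {y}) f (\<mu> (f' y)) = \<mu> y"
      using f(2) o x unfolding orientation_preserving_def by fastforce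
    ultimately show ?thesis using local_homology_compose[OF homeomorphism_symD[OF f(1)] f(1) x(1), of "\<mu> (f' y)"] x(2) by simp
  qed
  then show ?thesis unfolding orientation_preserving_def by simp
qed

lemma carrier_homeo_plus:
  "f \<in> carrier (homeo_plus n X \<Y>) \<longleftrightarrow> f \<in> Bij X \<and> pl_map X f \<and> orientation_preserving n X f \<and> (\<forall>Y\<in>\<Y>. f ` Y = Y)"
  by (simp add: homeo_plus_def)

lemma homeo_plus_closed:
  assumes X: "compact_polyhedron X" "\<Union>\<Y> \<subseteq> X"
  shows "(\<lambda>x\<in>X. x) \<in> carrier (homeo_plus 3 X \<Y>)"
    and "f \<in> carrier (homeo_plus 3 X \<Y>) \<Longrightarrow> g \<in> carrier (homeo_plus 3 X \<Y>) \<Longrightarrow> compose X f g \<in> carrier (homeo_plus 3 X \<Y>)"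
    and "f \<in> carrier (homeo_plus 3 X \<Y>) \<Longrightarrow> Bij_inv X f \<in> carrier (homeo_plus 3 X \<Y>)"
proof -
  have sub: "Y \<subseteq> X" if "Y \<in> \<Y>" for Y using X(2) that by blast
  have "pl_map X (\<lambda>x\<in>X. x)" by (rule pl_map_cong[OF pl_map_affine[OF X(1) affine_on_id]]) simp
  moreover have "(\<lambda>x\<in>X. x) \<in> Bij X" by (rule id_Bij)
  moreover have "(\<lambda>x\<in>X. x) ` Y = Y" if "Y \<in> \<Y>" for Y
  proof -
    have "(\<lambda>x\<in>X. x) ` Y = (\<lambda>x. x) ` Y" by (rule image_cong) (use sub[OF that] in auto)
    then show ?thesis by simp
  qed
  ultimately show "(\<lambda>x\<in>X. x) \<in> carrier (homeo_plus 3 X \<Y>)" using orientation_preserving_id by (simp add: carrier_homeo_plus)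
  show "compose X f g \<in> carrier (homeo_plus 3 X \<Y>)" if fg: "f \<in> carrier (homeo_plus 3 X \<Y>)" "g \<in> carrier (homeo_plus 3 X \<Y>)"
  proof -
    have f: "f \<in> Bij X" "pl_map X f" "orientation_preserving 3 X f" "\<forall>Y\<in>\<Y>. f ` Y = Y" using fg by (auto simp: carrier_homeo_plus)
    have g: "g \<in> Bij X" "pl_map X g" "orientation_preserving 3 X g" "\<forall>Y\<in>\<Y>. g ` Y = Y" using fg by (auto simp: carrier_homeo_plus)
    have "g ` X \<subseteq> X" using Bij_inv(3)[OF g(1)] by blast
    then have "pl_map X (compose X f g)" by (intro pl_map_cong[OF pl_map_compose[OF g(2) f(2)]]) (auto simp: compose_def)
    moreover have "compose X f g ` Y = Y" if Y: "Y \<in> \<Y>" for Y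
    proof -
      have "compose X f g ` Y = f ` g ` Y" unfolding image_image by (rule image_cong) (use sub[OF Y] in \<open>auto simp: compose_def\<close>)
      then show ?thesis using f(4) g(4) Y by simp
    qed
    ultimately show ?thesis using compose_Bij[OF f(1) g(1)]
        orientation_preserving_compose[OF Bij_pl_inverse(2)[OF f(1,2)] f(3) Bij_pl_inverse(2)[OF g(1,2)] g(3)]
      by (simp add: carrier_homeo_plus)
  qed
  show "Bij_inv X f \<in> carrier (homeo_plus 3 X \<Y>)" if "f \<in> carrier (homeo_plus 3 X \<Y>)"
  proof -
    have f: "f \<in> Bij X" "pl_map X f" "orientation_preserving 3 X f" "\<forall>Y\<in>\<Y>. f ` Y = Y" using that by (auto simp: carrier_homeo_plus)
    have "Bij_inv X f ` Y = Y" if Y: "Y \<in> \<Y>" for Y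
    proof -
      have "Bij_inv X f ` f ` Y = (\<lambda>x. x) ` Y" unfolding image_image by (intro image_cong refl Bij_inv(1)[OF f(1)] subsetD[OF sub[OF Y]])
      then show ?thesis using f(4) Y by simp
    qed
    then show ?thesis using restrict_inv_into_Bij[OF f(1)] Bij_pl_inverse(1)[OF f(1,2)]
        orientation_preserving_inverse[OF Bij_pl_inverse(2)[OF f(1,2)] f(3)] by (simp add: carrier_homeo_plus)
  qed
qed

text \<open>Applied to the ball \<open>Bp\<close> this makes the opposite ball invariant too: the
  Goeritz group fixes only \<open>Bp\<close> by definition, while upstairs both handlebodies are
  prescribed.\<close>

lemma homeomorphism_image_closure:
  assumes g: "homeomorphism X X g g'" and X: "closed X" "B \<subseteq> X" "g ` B = B" and C: "closure (X - B) = C"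
  shows "g ` C = C"
proof -
  have CX: "C \<subseteq> X" using closure_minimal[OF Diff_subset X(1), of B] C by simp
  have sub: "h ` C \<subseteq> C" if h: "homeomorphism X X h h'" "h ` B = B" for h h'
  proof -
    have i: "inj_on h X" "h ` X = X" using h(1) by (auto simp: homeomorphism_def intro: inj_on_inverseI)
    have "h ` (X - B) = X - B" using inj_on_image_set_diff[OF i(1), of X B] i(2) h(2) X(2) by simp
    then have "h ` (X - B) \<subseteq> C" using C closure_subset by metis
    moreover have "continuous_on (closure (X - B)) h" using h(1) CX C continuous_on_subset unfolding homeomorphism_def by metis
    ultimately show ?thesis using image_closure_subset[of "X - B" h C] C by auto
  qed
  have "g' ` g ` B = (\<lambda>x. x) ` B" unfolding image_image by (rule image_cong) (use g X(2) in \<open>auto simp: homeomorphism_def\<close>)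
  then have "g' ` B = B" using X(3) by simp
  then have s': "g' ` C \<subseteq> C" using sub[OF homeomorphism_symD[OF g]] by simp
  have "C \<subseteq> g ` C"
  proof
    fix x assume x: "x \<in> C"
    then have "g (g' x) = x" using g CX by (auto simp: homeomorphism_def)
    then show "x \<in> g ` C" using s' x by (metis imageI subsetD)
  qed
  then show ?thesis using sub[OF g X(3)] by blast
qed

lemma pl_ball_closure_interior:
  fixes B :: "'a::euclidean_space set"
  assumes "pl_ball 3 B D" shows "closure (B - D) = B"
proof -
  obtain \<Delta> :: "'a set" and f where \<Delta>: "int 3 simplex \<Delta>" and f: "pl_map \<Delta> f" "bij_betw f \<Delta> B" "f ` rel_frontier \<Delta> = D"
    using assms unfolding pl_ball_def pl_homeomorphism_def by blast
  have cl: "compact \<Delta>" "closure \<Delta> = \<Delta>" using compact_simplex[OF \<Delta>] by (auto simp: compact_imp_closed)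
  have fi: "inj_on f \<Delta>" "f ` \<Delta> = B" using f(2) by (auto simp: bij_betw_def)
  have "f ` (\<Delta> - rel_frontier \<Delta>) = f ` \<Delta> - f ` rel_frontier \<Delta>"
    by (rule inj_on_image_set_diff[OF fi(1)]) (auto simp: rel_frontier_def cl(2))
  moreover have "\<Delta> - rel_frontier \<Delta> = rel_interior \<Delta>" using rel_interior_subset[of \<Delta>] by (auto simp: rel_frontier_def cl(2))
  ultimately have im: "f ` rel_interior \<Delta> = B - D" using fi(2) f(3) by simp
  have c: "closure (rel_interior \<Delta>) = \<Delta>" using convex_closure_rel_interior[OF convex_simplex[OF \<Delta>]] cl(2) by simp
  have B: "closed B" using compact_continuous_image[OF pl_map_continuous[OF f(1)] cl(1)] fi(2) by (simp add: compact_imp_closed)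
  have "f ` closure (rel_interior \<Delta>) \<subseteq> closure (f ` rel_interior \<Delta>)"
    by (rule image_closure_subset[OF _ closed_closure closure_subset]) (use c pl_map_continuous[OF f(1)] in simp)
  then have "B \<subseteq> closure (B - D)" using c fi(2) im by simp
  moreover have "closure (B - D) \<subseteq> B" by (rule closure_minimal[OF Diff_subset B])
  ultimately show ?thesis by blast
qed

text \<open>The bridge decomposition enters through \<open>Bp\<close> and its complementary ball,
  recorded as the closure of the complement so that its invariance can be deduced.\<close>

locale bridge_cover = branched_deck S3 L M q T
  for S3 L :: "'a::euclidean_space set" and M :: "'b::euclidean_space set" and q :: "'b \<Rightarrow> 'a" and T +
  fixes Bp Bm
  assumes Bp: "Bp \<subseteq> S3" and Bm: "closure (S3 - Bp) = Bm" "Bm \<subseteq> S3"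
begin

section \<open>The two groups and the descent map between them\<close>

definition X where "X = {f \<in> carrier (homeo_plus 3 M {{x \<in> M. q x \<in> Bp}, {x \<in> M. q x \<in> Bm}}). fiber_preserving M q f}"

definition Y where "Y = carrier (homeo_plus 3 S3 {Bp, L})"

lemma in_X: "f \<in> X \<longleftrightarrow> f \<in> Bij M \<and> pl_map M f \<and> orientation_preserving 3 M f \<and> fiber_preserving M q f \<and>
    f ` {x \<in> M. q x \<in> Bp} = {x \<in> M. q x \<in> Bp} \<and> f ` {x \<in> M. q x \<in> Bm} = {x \<in> M. q x \<in> Bm}"
  by (auto simp: X_def carrier_homeo_plus)

lemma in_Y: "g \<in> Y \<longleftrightarrow> g \<in> Bij S3 \<and> pl_map S3 g \<and> orientation_preserving 3 S3 g \<and> g ` Bp = Bp \<and> g ` L = L"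
  by (simp add: Y_def carrier_homeo_plus)

lemma poly: "compact_polyhedron M" "compact_polyhedron S3"
  using pl_map_imp_polyhedron[OF pl_q] pl_map_image_polyhedron[OF pl_q] q_image by auto

lemma fiber_preserving_iff:
  assumes "f \<in> Bij M"
  shows "fiber_preserving M q f \<longleftrightarrow> (\<forall>x\<in>M. f ` {z \<in> M. q z = q x} = {z \<in> M. q z = q (f x)})"
proof
  assume "\<forall>x\<in>M. f ` {z \<in> M. q z = q x} = {z \<in> M. q z = q (f x)}"
  then show "fiber_preserving M q f" unfolding fiber_preserving_def using Bij_inv(3)[OF assms] by blast
qed (use fiber_preserving_imp[OF assms] in blast)

lemma subgroup_X: "subgroup X (BijGroup M)"
proof (rule subgroup_BijGroupI)
  note closed = homeo_plus_closed[OF poly(1), of "{{x \<in> M. q x \<in> Bp}, {x \<in> M. q x \<in> Bm}}"]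
  show "X \<subseteq> Bij M" using in_X by blast
  show "(\<lambda>x\<in>M. x) \<in> X" unfolding X_def
  proof (intro CollectI conjI)
    have "(\<lambda>x\<in>M. x) ` {z \<in> M. q z = q x} = (\<lambda>x. x) ` {z \<in> M. q z = q x}" for x by (rule image_cong) auto
    then show "fiber_preserving M q (\<lambda>x\<in>M. x)" using fiber_preserving_iff[OF id_Bij] by simp
  qed (rule closed, auto)
  fix f assume f: "f \<in> X"
  then have fB: "f \<in> Bij M" and "fiber_preserving M q f" using in_X by blast+
  then have ff: "\<And>x. x \<in> M \<Longrightarrow> f ` {z \<in> M. q z = q x} = {z \<in> M. q z = q (f x)}" by (rule fiber_preserving_imp)
  have fib: "{z \<in> M. q z = y} \<subseteq> M" for y by auto
  show "Bij_inv M f \<in> X" unfolding X_def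
  proof (intro CollectI conjI)
    show "Bij_inv M f \<in> carrier (homeo_plus 3 M {{x \<in> M. q x \<in> Bp}, {x \<in> M. q x \<in> Bm}})" by (rule closed(3)) (use f X_def in auto)
    have "Bij_inv M f ` {z \<in> M. q z = q x} = {z \<in> M. q z = q (Bij_inv M f x)}" if x: "x \<in> M" for x
    proof -
      let ?w = "Bij_inv M f x"
      have w: "?w \<in> M" "f ?w = x" using Bij_inv[OF fB x] by auto
      have "Bij_inv M f ` f ` {z \<in> M. q z = q ?w} = (\<lambda>x. x) ` {z \<in> M. q z = q ?w}"
        unfolding image_image by (intro image_cong refl Bij_inv(1)[OF fB]) simp
      then show ?thesis unfolding ff[OF w(1)] w(2) by simp
    qed
    then show "fiber_preserving M q (Bij_inv M f)" using fiber_preserving_iff[OF restrict_inv_into_Bij[OF fB]] by blast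
  qed
  fix g assume g: "g \<in> X"
  then have gB: "g \<in> Bij M" and "fiber_preserving M q g" using in_X by blast+
  then have gg: "\<And>x. x \<in> M \<Longrightarrow> g ` {z \<in> M. q z = q x} = {z \<in> M. q z = q (g x)}" by (rule fiber_preserving_imp)
  show "compose M f g \<in> X" unfolding X_def
  proof (intro CollectI conjI)
    show "compose M f g \<in> carrier (homeo_plus 3 M {{x \<in> M. q x \<in> Bp}, {x \<in> M. q x \<in> Bm}})" by (rule closed(2)) (use f g X_def in auto)
    have "compose M f g ` {z \<in> M. q z = q x} = {z \<in> M. q z = q (compose M f g x)}" if x: "x \<in> M" for x
    proof -
      have "compose M f g ` {z \<in> M. q z = q x} = f ` g ` {z \<in> M. q z = q x}"
        unfolding image_image by (rule image_cong) (auto simp: compose_def)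
      then show ?thesis using gg[OF x] ff[OF Bij_inv(3)[OF gB x]] x by (simp add: compose_eq)
    qed
    then show "fiber_preserving M q (compose M f g)" using fiber_preserving_iff[OF compose_Bij[OF fB gB]] by blast
  qed
qed

lemma subgroup_Y: "subgroup Y (BijGroup S3)"
  by (rule subgroup_BijGroupI) (use in_Y homeo_plus_closed[OF poly(2), of "{Bp, L}"] Bp L_sub in \<open>auto simp: Y_def\<close>)

lemma Y_link_homeo: "g \<in> Y \<Longrightarrow> link_homeo g"
  by (auto simp: in_Y link_homeo_def Bij_def)

lemma X_equi_lift:
  assumes f: "f \<in> X" shows "equi_lift (desc f) f"
  using f fiber_preserving_T(1)[of f] desc_q[of f] unfolding equi_lift_def in_X by auto

lemma lift_orientation:
  assumes g: "link_homeo g" "g \<in> Bij S3" and f: "equi_lift g f"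
  shows "orientation_preserving 3 M f \<longleftrightarrow> orientation_preserving 3 S3 g"
proof -
  have f': "f \<in> Bij M" "pl_map M f" and qf: "\<And>x. x \<in> M \<Longrightarrow> q (f x) = g (q x)" using f by (auto simp: equi_lift_def)
  have "pl_map S3 g" using g(1) by (simp add: link_homeo_def)
  then show ?thesis
    using orientation_preserving_lift[OF Bij_pl_inverse(2)[OF f'] Bij_pl_inverse(2)[OF g(2)] qf link_homeo_L[OF g(1)]] by blast
qed

lemma desc_X:
  assumes f: "f \<in> X" shows "desc f \<in> Y"
proof -
  have f': "f \<in> Bij M" "fiber_preserving M q f" "pl_map M f" using f in_X by auto
  note d = desc_link_homeo[OF f']
  have "desc f ` Bp = Bp" using image_preimage_desc[OF f'(1,2) Bp] f in_X by blast
  moreover have "orientation_preserving 3 S3 (desc f)" using lift_orientation[OF d X_equi_lift[OF f]] f in_X by blast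
  ultimately show ?thesis using d unfolding in_Y link_homeo_def by blast
qed

lemma lift_X:
  assumes g: "g \<in> Y" and f: "equi_lift g f" shows "f \<in> X" "desc f = g"
proof -
  note lg = Y_link_homeo[OF g]
  have gB: "g \<in> Bij S3" "pl_map S3 g" "g ` Bp = Bp" using g in_Y by auto
  have f': "f \<in> Bij M" "pl_map M f" "\<And>x. x \<in> M \<Longrightarrow> q (f x) = g (q x)" using f by (auto simp: equi_lift_def)
  have fp: "fiber_preserving M q f" by (rule equi_lift_fiber_preserving[OF lg f])
  show d: "desc f = g" by (rule desc_eq[OF f'(1) fp f'(3) Bij_imp_extensional[OF gB(1)]])
  have "closed S3" using compact_S3 by (rule compact_imp_closed)
  \<comment> \<open>Invariance of \<open>Bm\<close> is not part of membership in Y; it follows from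
    that of \<open>Bp\<close> by taking the closure of the complement.\<close>
  then have "g ` Bm = Bm" by (rule homeomorphism_image_closure[OF Bij_pl_inverse(2)[OF gB(1,2)] _ Bp gB(3) Bm(1)])
  then show "f \<in> X" using image_preimage_desc[OF f'(1) fp Bp] image_preimage_desc[OF f'(1) fp Bm(2)] d gB(3)
      lift_orientation[OF lg gB(1) f] f' fp g in_X in_Y by simp
qed

lemma quotient_iso:
  fixes F K
  defines "F \<equiv> (BijGroup M)\<lparr>carrier := X\<rparr>" and "K \<equiv> (BijGroup S3)\<lparr>carrier := Y\<rparr>"
  shows "generate (pi0 M F) {isotopy_class M F T} \<lhd> pi0 M F \<and>
    pi0 M F Mod generate (pi0 M F) {isotopy_class M F T} \<cong> pi0 S3 K"
proof -
  have gX: "pl_homeo_group M X" by (rule pl_homeo_group.intro[OF subgroup_X]) (simp add: in_X)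
  have gY: "pl_homeo_group S3 Y" by (rule pl_homeo_group.intro[OF subgroup_Y]) (simp add: in_Y)
  interpret X: pl_homeo_group M X by (rule gX)
  interpret Y: pl_homeo_group S3 Y by (rule gY)
  have XB: "f \<in> Bij M" "fiber_preserving M q f" "pl_map M f" if "f \<in> X" for f using that in_X by auto
  have idY: "(\<lambda>y\<in>S3. y) \<in> Y" using subgroup.one_closed[OF subgroup_Y] by (simp add: BijGroup_def)
  have idX: "(\<lambda>x\<in>M. x) \<in> X" using subgroup.one_closed[OF subgroup_X] by (simp add: BijGroup_def)
  have T: "T \<in> X" "desc T = (\<lambda>y\<in>S3. y)" using lift_X[OF idY T_equi_lift] by auto
  have desc_id: "desc (\<lambda>x\<in>M. x) = (\<lambda>y\<in>S3. y)" by (rule desc_eq) (use XB[OF idX] q_in in auto)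
  show ?thesis unfolding F_def K_def
  proof (rule pi0_quotient_iso[OF gX gY, where \<Phi> = desc])
    show "desc \<in> hom X.G Y.G"
    proof (rule homI)
      show "desc f \<in> carrier Y.G" if "f \<in> carrier X.G" for f using desc_X that by simp
      fix f f' assume "f \<in> carrier X.G" "f' \<in> carrier X.G"
      then have f: "f \<in> X" "f' \<in> X" by auto
      have c: "compose M f f' \<in> X" using subgroup.m_closed[OF subgroup_X f] XB(1) f by (simp add: BijGroup_def)
      have "desc (compose M f f') = compose S3 (desc f) (desc f')"
      proof (rule desc_eq[OF XB(1,2)[OF c]])
        fix x assume x: "x \<in> M"
        then have "f' x \<in> M" using Bij_inv(3)[OF XB(1)[OF f(2)]] by blast
        then show "q (compose M f f' x) = compose S3 (desc f) (desc f') (q x)"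
          using x q_in[OF x] desc_q[OF XB(1,2)] f by (simp add: compose_eq)
      qed simp
      then show "desc (f \<otimes>\<^bsub>X.G\<^esub> f') = desc f \<otimes>\<^bsub>Y.G\<^esub> desc f'"
        using X.mult_G[OF f] Y.mult_G[OF desc_X[OF f(1)] desc_X[OF f(2)]] by simp
    qed
    show "desc ` X = Y"
    proof
      show "desc ` X \<subseteq> Y" using desc_X by blast
      show "Y \<subseteq> desc ` X"
      proof
        fix g assume g: "g \<in> Y"
        obtain f where f: "equi_lift g f" using equi_lift_exists[OF Y_link_homeo[OF g]] by metis
        then show "g \<in> desc ` X" using lift_X[OF g f] by blast
      qed
    qed
    show "isotopic S3 Y.G (desc f) (desc g)" if fg: "isotopic M X.G f g" for f g
    proof -
      obtain H where H: "pl_map (M \<times> {0..1}) (\<lambda>(x, t). H t x)" "\<forall>t\<in>{0..1}. H t \<in> X" "H (0::real) = f" "H 1 = g"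
        using fg unfolding isotopic_def by auto
      have "pl_map (S3 \<times> {0..1}) (\<lambda>(y, t). desc (H t) y)" by (rule desc_isotopy[OF H(1)]) (use H(2) XB in blast)
      then show ?thesis unfolding isotopic_def using H desc_X by (intro exI[of _ "\<lambda>t. desc (H t)"]) simp
    qed
    show "\<exists>f'. isotopic M X.G f f' \<and> desc f' = k" if f: "f \<in> X" and k: "isotopic S3 Y.G (desc f) k" for f k
    proof -
      obtain G where G: "pl_map (S3 \<times> {0..1}) (\<lambda>(x, t). G t x)" "\<And>t. t \<in> {0..1} \<Longrightarrow> G t \<in> Y" "G (0::real) = desc f" "G 1 = k"
        using k unfolding isotopic_def by auto
      have G': "bij_betw (G t) S3 S3 \<and> G t ` L = L" if "t \<in> {0..1}" for t using G(2)[OF that] by (auto simp: in_Y Bij_def)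
      have "equi_lift (G 0) f" using X_equi_lift[OF f] G(3) by simp
      \<comment> \<open>The lifted isotopy starts at the given f rather than at some lift, so its
        end lies in the class of f.\<close>
      from isotopy_lift[OF G(1) G' this]
      obtain H where H: "pl_map (M \<times> {0..1}) (\<lambda>(x, t). H t x)" "\<And>t. t \<in> {0..1} \<Longrightarrow> equi_lift (G t) (H t)" "H (0::real) = f" by blast
      have HX: "H t \<in> X" "desc (H t) = G t" if "t \<in> {0..1}" for t using lift_X[OF G(2)[OF that] H(2)[OF that]] by auto
      have "isotopic M X.G f (H 1)" unfolding isotopic_def using H(1,3) HX(1) by (intro exI[of _ H]) simp
      then show ?thesis using HX(2)[of 1] G(4) by auto
    qed
    show "T \<in> X" by (rule T)
    show "desc f = \<one>\<^bsub>Y.G\<^esub> \<longleftrightarrow> f = \<one>\<^bsub>X.G\<^esub> \<or> f = T" if f: "f \<in> X" for f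
    proof -
      have "f = (\<lambda>x\<in>M. x) \<or> f = T" if d: "desc f = (\<lambda>y\<in>S3. y)"
        by (rule deck_unique[OF XB(1,3,2)[OF f]]) (use desc_q[OF XB(1,2)[OF f]] d q_in in simp)
      then show ?thesis using T(2) desc_id X.one_G Y.one_G by auto
    qed
  qed
qed

end

text \<open>Supplies a point of L, on which the connectedness of the cover depends.\<close>

lemma trivial_tangle_nonempty:
  assumes "trivial_tangle n B D A" "n > 0" shows "A \<noteq> {}"
proof -
  obtain \<T> where T: "finite \<T>" "card \<T> = n" "\<Union>\<T> = A" "\<forall>t\<in>\<T>. properly_embedded_arc B D t"
    using assms(1) unfolding trivial_tangle_def by blast
  then obtain t where t: "t \<in> \<T>" using assms(2) by fastforce
  then obtain E where "pl_ball 1 t E" using T(4) unfolding properly_embedded_arc_def by blast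
  then obtain \<Delta> :: "'a set" and f where "int 1 simplex \<Delta>" "bij_betw f \<Delta> t"
    unfolding pl_ball_def pl_homeomorphism_def by blast
  then have "t \<noteq> {}" using aff_dim_simplex[of "int 1" \<Delta>] by (auto simp: bij_betw_def)
  then show ?thesis using t T(3) by blast
qed

theorem theorem0p1:
  fixes n :: nat
    and S3 L Bp Bm S :: "'a::euclidean_space set"
    and M Vp Vm :: "'b::euclidean_space set"
    and q :: "'b \<Rightarrow> 'a" and T :: "'b \<Rightarrow> 'b"
  assumes "n \<ge> 2"
    and "pl_sphere 3 S3"
    and "bridge_decomposition n S3 L Bp Bm S"
    and "double_branched_cover M q S3 L"
    and "Vp = {x\<in>M. q x \<in> Bp}" and "Vm = {x\<in>M. q x \<in> Bm}"
    and "deck_transformation M q T" and "T \<noteq> (\<lambda>x\<in>M. x)"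
  shows "generate (hyperelliptic_goeritz_group M q Vp Vm)
           {isotopy_class M (fiber_preserving_homeos M q Vp Vm) T}
           \<lhd> hyperelliptic_goeritz_group M q Vp Vm
       \<and> hyperelliptic_goeritz_group M q Vp Vm Mod
           generate (hyperelliptic_goeritz_group M q Vp Vm)
             {isotopy_class M (fiber_preserving_homeos M q Vp Vm) T}
         \<cong> goeritz_group S3 L Bp"
proof -
  have bd: "pl_link L" "L \<subseteq> S3" "Bp \<union> Bm = S3" "Bp \<inter> Bm = S" "trivial_tangle n Bp S (Bp \<inter> L)" "trivial_tangle n Bm S (Bm \<inter> L)"
    using assms(3) by (auto simp: bridge_decomposition_def)
  have "L \<noteq> {}" using trivial_tangle_nonempty[OF bd(5)] assms(1) by auto
  moreover have "closure (S3 - Bp) = Bm"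
  proof -
    \<comment> \<open>S is the boundary sphere of the ball \<open>Bm\<close>, so this is its
      interior, whose closure is the ball.\<close>
    have "S3 - Bp = Bm - S" using bd(3,4) by auto
    then show ?thesis using bd(6) pl_ball_closure_interior unfolding trivial_tangle_def by metis
  qed
  ultimately interpret bridge_cover S3 L M q T Bp Bm
    by unfold_locales (use assms bd in auto)
  have F: "fiber_preserving_homeos M q Vp Vm = (BijGroup M)\<lparr>carrier := X\<rparr>"
    unfolding fiber_preserving_homeos_def X_def assms(5,6) ..
  have K: "homeo_plus 3 S3 {Bp, L} = (BijGroup S3)\<lparr>carrier := Y\<rparr>"
    unfolding Y_def homeo_plus_def by simp
  show ?thesis unfolding hyperelliptic_goeritz_group_def goeritz_group_def MCG_def F K by (rule quotient_iso)
qed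

end
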